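(* In the setting described in the context, let $a_0\in L^\infty(D)$ with $\operatorname{ess\,inf}_{D} a_0>0$, and assume there exist $p^*\in(0,1)$ and a sequence $\{b_j\}_{j\ge1}\in\ell^{p^*}(\mathbb N)$ with $0<b_j\le 1$ for all $j$ such that $$\kappa:=\left\|\frac{\sum_{j\ge1}|\phi_j|/b_j}{2a_0}\right\|_{L^\infty(D)}<1 .$$ Assume the finite element method converges with rate $\tau=t+t'>0$, i.e. there is a constant $C$ independent of $h$ and $\boldsymbol y$ with $$|G(u(\cdot,\boldsymbol y))-G(u^h(\cdot,\boldsymbol y))|\le C\,h^\tau\,\|f\|_{H^{-1+t}(D)}\,\|G\|_{H^{-1+t'}(D)}\qquad\text{for all }\boldsymbol y\in\Omega^{\mathbb N},$$ as $h\to0$, under the conditions on $D,f,G,a_0,\{\phi_j\}$ listed in the context, and that solving a finite element linear system with meshwidth $h$ costs $O(h^{-d'})$. For a requested error tolerance $\epsilon>0$ let the active set $\mathfrak U(\epsilon)$, the numbers of cubature points $n_{\mathfrak u}$ and the meshwidths $h_{\mathfrak u}$ be chosen as in the context. Set $$\lambda:=\frac{\tau(1-p^* )}{p^*(\tau+d')},\qquad \alpha:=\lfloor\lambda\rfloor+1,$$ and assume $\kappa<\frac1{2\alpha+1}$. Then the following hold, with implied constants independent of $\epsilon$. 1. If $\lambda\ge1$, then the MDFEM based on interlaced polynomial lattice rules in base 2 with interlacing factor $\alpha$ satisfying the error bound (I) of the context with this $\lambda$ achieves $$|\,I(G(u))-Q^{\mathrm{MDFEM}}_\epsilon(G(u))\,|\lesssim\epsilon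 .$$ 2. If $\frac12\le\lambda<1$, then the MDFEM based on randomly digitally shifted polynomial lattice rules in base 2 satisfying the root-mean-square error bound (R) of the context with this $\lambda$ achieves $$\sqrt{\mathbb E_{\boldsymbol\Delta}\left[|\,I(G(u))-Q^{\mathrm{MDFEM}}_\epsilon(G(u))\,|^2\right]}\lesssim\epsilon .$$ In both cases the computational cost is bounded as $$\mathrm{cost}(Q^{\mathrm{MDFEM}}_\epsilon)\lesssim\epsilon^{-a_{\mathrm{MDFEM}}},\qquad a_{\mathrm{MDFEM}}:=\frac1\lambda+\frac{d'}{\tau}=\frac{1+d'/\tau}{1/p^*-1}+\frac{d'}\tau .$$
   Context: **PDE.** $D\subset\mathbb R^d$ is a convex bounded polyhedron, $\Omega=[-\frac12,\frac12]$, $V=H^1_0(D)$ with $\|v\|_V=\|\nabla v\|_{L^2(D)}$, $V^*$ its dual. For $\boldsymbol y\in\Omega^{\mathbb N}$ let $a(\boldsymbol x,\boldsymbol y)=a_0(\boldsymbol x)+\sum_{j\ge1}y_j\phi_j(\boldsymbol x)$ for given functions $\phi_j$ on $D$, and let $u(\cdot,\boldsymbol y)\in V$ be the unique solution of $\int_D a(\boldsymbol x,\boldsymbol y)\nabla u(\boldsymbol x,\boldsymbol y)\cdot\nabla v(\boldsymbol x)\,d\boldsymbol x=\int_D f v\,d\boldsymbol x$ for all $v\in V$. $G:V\to\mathbb R$ is a bounded linear functional. $I(G(u))=\int_{\Omega^{\mathbb N}}G(u(\cdot,\boldsymbol y))\,d\mu(\boldsymbol y)$ with $\mu$ the countable product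 of the uniform probability measures on $\Omega$. **Finite elements.** $V^h\subset V$ is a finite-dimensional (finite element) subspace with meshwidth $h>0$; $u^h(\cdot,\boldsymbol y)\in V^h$ solves the weak problem with $V$ replaced by $V^h$. Assume $f\in H^{-1+t}(D)$, $G\in H^{-1+t'}(D)$ for reals $t,t'\ge0$. If $0\le t,t'\le1$, assume $a_0\in W^{1,\infty}(D)$ and $\sum_j\|\phi_j\|_{W^{1,\infty}(D)}<\infty$. If $t_0:=\max\{t,t'\}>1$, assume $a_0\in W^{t_0,\infty}_K(D)$ and $\sum_j\|\phi_j\|_{W_K^{t_0,\infty}(D)}<\infty$, where $W_K^{t_0,\infty}(D)$ is the weighted Sobolev space of Kondrat'ev type, with norm $\max_{|\boldsymbol\omega|\le t_0}\|r_D^{|\boldsymbol\omega|}\partial_{\boldsymbol x}^{\boldsymbol\omega}v\|_{L^\infty(D)}$, $r_D(\boldsymbol x)$ being comparable to the distance of $\boldsymbol x$ to the set of singular boundary points (corners, edges) of $D$. The number $d'>0$ is the linear-system cost exponent. **Anchored decomposition.** For finite $\mathfrak u\subset\mathbb N$, $\boldsymbol y_{\mathfrak u}\in\Omega^{\mathbb N}$ has components $y_j$ for $j\in\mathfrak u$ and $0$ otherwise. Put $u_{\mathfrak u}(\cdot,\boldsymbol y_{\mathfrak u})=\sum_{\mathfrak v\subseteq\mathfrak u}(-1)^{|\mathfrak u|-|\mathfrak v|}u(\cdot,\boldsymbol y_{\mathfrak v})$ and $u^{h_{\mathfrak u}}_{\mathfrak u}(\cdot,\boldsymbol y_{\mathfrak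 u})=\sum_{\mathfrak v\subseteq\mathfrak u}(-1)^{|\mathfrak u|-|\mathfrak v|}u^{h_{\mathfrak u}}(\cdot,\boldsymbol y_{\mathfrak v})$. **Spaces.** Let $$K_{\alpha,0}(x,y)=\sum_{r=1}^{\alpha-1}\frac{x^r}{r!}\frac{y^r}{r!}+\mathbb 1_{\{xy>0\}}\int_0^{\min\{|x|,|y|\}}\frac{(|x|-t)^{\alpha-1}}{(\alpha-1)!}\frac{(|y|-t)^{\alpha-1}}{(\alpha-1)!}\,dt$$ on $\Omega\times\Omega$, and let $H_{\alpha,0,\mathfrak u}$ be the reproducing kernel Hilbert space with kernel $\prod_{j\in\mathfrak u}K_{\alpha,0}(x_j,y_j)$ (the constants if $\mathfrak u=\emptyset$). Put $M=\int_\Omega K_{\alpha,0}(y,y)^{1/2}dy$, $M_{\mathfrak u}=M^{|\mathfrak u|}$, $\gamma_{\mathfrak u}=\prod_{j\in\mathfrak u}b_j$, $I_{\mathfrak u}(F)=\int_{\Omega^{|\mathfrak u|}}F(\boldsymbol y_{\mathfrak u})\,d\boldsymbol y_{\mathfrak u}$. Empty products are $1$ and $0^0=1$. **MDFEM.** $Q^{\mathrm{MDFEM}}_\epsilon(G(u))=\sum_{\mathfrak u\in\mathfrak U(\epsilon)}Q_{\mathfrak u,n_{\mathfrak u}}(G(u_{\mathfrak u}^{h_{\mathfrak u}}))$, with $$\mathfrak U(\epsilon)=\Big\{\mathfrak u\subset\mathbb N,\ |\mathfrak u|<\infty:\ (\gamma_{\mathfrak u}M_{\mathfrak u})^{1-p^*}>\frac{\epsilon/2}{\sum_{|\mathfrak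 v|<\infty}(\gamma_{\mathfrak v}M_{\mathfrak v})^{p^*}}\Big\}.$$ Its cost is, up to a constant factor, $\mathrm{cost}(Q^{\mathrm{MDFEM}}_\epsilon)=\sum_{\mathfrak u\in\mathfrak U(\epsilon)}n_{\mathfrak u}h_{\mathfrak u}^{-d'}\pounds_{\mathfrak u}$ with $\pounds_{\mathfrak u}=2^{|\mathfrak u|}\max\{1,|\mathfrak u|\}$ (constructing the cubature rules is not counted). The positive reals $(k_{\mathfrak u},h_{\mathfrak u})_{\mathfrak u\in\mathfrak U(\epsilon)}$ are the solution of: minimize $\sum_{\mathfrak u\in\mathfrak U(\epsilon)}k_{\mathfrak u}h_{\mathfrak u}^{-d'}\pounds_{\mathfrak u}$ subject to $$\sum_{\mathfrak u\in\mathfrak U(\epsilon)}\Big(\frac{\gamma_{\mathfrak u}\,2^\lambda\,C_{\mathfrak u,\lambda}}{k_{\mathfrak u}^\lambda}+2^{|\mathfrak u|}h_{\mathfrak u}^\tau\Big)=\frac\epsilon2 ,$$ with $C_{\mathfrak u,\lambda}$ the constant in (I) resp. (R) below; and $n_{\mathfrak u}=2^{\lfloor\log_2k_{\mathfrak u}\rfloor}$ if $k_{\mathfrak u}\ge1$, $n_{\mathfrak u}=0$ otherwise. **Cubature rules.** $Q_{\mathfrak u,0}=0$. For $n=2^m$, $Q_{\mathfrak u,n}$ is the equal-weight average of function values over $n$ points in $[0,1)^{|\mathfrak u|}$, translated by $-\frac12$ in each coordinate. A polynomial lattice in dimension $s$ over $\mathbb F_2$ has a modulus $P\in\mathbb F_2[x]$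 of degree $m$ and generating polynomials $q_1,\dots,q_s\in\mathbb F_2[x]$ of degree $<m$; its $k$-th point ($0\le k<2^m$, $k=\sum_i k_i2^i$ identified with $k(x)=\sum_i k_ix^i$) has $j$-th coordinate $v_m(k(x)q_j(x)/P(x))$, where $v_m$ maps a formal Laurent series over $\mathbb F_2$ with coefficients $t_\ell$ of $x^{-\ell}$ to $\sum_{\ell=1}^m t_\ell2^{-\ell}$. An interlaced polynomial lattice rule with interlacing factor $\alpha$ in dimension $s$ takes a polynomial lattice in dimension $\alpha s$ and maps each consecutive block of $\alpha$ coordinates with binary digits $\xi_{r,a}$ ($1\le r\le\alpha$, $a\ge1$) to $\sum_{a\ge1}\sum_{r=1}^\alpha\xi_{r,a}2^{-r-(a-1)\alpha}$. A randomly digitally shifted polynomial lattice rule adds digit-wise modulo 2 to all points one uniformly distributed shift $\Delta_{\mathfrak u}\in[0,1)^{|\mathfrak u|}$; shifts for different $\mathfrak u$ are independent and $\mathbb E_{\boldsymbol\Delta}$ is the expectation over all of them. The rules are chosen (such rules exist) so that for all $F\in H_{\alpha,0,\mathfrak u}$ and $n=2^m$, $m\in\mathbb N$: (I) for $\alpha\ge2$ and $1\le\lambda<\alpha$: $|I_{\mathfrak u}(F)-Q_{\mathfrak u,n}(F)|\le C_{\mathfrak u,\lambda}\,n^{-\lambda}\|F\|_{H_{\alpha,0,\mathfrak u}}$ with $C_{\mathfrak u,\lambda}=4^\lambda C_{\alpha,\lambda}^{|\mathfrak u|\lambda}$ and $C_{\alpha,\lambda}=2^{\alpha(\alpha-1)/2}\,\alpha!\,\sqrt\alpha\,(\frac32)^\alpha(\frac53)^{\alpha-1}\big(1+\frac1{2^{\alpha/\lambda}-2}\big)^\alpha$;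 (R) for $\alpha=1$ and $\frac12\le\lambda<1$: $\sqrt{\mathbb E_{\Delta_{\mathfrak u}}|I_{\mathfrak u}(F)-Q_{\mathfrak u,n}(F)|^2}\le C_{\mathfrak u,\lambda}\,n^{-\lambda}\|F\|_{H_{1,0,\mathfrak u}}$ with $C_{\mathfrak u,\lambda}=2^\lambda C_{1,\lambda}^{|\mathfrak u|\lambda}$, where $C_{1,\lambda}=(\frac{13}{12})^{1/(2\lambda)}+\frac16$ if $\lambda=\frac12$ and $C_{1,\lambda}=(\frac{13}{12})^{1/(2\lambda)}+\frac1{3^{1/(2\lambda)}(2^{1/\lambda}-2)}$ if $\frac12<\lambda<1$. For $n\in\{0,1\}$ the (root-mean-square) error is at most $C_{\mathfrak u,\lambda}\|F\|_{H_{\alpha,0,\mathfrak u}}$. *)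

theory Defs
  imports
    "HOL-Probability.Probability"
    "HOL-Computational_Algebra.Polynomial"
    "HOL-Computational_Algebra.Formal_Laurent_Series"
    "HOL-Library.Z2"
begin

section \<open>Function spaces on the spatial domain\<close>

text \<open>
  Real functions on \<open>D\<close> are total functions on the ambient Euclidean space; only their values
  almost everywhere on \<open>D\<close> matter. A multi-index is encoded by a list of coordinate directions
  (elements of \<^const>\<open>Basis\<close>), its order being the length of the list. The order of the entries is
  irrelevant for smooth functions, so every multi-index is represented (possibly several times).
\<close>

definition pderiv1 :: "'a::euclidean_space \<Rightarrow> ('a \<Rightarrow> real) \<Rightarrow> 'a \<Rightarrow> real" where
  "pderiv1 i \<phi> = (\<lambda>x. frechet_derivative \<phi> (at x) i)"

fun pderivs :: "'a::euclidean_space list \<Rightarrow> ('a \<Rightarrow> real) \<Rightarrow> 'a \<Rightarrow> real" where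
  "pderivs [] \<phi> = \<phi>"
| "pderivs (i # \<omega>) \<phi> = pderiv1 i (pderivs \<omega> \<phi>)"

definition midx :: "real \<Rightarrow> 'a::euclidean_space list set" where
  "midx k = {\<omega>. set \<omega> \<subseteq> Basis \<and> real (length \<omega>) \<le> k}"

text \<open>Test functions: compactly supported smooth functions on \<open>D\<close>.\<close>

definition test_fun :: "'a::euclidean_space set \<Rightarrow> ('a \<Rightarrow> real) set" where
  "test_fun D = {\<phi>.
     (\<forall>\<omega> x. set \<omega> \<subseteq> Basis \<longrightarrow> pderivs \<omega> \<phi> differentiable (at x)) \<and>
     compact (closure {x. \<phi> x \<noteq> 0}) \<and> closure {x. \<phi> x \<noteq> 0} \<subseteq> D}"

definition loc_integrable :: "'a::euclidean_space set \<Rightarrow> ('a \<Rightarrow> real) \<Rightarrow> bool" where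
  "loc_integrable D v \<longleftrightarrow> (\<forall>K. compact K \<and> K \<subseteq> D \<longrightarrow> integrable (lebesgue_on K) v)"

definition weak_deriv ::
    "'a::euclidean_space set \<Rightarrow> 'a list \<Rightarrow> ('a \<Rightarrow> real) \<Rightarrow> ('a \<Rightarrow> real) \<Rightarrow> bool" where
  "weak_deriv D \<omega> v w \<longleftrightarrow> loc_integrable D v \<and> loc_integrable D w \<and>
     (\<forall>\<phi>\<in>test_fun D. (LINT x|lebesgue_on D. v x * pderivs \<omega> \<phi> x)
        = (-1) ^ length \<omega> * (LINT x|lebesgue_on D. w x * \<phi> x))"

definition weak_grad ::
    "'a::euclidean_space set \<Rightarrow> ('a \<Rightarrow> real) \<Rightarrow> ('a \<Rightarrow> 'a) \<Rightarrow> bool" where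
  "weak_grad D v g \<longleftrightarrow> (\<forall>i\<in>Basis. weak_deriv D [i] v (\<lambda>x. g x \<bullet> i))"

definition wgrad :: "'a::euclidean_space set \<Rightarrow> ('a \<Rightarrow> real) \<Rightarrow> 'a \<Rightarrow> 'a" where
  "wgrad D v = (SOME g. weak_grad D v g)"

definition grad :: "('a::euclidean_space \<Rightarrow> real) \<Rightarrow> 'a \<Rightarrow> 'a" where
  "grad \<phi> x = (\<Sum>i\<in>Basis. pderiv1 i \<phi> x *\<^sub>R i)"

definition L2_sq :: "'a::euclidean_space set \<Rightarrow> ('a \<Rightarrow> 'b::real_normed_vector) \<Rightarrow> ennreal" where
  "L2_sq D v = (\<integral>\<^sup>+x. ennreal ((norm (v x))\<^sup>2) \<partial>lebesgue_on D)"

definition Linf_norm :: "'a::euclidean_space set \<Rightarrow> ('a \<Rightarrow> real) \<Rightarrow> ennreal" where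
  "Linf_norm D v = esssup (lebesgue_on D) (\<lambda>x. ennreal \<bar>v x\<bar>)"

definition ess_inf :: "'a::euclidean_space set \<Rightarrow> ('a \<Rightarrow> real) \<Rightarrow> ereal" where
  "ess_inf D v = - esssup (lebesgue_on D) (\<lambda>x. - ereal (v x))"

text \<open>\<open>V = H\<^sup>1\<^sub>0(D)\<close>, the closure of the test functions in \<open>H\<^sup>1(D)\<close>, with norm \<open>\<parallel>\<nabla>v\<parallel>\<^bsub>L\<^sup>2(D)\<^esub>\<close>.\<close>

definition H10 :: "'a::euclidean_space set \<Rightarrow> ('a \<Rightarrow> real) set" where
  "H10 D = {v. \<exists>g. weak_grad D v g \<and> L2_sq D v < \<infinity> \<and> L2_sq D g < \<infinity> \<and>
     (\<exists>\<psi>. (\<forall>n::nat. \<psi> n \<in> test_fun D) \<and>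
        (\<lambda>n. L2_sq D (\<lambda>x. v x - \<psi> n x) + L2_sq D (\<lambda>x. g x - grad (\<psi> n) x))
          \<longlonglongrightarrow> 0)}"

definition V_norm :: "'a::euclidean_space set \<Rightarrow> ('a \<Rightarrow> real) \<Rightarrow> real" where
  "V_norm D v = sqrt (LINT x|lebesgue_on D. (norm (wgrad D v x))\<^sup>2)"

definition V_dual :: "'a::euclidean_space set \<Rightarrow> (('a \<Rightarrow> real) \<Rightarrow> real) set" where
  "V_dual D = {l.
     (\<forall>v\<in>H10 D. \<forall>w\<in>H10 D. l (\<lambda>x. v x + w x) = l v + l w) \<and>
     (\<forall>c. \<forall>v\<in>H10 D. l (\<lambda>x. c * v x) = c * l v) \<and>
     (\<exists>C. \<forall>v\<in>H10 D. \<bar>l v\<bar> \<le> C * V_norm D v)}"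

text \<open>
  The norm of \<open>W\<^bsub>K\<^esub>\<^bsup>k,\<infinity>\<^esup>(D)\<close> with weight \<open>r\<close>; the weight \<open>1\<close> gives \<open>W\<^bsup>k,\<infinity>\<^esup>(D)\<close>. Weak
  derivatives are unique almost everywhere, so the inner infimum is over equal values, and it is
  \<open>\<infinity>\<close> if the weak derivative does not exist; membership in the space is finiteness of the norm.
  The same encoding is used for the Sobolev-Slobodeckij norms below.
\<close>

definition W_inf_norm ::
    "'a::euclidean_space set \<Rightarrow> ('a \<Rightarrow> real) \<Rightarrow> real \<Rightarrow> ('a \<Rightarrow> real) \<Rightarrow> ennreal" where
  "W_inf_norm D r k v =
     (SUP \<omega>\<in>midx k. INF w\<in>{w. weak_deriv D \<omega> v w}. Linf_norm D (\<lambda>x. r x ^ length \<omega> * w x))"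

definition slobodeckij_sq :: "'a::euclidean_space set \<Rightarrow> real \<Rightarrow> ('a \<Rightarrow> real) \<Rightarrow> ennreal" where
  "slobodeckij_sq D \<sigma> w = (\<integral>\<^sup>+x. (\<integral>\<^sup>+y.
      ennreal ((w x - w y)\<^sup>2 / dist x y powr (real DIM('a) + 2 * \<sigma>)) \<partial>lebesgue_on D) \<partial>lebesgue_on D)"

text \<open>
  Squared norm of \<open>H\<^sup>s(D)\<close>, \<open>s \<ge> 0\<close>. Because of the list encoding each derivative tensor enters with
  its full Frobenius norm.
\<close>

definition Hs_sq :: "'a::euclidean_space set \<Rightarrow> real \<Rightarrow> ('a \<Rightarrow> real) \<Rightarrow> ennreal" where
  "Hs_sq D s v =
     (let k = real_of_int \<lfloor>s\<rfloor>; \<sigma> = s - k in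
       (\<Sum>\<omega>\<in>midx k. INF w\<in>{w. weak_deriv D \<omega> v w}. L2_sq D w) +
       (if \<sigma> = 0 then 0
        else (\<Sum>\<omega>\<in>{\<omega>\<in>midx k. real (length \<omega>) = k}.
                INF w\<in>{w. weak_deriv D \<omega> v w}. slobodeckij_sq D \<sigma> w)))"

text \<open>
  \<open>H\<^bsup>-1+t\<^esup>(D)\<close> for \<open>t \<ge> 0\<close> as a space of functionals in \<open>V\<^sup>*\<close>: for \<open>t = 0\<close> it is \<open>V\<^sup>*\<close>, for
  \<open>0 < t < 1\<close> the dual of \<open>H\<^sub>0\<^bsup>1-t\<^esup>(D)\<close> (closure of the test functions in \<open>H\<^bsup>1-t\<^esup>(D)\<close>), and for \<open>t \<ge> 1\<close>
  the functionals \<open>v \<mapsto> \<integral>\<^sub>D g v\<close> with \<open>g \<in> H\<^bsup>t-1\<^esup>(D)\<close>.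
\<close>

definition Hneg_sq :: "'a::euclidean_space set \<Rightarrow> real \<Rightarrow> (('a \<Rightarrow> real) \<Rightarrow> real) \<Rightarrow> ennreal" where
  "Hneg_sq D t l =
     (if t = 0 then (SUP v\<in>{v\<in>H10 D. V_norm D v \<le> 1}. ennreal ((l v)\<^sup>2))
      else if t < 1 then (SUP v\<in>{v\<in>test_fun D. Hs_sq D (1 - t) v \<le> 1}. ennreal ((l v)\<^sup>2))
      else (INF g\<in>{g. \<forall>v\<in>H10 D. l v = (LINT x|lebesgue_on D. g x * v x)}. Hs_sq D (t - 1) g))"

definition Hneg :: "'a::euclidean_space set \<Rightarrow> real \<Rightarrow> (('a \<Rightarrow> real) \<Rightarrow> real) set" where
  "Hneg D t = {l\<in>V_dual D. Hneg_sq D t l < \<infinity>}"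

definition Hneg_norm :: "'a::euclidean_space set \<Rightarrow> real \<Rightarrow> (('a \<Rightarrow> real) \<Rightarrow> real) \<Rightarrow> real" where
  "Hneg_norm D t l = sqrt (enn2real (Hneg_sq D t l))"

text \<open>\<open>D\<close> is taken open; it is then the interior of the closed polyhedron \<^term>\<open>closure D\<close>.\<close>

definition convex_polyhedral_domain :: "'a::euclidean_space set \<Rightarrow> bool" where
  "convex_polyhedral_domain D \<longleftrightarrow>
     open D \<and> D \<noteq> {} \<and> bounded D \<and> convex D \<and> polyhedron (closure D)"

text \<open>The faces of codimension at least two; in dimension one, the end points.\<close>

definition singular_points :: "'a::euclidean_space set \<Rightarrow> 'a set" where
  "singular_points D = \<Union>{F. F face_of closure D \<and> aff_dim F \<le> max 0 (int DIM('a) - 2)}"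

definition singular_weight :: "'a::euclidean_space set \<Rightarrow> ('a \<Rightarrow> real) \<Rightarrow> bool" where
  "singular_weight D r \<longleftrightarrow> (\<exists>c1>0. \<exists>c2>0. \<forall>x\<in>D.
     c1 * infdist x (singular_points D) \<le> r x \<and> r x \<le> c2 * infdist x (singular_points D))"


section \<open>The parametric problem and its discretisation\<close>

definition \<Omega> :: "real set" where
  "\<Omega> = {-1/2..1/2}"

definition param_seqs :: "(nat \<Rightarrow> real) set" where
  "param_seqs = {y. \<forall>j. y j \<in> \<Omega>}"

text \<open>Lebesgue measure on \<open>\<Omega>\<close> has total mass one, so it is the uniform probability measure.\<close>

definition unif_\<Omega> :: "real measure" where
  "unif_\<Omega> = restrict_space lborel \<Omega>"

definition coeff_a :: "('a \<Rightarrow> real) \<Rightarrow> (nat \<Rightarrow> 'a \<Rightarrow> real) \<Rightarrow> (nat \<Rightarrow> real) \<Rightarrow> 'a \<Rightarrow> real" where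
  "coeff_a a0 \<phi> y x = a0 x + (\<Sum>j. y j * \<phi> j x)"

definition kappa ::
    "'a::euclidean_space set \<Rightarrow> ('a \<Rightarrow> real) \<Rightarrow> (nat \<Rightarrow> 'a \<Rightarrow> real) \<Rightarrow> (nat \<Rightarrow> real) \<Rightarrow> ennreal" where
  "kappa D a0 \<phi> b =
     esssup (lebesgue_on D) (\<lambda>x. (\<Sum>j. ennreal (\<bar>\<phi> j x\<bar> / b j)) / ennreal (2 * a0 x))"

definition weak_solution ::
    "'a::euclidean_space set \<Rightarrow> ('a \<Rightarrow> real) \<Rightarrow> (('a \<Rightarrow> real) \<Rightarrow> real) \<Rightarrow> ('a \<Rightarrow> real) set
      \<Rightarrow> ('a \<Rightarrow> real) \<Rightarrow> bool" where
  "weak_solution D a f W w \<longleftrightarrow> w \<in> W \<and>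
     (\<forall>v\<in>W. (LINT x|lebesgue_on D. a x * (wgrad D w x \<bullet> wgrad D v x)) = f v)"

definition fin_dim_subspace :: "('a \<Rightarrow> real) set \<Rightarrow> ('a \<Rightarrow> real) set \<Rightarrow> bool" where
  "fin_dim_subspace W V \<longleftrightarrow>
     (\<exists>B. finite B \<and> B \<subseteq> V \<and> W = {\<lambda>x. \<Sum>\<beta>\<in>B. c \<beta> * \<beta> x |c. True})"

definition anchor :: "nat set \<Rightarrow> (nat \<Rightarrow> real) \<Rightarrow> nat \<Rightarrow> real" where
  "anchor \<uu> y = (\<lambda>j. if j \<in> \<uu> then y j else 0)"

definition anchored ::
    "((nat \<Rightarrow> real) \<Rightarrow> 'a \<Rightarrow> real) \<Rightarrow> nat set \<Rightarrow> (nat \<Rightarrow> real) \<Rightarrow> 'a \<Rightarrow> real" where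
  "anchored u \<uu> y = (\<lambda>x. \<Sum>\<vv>\<in>Pow \<uu>. (-1) ^ (card \<uu> - card \<vv>) * u (anchor \<vv> y) x)"

definition integral_inf :: "((nat \<Rightarrow> real) \<Rightarrow> real) \<Rightarrow> real" where
  "integral_inf F = (LINT y|PiM UNIV (\<lambda>_. unif_\<Omega>). F y)"

text \<open>
  A function of the variables \<open>y\<^sub>j\<close>, \<open>j \<in> \<uu>\<close>, is evaluated at points whose other components are \<open>0\<close>.
\<close>

definition integral_fin :: "nat set \<Rightarrow> ((nat \<Rightarrow> real) \<Rightarrow> real) \<Rightarrow> real" where
  "integral_fin \<uu> F = (LINT y|PiM \<uu> (\<lambda>_. unif_\<Omega>). F (anchor \<uu> y))"


section \<open>Reproducing kernel Hilbert spaces\<close>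

text \<open>
  \<open>H\<close> with inner product \<open>ip\<close> is the Hilbert space of real functions on \<open>X\<close> with reproducing kernel \<open>K\<close>.
  Functions on \<open>X\<close> are represented by functions vanishing outside \<open>X\<close>.
\<close>

definition is_rkhs ::
    "'x set \<Rightarrow> ('x \<Rightarrow> 'x \<Rightarrow> real) \<Rightarrow> ('x \<Rightarrow> real) set
      \<Rightarrow> (('x \<Rightarrow> real) \<Rightarrow> ('x \<Rightarrow> real) \<Rightarrow> real) \<Rightarrow> bool" where
  "is_rkhs X K H ip \<longleftrightarrow>
     (\<forall>F\<in>H. \<forall>x. x \<notin> X \<longrightarrow> F x = 0) \<and>
     (\<lambda>_. 0) \<in> H \<and>
     (\<forall>F\<in>H. \<forall>E\<in>H. (\<lambda>x. F x + E x) \<in> H) \<and>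
     (\<forall>c. \<forall>F\<in>H. (\<lambda>x. c * F x) \<in> H) \<and>
     (\<forall>F\<in>H. \<forall>E\<in>H. ip F E = ip E F) \<and>
     (\<forall>F\<in>H. \<forall>E\<in>H. \<forall>S\<in>H. ip (\<lambda>x. F x + E x) S = ip F S + ip E S) \<and>
     (\<forall>c. \<forall>F\<in>H. \<forall>E\<in>H. ip (\<lambda>x. c * F x) E = c * ip F E) \<and>
     (\<forall>F\<in>H. 0 \<le> ip F F) \<and>
     (\<forall>F\<in>H. ip F F = 0 \<longrightarrow> F = (\<lambda>_. 0)) \<and>
     (\<forall>S. (\<forall>n::nat. S n \<in> H) \<and>
          (\<forall>e>0. \<exists>N. \<forall>m\<ge>N. \<forall>n\<ge>N. ip (\<lambda>x. S m x - S n x) (\<lambda>x. S m x - S n x) < e) \<longrightarrow>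
          (\<exists>F\<in>H. (\<lambda>n. ip (\<lambda>x. S n x - F x) (\<lambda>x. S n x - F x)) \<longlonglongrightarrow> 0)) \<and>
     (\<forall>x\<in>X. (\<lambda>z. if z \<in> X then K z x else 0) \<in> H) \<and>
     (\<forall>F\<in>H. \<forall>x\<in>X. ip F (\<lambda>z. if z \<in> X then K z x else 0) = F x)"

definition kernel1 :: "nat \<Rightarrow> real \<Rightarrow> real \<Rightarrow> real" where
  "kernel1 \<alpha> x y =
     (\<Sum>r\<in>{1..<\<alpha>}. x ^ r / fact r * (y ^ r / fact r)) +
     of_bool (x * y > 0) *
       integral {0..min \<bar>x\<bar> \<bar>y\<bar>}
         (\<lambda>t. (\<bar>x\<bar> - t) ^ (\<alpha> - 1) / fact (\<alpha> - 1) * ((\<bar>y\<bar> - t) ^ (\<alpha> - 1) / fact (\<alpha> - 1)))"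

definition kernel_u :: "nat \<Rightarrow> nat set \<Rightarrow> (nat \<Rightarrow> real) \<Rightarrow> (nat \<Rightarrow> real) \<Rightarrow> real" where
  "kernel_u \<alpha> \<uu> x y = (\<Prod>j\<in>\<uu>. kernel1 \<alpha> (x j) (y j))"

text \<open>\<open>\<Omega>\<^sup>\<uu>\<close>, with points extended by \<open>0\<close>.\<close>

definition box_u :: "nat set \<Rightarrow> (nat \<Rightarrow> real) set" where
  "box_u \<uu> = {y\<in>param_seqs. \<forall>j. j \<notin> \<uu> \<longrightarrow> y j = 0}"

definition M_const :: "nat \<Rightarrow> real" where
  "M_const \<alpha> = integral \<Omega> (\<lambda>y. sqrt (kernel1 \<alpha> y y))"

definition M_u :: "nat \<Rightarrow> nat set \<Rightarrow> real" where
  "M_u \<alpha> \<uu> = M_const \<alpha> ^ card \<uu>"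

definition gamma_u :: "(nat \<Rightarrow> real) \<Rightarrow> nat set \<Rightarrow> real" where
  "gamma_u b \<uu> = (\<Prod>j\<in>\<uu>. b j)"


section \<open>Polynomial lattice rules over the field with two elements\<close>

text \<open>
  Laurent series in \<open>x\<^bsup>-1\<^esup>\<close>: the library's variable stands for \<open>x\<^bsup>-1\<^esup>\<close>, so \<open>fls_nth w l\<close> is the coefficient of
  \<open>x\<^bsup>-l\<^esup>\<close>, and the quotient of two polynomials in \<open>x\<close> is formed in the field of such series.
\<close>

definition poly_to_series :: "bit poly \<Rightarrow> bit fls" where
  "poly_to_series p = (\<Sum>i\<le>degree p. fls_const (poly.coeff p i) * fls_X_inv ^ i)"

definition v_map :: "nat \<Rightarrow> bit fls \<Rightarrow> real" where
  "v_map m w = (\<Sum>l=1..m. of_bit (fls_nth w (int l)) / 2 ^ l)"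

definition nat_poly :: "nat \<Rightarrow> nat \<Rightarrow> bit poly" where
  "nat_poly m k = (\<Sum>i<m. monom (of_nat (k div 2 ^ i)) i)"

text \<open>Coordinates of a point are numbered from \<open>0\<close>; the \<open>j\<close>-th generating polynomial is \<open>q j\<close>.\<close>

definition polylat_point :: "bit poly \<Rightarrow> (nat \<Rightarrow> bit poly) \<Rightarrow> nat \<Rightarrow> nat \<Rightarrow> real" where
  "polylat_point P q k j = v_map (degree P)
     (poly_to_series (nat_poly (degree P) k * q j) / poly_to_series P)"

text \<open>The \<open>a\<close>-th binary digit after the point.\<close>

definition bdigit :: "nat \<Rightarrow> real \<Rightarrow> int" where
  "bdigit a x = \<lfloor>2 ^ a * x\<rfloor> mod 2"

text \<open>The summation index \<open>a\<close> is shifted by one with respect to the position of the digit.\<close>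

definition interlace :: "nat \<Rightarrow> (nat \<Rightarrow> real) \<Rightarrow> nat \<Rightarrow> real" where
  "interlace \<alpha> z i =
     (\<Sum>a. \<Sum>r=1..\<alpha>. real_of_int (bdigit (Suc a) (z (\<alpha> * i + r - 1))) / 2 ^ (r + a * \<alpha>))"

definition digital_shift :: "real \<Rightarrow> real \<Rightarrow> real" where
  "digital_shift x \<delta> =
     (\<Sum>a. real_of_int ((bdigit (Suc a) x + bdigit (Suc a) \<delta>) mod 2) / 2 ^ Suc a)"

text \<open>The elements of \<open>\<uu>\<close> are numbered \<open>0, 1, \<dots>\<close> in increasing order.\<close>

definition rank_in :: "nat set \<Rightarrow> nat \<Rightarrow> nat" where
  "rank_in \<uu> j = card {i\<in>\<uu>. i < j}"

definition average :: "nat \<Rightarrow> (nat \<Rightarrow> nat \<Rightarrow> real) \<Rightarrow> ((nat \<Rightarrow> real) \<Rightarrow> real) \<Rightarrow> real" where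
  "average n pts F = (if n = 0 then 0 else (\<Sum>k<n. F (pts k)) / real n)"

text \<open>\<open>P \<uu> n\<close> and \<open>q \<uu> n\<close> are the modulus and generating polynomials of the \<open>n\<close>-point rule for \<open>\<uu>\<close>.\<close>

definition interlaced_rule ::
    "nat \<Rightarrow> (nat set \<Rightarrow> nat \<Rightarrow> bit poly) \<Rightarrow> (nat set \<Rightarrow> nat \<Rightarrow> nat \<Rightarrow> bit poly)
      \<Rightarrow> nat set \<Rightarrow> nat \<Rightarrow> ((nat \<Rightarrow> real) \<Rightarrow> real) \<Rightarrow> real" where
  "interlaced_rule \<alpha> P q \<uu> n =
     average n (\<lambda>k j. if j \<in> \<uu>
       then interlace \<alpha> (polylat_point (P \<uu> n) (q \<uu> n) k) (rank_in \<uu> j) - 1/2 else 0)"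

definition shifted_rule ::
    "(nat set \<Rightarrow> nat \<Rightarrow> bit poly) \<Rightarrow> (nat set \<Rightarrow> nat \<Rightarrow> nat \<Rightarrow> bit poly)
      \<Rightarrow> nat set \<Rightarrow> nat \<Rightarrow> (nat \<Rightarrow> real) \<Rightarrow> ((nat \<Rightarrow> real) \<Rightarrow> real) \<Rightarrow> real" where
  "shifted_rule P q \<uu> n \<delta> =
     average n (\<lambda>k j. if j \<in> \<uu>
       then digital_shift (polylat_point (P \<uu> n) (q \<uu> n) k (rank_in \<uu> j)) (\<delta> j) - 1/2 else 0)"

text \<open>The lattice underlying the rule for \<open>\<uu>\<close> has dimension \<open>\<alpha> |\<uu>|\<close>.\<close>

definition polylat_generators ::
    "nat \<Rightarrow> (nat set \<Rightarrow> nat \<Rightarrow> bit poly) \<Rightarrow> (nat set \<Rightarrow> nat \<Rightarrow> nat \<Rightarrow> bit poly) \<Rightarrow> bool" where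
  "polylat_generators \<alpha> P q \<longleftrightarrow>
     (\<forall>\<uu> m. finite \<uu> \<longrightarrow> P \<uu> (2 ^ m) \<noteq> 0 \<and> degree (P \<uu> (2 ^ m)) = m \<and>
        (\<forall>j<\<alpha> * card \<uu>. q \<uu> (2 ^ m) j = 0 \<or> degree (q \<uu> (2 ^ m) j) < m))"

definition unif_01 :: "real measure" where
  "unif_01 = restrict_space lborel {0..<1}"

definition shift_measure :: "nat set \<Rightarrow> (nat \<Rightarrow> real) measure" where
  "shift_measure \<uu> = PiM \<uu> (\<lambda>_. unif_01)"

definition C_interlaced :: "nat \<Rightarrow> real \<Rightarrow> nat \<Rightarrow> real" where
  "C_interlaced \<alpha> l s = 4 powr l *
     (2 powr (real \<alpha> * (real \<alpha> - 1) / 2) * fact \<alpha> * sqrt (real \<alpha>) * (3/2) ^ \<alpha> *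
      (5/3) ^ (\<alpha> - 1) * (1 + 1 / (2 powr (real \<alpha> / l) - 2)) ^ \<alpha>) powr (real s * l)"

definition C_shifted :: "real \<Rightarrow> nat \<Rightarrow> real" where
  "C_shifted l s = 2 powr l *
     ((13/12) powr (1 / (2 * l)) +
      (if l = 1/2 then 1/6 else 1 / (3 powr (1 / (2 * l)) * (2 powr (1 / l) - 2)))) powr (real s * l)"

definition C_cub :: "nat \<Rightarrow> real \<Rightarrow> nat set \<Rightarrow> real" where
  "C_cub \<alpha> l \<uu> = (if \<alpha> \<ge> 2 then C_interlaced \<alpha> l (card \<uu>) else C_shifted l (card \<uu>))"

text \<open>Deterministic and root-mean-square error bounds over the spaces \<open>H \<uu>\<close> with inner products \<open>ip \<uu>\<close>.\<close>

definition interlaced_bound ::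
    "nat \<Rightarrow> real \<Rightarrow> (nat set \<Rightarrow> ((nat \<Rightarrow> real) \<Rightarrow> real) set)
      \<Rightarrow> (nat set \<Rightarrow> ((nat \<Rightarrow> real) \<Rightarrow> real) \<Rightarrow> ((nat \<Rightarrow> real) \<Rightarrow> real) \<Rightarrow> real)
      \<Rightarrow> (nat set \<Rightarrow> nat \<Rightarrow> bit poly) \<Rightarrow> (nat set \<Rightarrow> nat \<Rightarrow> nat \<Rightarrow> bit poly) \<Rightarrow> bool" where
  "interlaced_bound \<alpha> l H ip P q \<longleftrightarrow>
     (\<forall>\<uu>. finite \<uu> \<longrightarrow> (\<forall>F\<in>H \<uu>.
        (\<forall>m. \<bar>integral_fin \<uu> F - interlaced_rule \<alpha> P q \<uu> (2 ^ m) F\<bar>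
              \<le> C_cub \<alpha> l \<uu> * real (2 ^ m) powr (- l) * sqrt (ip \<uu> F F)) \<and>
        (\<forall>n\<in>{0,1}. \<bar>integral_fin \<uu> F - interlaced_rule \<alpha> P q \<uu> n F\<bar>
              \<le> C_cub \<alpha> l \<uu> * sqrt (ip \<uu> F F))))"

definition shifted_bound ::
    "nat \<Rightarrow> real \<Rightarrow> (nat set \<Rightarrow> ((nat \<Rightarrow> real) \<Rightarrow> real) set)
      \<Rightarrow> (nat set \<Rightarrow> ((nat \<Rightarrow> real) \<Rightarrow> real) \<Rightarrow> ((nat \<Rightarrow> real) \<Rightarrow> real) \<Rightarrow> real)
      \<Rightarrow> (nat set \<Rightarrow> nat \<Rightarrow> bit poly) \<Rightarrow> (nat set \<Rightarrow> nat \<Rightarrow> nat \<Rightarrow> bit poly) \<Rightarrow> bool" where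
  "shifted_bound \<alpha> l H ip P q \<longleftrightarrow>
     (\<forall>\<uu>. finite \<uu> \<longrightarrow> (\<forall>F\<in>H \<uu>.
        (\<forall>m. sqrt (LINT \<delta>|shift_measure \<uu>.
                 \<bar>integral_fin \<uu> F - shifted_rule P q \<uu> (2 ^ m) \<delta> F\<bar>\<^sup>2)
              \<le> C_cub \<alpha> l \<uu> * real (2 ^ m) powr (- l) * sqrt (ip \<uu> F F)) \<and>
        (\<forall>n\<in>{0,1}. sqrt (LINT \<delta>|shift_measure \<uu>.
                 \<bar>integral_fin \<uu> F - shifted_rule P q \<uu> n \<delta> F\<bar>\<^sup>2)
              \<le> C_cub \<alpha> l \<uu> * sqrt (ip \<uu> F F))))"


section \<open>The multivariate decomposition finite element method\<close>

definition active_set :: "nat \<Rightarrow> (nat \<Rightarrow> real) \<Rightarrow> real \<Rightarrow> real \<Rightarrow> nat set set" where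
  "active_set \<alpha> b p \<epsilon> = {\<uu>. finite \<uu> \<and>
     (gamma_u b \<uu> * M_u \<alpha> \<uu>) powr (1 - p)
       > (\<epsilon> / 2) / (\<Sum>\<^sub>\<infinity>\<vv>\<in>{\<vv>. finite \<vv>}. (gamma_u b \<vv> * M_u \<alpha> \<vv>) powr p)}"

definition pounds :: "nat set \<Rightarrow> real" where
  "pounds \<uu> = 2 ^ card \<uu> * max 1 (real (card \<uu>))"

text \<open>
  Cost of evaluating \<open>n \<uu>\<close> cubature points with meshwidth \<open>h \<uu>\<close> for each \<open>\<uu> \<in> U\<close>, if a finite element
  system with meshwidth \<open>h\<close> is solved at cost \<open>work h\<close>.
\<close>

definition mdfem_cost ::
    "(real \<Rightarrow> real) \<Rightarrow> nat set set \<Rightarrow> (nat set \<Rightarrow> real) \<Rightarrow> (nat set \<Rightarrow> real) \<Rightarrow> real" where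
  "mdfem_cost work U n h = (\<Sum>\<uu>\<in>U. n \<uu> * work (h \<uu>) * pounds \<uu>)"

definition mdfem_feasible ::
    "nat \<Rightarrow> real \<Rightarrow> (nat \<Rightarrow> real) \<Rightarrow> real \<Rightarrow> nat set set \<Rightarrow> real
      \<Rightarrow> (nat set \<Rightarrow> real) \<Rightarrow> (nat set \<Rightarrow> real) \<Rightarrow> bool" where
  "mdfem_feasible \<alpha> l b \<tau> U \<epsilon> k h \<longleftrightarrow>
     (\<forall>\<uu>\<in>U. k \<uu> > 0 \<and> h \<uu> > 0) \<and>
     (\<Sum>\<uu>\<in>U. gamma_u b \<uu> * 2 powr l * C_cub \<alpha> l \<uu> / k \<uu> powr l
                + 2 ^ card \<uu> * h \<uu> powr \<tau>) = \<epsilon> / 2"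

definition mdfem_optimal ::
    "nat \<Rightarrow> real \<Rightarrow> (nat \<Rightarrow> real) \<Rightarrow> real \<Rightarrow> real \<Rightarrow> nat set set \<Rightarrow> real
      \<Rightarrow> (nat set \<Rightarrow> real) \<Rightarrow> (nat set \<Rightarrow> real) \<Rightarrow> bool" where
  "mdfem_optimal \<alpha> l b \<tau> d' U \<epsilon> k h \<longleftrightarrow>
     mdfem_feasible \<alpha> l b \<tau> U \<epsilon> k h \<and>
     (\<forall>k' h'. mdfem_feasible \<alpha> l b \<tau> U \<epsilon> k' h' \<longrightarrow>
        mdfem_cost (\<lambda>x. x powr (- d')) U k h \<le> mdfem_cost (\<lambda>x. x powr (- d')) U k' h')"

definition n_points :: "real \<Rightarrow> nat" where
  "n_points k = (if k \<ge> 1 then 2 ^ nat \<lfloor>log 2 k\<rfloor> else 0)"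

definition mdfem ::
    "(nat set \<Rightarrow> nat \<Rightarrow> ((nat \<Rightarrow> real) \<Rightarrow> real) \<Rightarrow> real)
      \<Rightarrow> (('a \<Rightarrow> real) \<Rightarrow> real) \<Rightarrow> (real \<Rightarrow> (nat \<Rightarrow> real) \<Rightarrow> 'a \<Rightarrow> real)
      \<Rightarrow> nat set set \<Rightarrow> (nat set \<Rightarrow> nat) \<Rightarrow> (nat set \<Rightarrow> real) \<Rightarrow> real" where
  "mdfem Q G uh U n h = (\<Sum>\<uu>\<in>U. Q \<uu> (n \<uu>) (\<lambda>y. G (anchored (uh (h \<uu>)) \<uu> y)))"

end

theory Submission
  imports Defs
begin

text \<open>
  Since \<open>\<kappa> < 1/3\<close>, the weighted coefficient sum \<open>\<Sum>j. |\<phi>\<^sub>j| / b\<^sub>j\<close> is dominated by \<open>2/3 a\<^sub>0\<close>, and each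
  differentiation of the Galerkin equations in \<open>y\<^sub>j\<close> contributes a factor \<open>b\<^sub>j\<close>: on every
  finite-dimensional subspace \<open>G(u\<^sup>h(y))\<close> is a power series whose coefficient at \<open>y\<^sup>\<nu>\<close> is at most
  \<open>C \<Prod>j. b\<^sub>j ^ \<nu>\<^sub>j\<close>, with \<open>C\<close> independent of the subspace. The anchored term of \<open>\<uu>\<close> collects the
  monomials with support exactly \<open>\<uu>\<close>; hence its supremum and its norm in the reproducing kernel space
  are at most \<open>C c ^ |\<uu>| \<gamma>\<^sub>\<uu>\<close>. The exact solution is only used as the limit of \<open>u\<^sup>h\<close>.

  The optimal \<open>k\<close> and \<open>h\<close> are explicit: by weighted AM-GM the share of \<open>\<uu>\<close> in the error budget is
  proportional to \<open>w\<^sub>\<uu> ^ (1 / (1/\<lambda> + d'/\<tau> + 1))\<close>, and \<open>\<lambda>\<close> is chosen so that this power is at most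
  \<open>K c ^ |\<uu>| \<gamma>\<^sub>\<uu> ^ p\<close>. Since \<open>\<Sum> c ^ |\<uu>| \<gamma>\<^sub>\<uu> ^ p\<close> over the finite sets \<open>\<uu>\<close> is at most
  \<open>exp (c \<Sum>j. b\<^sub>j ^ p)\<close> for every \<open>c\<close>, all exponential factors in \<open>|\<uu>|\<close> are harmless in the truncation
  error, the cubature error and the cost alike.
\<close>

section \<open>Optimal splitting of an error budget\<close>

text \<open>Three obstacles shape the development. The constraint on \<open>k\<close> and
  \<open>h\<close> accounts for \<open>gamma_u\<close>, the cubature constant and
  \<open>2 ^ card u\<close>, but the norms proved here carry a further factor c ^ |u|. Knowing that
  the shares add up to \<epsilon>/2 is then not enough: the share of each single set is needed, and
  since \<open>k\<close> and \<open>h\<close> are given only as a minimiser, this calls for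
  uniqueness, i.e. the equality case of AM-GM. The spaces \<open>H u\<close> are given only by
  axioms, with no norm in terms of derivatives. Membership and norm are read off from values:
  (\<Sum> c_i F(x_i))^2 \<le> A^2 \<Sum> c_i c_j K(x_i, x_j) for all finite choices. This condition
  can be checked one coordinate at a time and is stable under pointwise limits. Gradients are chosen
  by \<open>SOME\<close>, so even additivity of the energy form rests on almost-everywhere
  uniqueness of weak derivatives, hence on the fundamental lemma of the calculus of variations.
  Power series coefficients are estimated together, through a weighted energy of each degree,
  because estimating them singly from the recursion would bring in multinomial factors.\<close>

lemma sum_subsets_prod_le:
  fixes x :: "nat \<Rightarrow> real"
  assumes nn: "\<And>j. 0 \<le> x j" and sm: "summable x" and fin: "finite UU" "\<And>u. u \<in> UU \<Longrightarrow> finite u"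
  shows "(\<Sum>u\<in>UU. \<Prod>j\<in>u. x j) \<le> exp (suminf x)"
proof -
  have "finite (\<Union>UU)" using fin by auto
  then obtain N where N: "\<Union>UU \<subseteq> {..<N}" by (meson finite_nat_iff_bounded)
  have "(\<Sum>u\<in>UU. \<Prod>j\<in>u. x j) \<le> (\<Sum>u\<in>Pow {..<N}. \<Prod>j\<in>u. x j)"
    by (rule sum_mono2) (use N nn in \<open>auto intro: prod_nonneg\<close>)
  \<comment> \<open>Expanding the product selects \<open>x j\<close> or 1 for each j, which lists
    every subset of \<open>{..<N}\<close> exactly once.\<close>
  also have "\<dots> = (\<Prod>j<N. x j + 1)" by (subst prod_add) auto
  also have "\<dots> \<le> (\<Prod>j<N. exp (x j))"
    by (intro prod_mono) (use nn in \<open>auto simp: add.commute intro: add_nonneg_nonneg\<close>)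
  also have "\<dots> = exp (\<Sum>j<N. x j)" by (simp add: exp_sum)
  also have "\<dots> \<le> exp (suminf x)" using sum_le_suminf[OF sm] nn by auto
  finally show ?thesis .
qed

text \<open>Convexity: the left side is the tangent plane at (1, 1). In this linear form weighted
  AM-GM can be summed against a linear constraint. The equality case is what later identifies the
  minimiser.\<close>

lemma powr_mult_ge_tangent:
  fixes x y a e :: real
  assumes "x > 0" "y > 0" "a > 0" "e > 0"
  shows "1 - a * (x - 1) - e * (y - 1) \<le> x powr (-a) * y powr (-e)"
    and "x powr (-a) * y powr (-e) = 1 - a * (x - 1) - e * (y - 1) \<Longrightarrow> x = 1 \<and> y = 1"
proof -
  have eq: "x powr (-a) * y powr (-e) = exp (- a * ln x - e * ln y)"
    using assms by (simp add: powr_def exp_add[symmetric])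
  have 1: "1 + (- a * ln x - e * ln y) \<le> exp (- a * ln x - e * ln y)" by (rule exp_ge_add_one_self)
  have lx: "a * ln x \<le> a * (x - 1)" and ly: "e * ln y \<le> e * (y - 1)"
    using assms by (auto simp: ln_le_minus_one)
  show "1 - a * (x - 1) - e * (y - 1) \<le> x powr (-a) * y powr (-e)"
    unfolding eq using 1 lx ly by linarith
  assume "x powr (-a) * y powr (-e) = 1 - a * (x - 1) - e * (y - 1)"
  with 1 lx ly have "a * ln x = a * (x - 1)" "e * ln y = e * (y - 1)" unfolding eq by linarith+
  then show "x = 1 \<and> y = 1" using assms ln_eq_minus_one by auto
qed

section \<open>Closed form and uniqueness of the optimal split\<close>

locale error_splitting =
  fixes U :: "'i set" and W :: "'i \<Rightarrow> real" and a e E :: real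
  assumes fin: "finite U" and ne: "U \<noteq> {}" and Wpos: "\<And>i. i \<in> U \<Longrightarrow> 0 < W i"
    and pos: "0 < a" "0 < e" "0 < E"
begin

text \<open>Stationarity of the Lagrangian makes p and q in the ratio a : e and both proportional to
  the term \<open>W i * p powr (-a) * q powr (-e)\<close>. With p and q proportional to w this says
  that w to the power a + e + 1 is proportional to \<open>W i\<close>.\<close>

definition wt :: "'i \<Rightarrow> real" where "wt i = W i powr (1 / (a + e + 1))"
definition Z :: real where "Z = (\<Sum>i\<in>U. wt i)"
definition P :: "'i \<Rightarrow> real" where "P i = a / (a + e) * E * wt i / Z"
definition Q :: "'i \<Rightarrow> real" where "Q i = e / (a + e) * E * wt i / Z"
text \<open>The common ratio of an optimal term to its weight, so that \<open>KK * Z\<close> is the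
  minimum.\<close>

definition KK :: real where
  "KK = (a / (a + e)) powr (-a) * (e / (a + e)) powr (-e) * (E / Z) powr (-(a + e))"

lemma wt_pos: "i \<in> U \<Longrightarrow> 0 < wt i" unfolding wt_def using Wpos[of i] by simp
lemma Z_pos: "0 < Z" unfolding Z_def using fin ne wt_pos by (simp add: sum_pos)
lemma P_pos: "i \<in> U \<Longrightarrow> 0 < P i" and Q_pos: "i \<in> U \<Longrightarrow> 0 < Q i"
  unfolding P_def Q_def using wt_pos[of i] Z_pos pos by (auto intro!: divide_pos_pos mult_pos_pos)

lemma PQ_sum: "(\<Sum>i\<in>U. P i + Q i) = E"
proof -
  have "P i + Q i = E / Z * wt i" for i
  proof -
    have "P i + Q i = (a / (a + e) + e / (a + e)) * (E * wt i / Z)"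
      unfolding P_def Q_def by (simp only: distrib_right) simp
    also have "a / (a + e) + e / (a + e) = 1" using pos by (simp add: add_divide_distrib[symmetric])
    finally show ?thesis by simp
  qed
  then have "(\<Sum>i\<in>U. P i + Q i) = E / Z * Z" unfolding Z_def by (simp only: sum_distrib_left)
  then show ?thesis using Z_pos by simp
qed

lemma value_PQ: assumes "i \<in> U" shows "W i * P i powr (-a) * Q i powr (-e) = KK * wt i"
proof -
  have "P i = a / (a+e) * (E / Z) * wt i" "Q i = e / (a+e) * (E / Z) * wt i"
    by (simp_all add: P_def Q_def)
  then have "W i * P i powr (-a) * Q i powr (-e) =
     W i * ((a / (a+e)) powr (-a) * (E / Z) powr (-a) * wt i powr (-a)) *
       ((e / (a+e)) powr (-e) * (E / Z) powr (-e) * wt i powr (-e))"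
    using pos Z_pos wt_pos[OF assms] by (simp only: powr_mult)
  also have "\<dots> = KK * (W i * wt i powr (-(a+e)))"
  proof -
    have "(E / Z) powr (-(a+e)) = (E / Z) powr (-a) * (E / Z) powr (-e)"
      "wt i powr (-(a+e)) = wt i powr (-a) * wt i powr (-e)"
      by (simp_all add: powr_add[symmetric])
    then show ?thesis unfolding KK_def by (simp only: mult_ac)
  qed
  also have "W i * wt i powr (-(a+e)) = wt i"
  proof -
    have "W i = wt i powr (a + e + 1)"
      unfolding wt_def using Wpos[OF assms] pos by (simp add: powr_powr)
    then have "W i * wt i powr (-(a+e)) = wt i powr (a + e + 1) * wt i powr (-(a+e))" by simp
    also have "\<dots> = wt i powr 1" by (simp add: powr_add[symmetric])
    finally show ?thesis using wt_pos[OF assms] by simp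
  qed
  finally show ?thesis .
qed

text \<open>The minimiser of the method is known only through its minimality; this identifies it.
  Each term lies above its tangent at the optimum, and the tangents sum to \<open>KK * Z\<close> by
  the constraint. A total of at most \<open>KK * Z\<close> leaves no slack, so every term is in the
  equality case.\<close>

lemma optimal_unique:
  assumes pq: "\<And>i. i \<in> U \<Longrightarrow> 0 < p i" "\<And>i. i \<in> U \<Longrightarrow> 0 < q i" "(\<Sum>i\<in>U. p i + q i) = E"
    and le: "(\<Sum>i\<in>U. W i * p i powr (-a) * q i powr (-e)) \<le> KK * Z"
    and i: "i \<in> U"
  shows "p i = P i" "q i = Q i"
proof -
  define X Y where "X i = p i / P i" and "Y i = q i / Q i" for i
  have XY: "X i > 0" "Y i > 0" if "i \<in> U" for i
    unfolding X_def Y_def using pq P_pos Q_pos that by auto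
  have KK0: "0 < KK" unfolding KK_def using pos Z_pos by simp
  have val: "W i * p i powr (-a) * q i powr (-e) = KK * wt i * (X i powr (-a) * Y i powr (-e))" if "i \<in> U" for i
  proof -
    have "p i = P i * X i" "q i = Q i * Y i" unfolding X_def Y_def using P_pos[OF that] Q_pos[OF that] by auto
    then have "W i * p i powr (-a) * q i powr (-e) = W i * P i powr (-a) * Q i powr (-e) * (X i powr (-a) * Y i powr (-e))"
      using P_pos[OF that] Q_pos[OF that] XY[OF that] by (simp add: powr_mult)
    then show ?thesis using value_PQ[OF that] by simp
  qed
  define T where "T i = KK * wt i * (1 - a * (X i - 1) - e * (Y i - 1))" for i
  \<comment> \<open>At the optimum both partial derivatives of a term equal the same number
    \<open>- KK * (a + e) * Z / E\<close>, for every i. This is the Lagrange multiplier; because of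
    it the linear parts cancel in the sum.\<close>
  have T: "T i = KK * wt i + KK * (a + e) * Z / E * ((P i + Q i) - (p i + q i))" if "i \<in> U" for i
  proof -
    have w: "wt i > 0" by (rule wt_pos[OF that])
    define s where "s = a + e"
    have s: "s > 0" using pos by (simp add: s_def)
    have 1: "wt i * (a * (X i - 1)) = (a + e) * Z / E * (p i - P i)"
      unfolding X_def P_def s_def[symmetric] using w Z_pos pos s by (simp add: field_simps)
    have 2: "wt i * (e * (Y i - 1)) = (a + e) * Z / E * (q i - Q i)"
      unfolding Y_def Q_def s_def[symmetric] using w Z_pos pos s by (simp add: field_simps)
    have "T i = KK * wt i - KK * (wt i * (a * (X i - 1))) - KK * (wt i * (e * (Y i - 1)))"
      by (simp add: T_def algebra_simps)
    then have "T i = KK * wt i - KK * ((a + e) * Z / E * (p i - P i)) - KK * ((a + e) * Z / E * (q i - Q i))"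
      unfolding 1 2 .
    also have "\<dots> = KK * wt i + KK * ((a + e) * Z / E) * ((P i + Q i) - (p i + q i))"
      by (simp only: right_diff_distrib distrib_left mult.assoc)
    finally show ?thesis by simp
  qed
  have "(\<Sum>i\<in>U. T i) = (\<Sum>i\<in>U. KK * wt i + KK * (a + e) * Z / E * ((P i + Q i) - (p i + q i)))"
    by (rule sum.cong) (use T in auto)
  also have "\<dots> = KK * Z + KK * (a + e) * Z / E * ((\<Sum>i\<in>U. P i + Q i) - (\<Sum>i\<in>U. p i + q i))"
  proof -
    define c where "c = KK * (a + e) * Z / E"
    show ?thesis unfolding c_def[symmetric] sum.distrib sum_distrib_left[symmetric] sum_subtractf
      by (simp add: Z_def)
  qed
  finally have sT: "(\<Sum>i\<in>U. T i) = KK * Z" using PQ_sum pq(3) by simp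
  have Tle: "T i \<le> W i * p i powr (-a) * q i powr (-e)" if "i \<in> U" for i
    unfolding val[OF that] T_def
    by (rule mult_left_mono) (use powr_mult_ge_tangent(1)[OF XY[OF that] pos(1,2)] KK0 wt_pos[OF that] in auto)
  have "T i = W i * p i powr (-a) * q i powr (-e)"
  proof (rule ccontr)
    assume "T i \<noteq> W i * p i powr (-a) * q i powr (-e)"
    with Tle[OF i] have "(\<Sum>i\<in>U. T i) < (\<Sum>i\<in>U. W i * p i powr (-a) * q i powr (-e))"
      by (intro sum_strict_mono_ex1) (use Tle fin i in \<open>auto simp: less_le\<close>)
    with le sT show False by simp
  qed
  then have "X i powr (-a) * Y i powr (-e) = 1 - a * (X i - 1) - e * (Y i - 1)"
    unfolding val[OF i] T_def using KK0 wt_pos[OF i] by simp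
  from powr_mult_ge_tangent(2)[OF XY[OF i] pos(1,2) this]
  show "p i = P i" "q i = Q i" unfolding X_def Y_def using P_pos[OF i] Q_pos[OF i] by auto
qed

lemma optimal_value: "(\<Sum>i\<in>U. W i * P i powr (-a) * Q i powr (-e)) = KK * Z"
  by (simp add: value_PQ Z_def sum_distrib_left cong: sum.cong)

text \<open>Separates the budget from the weights: the exponent of E becomes the rate in the
  tolerance, and a bound on Z is all that remains to be shown for the cost.\<close>

lemma KK_Z_eq: "KK * Z = (a / (a + e)) powr (-a) * (e / (a + e)) powr (-e) * E powr (-(a + e)) * Z powr (a + e + 1)"
proof -
  have "(E / Z) powr (-(a + e)) = E powr (-(a+e)) * Z powr (a + e)"
    proof -
    have "Z powr (-(a + e)) = inverse (Z powr (a + e))" by (rule powr_minus)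
    then show ?thesis unfolding powr_divide using Z_pos by (simp only: divide_inverse inverse_inverse_eq)
  qed
  moreover have "Z powr (a + e) * Z = Z powr (a + e + 1)" using Z_pos by (simp add: powr_add)
  ultimately show ?thesis unfolding KK_def by (simp add: mult_ac)
qed

end

section \<open>Reproducing kernel Hilbert spaces\<close>

locale rkhs =
  fixes X :: "'x set" and K H ip
  assumes is_rkhs: "is_rkhs X K H ip"
begin

definition kf :: "'x \<Rightarrow> 'x \<Rightarrow> real" where "kf x = (\<lambda>z. if z \<in> X then K z x else 0)"

lemma
  shows supp: "F \<in> H \<Longrightarrow> x \<notin> X \<Longrightarrow> F x = 0"
  and zero: "(\<lambda>_. 0) \<in> H"
  and add: "F \<in> H \<Longrightarrow> E \<in> H \<Longrightarrow> (\<lambda>x. F x + E x) \<in> H"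
  and scale: "F \<in> H \<Longrightarrow> (\<lambda>x. c * F x) \<in> H"
  and ip_sym: "F \<in> H \<Longrightarrow> E \<in> H \<Longrightarrow> ip F E = ip E F"
  and ip_add: "F \<in> H \<Longrightarrow> E \<in> H \<Longrightarrow> S \<in> H \<Longrightarrow> ip (\<lambda>x. F x + E x) S = ip F S + ip E S"
  and ip_scale: "F \<in> H \<Longrightarrow> E \<in> H \<Longrightarrow> ip (\<lambda>x. c * F x) E = c * ip F E"
  and ip_nonneg: "F \<in> H \<Longrightarrow> 0 \<le> ip F F"
  and complete: "\<lbrakk>\<And>n::nat. Sq n \<in> H;
      \<And>e. e > 0 \<Longrightarrow> \<exists>N. \<forall>m\<ge>N. \<forall>n\<ge>N. ip (\<lambda>x. Sq m x - Sq n x) (\<lambda>x. Sq m x - Sq n x) < e\<rbrakk> \<Longrightarrow>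
      \<exists>F\<in>H. (\<lambda>n. ip (\<lambda>x. Sq n x - F x) (\<lambda>x. Sq n x - F x)) \<longlonglongrightarrow> 0"
  and kf_in: "x \<in> X \<Longrightarrow> kf x \<in> H"
  and reproducing: "F \<in> H \<Longrightarrow> x \<in> X \<Longrightarrow> ip F (kf x) = F x"
proof -
  note r = is_rkhs[unfolded is_rkhs_def]
  note a1 = r[THEN conjunct1] and b1 = r[THEN conjunct2]
  note a2 = b1[THEN conjunct1] and b2 = b1[THEN conjunct2]
  note a3 = b2[THEN conjunct1] and b3 = b2[THEN conjunct2]
  note a4 = b3[THEN conjunct1] and b4 = b3[THEN conjunct2]
  note a5 = b4[THEN conjunct1] and b5 = b4[THEN conjunct2]
  note a6 = b5[THEN conjunct1] and b6 = b5[THEN conjunct2]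
  note a7 = b6[THEN conjunct1] and b7 = b6[THEN conjunct2]
  note a8 = b7[THEN conjunct1] and b8 = b7[THEN conjunct2]
  note b9 = b8[THEN conjunct2]
  note a10 = b9[THEN conjunct1] and b10 = b9[THEN conjunct2]
  show "F \<in> H \<Longrightarrow> x \<notin> X \<Longrightarrow> F x = 0" by (rule a1[rule_format])
  show "(\<lambda>_. 0) \<in> H" by (rule a2)
  show "F \<in> H \<Longrightarrow> E \<in> H \<Longrightarrow> (\<lambda>x. F x + E x) \<in> H" by (rule a3[rule_format])
  show "F \<in> H \<Longrightarrow> (\<lambda>x. c * F x) \<in> H" by (rule a4[rule_format])
  show "F \<in> H \<Longrightarrow> E \<in> H \<Longrightarrow> ip F E = ip E F" by (rule a5[rule_format])
  show "F \<in> H \<Longrightarrow> E \<in> H \<Longrightarrow> S \<in> H \<Longrightarrow> ip (\<lambda>x. F x + E x) S = ip F S + ip E S" by (rule a6[rule_format])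
  show "F \<in> H \<Longrightarrow> E \<in> H \<Longrightarrow> ip (\<lambda>x. c * F x) E = c * ip F E" by (rule a7[rule_format])
  show "F \<in> H \<Longrightarrow> 0 \<le> ip F F" by (rule a8[rule_format])
  show "\<exists>F\<in>H. (\<lambda>n. ip (\<lambda>x. Sq n x - F x) (\<lambda>x. Sq n x - F x)) \<longlonglongrightarrow> 0"
    if "\<And>n::nat. Sq n \<in> H" "\<And>e. e > 0 \<Longrightarrow> \<exists>N. \<forall>m\<ge>N. \<forall>n\<ge>N. ip (\<lambda>x. Sq m x - Sq n x) (\<lambda>x. Sq m x - Sq n x) < e"
    by (rule a10[rule_format]) (use that in auto)
  show "x \<in> X \<Longrightarrow> kf x \<in> H" unfolding kf_def by (rule b10[THEN conjunct1, rule_format])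
  show "F \<in> H \<Longrightarrow> x \<in> X \<Longrightarrow> ip F (kf x) = F x" unfolding kf_def by (rule b10[THEN conjunct2, rule_format])
qed

lemma diff: assumes "F \<in> H" "E \<in> H" shows "(\<lambda>x. F x - E x) \<in> H"
proof -
  have "(\<lambda>x. F x + (-1) * E x) \<in> H" by (rule add[OF assms(1) scale[OF assms(2)]])
  then show ?thesis by simp
qed

lemma ip_diff: assumes "F \<in> H" "E \<in> H" "S \<in> H" shows "ip (\<lambda>x. F x - E x) S = ip F S - ip E S"
proof -
  have "ip (\<lambda>x. F x + (-1) * E x) S = ip F S + (-1) * ip E S"
    unfolding ip_add[OF assms(1) scale[OF assms(2)] assms(3)] ip_scale[OF assms(2,3)] ..
  then show ?thesis by simp
qed

lemma ip_add': assumes "F \<in> H" "E \<in> H" "S \<in> H" shows "ip S (\<lambda>x. F x + E x) = ip S F + ip S E"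
  unfolding ip_sym[OF assms(3) add[OF assms(1,2)]] ip_add[OF assms]
    ip_sym[OF assms(1,3)] ip_sym[OF assms(2,3)] ..

lemma ip_scale': assumes "F \<in> H" "E \<in> H" shows "ip E (\<lambda>x. c * F x) = c * ip E F"
  unfolding ip_sym[OF assms(2) scale[OF assms(1)]] ip_scale[OF assms] ip_sym[OF assms] ..

lemma ip_lincomb:
  assumes "F \<in> H" "E \<in> H"
  shows "ip (\<lambda>x. F x + s * E x) (\<lambda>x. F x + s * E x) = ip F F + 2 * s * ip F E + s\<^sup>2 * ip E E"
proof -
  note sE = scale[OF assms(2), of s] and FE = add[OF assms(1) scale[OF assms(2), of s]]
  show ?thesis
    unfolding ip_add[OF assms(1) sE FE] ip_add'[OF assms(1) sE assms(1)] ip_add'[OF assms(1) sE sE]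
      ip_scale[OF assms(2) assms(1)] ip_scale[OF assms(2) sE] ip_scale'[OF assms(2) assms(1)]
      ip_scale'[OF assms(2) assms(2)] ip_sym[OF assms(2,1)]
    by (simp add: power2_eq_square algebra_simps)
qed

lemma Cauchy_Schwarz: assumes "F \<in> H" "E \<in> H" shows "(ip F E)\<^sup>2 \<le> ip F F * ip E E"
proof -
  have q: "0 \<le> ip F F + 2 * s * ip F E + s\<^sup>2 * ip E E" for s
    using ip_nonneg[OF add[OF assms(1) scale[OF assms(2), of s]]] unfolding ip_lincomb[OF assms] .
  show ?thesis
  proof (cases "ip E E = 0")
    case True
    have "ip F E = 0"
    proof (rule ccontr)
      assume n: "ip F E \<noteq> 0"
      have "2 * (- (ip F F + 1) / (2 * ip F E)) * ip F E = - (ip F F + 1)" using n by simp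
      then have "ip F F + 2 * (- (ip F F + 1) / (2 * ip F E)) * ip F E + (- (ip F F + 1) / (2 * ip F E))\<^sup>2 * ip E E = -1"
        unfolding True by simp
      with q[of "- (ip F F + 1) / (2 * ip F E)"] show False by linarith
    qed
    then show ?thesis using True by simp
  next
    case False
    then have p: "ip E E > 0" using ip_nonneg[OF assms(2)] by simp
    have "0 \<le> (ip F F + 2 * (- ip F E / ip E E) * ip F E + (- ip F E / ip E E)\<^sup>2 * ip E E) * ip E E"
      by (rule mult_nonneg_nonneg[OF q]) (use p in simp)
    also have "\<dots> = ip F F * ip E E - (ip F E)\<^sup>2" using p by (simp add: power2_eq_square field_simps)
    finally show ?thesis by simp
  qed
qed

section \<open>Finite combinations of kernel functions and a membership criterion\<close>

fun comb :: "(real \<times> 'x) list \<Rightarrow> 'x \<Rightarrow> real" where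
  "comb [] = (\<lambda>_. 0)"
| "comb ((c, x) # xs) = (\<lambda>z. c * kf x z + comb xs z)"

definition ev :: "('x \<Rightarrow> real) \<Rightarrow> (real \<times> 'x) list \<Rightarrow> real" where
  "ev F xs = (\<Sum>(c, x)\<leftarrow>xs. c * F x)"

lemma comb_in: "snd ` set xs \<subseteq> X \<Longrightarrow> comb xs \<in> H"
proof (induction xs rule: comb.induct)
  case 1
  show ?case unfolding comb.simps by (rule zero)
next
  case (2 c x xs)
  then have x: "x \<in> X" and xs: "comb xs \<in> H" by auto
  show ?case unfolding comb.simps by (rule add[OF scale[OF kf_in[OF x]] xs])
qed

lemma ip_comb: "E \<in> H \<Longrightarrow> snd ` set xs \<subseteq> X \<Longrightarrow> ip E (comb xs) = ev E xs"
proof (induction xs rule: comb.induct)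
  case 1
  show ?case unfolding comb.simps using ip_scale'[OF 1(1) 1(1), of 0] by (simp add: ev_def)
next
  case (2 c x xs)
  then have x: "x \<in> X" and xs: "comb xs \<in> H" "ip E (comb xs) = ev E xs" using comb_in by auto
  show ?case
    unfolding comb.simps ip_add'[OF scale[OF kf_in[OF x]] xs(1) 2(2)] ip_scale'[OF kf_in[OF x] 2(2)]
      reproducing[OF 2(2) x] xs(2) by (simp add: ev_def)
qed

text \<open>Points may occur repeatedly in a list, so concatenation is addition and no coefficients
  have to be collected.\<close>

lemma comb_append: "comb (xs @ ys) = (\<lambda>z. comb xs z + comb ys z)"
  by (induction xs rule: comb.induct) (auto simp: fun_eq_iff)

lemma comb_scale: "comb (map (\<lambda>(c, x). (s * c, x)) xs) = (\<lambda>z. s * comb xs z)"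
  by (induction xs rule: comb.induct) (auto simp: fun_eq_iff algebra_simps)

lemma ev_append: "ev F (xs @ ys) = ev F xs + ev F ys"
  by (simp add: ev_def)

lemma ev_scale: "ev F (map (\<lambda>(c, x). (s * c, x)) xs) = s * ev F xs"
  unfolding ev_def by (induction xs) (auto simp: algebra_simps)

lemma ev_comb: "snd ` set xs \<subseteq> X \<Longrightarrow> ev (comb ys) xs = (\<Sum>(c, x)\<leftarrow>xs. \<Sum>(c', x')\<leftarrow>ys. c * c' * K x x')"
proof -
  have *: "c * comb ys x = (\<Sum>(c', x')\<leftarrow>ys. c * c' * K x x')" if "x \<in> X" for c x
    using that by (induction ys rule: comb.induct) (auto simp: kf_def algebra_simps)
  show "snd ` set xs \<subseteq> X \<Longrightarrow> ?thesis"
    unfolding ev_def by (induction xs) (auto simp: *)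
qed

text \<open>A minimising sequence of \<open>J\<close>, the squared distance to \<open>F\<close> up to a constant, is Cauchy; its limit has
  the values of \<open>F\<close>.\<close>

lemma criterion:
  assumes out: "\<And>x. x \<notin> X \<Longrightarrow> F x = 0" and c: "0 \<le> c"
    and bound: "\<And>xs. snd ` set xs \<subseteq> X \<Longrightarrow>
      (\<Sum>(c, x)\<leftarrow>xs. c * F x)\<^sup>2 \<le> c\<^sup>2 * (\<Sum>(c, x)\<leftarrow>xs. \<Sum>(c', x')\<leftarrow>xs. c * c' * K x x')"
  shows "F \<in> H" "ip F F \<le> c\<^sup>2"
proof -
  define q where "q xs = ip (comb xs) (comb xs)" for xs
  define J where "J xs = q xs - 2 * ev F xs" for xs
  let ?L = "{xs :: (real \<times> 'x) list. snd ` set xs \<subseteq> X}"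
  have q0: "q xs \<ge> 0" if "xs \<in> ?L" for xs unfolding q_def by (rule ip_nonneg[OF comb_in]) (use that in simp)
  have bd: "(ev F xs)\<^sup>2 \<le> c\<^sup>2 * q xs" if "xs \<in> ?L" for xs
  proof -
    have x: "snd ` set xs \<subseteq> X" using that by simp
    show ?thesis unfolding q_def ip_comb[OF comb_in[OF x] x] ev_comb[OF x] using bound[OF x] by (simp add: ev_def)
  qed
  have Jge: "- c\<^sup>2 \<le> J xs" if "xs \<in> ?L" for xs
  proof -
    have "ev F xs \<le> c * sqrt (q xs)"
      by (rule power2_le_imp_le) (use bd[OF that] q0[OF that] c in \<open>auto simp: power_mult_distrib\<close>)
    moreover have "0 \<le> (sqrt (q xs) - c)\<^sup>2" by simp
    ultimately show ?thesis unfolding J_def using q0[OF that] by (simp add: power2_diff mult.commute[of _ c])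
  qed
  define m where "m = Inf (J ` ?L)"
  have bdd: "bdd_below (J ` ?L)" using Jge by (auto intro!: bdd_belowI[of _ "- c\<^sup>2"])
  have mle: "m \<le> J xs" if "xs \<in> ?L" for xs unfolding m_def by (rule cInf_lower) (use that bdd in auto)
  have "\<exists>xs\<in>?L. J xs < m + 1 / Suc n" for n
  proof -
    have "[] \<in> ?L" by simp
    then have "J ` ?L \<noteq> {}" by blast
    moreover have "Inf (J ` ?L) < m + 1 / Suc n" unfolding m_def[symmetric] by simp
    ultimately show ?thesis using cInf_lessD[of "J ` ?L" "m + 1 / Suc n"] by auto
  qed
  then obtain xs where xs: "\<And>n. xs n \<in> ?L" "\<And>n. J (xs n) < m + 1 / Suc n" by metis
  define S where "S n = comb (xs n)" for n
  have SH: "S n \<in> H" for n unfolding S_def using xs(1)[of n] comb_in by simp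
  have J_add: "J (as @ bs) = J as + J bs + 2 * ip (comb as) (comb bs)" if "as \<in> ?L" "bs \<in> ?L" for as bs
  proof -
    have a: "comb as \<in> H" and b: "comb bs \<in> H" using that comb_in by auto
    show ?thesis unfolding J_def q_def comb_append ev_append using ip_lincomb[OF a b, of 1] by simp
  qed
  have J_scale: "J (map (\<lambda>(c, x). (s * c, x)) as) = s\<^sup>2 * q as - 2 * s * ev F as" if "as \<in> ?L" for s as
  proof -
    have a: "comb as \<in> H" using that comb_in by auto
    show ?thesis unfolding J_def q_def comb_scale ev_scale ip_scale[OF a scale[OF a]] ip_scale'[OF a a]
      by (simp add: power2_eq_square)
  qed
  have diffb: "ip (\<lambda>x. S i x - S j x) (\<lambda>x. S i x - S j x) \<le> 2 / Suc i + 2 / Suc j" for i j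
  proof -
    \<comment> \<open>The midpoint of two nearly minimal combinations cannot go below m. Together
      with the parallelogram law this forces the two combinations to be close.\<close>
    let ?m = "map (\<lambda>(c, x). (1/2 * c, x)) (xs i @ xs j)"
    have ap: "xs i @ xs j \<in> ?L" using xs(1)[of i] xs(1)[of j] by auto
    have "?m \<in> ?L" using ap by force
    then have "m \<le> J ?m" by (rule mle)
    also have "\<dots> = (1/4) * q (xs i @ xs j) - ev F (xs i) - ev F (xs j)"
      unfolding J_scale[OF ap] ev_append by (simp add: power2_eq_square algebra_simps)
    finally have 1: "m \<le> (1/4) * q (xs i @ xs j) - ev F (xs i) - ev F (xs j)" .
    have "q (xs i @ xs j) + ip (\<lambda>x. S i x - S j x) (\<lambda>x. S i x - S j x) = 2 * q (xs i) + 2 * q (xs j)"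
      unfolding q_def comb_append S_def[symmetric]
      using ip_lincomb[OF SH SH, of i 1 j] ip_lincomb[OF SH SH, of i "-1" j] by simp
    moreover have "2 / real (Suc n) = 2 * (1 / real (Suc n))" for n by simp
    ultimately show ?thesis using 1 xs(2)[of i] xs(2)[of j] unfolding J_def by linarith
  qed
  have "\<exists>N. \<forall>m\<ge>N. \<forall>n\<ge>N. ip (\<lambda>x. S m x - S n x) (\<lambda>x. S m x - S n x) < e" if "e > 0" for e
  proof -
    obtain N where N: "4 / e < real N" using reals_Archimedean2 by blast
    have "ip (\<lambda>x. S i x - S j x) (\<lambda>x. S i x - S j x) < e" if "i \<ge> N" "j \<ge> N" for i j
    proof -
      have "2 / Suc i \<le> 2 / Suc N" "2 / Suc j \<le> 2 / Suc N" using that by (auto intro!: divide_left_mono)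
      moreover have "4 < e * real N" using N \<open>e > 0\<close> by (simp add: field_simps)
      then have "4 < e * real (Suc N)" using \<open>e > 0\<close> by (simp add: algebra_simps)
      then have "4 / Suc N < e" by (simp add: field_simps)
      moreover have "2 / real (Suc N) + 2 / Suc N = 4 / Suc N" by simp
      ultimately show ?thesis using diffb[of i j] by linarith
    qed
    then show ?thesis by blast
  qed
  then obtain F' where F': "F' \<in> H" "(\<lambda>n. ip (\<lambda>x. S n x - F' x) (\<lambda>x. S n x - F' x)) \<longlonglongrightarrow> 0"
    using complete[of S] SH by blast
  have lim: "(\<lambda>n. ip (S n) E) \<longlonglongrightarrow> ip F' E" if E: "E \<in> H" for E
  proof -
    have l0: "(\<lambda>n. sqrt (ip (\<lambda>x. S n x - F' x) (\<lambda>x. S n x - F' x) * ip E E)) \<longlonglongrightarrow> sqrt (0 * ip E E)"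
      by (intro tendsto_intros F')
    have bnd: "norm (ip (S n) E - ip F' E) \<le> sqrt (ip (\<lambda>x. S n x - F' x) (\<lambda>x. S n x - F' x) * ip E E)" for n
    proof -
      have "(ip (S n) E - ip F' E)\<^sup>2 \<le> ip (\<lambda>x. S n x - F' x) (\<lambda>x. S n x - F' x) * ip E E"
        using Cauchy_Schwarz[OF diff[OF SH F'(1)] E, of n] unfolding ip_diff[OF SH F'(1) E] .
      then have "sqrt ((ip (S n) E - ip F' E)\<^sup>2) \<le> sqrt (ip (\<lambda>x. S n x - F' x) (\<lambda>x. S n x - F' x) * ip E E)"
        by (rule real_sqrt_le_mono)
      then show ?thesis by simp
    qed
    have "(\<lambda>n. ip (S n) E - ip F' E) \<longlonglongrightarrow> 0"
      by (rule Lim_null_comparison[OF always_eventually[OF allI[OF bnd]]]) (use l0 in simp)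
    then show ?thesis by (simp add: LIM_zero_iff)
  qed
  have "F' x = F x" if x: "x \<in> X" for x
  proof -
    define d where "d n = S n x - F x" for n
    define k where "k = ip (kf x) (kf x)"
    have k0: "k \<ge> 0" unfolding k_def using kf_in[OF x] by (rule ip_nonneg)
    have dn: "(d n)\<^sup>2 \<le> (k + 1) / Suc n" for n
    proof -
      \<comment> \<open>Adding \<open>s\<close> times \<open>kf x\<close> changes J by
        \<open>s^2 * k + 2 * s * d n\<close>. This s is close to the minimising one; k + 1 replaces
        k because the kernel may vanish at x. As J cannot fall below m, the defect
        \<open>d n\<close> must be small.\<close>
      define s where "s = - d n / (k + 1)"
      have sx: "[(s, x)] \<in> ?L" using x by simp
      have "xs n @ [(s, x)] \<in> ?L" using xs(1)[of n] x by auto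
      then have "m \<le> J (xs n @ [(s, x)])" by (rule mle)
      also have "\<dots> = J (xs n) + J [(s, x)] + 2 * ip (comb (xs n)) (comb [(s, x)])"
        by (rule J_add[OF xs(1) sx])
      also have "\<dots> = J (xs n) + s\<^sup>2 * k + 2 * s * d n"
      proof -
        have k: "kf x \<in> H" by (rule kf_in[OF x])
        have "J [(s, x)] = s\<^sup>2 * k - 2 * (s * F x)"
          unfolding J_def q_def using ip_scale[OF k scale[OF k], of s s] ip_scale'[OF k k, of s]
          by (simp add: k_def ev_def power2_eq_square)
        moreover have "ip (comb (xs n)) (comb [(s, x)]) = s * S n x"
          using ip_scale'[OF k SH, of n s] reproducing[OF SH x, of n] by (simp add: S_def)
        ultimately show ?thesis by (simp add: d_def algebra_simps)
      qed
      finally have "0 \<le> 1 / Suc n + s\<^sup>2 * k + 2 * s * d n" using xs(2)[of n] by linarith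
      moreover have "s\<^sup>2 * k + 2 * s * d n \<le> - (d n)\<^sup>2 / (k + 1)"
      proof -
        have "s\<^sup>2 * k \<le> s\<^sup>2 * (k + 1)" by (intro mult_left_mono) auto
        also have "\<dots> = (d n)\<^sup>2 / (k + 1)"
        proof -
          have "k + 1 \<noteq> 0" using k0 by simp
          then show ?thesis unfolding s_def by (simp add: power2_eq_square)
        qed
        also have "\<dots> = - (s * d n)" unfolding s_def by (simp add: power2_eq_square)
        finally show ?thesis unfolding s_def by (simp add: power2_eq_square)
      qed
      ultimately have "(d n)\<^sup>2 / (k + 1) \<le> 1 / Suc n" by linarith
      then show ?thesis using k0 by (simp add: field_simps)
    qed
    have "(\<lambda>n. (k + 1) * inverse (real (Suc n))) \<longlonglongrightarrow> (k + 1) * 0"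
      by (intro tendsto_intros LIMSEQ_inverse_real_of_nat)
    then have "(\<lambda>n. (d n)\<^sup>2) \<longlonglongrightarrow> 0"
      by (intro Lim_null_comparison[of "\<lambda>n. (d n)\<^sup>2" "\<lambda>n. (k + 1) * inverse (real (Suc n))"] always_eventually)
        (use dn in \<open>auto simp: divide_inverse\<close>)
    then have "d \<longlonglongrightarrow> 0" using tendsto_real_sqrt[of "\<lambda>n. (d n)\<^sup>2" 0] by (simp add: tendsto_rabs_zero_iff)
    moreover have "d \<longlonglongrightarrow> F' x - F x" unfolding d_def
      using lim[OF kf_in[OF x]] unfolding reproducing[OF SH x] reproducing[OF F'(1) x] by (intro tendsto_intros)
    ultimately show ?thesis using LIMSEQ_unique by fastforce
  qed
  then have FF': "F' = F" using out supp[OF F'(1)] by (metis ext)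
  show FH: "F \<in> H" using F' FF' by simp
  \<comment> \<open>The hypothesis, applied to the combinations \<open>xs n\<close>, bounds
    \<open>ip (S n) F\<close> by their norms; in the limit both sides are powers of
    \<open>ip F F\<close>.\<close>
  have "(ip F F)\<^sup>2 \<le> c\<^sup>2 * ip F F"
  proof (rule LIMSEQ_le)
    show "(\<lambda>n. (ip (S n) F)\<^sup>2) \<longlonglongrightarrow> (ip F F)\<^sup>2"
      using lim[OF FH] FF' by (intro tendsto_intros) auto
    have "(\<lambda>n. c\<^sup>2 * (ip (\<lambda>x. S n x - F x) (\<lambda>x. S n x - F x) + 2 * ip (S n) F - ip F F)) \<longlonglongrightarrow> c\<^sup>2 * (0 + 2 * ip F F - ip F F)"
      using lim[OF FH] F'(2) FF' by (intro tendsto_intros) auto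
    moreover have "ip (\<lambda>x. S n x - F x) (\<lambda>x. S n x - F x) + 2 * ip (S n) F - ip F F = q (xs n)" for n
      using ip_lincomb[OF SH FH, of n "-1"] by (simp add: q_def S_def)
    ultimately show "(\<lambda>n. c\<^sup>2 * q (xs n)) \<longlonglongrightarrow> c\<^sup>2 * ip F F" by simp
    show "\<exists>N. \<forall>n\<ge>N. (ip (S n) F)\<^sup>2 \<le> c\<^sup>2 * q (xs n)"
    proof (intro exI allI impI)
      fix n
      have "ip (S n) F = ev F (xs n)"
        unfolding ip_sym[OF SH FH] unfolding S_def by (rule ip_comb[OF FH]) (use xs(1)[of n] in simp)
      then show "(ip (S n) F)\<^sup>2 \<le> c\<^sup>2 * q (xs n)" using bd[OF xs(1)] by simp
    qed
  qed
  then show "ip F F \<le> c\<^sup>2" using ip_nonneg[OF FH] by (cases "ip F F = 0") (auto simp: power2_eq_square)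
qed

end

section \<open>The anchored kernel\<close>

text \<open>The integral in \<^const>\<open>kernel1\<close> is the inner product of truncated powers in \<open>L\<^sup>2(0, 1/2)\<close>; negative
  arguments are treated by reflection.\<close>

definition half_unit :: "real measure" where
  "half_unit = restrict_space lborel {0..1/2}"

text \<open>The condition 0 < x makes the function vanish identically at x = 0 as well, where for
  \<alpha> = 1 the formula would give 1 at t = 0. Products for arguments with x * y \<le> 0 are then
  zero everywhere, as in \<open>kernel1\<close>.\<close>

definition trunc_pow :: "nat \<Rightarrow> real \<Rightarrow> real \<Rightarrow> real" where
  "trunc_pow \<alpha> x t = (if 0 < x \<and> 0 \<le> t \<and> t \<le> x then (x - t) ^ (\<alpha> - 1) / fact (\<alpha> - 1) else 0)"

lemma finite_half_unit: "finite_measure half_unit"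
  unfolding half_unit_def by (intro finite_measureI) (simp add: emeasure_restrict_space)

lemma measure_half_unit: "measure half_unit (space half_unit) = 1/2"
  unfolding half_unit_def by (simp add: measure_restrict_space)

lemma measurable_trunc_pow [measurable]: "trunc_pow \<alpha> x \<in> borel_measurable borel"
  unfolding trunc_pow_def[abs_def] by measurable

lemma measurable_half_unitI: "f \<in> borel_measurable borel \<Longrightarrow> f \<in> borel_measurable half_unit"
  unfolding half_unit_def by (simp add: measurable_restrict_space1)

lemma integrable_half_unit:
  assumes "f \<in> borel_measurable borel" "\<And>t. \<bar>f t\<bar> \<le> B"
  shows "integrable half_unit (f :: real \<Rightarrow> real)"
  using finite_measure.integrable_const_bound[OF finite_half_unit, of f B]
    measurable_half_unitI[OF assms(1)] assms(2) by auto

lemma LINT_half_unit: "(LINT t|half_unit. f t) = (LINT t|lborel. indicator {0..1/2} t * (f t :: real))"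
  unfolding half_unit_def by (subst integral_restrict_space) auto

lemma trunc_pow_bound:
  assumes "\<bar>x\<bar> \<le> 1/2" shows "\<bar>trunc_pow \<alpha> x t\<bar> \<le> 1"
proof -
  have "(x - t) ^ (\<alpha> - 1) \<le> 1" if "0 \<le> t" "t \<le> x"
    using assms that by (intro power_le_one) auto
  moreover have "(1::real) \<le> fact (\<alpha> - 1)" by (simp add: fact_ge_1)
  ultimately show ?thesis unfolding trunc_pow_def
    by (auto simp: divide_le_eq intro: order_trans)
qed

text \<open>Cauchy-Schwarz against the constant 1 on a space of mass 1/2, proved as nonnegativity of
  the variance about the mean 2 * m.\<close>

lemma square_LINT_half_unit_le:
  fixes f :: "real \<Rightarrow> real"
  assumes "f \<in> borel_measurable borel" "\<And>t. \<bar>f t\<bar> \<le> B"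
  shows "(LINT t|half_unit. f t)\<^sup>2 \<le> (1/2) * (LINT t|half_unit. (f t)\<^sup>2)"
proof -
  interpret finite_measure half_unit by (rule finite_half_unit)
  define m where "m = (LINT t|half_unit. f t)"
  have i: "integrable half_unit f" by (rule integrable_half_unit[OF assms])
  have "\<bar>(f t)\<^sup>2\<bar> \<le> B\<^sup>2" for t using assms(2)[of t] by (simp add: abs_le_square_iff[symmetric])
  then have i2: "integrable half_unit (\<lambda>t. (f t)\<^sup>2)"
    by (intro integrable_half_unit) (use assms in auto)
  have "0 \<le> (LINT t|half_unit. (f t - 2 * m)\<^sup>2)" by simp
  also have "(\<lambda>t. (f t - 2 * m)\<^sup>2) = (\<lambda>t. (f t)\<^sup>2 - 4 * m * f t + 4 * m\<^sup>2)"
    by (auto simp: power2_eq_square algebra_simps)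
  also have "(LINT t|half_unit. (f t)\<^sup>2 - 4 * m * f t + 4 * m\<^sup>2) = (LINT t|half_unit. (f t)\<^sup>2) - 4 * m * m + 4 * m\<^sup>2 * (1/2)"
    using i i2 by (simp add: m_def measure_half_unit)
  finally show ?thesis unfolding m_def[symmetric] by (simp add: power2_eq_square)
qed

lemma kernel_tail:
  assumes "0 < x" "0 < y" "\<bar>x\<bar> \<le> 1/2" "\<bar>y\<bar> \<le> 1/2"
  shows "(LINT t|half_unit. trunc_pow \<alpha> x t * trunc_pow \<alpha> y t) =
    integral {0..min x y} (\<lambda>t. (x - t) ^ (\<alpha> - 1) / fact (\<alpha> - 1) * ((y - t) ^ (\<alpha> - 1) / fact (\<alpha> - 1)))"
    (is "_ = integral ?S ?f")
proof -
  have "(LINT t|half_unit. trunc_pow \<alpha> x t * trunc_pow \<alpha> y t) = (LINT t|lborel. indicator ?S t *\<^sub>R ?f t)"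
    unfolding LINT_half_unit
    by (rule Bochner_Integration.integral_cong)
      (use assms in \<open>auto simp: trunc_pow_def indicator_def\<close>)
  also have "\<dots> = (LINT t:?S|lborel. ?f t)" by (simp add: set_lebesgue_integral_def)
  also have "\<dots> = integral ?S ?f"
  proof (rule set_borel_integral_eq_integral)
    show "set_integrable lborel ?S ?f" unfolding set_integrable_def
      by (rule borel_integrable_compact) (auto intro!: continuous_intros)
  qed
  finally show ?thesis .
qed

lemma trunc_pow_neg: "x \<le> 0 \<Longrightarrow> trunc_pow \<alpha> x t = 0"
  by (simp add: trunc_pow_def)

text \<open>Exhibits the kernel as a sum and an integral of products g(x) g(y), the form that the
  Schur product argument below uses.\<close>

lemma kernel1_eq:
  assumes "\<bar>x\<bar> \<le> 1/2" "\<bar>y\<bar> \<le> 1/2"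
  shows "kernel1 \<alpha> x y = (\<Sum>r\<in>{1..<\<alpha>}. x ^ r / fact r * (y ^ r / fact r)) +
     (LINT t|half_unit. trunc_pow \<alpha> x t * trunc_pow \<alpha> y t) +
     (LINT t|half_unit. trunc_pow \<alpha> (-x) t * trunc_pow \<alpha> (-y) t)"
proof -
  consider "0 < x" "0 < y" | "x < 0" "y < 0" | "x * y \<le> 0"
    by (metis linorder_less_linear mult_neg_pos mult_pos_neg mult_zero_left mult_zero_right order_le_less)
  then show ?thesis
  proof cases
    case 1
    then show ?thesis using kernel_tail[of x y \<alpha>] assms
      by (simp add: kernel1_def trunc_pow_neg abs_of_pos)
  next
    case 2
    then show ?thesis using kernel_tail[of "-x" "-y" \<alpha>] assms
      by (simp add: kernel1_def trunc_pow_neg abs_of_neg mult_neg_neg)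
  next
    case 3
    then have "(\<lambda>t. trunc_pow \<alpha> x t * trunc_pow \<alpha> y t) = (\<lambda>_. 0)"
      "(\<lambda>t. trunc_pow \<alpha> (-x) t * trunc_pow \<alpha> (-y) t) = (\<lambda>_. 0)"
      by (auto simp: trunc_pow_def mult_le_0_iff)
    then show ?thesis using 3 by (simp add: kernel1_def)
  qed
qed

section \<open>Monomials as integrals of truncated powers\<close>

lemma DERIV_power_over_fact:
  "((\<lambda>t::real. t ^ (m + 1) / fact (m + 1)) has_real_derivative t ^ m / fact m) (at t)"
proof -
  have "((\<lambda>t::real. t ^ (m + 1) / fact (m + 1)) has_real_derivative (real (m + 1) * t ^ (m + 1 - Suc 0)) / fact (m + 1)) (at t)"
    by (rule DERIV_cdivide[OF DERIV_pow])
  also have "(real (m + 1) * t ^ (m + 1 - Suc 0)) / fact (m + 1) = t ^ m / fact m"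
    by (simp add: field_simps del: of_nat_Suc of_nat_add)
  finally show ?thesis .
qed

text \<open>Euler's beta integral by repeated integration by parts. Carrying an antiderivative on
  the whole line through the induction avoids integrability and sign conditions on x.\<close>

lemma beta_antideriv:
  "\<exists>A. (\<forall>t::real. (A has_real_derivative (x - t) ^ p / fact p * (t ^ m / fact m)) (at t)) \<and>
      A x - A 0 = x ^ (p + m + 1) / fact (p + m + 1)"
proof (induction p arbitrary: m)
  case 0
  show ?case
    using DERIV_power_over_fact[of m]
    by (intro exI[of _ "\<lambda>t. t ^ (m + 1) / fact (m + 1)"] conjI allI) (auto simp del: fact_Suc)
next
  case (Suc p)
  from Suc[of "m + 1"] obtain A where A:
    "\<And>t. (A has_real_derivative (x - t) ^ p / fact p * (t ^ (m+1) / fact (m+1))) (at t)"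
    "A x - A 0 = x ^ (p + (m + 1) + 1) / fact (p + (m + 1) + 1)" by blast
  define B where "B t = (x - t) ^ Suc p / fact (Suc p) * (t ^ (m + 1) / fact (m + 1)) + A t" for t
  have "(B has_real_derivative (x - t) ^ Suc p / fact (Suc p) * (t ^ m / fact m)) (at t)" for t
  proof -
    have 1: "((\<lambda>t. (x - t) ^ Suc p / fact (Suc p)) has_real_derivative - ((x - t) ^ p / fact p)) (at t)"
    proof -
      have "((\<lambda>t. x - t) has_real_derivative -1) (at t)" by (auto intro!: derivative_eq_intros)
      from DERIV_chain2[OF DERIV_power_over_fact[of p "x - t"] this] show ?thesis by simp
    qed
    note 2 = DERIV_power_over_fact[of m t]
    show ?thesis unfolding B_def
      by (rule DERIV_cong[OF DERIV_add[OF DERIV_mult[OF 1 2] A(1)]]) (simp add: algebra_simps)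
  qed
  moreover have "B x - B 0 = x ^ (Suc p + m + 1) / fact (Suc p + m + 1)"
    using A(2) by (simp add: B_def)
  ultimately show ?case by blast
qed

lemma LINT_trunc_pow_power:
  assumes x: "0 < x" "x \<le> 1/2" and n: "1 \<le> \<alpha>" "\<alpha> \<le> n"
  shows "(LINT t|half_unit. trunc_pow \<alpha> x t * t ^ (n - \<alpha>)) = fact (n - \<alpha>) / fact n * x ^ n"
proof -
  obtain A where A: "\<And>t. (A has_real_derivative (x - t) ^ (\<alpha>-1) / fact (\<alpha>-1) * (t ^ (n-\<alpha>) / fact (n-\<alpha>))) (at t)"
      "A x - A 0 = x ^ (\<alpha>-1 + (n-\<alpha>) + 1) / fact (\<alpha>-1 + (n-\<alpha>) + 1)" using beta_antideriv by blast
  have "(LINT t|half_unit. trunc_pow \<alpha> x t * t ^ (n - \<alpha>)) =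
      (LINT t|lborel. fact (n-\<alpha>) * ((x - t) ^ (\<alpha>-1) / fact (\<alpha>-1) * (t ^ (n-\<alpha>) / fact (n-\<alpha>)) * indicator {0..x} t))"
    unfolding LINT_half_unit
    by (rule Bochner_Integration.integral_cong) (use x in \<open>auto simp: trunc_pow_def indicator_def\<close>)
  also have "\<dots> = fact (n-\<alpha>) * (LINT t|lborel. (x - t) ^ (\<alpha>-1) / fact (\<alpha>-1) * (t ^ (n-\<alpha>) / fact (n-\<alpha>)) * indicator {0..x} t)"
    by (rule integral_mult_right_zero)
  also have "(LINT t|lborel. (x - t) ^ (\<alpha>-1) / fact (\<alpha>-1) * (t ^ (n-\<alpha>) / fact (n-\<alpha>)) * indicator {0..x} t) = A x - A 0"
    by (rule integral_FTC_Icc_real) (use x A in \<open>auto intro!: continuous_intros\<close>)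
  also have "\<alpha>-1 + (n-\<alpha>) + 1 = n" using n by simp
  then have "A x - A 0 = x ^ n / fact n" using A(2) by simp
  finally show ?thesis by simp
qed

text \<open>Taylor's formula at 0 with integral remainder. Since \<alpha> \<le> n, the derivatives
  of the monomial of order below \<alpha> vanish at 0 and only the remainder is left. Reflection
  handles x < 0 and produces the sign (-1) ^ n.\<close>

lemma power_eq_LINT:
  assumes x: "\<bar>x\<bar> \<le> 1/2" and n: "1 \<le> \<alpha>" "\<alpha> \<le> n"
  shows "x ^ n = fact n / fact (n - \<alpha>) *
    (LINT t|half_unit. (trunc_pow \<alpha> x t + (-1) ^ n * trunc_pow \<alpha> (-x) t) * t ^ (n - \<alpha>))"
proof -
  consider "x = 0" | "0 < x" | "x < 0" by linarith
  then show ?thesis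
  proof cases
    case 1 then show ?thesis using n by (simp add: trunc_pow_def)
  next
    case 2 then show ?thesis using LINT_trunc_pow_power[of x \<alpha> n] x n
      by (simp add: trunc_pow_neg)
  next
    case 3
    have "(LINT t|half_unit. (trunc_pow \<alpha> x t + (-1) ^ n * trunc_pow \<alpha> (-x) t) * t ^ (n - \<alpha>))
       = (-1) ^ n * (LINT t|half_unit. trunc_pow \<alpha> (-x) t * t ^ (n - \<alpha>))"
      using 3 by (simp add: trunc_pow_neg mult.assoc)
    also have "\<dots> = (-1) ^ n * (fact (n - \<alpha>) / fact n * (-x) ^ n)"
      using LINT_trunc_pow_power[of "-x" \<alpha> n] 3 x n by simp
    also have "(-x) ^ n = (-1) ^ n * x ^ n" by (rule power_minus)
    finally show ?thesis by (simp flip: power_add mult.assoc)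
  qed
qed

text \<open>A bound for the norm of y ^ n in the one-variable space: fact n / fact (n - \<alpha>) is
  at most n ^ \<alpha>, and t ^ (n - \<alpha>) is at most 2 ^ \<alpha> / 2 ^ n on [0, 1/2]. For n <
  \<alpha> it dominates fact n.\<close>

definition mono_weight :: "nat \<Rightarrow> nat \<Rightarrow> real" where
  "mono_weight \<alpha> n = real n ^ \<alpha> * 2 ^ \<alpha> / 2 ^ n"

lemma fact_div_fact_le: "\<alpha> \<le> n \<Longrightarrow> fact n / fact (n - \<alpha>) \<le> (real n ^ \<alpha>)"
proof (induction \<alpha>)
  case (Suc \<alpha>)
  have "n - \<alpha> = Suc (n - Suc \<alpha>)" using Suc.prems by simp
  then have f: "fact (n - \<alpha>) = real (n - \<alpha>) * fact (n - Suc \<alpha>)" by (metis fact_Suc)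
  have "fact n / fact (n - Suc \<alpha>) = real (n - \<alpha>) * (fact n / fact (n - \<alpha>))"
    unfolding f using Suc.prems by simp
  also have "\<dots> \<le> real n * real n ^ \<alpha>"
    by (intro mult_mono Suc.IH) (use Suc.prems in auto)
  finally show ?case by simp
qed simp

lemma mono_weight_pos: "1 \<le> n \<Longrightarrow> 0 < mono_weight \<alpha> n"
  by (simp add: mono_weight_def)

section \<open>Multiplication by one more variable, at the level of quadratic forms\<close>

context
  fixes m :: nat and \<alpha> :: nat and x :: "nat \<Rightarrow> real" and Kr :: "nat \<Rightarrow> nat \<Rightarrow> real" and Fr :: "nat \<Rightarrow> real"
  assumes x: "\<And>i. i < m \<Longrightarrow> \<bar>x i\<bar> \<le> 1/2" and \<alpha>: "1 \<le> \<alpha>"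
    and dom: "\<And>d. (\<Sum>i<m. d i * Fr i)\<^sup>2 \<le> (\<Sum>i<m. \<Sum>j<m. d i * d j * Kr i j)"
begin

private definition quad :: "(nat \<Rightarrow> real) \<Rightarrow> real" where
  "quad d = (\<Sum>i<m. \<Sum>j<m. d i * d j * Kr i j)"

private lemma quad_ge: "(\<Sum>i<m. d i * Fr i)\<^sup>2 \<le> quad d"
  unfolding quad_def by (rule dom)

private lemma quad_nonneg: "0 \<le> quad d"
  by (rule order_trans[OF zero_le_power2 quad_ge])

private lemma LINT_quad:
  assumes "s = 1 \<or> s = -1"
  shows "integrable half_unit (\<lambda>t. quad (\<lambda>i. c i * trunc_pow \<alpha> (s * x i) t))"
    "(LINT t|half_unit. quad (\<lambda>i. c i * trunc_pow \<alpha> (s * x i) t)) =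
      (\<Sum>i<m. \<Sum>j<m. c i * c j * (LINT t|half_unit. trunc_pow \<alpha> (s * x i) t * trunc_pow \<alpha> (s * x j) t) * Kr i j)"
proof -
  have b: "\<bar>s * x i\<bar> \<le> 1/2" if "i < m" for i using x[OF that] assms by auto
  have i: "integrable half_unit (\<lambda>t. trunc_pow \<alpha> (s * x i) t * trunc_pow \<alpha> (s * x j) t)" if "i < m" "j < m" for i j
    by (rule integrable_half_unit[of _ 1])
      (use trunc_pow_bound[OF b[OF that(1)]] trunc_pow_bound[OF b[OF that(2)]] in \<open>auto simp: abs_mult intro: mult_le_one\<close>)
  have e: "quad (\<lambda>i. c i * trunc_pow \<alpha> (s * x i) t) =
     (\<Sum>i<m. \<Sum>j<m. c i * c j * Kr i j * (trunc_pow \<alpha> (s * x i) t * trunc_pow \<alpha> (s * x j) t))" for t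
    unfolding quad_def by (intro sum.cong refl) (simp add: mult_ac)
  show "integrable half_unit (\<lambda>t. quad (\<lambda>i. c i * trunc_pow \<alpha> (s * x i) t))"
    unfolding e by (intro Bochner_Integration.integrable_sum integrable_mult_right i) auto
  have "(LINT t|half_unit. quad (\<lambda>i. c i * trunc_pow \<alpha> (s * x i) t)) =
     (\<Sum>i<m. \<Sum>j<m. c i * c j * Kr i j * (LINT t|half_unit. trunc_pow \<alpha> (s * x i) t * trunc_pow \<alpha> (s * x j) t))"
    unfolding e
    by (subst Bochner_Integration.integral_sum, (intro Bochner_Integration.integrable_sum integrable_mult_right i; simp),
        intro sum.cong refl,
        subst Bochner_Integration.integral_sum, (intro integrable_mult_right i; simp),
        intro sum.cong refl, rule integral_mult_right_zero)
  then show "(LINT t|half_unit. quad (\<lambda>i. c i * trunc_pow \<alpha> (s * x i) t)) =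
      (\<Sum>i<m. \<Sum>j<m. c i * c j * (LINT t|half_unit. trunc_pow \<alpha> (s * x i) t * trunc_pow \<alpha> (s * x j) t) * Kr i j)"
    by (simp add: mult_ac)
qed

text \<open>The Schur product argument: \<open>kernel1\<close> is a sum and an integral of rank-one
  kernels, so multiplying \<open>Kr\<close> by it averages \<open>quad\<close> over modified
  coefficients. Every contribution is nonnegative by \<open>quad_nonneg\<close>.\<close>

private lemma quad_kernel1:
  "(\<Sum>i<m. \<Sum>j<m. c i * c j * (kernel1 \<alpha> (x i) (x j) * Kr i j)) =
    (\<Sum>r\<in>{1..<\<alpha>}. quad (\<lambda>i. c i * (x i ^ r / fact r))) +
    (LINT t|half_unit. quad (\<lambda>i. c i * trunc_pow \<alpha> (1 * x i) t)) +
    (LINT t|half_unit. quad (\<lambda>i. c i * trunc_pow \<alpha> (-1 * x i) t))"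
proof -
  have "(\<Sum>r\<in>{1..<\<alpha>}. quad (\<lambda>i. c i * (x i ^ r / fact r))) =
      (\<Sum>i<m. \<Sum>j<m. \<Sum>r\<in>{1..<\<alpha>}. c i * (x i ^ r / fact r) * (c j * (x j ^ r / fact r)) * Kr i j)"
    unfolding quad_def by (subst sum.swap, intro sum.cong refl sum.swap)
  also have "\<dots> = (\<Sum>i<m. \<Sum>j<m. c i * c j * (\<Sum>r\<in>{1..<\<alpha>}. x i ^ r / fact r * (x j ^ r / fact r)) * Kr i j)"
    by (intro sum.cong refl) (simp only: sum_distrib_left sum_distrib_right mult_ac)
  finally have 1: "(\<Sum>r\<in>{1..<\<alpha>}. quad (\<lambda>i. c i * (x i ^ r / fact r))) = \<dots>" .
  show ?thesis unfolding 1 LINT_quad(2)[of 1, OF disjI1[OF refl]] LINT_quad(2)[of "-1", OF disjI2[OF refl]]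
      sum.distrib[symmetric]
  proof (intro sum.cong refl)
    fix i j assume "i \<in> {..<m}" "j \<in> {..<m}"
    then have "\<bar>x i\<bar> \<le> 1/2" "\<bar>x j\<bar> \<le> 1/2" using x by auto
    note e = kernel1_eq[OF this, of \<alpha>]
    show "c i * c j * (kernel1 \<alpha> (x i) (x j) * Kr i j) =
      c i * c j * (\<Sum>r\<in>{1..<\<alpha>}. x i ^ r / fact r * (x j ^ r / fact r)) * Kr i j +
      c i * c j * (LINT t|half_unit. trunc_pow \<alpha> (1 * x i) t * trunc_pow \<alpha> (1 * x j) t) * Kr i j +
      c i * c j * (LINT t|half_unit. trunc_pow \<alpha> (- 1 * x i) t * trunc_pow \<alpha> (- 1 * x j) t) * Kr i j"
      unfolding e mult_1_left mult_minus1 distrib_left distrib_right mult.assoc ..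
  qed
qed

text \<open>The norm of a product function in a tensor product space, without tensor products:
  \<open>Fr\<close> and \<open>Kr\<close> enter only through the domination \<open>dom\<close> on
  the given points, and the conclusion has the same shape up to the constant, so the lemma can be
  iterated over the coordinates.\<close>

lemma dominated_mult_power:
  assumes n: "1 \<le> n"
  shows "(\<Sum>i<m. c i * (x i ^ n * Fr i))\<^sup>2 \<le>
    (mono_weight \<alpha> n)\<^sup>2 * (\<Sum>i<m. \<Sum>j<m. c i * c j * (kernel1 \<alpha> (x i) (x j) * Kr i j))"
proof -
  let ?I = "\<lambda>s. LINT t|half_unit. quad (\<lambda>i. c i * trunc_pow \<alpha> (s * x i) t)"
  have I0: "0 \<le> ?I s" for s by (simp add: quad_nonneg)
  show ?thesis
  proof (cases "n < \<alpha>")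
    case True
    \<comment> \<open>For n < \<alpha> the function y ^ n / fact n is itself one of the rank-one
      pieces of the kernel, so the single summand r = n dominates.\<close>
    define d where "d i = c i * (x i ^ n / fact n)" for i
    have "(\<Sum>i<m. c i * (x i ^ n * Fr i)) = fact n * (\<Sum>i<m. d i * Fr i)"
      unfolding sum_distrib_left by (intro sum.cong refl) (simp add: d_def)
    then have "(\<Sum>i<m. c i * (x i ^ n * Fr i))\<^sup>2 = (fact n)\<^sup>2 * (\<Sum>i<m. d i * Fr i)\<^sup>2"
      by (simp add: power_mult_distrib)
    also have "\<dots> \<le> (mono_weight \<alpha> n)\<^sup>2 * quad d"
    proof (intro mult_mono quad_ge power_mono)
      have "(fact n :: real) \<le> real n ^ n" using fact_le_power[of n, where ?'a = real] by simp
      also have "\<dots> \<le> real n ^ \<alpha>" using True n by (intro power_increasing) auto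
      also have "\<dots> \<le> real n ^ \<alpha> * (2 ^ \<alpha> / 2 ^ n)"
        using True power_increasing[of n \<alpha> "2::real"] by (intro mult_le_cancel_left1[THEN iffD2]) auto
      finally show "fact n \<le> mono_weight \<alpha> n" by (simp add: mono_weight_def)
    qed auto
    also have "quad d \<le> (\<Sum>r\<in>{1..<\<alpha>}. quad (\<lambda>i. c i * (x i ^ r / fact r)))"
      unfolding d_def by (rule member_le_sum) (use True n quad_nonneg in auto)
    also have "\<dots> \<le> (\<Sum>i<m. \<Sum>j<m. c i * c j * (kernel1 \<alpha> (x i) (x j) * Kr i j))"
      unfolding quad_kernel1 using I0[of 1] I0[of "-1"] by linarith
    finally show ?thesis by (simp add: mult_left_mono)
  next
    case False
    define \<Psi> where "\<Psi> s t = (\<Sum>i<m. c i * trunc_pow \<alpha> (s * x i) t * Fr i)" for s t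
    define k where "k = n - \<alpha>"
    \<comment> \<open>The indicator changes nothing under \<open>half_unit\<close>, but it keeps t ^
      k bounded on the whole line, and \<open>integrable_half_unit\<close> asks for a global
      bound.\<close>
    define f where "f t = (\<Psi> 1 t + (-1) ^ n * \<Psi> (-1) t) * (indicator {0..1/2} t * t ^ k)" for t
    have tb: "\<bar>indicator {0..1/2} t * t ^ k\<bar> \<le> (1/2 :: real) ^ k" for t
      by (auto simp: indicator_def power_abs intro: power_mono)
    have m\<Psi> [measurable]: "\<Psi> s \<in> borel_measurable borel" for s
      unfolding \<Psi>_def[abs_def] by measurable
    have \<Psi>b: "\<bar>\<Psi> s t\<bar> \<le> (\<Sum>i<m. \<bar>c i * Fr i\<bar>)" if "s = 1 \<or> s = -1" for s t
      unfolding \<Psi>_def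
    proof (intro order_trans[OF sum_abs] sum_mono)
      fix i assume "i \<in> {..<m}"
      then have "\<bar>trunc_pow \<alpha> (s * x i) t\<bar> \<le> 1" by (intro trunc_pow_bound) (use x that in auto)
      from mult_left_le[OF this, of "\<bar>c i * Fr i\<bar>"] show "\<bar>c i * trunc_pow \<alpha> (s * x i) t * Fr i\<bar> \<le> \<bar>c i * Fr i\<bar>"
        by (simp add: abs_mult mult_ac)
    qed
    define B where "B = (\<Sum>i<m. \<bar>c i * Fr i\<bar>)"
    have B0: "0 \<le> B" unfolding B_def by (simp add: sum_nonneg)
    have fb: "\<bar>f t\<bar> \<le> 2 * B * (1/2) ^ k" for t
    proof -
      have "\<bar>\<Psi> 1 t + (-1) ^ n * \<Psi> (-1) t\<bar> \<le> \<bar>\<Psi> 1 t\<bar> + \<bar>(-1) ^ n * \<Psi> (-1) t\<bar>" by (rule abs_triangle_ineq)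
      also have "\<dots> \<le> 2 * B" using \<Psi>b[of 1 t] \<Psi>b[of "-1" t] by (simp add: abs_mult B_def power_abs)
      finally show ?thesis unfolding f_def abs_mult using tb[of t] by (intro mult_mono) (auto simp: abs_mult)
    qed
    have mf: "f \<in> borel_measurable borel" unfolding f_def by measurable
    have "(\<Sum>i<m. c i * (x i ^ n * Fr i)) =
       (\<Sum>i<m. fact n / fact k * (LINT t|half_unit. c i * Fr i * ((trunc_pow \<alpha> (1 * x i) t + (-1) ^ n * trunc_pow \<alpha> (-1 * x i) t) * (indicator {0..1/2} t * t ^ k))))"
    proof (intro sum.cong refl)
      fix i assume "i \<in> {..<m}"
      then have xi: "\<bar>x i\<bar> \<le> 1/2" using x by simp
      have "x i ^ n = fact n / fact k *
        (LINT t|half_unit. (trunc_pow \<alpha> (1 * x i) t + (-1) ^ n * trunc_pow \<alpha> (-1 * x i) t) * (indicator {0..1/2} t * t ^ k))"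
      proof -
        have "x i ^ n = fact n / fact k * (LINT t|half_unit. (trunc_pow \<alpha> (x i) t + (-1) ^ n * trunc_pow \<alpha> (- x i) t) * t ^ k)"
          using power_eq_LINT[OF xi \<alpha>, of n] False unfolding k_def by simp
        also have "(LINT t|half_unit. (trunc_pow \<alpha> (x i) t + (-1) ^ n * trunc_pow \<alpha> (- x i) t) * t ^ k) =
           (LINT t|half_unit. (trunc_pow \<alpha> (1 * x i) t + (-1) ^ n * trunc_pow \<alpha> (-1 * x i) t) * (indicator {0..1/2} t * t ^ k))"
          unfolding LINT_half_unit by (rule Bochner_Integration.integral_cong) (auto simp: indicator_def)
        finally show ?thesis .
      qed
      then show "c i * (x i ^ n * Fr i) = fact n / fact k * (LINT t|half_unit. c i * Fr i * ((trunc_pow \<alpha> (1 * x i) t + (-1) ^ n * trunc_pow \<alpha> (-1 * x i) t) * (indicator {0..1/2} t * t ^ k)))"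
        by (simp only: integral_mult_right_zero mult_ac)
    qed
    also have "\<dots> = fact n / fact k * (LINT t|half_unit. f t)"
    proof -
      have "integrable half_unit (\<lambda>t. c i * Fr i * ((trunc_pow \<alpha> (1 * x i) t + (-1) ^ n * trunc_pow \<alpha> (-1 * x i) t) * (indicator {0..1/2} t * t ^ k)))" if "i < m" for i
      proof (rule integrable_half_unit[of _ "\<bar>c i * Fr i\<bar> * (2 * (1/2) ^ k)"])
        fix t
        have "\<bar>trunc_pow \<alpha> (1 * x i) t + (-1) ^ n * trunc_pow \<alpha> (-1 * x i) t\<bar> \<le> \<bar>trunc_pow \<alpha> (1 * x i) t\<bar> + \<bar>(-1) ^ n * trunc_pow \<alpha> (-1 * x i) t\<bar>"
          by (rule abs_triangle_ineq)
        also have "\<dots> \<le> 2" using trunc_pow_bound[of "x i" \<alpha> t] trunc_pow_bound[of "- x i" \<alpha> t] x[OF that]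
          by (simp add: abs_mult power_abs)
        finally show "\<bar>c i * Fr i * ((trunc_pow \<alpha> (1 * x i) t + (-1) ^ n * trunc_pow \<alpha> (-1 * x i) t) * (indicator {0..1/2} t * t ^ k))\<bar>
            \<le> \<bar>c i * Fr i\<bar> * (2 * (1/2) ^ k)"
          unfolding abs_mult using tb[of t] by (intro mult_left_mono mult_mono) (auto simp: abs_mult)
      qed measurable
      then have "(\<Sum>i<m. LINT t|half_unit. c i * Fr i * ((trunc_pow \<alpha> (1 * x i) t + (-1) ^ n * trunc_pow \<alpha> (-1 * x i) t) * (indicator {0..1/2} t * t ^ k)))
        = (LINT t|half_unit. (\<Sum>i<m. c i * Fr i * ((trunc_pow \<alpha> (1 * x i) t + (-1) ^ n * trunc_pow \<alpha> (-1 * x i) t) * (indicator {0..1/2} t * t ^ k))))"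
        by (subst Bochner_Integration.integral_sum) auto
      also have "\<dots> = (LINT t|half_unit. f t)"
      proof (rule Bochner_Integration.integral_cong[OF refl])
        fix t
        show "(\<Sum>i<m. c i * Fr i * ((trunc_pow \<alpha> (1 * x i) t + (-1) ^ n * trunc_pow \<alpha> (-1 * x i) t) * (indicator {0..1/2} t * t ^ k))) = f t"
          unfolding f_def \<Psi>_def sum_distrib_left sum_distrib_right sum.distrib[symmetric]
          by (intro sum.cong refl) (simp add: algebra_simps)
      qed
      finally show ?thesis unfolding sum_distrib_left[symmetric] by simp
    qed
    finally have eq: "(\<Sum>i<m. c i * (x i ^ n * Fr i)) = fact n / fact k * (LINT t|half_unit. f t)" .
    have "(LINT t|half_unit. f t)\<^sup>2 \<le> (1/2) * (LINT t|half_unit. (f t)\<^sup>2)"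
      by (rule square_LINT_half_unit_le[OF mf fb])
    also have "(LINT t|half_unit. (f t)\<^sup>2) \<le> (LINT t|half_unit. 2 * ((1/2) ^ k)\<^sup>2 * (quad (\<lambda>i. c i * trunc_pow \<alpha> (1 * x i) t) + quad (\<lambda>i. c i * trunc_pow \<alpha> (-1 * x i) t)))"
    proof (rule integral_mono)
      show "integrable half_unit (\<lambda>t. (f t)\<^sup>2)"
      proof (rule integrable_half_unit[of _ "(2 * B * (1/2) ^ k)\<^sup>2"])
        show "(\<lambda>t. (f t)\<^sup>2) \<in> borel_measurable borel" using mf by measurable
        show "\<bar>(f t)\<^sup>2\<bar> \<le> (2 * B * (1/2) ^ k)\<^sup>2" for t
          using power_mono[OF fb[of t] abs_ge_zero, of 2] by simp
      qed
      show "integrable half_unit (\<lambda>t. 2 * ((1/2) ^ k)\<^sup>2 * (quad (\<lambda>i. c i * trunc_pow \<alpha> (1 * x i) t) + quad (\<lambda>i. c i * trunc_pow \<alpha> (-1 * x i) t)))"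
        by (intro integrable_mult_right Bochner_Integration.integrable_add LINT_quad) auto
      fix t
      have "(f t)\<^sup>2 = (\<Psi> 1 t + (-1) ^ n * \<Psi> (-1) t)\<^sup>2 * \<bar>indicator {0..1/2} t * t ^ k\<bar>\<^sup>2"
        unfolding f_def power_mult_distrib by (simp add: power_mult_distrib)
      also have "\<dots> \<le> (2 * ((\<Psi> 1 t)\<^sup>2 + (\<Psi> (-1) t)\<^sup>2)) * ((1/2) ^ k)\<^sup>2"
      proof (intro mult_mono power_mono tb)
        have "(\<Psi> 1 t + (-1) ^ n * \<Psi> (-1) t)\<^sup>2 \<le> 2 * ((\<Psi> 1 t)\<^sup>2 + ((-1) ^ n * \<Psi> (-1) t)\<^sup>2)"
          using sum_squares_bound[of "\<Psi> 1 t" "(-1) ^ n * \<Psi> (-1) t"] by (simp add: power2_sum)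
        then show "(\<Psi> 1 t + (-1) ^ n * \<Psi> (-1) t)\<^sup>2 \<le> 2 * ((\<Psi> 1 t)\<^sup>2 + (\<Psi> (-1) t)\<^sup>2)"
          by (simp add: power_mult_distrib flip: power_mult)
      qed auto
      also have "\<dots> \<le> (2 * (quad (\<lambda>i. c i * trunc_pow \<alpha> (1 * x i) t) + quad (\<lambda>i. c i * trunc_pow \<alpha> (-1 * x i) t))) * ((1/2) ^ k)\<^sup>2"
        unfolding \<Psi>_def by (intro mult_right_mono mult_left_mono add_mono quad_ge) auto
      finally show "(f t)\<^sup>2 \<le> 2 * ((1/2) ^ k)\<^sup>2 * (quad (\<lambda>i. c i * trunc_pow \<alpha> (1 * x i) t) + quad (\<lambda>i. c i * trunc_pow \<alpha> (-1 * x i) t))"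
        by (simp only: mult_ac)
    qed
    also have "(LINT t|half_unit. 2 * ((1/2) ^ k)\<^sup>2 * (quad (\<lambda>i. c i * trunc_pow \<alpha> (1 * x i) t) + quad (\<lambda>i. c i * trunc_pow \<alpha> (-1 * x i) t)))
      = 2 * ((1/2) ^ k)\<^sup>2 * (?I 1 + ?I (-1))"
      using LINT_quad(1)[of 1 c] LINT_quad(1)[of "-1" c] by simp
    \<comment> \<open>The factor 1/2 from Cauchy-Schwarz on mass 1/2 cancels the 2 from squaring the
      sum of the two half-line parts.\<close>
    finally have "(LINT t|half_unit. f t)\<^sup>2 \<le> ((1/2) ^ k)\<^sup>2 * (?I 1 + ?I (-1))" by simp
    then have "(\<Sum>i<m. c i * (x i ^ n * Fr i))\<^sup>2 \<le> (fact n / fact k)\<^sup>2 * (((1/2) ^ k)\<^sup>2 * (?I 1 + ?I (-1)))"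
      unfolding eq power_mult_distrib by (intro mult_left_mono) auto
    also have "\<dots> = (fact n / fact k * (1/2) ^ k)\<^sup>2 * (?I 1 + ?I (-1))"
      unfolding power_mult_distrib by simp
    also have "\<dots> \<le> (mono_weight \<alpha> n)\<^sup>2 * (\<Sum>i<m. \<Sum>j<m. c i * c j * (kernel1 \<alpha> (x i) (x j) * Kr i j))"
    proof (intro mult_mono power_mono)
      have e: "mono_weight \<alpha> n = real n ^ \<alpha> * (1/2) ^ k"
        using False unfolding k_def mono_weight_def by (simp add: power_diff power_one_over field_simps)
      show "fact n / fact k * (1/2) ^ k \<le> mono_weight \<alpha> n"
        unfolding e using fact_div_fact_le[of \<alpha> n] False unfolding k_def by (intro mult_right_mono) auto
      have "0 \<le> (\<Sum>r\<in>{1..<\<alpha>}. quad (\<lambda>i. c i * (x i ^ r / fact r)))" by (intro sum_nonneg quad_nonneg)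
      then show "?I 1 + ?I (-1) \<le> (\<Sum>i<m. \<Sum>j<m. c i * c j * (kernel1 \<alpha> (x i) (x j) * Kr i j))"
        unfolding quad_kernel1 by linarith
      show "0 \<le> ?I 1 + ?I (-1)" using I0[of 1] I0[of "-1"] by linarith
    qed simp_all
    finally show ?thesis .
  qed
qed

end

lemma dominated_monomial:
  fixes x :: "nat \<Rightarrow> nat \<Rightarrow> real" and m :: nat
  assumes "finite u" "1 \<le> \<alpha>" "\<And>i j. i < m \<Longrightarrow> j \<in> u \<Longrightarrow> \<bar>x i j\<bar> \<le> 1/2" "\<And>j. j \<in> u \<Longrightarrow> 1 \<le> \<nu> j"
  shows "(\<Sum>i<m. c i * (\<Prod>j\<in>u. x i j ^ \<nu> j))\<^sup>2 \<le>
    (\<Prod>j\<in>u. mono_weight \<alpha> (\<nu> j))\<^sup>2 * (\<Sum>i<m. \<Sum>j<m. c i * c j * kernel_u \<alpha> u (x i) (x j))"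
  using assms(1,3,4)
proof (induction u arbitrary: c rule: finite_induct)
  case empty
  then show ?case by (simp add: kernel_u_def power2_eq_square sum_product)
next
  case (insert k u)
  let ?W = "\<Prod>j\<in>u. mono_weight \<alpha> (\<nu> j)"
  have W: "?W > 0" using insert.prems by (intro prod_pos) (auto intro: mono_weight_pos)
  \<comment> \<open>Dividing by the weight product normalises the domination constant to 1, as the
    one-variable step expects.\<close>
  define Fr where "Fr i = (\<Prod>j\<in>u. x i j ^ \<nu> j) / ?W" for i
  have IH: "(\<Sum>i<m. d i * Fr i)\<^sup>2 \<le> (\<Sum>i<m. \<Sum>j<m. d i * d j * kernel_u \<alpha> u (x i) (x j))" for d
  proof -
    have "(\<Sum>i<m. d i * Fr i) = (\<Sum>i<m. d i * (\<Prod>j\<in>u. x i j ^ \<nu> j)) / ?W"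
      unfolding Fr_def by (simp add: sum_divide_distrib)
    moreover have "(\<Sum>i<m. d i * (\<Prod>j\<in>u. x i j ^ \<nu> j))\<^sup>2 \<le> ?W\<^sup>2 * (\<Sum>i<m. \<Sum>j<m. d i * d j * kernel_u \<alpha> u (x i) (x j))"
      by (rule insert.IH) (use insert.prems in auto)
    moreover have "0 < ?W\<^sup>2" using W by simp
    ultimately show ?thesis by (simp only: power_divide pos_divide_le_eq mult.commute)
  qed
  have "(\<Sum>i<m. c i * (\<Prod>j\<in>insert k u. x i j ^ \<nu> j)) = ?W * (\<Sum>i<m. c i * (x i k ^ \<nu> k * Fr i))"
  proof -
    have "\<forall>j\<in>u. mono_weight \<alpha> (\<nu> j) \<noteq> 0" using insert.prems mono_weight_pos by (metis insertI2 less_irrefl)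
    then show ?thesis
      unfolding sum_distrib_left Fr_def using insert.hyps by (intro sum.cong refl) simp
  qed
  then have "(\<Sum>i<m. c i * (\<Prod>j\<in>insert k u. x i j ^ \<nu> j))\<^sup>2 = ?W\<^sup>2 * (\<Sum>i<m. c i * (x i k ^ \<nu> k * Fr i))\<^sup>2"
    by (simp add: power_mult_distrib)
  also have "\<dots> \<le> ?W\<^sup>2 * ((mono_weight \<alpha> (\<nu> k))\<^sup>2 * (\<Sum>i<m. \<Sum>j<m. c i * c j * (kernel1 \<alpha> (x i k) (x j k) * kernel_u \<alpha> u (x i) (x j))))"
  proof (rule mult_left_mono[OF dominated_mult_power[where x = "\<lambda>i. x i k" and Kr = "\<lambda>i j. kernel_u \<alpha> u (x i) (x j)"]])
    show "\<bar>x i k\<bar> \<le> 1/2" if "i < m" for i using insert.prems(1)[OF that] by simp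
    show "1 \<le> \<nu> k" using insert.prems(2) by simp
    show "(\<Sum>i<m. d i * Fr i)\<^sup>2 \<le> (\<Sum>i<m. \<Sum>j<m. d i * d j * kernel_u \<alpha> u (x i) (x j))" for d by (rule IH)
  qed (use assms(2) in simp_all)
  also have "\<dots> = (\<Prod>j\<in>insert k u. mono_weight \<alpha> (\<nu> j))\<^sup>2 * (\<Sum>i<m. \<Sum>j<m. c i * c j * kernel_u \<alpha> (insert k u) (x i) (x j))"
    using insert.hyps by (simp add: kernel_u_def power_mult_distrib mult_ac)
  finally show ?case .
qed

section \<open>Positivity of the constant M and summability of the monomial weights\<close>

lemma kernel1_diag:
  assumes "\<bar>y\<bar> \<le> 1/2" "1 \<le> \<alpha>"
  shows "kernel1 \<alpha> y y = (\<Sum>r\<in>{1..<\<alpha>}. (y ^ r / fact r)\<^sup>2) + \<bar>y\<bar> ^ (2 * \<alpha> - 1) / (real (2 * \<alpha> - 1) * (fact (\<alpha> - 1))\<^sup>2)"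
proof (cases "y = 0")
  case True
  then show ?thesis using assms by (simp add: kernel1_def power2_eq_square)
next
  case False
  define x where "x = \<bar>y\<bar>"
  have x: "0 < x" "x * x = y * y" using False by (auto simp: x_def)
  have "((\<lambda>t. - ((x - t) ^ (2 * \<alpha> - 1)) / (real (2 * \<alpha> - 1) * (fact (\<alpha> - 1))\<^sup>2)) has_real_derivative
      (x - t) ^ (\<alpha> - 1) / fact (\<alpha> - 1) * ((x - t) ^ (\<alpha> - 1) / fact (\<alpha> - 1))) (at t)" for t
  proof -
    have "2 * \<alpha> - 1 - 1 = (\<alpha> - 1) + (\<alpha> - 1)" using assms by simp
    then have e: "(x - t) ^ (2 * \<alpha> - 1 - 1) = (x - t) ^ (\<alpha> - 1) * (x - t) ^ (\<alpha> - 1)" by (simp only: power_add)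
    have "((\<lambda>t. (x - t) ^ (2 * \<alpha> - 1)) has_real_derivative (real (2 * \<alpha> - 1) * (x - t) ^ (2 * \<alpha> - 1 - 1)) * -1) (at t)"
      by (rule DERIV_chain2[of "\<lambda>s. s ^ (2 * \<alpha> - 1)"]) (auto intro!: derivative_eq_intros)
    from DERIV_cdivide[OF DERIV_minus[OF this], of "real (2 * \<alpha> - 1) * (fact (\<alpha> - 1))\<^sup>2"]
    show ?thesis
      unfolding e by (rule DERIV_cong) (use assms in \<open>simp add: power2_eq_square del: of_nat_diff of_nat_mult\<close>)
  qed
  then have "((\<lambda>t. (x - t) ^ (\<alpha> - 1) / fact (\<alpha> - 1) * ((x - t) ^ (\<alpha> - 1) / fact (\<alpha> - 1))) has_integral
     (- ((x - x) ^ (2 * \<alpha> - 1)) / (real (2 * \<alpha> - 1) * (fact (\<alpha> - 1))\<^sup>2) - - ((x - 0) ^ (2 * \<alpha> - 1)) / (real (2 * \<alpha> - 1) * (fact (\<alpha> - 1))\<^sup>2))) {0..x}"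
    using x by (intro fundamental_theorem_of_calculus)
      (auto simp: has_real_derivative_iff_has_vector_derivative[symmetric] intro: has_field_derivative_at_within)
  then have "integral {0..x} (\<lambda>t. (x - t) ^ (\<alpha> - 1) / fact (\<alpha> - 1) * ((x - t) ^ (\<alpha> - 1) / fact (\<alpha> - 1))) =
     x ^ (2 * \<alpha> - 1) / (real (2 * \<alpha> - 1) * (fact (\<alpha> - 1))\<^sup>2)"
    by (subst integral_unique, assumption) (use assms in simp)
  moreover have "0 < y * y" using False by (simp add: zero_less_mult_iff linorder_neq_iff disj_commute)
  ultimately show ?thesis unfolding x_def kernel1_def by (simp add: power2_eq_square)
qed

text \<open>Truncation will divide by M. The integrand agrees on the interval with a continuous
  nonnegative function that is positive at 1/2; continuity also excludes that the integral is 0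
  merely as the default value of a non-integrable function.\<close>

lemma M_const_pos: assumes "1 \<le> \<alpha>" shows "0 < M_const \<alpha>"
proof -
  define g :: "real \<Rightarrow> real" where "g y = sqrt ((\<Sum>r\<in>{1..<\<alpha>}. (y ^ r / fact r)\<^sup>2) + \<bar>y\<bar> ^ (2 * \<alpha> - 1) / (real (2 * \<alpha> - 1) * (fact (\<alpha> - 1))\<^sup>2))" for y
  have gi: "M_const \<alpha> = integral {-1/2..1/2} g"
    unfolding M_const_def \<Omega>_def
  proof (intro Henstock_Kurzweil_Integration.integral_cong)
    fix y :: real assume "y \<in> {-1/2..1/2}"
    then have "\<bar>y\<bar> \<le> 1/2" by auto
    from kernel1_diag[OF this assms] show "sqrt (kernel1 \<alpha> y y) = g y" unfolding g_def by (rule arg_cong)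
  qed
  have c: "continuous_on {-1/2..1/2} g" unfolding g_def by (intro continuous_intros) (use assms in auto)
  have g0: "0 \<le> g y" for y unfolding g_def by (auto intro!: add_nonneg_nonneg sum_nonneg)
  have "integral {-1/2..1/2} g \<noteq> 0"
  proof
    assume "integral {-1/2..1/2} g = 0"
    moreover have "g integrable_on {-1/2..1/2}" by (rule integrable_continuous_interval[OF c])
    ultimately have "(g has_integral 0) (cbox (-1/2) (1/2))" using integrable_integral by fastforce
    then have "g (1/2) = 0"
      by (rule has_integral_0_cbox_imp_0[rotated 2]) (use c g0 in auto)
    moreover have "0 < (\<Sum>r\<in>{1..<\<alpha>}. ((1/2::real) ^ r / fact r)\<^sup>2) + \<bar>1/2\<bar> ^ (2 * \<alpha> - 1) / (real (2 * \<alpha> - 1) * (fact (\<alpha> - 1))\<^sup>2)"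
      using assms by (intro add_nonneg_pos sum_nonneg) auto
    ultimately show False unfolding g_def by simp
  qed
  moreover have "0 \<le> integral {-1/2..1/2} g" using g0 by (intro Henstock_Kurzweil_Integration.integral_nonneg integrable_continuous_interval[OF c]) auto
  ultimately show ?thesis using gi by simp
qed

text \<open>Termwise differentiation raises the exponent: \<open>diffs\<close> sends the sequence n
  ^ \<alpha> to (n + 1) ^ (\<alpha> + 1), which is the series sought up to a shift and a factor
  x.\<close>

lemma summable_power_mult_geometric: "norm (x :: real) < 1 \<Longrightarrow> summable (\<lambda>n. real n ^ \<alpha> * x ^ n)"
proof (induction \<alpha> arbitrary: x)
  case (Suc \<alpha>)
  have "summable (\<lambda>n. diffs (\<lambda>n. real n ^ \<alpha>) n * x ^ n)"
    by (rule termdiff_converges[of x 1]) (use Suc in auto)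
  then have "summable (\<lambda>n. x * (diffs (\<lambda>n. real n ^ \<alpha>) n * x ^ n))" by (rule summable_mult)
  then have "summable (\<lambda>n. real (Suc n) ^ Suc \<alpha> * x ^ Suc n)" by (simp add: diffs_def mult_ac)
  then show ?case by (subst summable_Suc_iff[symmetric])
qed (simp add: summable_geometric)

lemma summable_mono_weight: "summable (mono_weight \<alpha>)"
proof -
  have "summable (\<lambda>n. 2 ^ \<alpha> * (real n ^ \<alpha> * (1/2) ^ n))"
    by (intro summable_mult summable_power_mult_geometric) simp
  then show ?thesis by (simp add: mono_weight_def[abs_def] power_one_over field_simps)
qed

section \<open>Test functions and weak derivatives\<close>

text \<open>The classical function exp (-1/x) extended by 0, times a polynomial in 1/x. The
  polynomial factor makes the family closed under differentiation, so that one derivative formula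
  yields all orders.\<close>

definition flat :: "real poly \<Rightarrow> real \<Rightarrow> real" where
  "flat P x = (if 0 < x then poly P (1 / x) * exp (- (1 / x)) else 0)"

lemma poly_mult_exp_uminus_tendsto_0: "((\<lambda>z. poly P z * exp (- z)) \<longlongrightarrow> (0::real)) at_top"
proof -
  have "((\<lambda>z. \<Sum>i\<le>degree P. coeff P i * (z ^ i / exp z)) \<longlongrightarrow> (\<Sum>i\<le>degree P. coeff P i * 0)) at_top"
    by (intro tendsto_intros tendsto_power_div_exp_0)
  then show ?thesis
    by (simp add: poly_altdef sum_distrib_right exp_minus divide_inverse mult.assoc)
qed

lemma DERIV_flat: "(flat P has_real_derivative flat ([:0, 0, 1:] * (P - pderiv P)) x) (at x)"
proof -
  consider "0 < x" | "x < 0" | "x = 0" by linarith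
  then show ?thesis
  proof cases
    case 1
    have "((\<lambda>x. poly P (1 / x) * exp (- (1 / x))) has_real_derivative
        (poly (pderiv P) (1 / x) * (- 1 / x\<^sup>2)) * exp (- (1 / x)) + poly P (1 / x) * (exp (- (1 / x)) * (1 / x\<^sup>2))) (at x)"
      using 1 by (auto intro!: derivative_eq_intros DERIV_chain2[OF poly_DERIV] simp: power2_eq_square)
    then have "(flat P has_real_derivative
        (poly (pderiv P) (1 / x) * (- 1 / x\<^sup>2)) * exp (- (1 / x)) + poly P (1 / x) * (exp (- (1 / x)) * (1 / x\<^sup>2))) (at x)"
      by (rule has_field_derivative_transform_within_open[of _ _ _ "{0<..}"]) (use 1 in \<open>auto simp: flat_def\<close>)
    moreover have "(poly (pderiv P) (1 / x) * (- 1 / x\<^sup>2)) * exp (- (1 / x)) + poly P (1 / x) * (exp (- (1 / x)) * (1 / x\<^sup>2)) =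
       flat ([:0, 0, 1:] * (P - pderiv P)) x"
      using 1 by (simp add: flat_def power2_eq_square field_simps)
    ultimately show ?thesis by simp
  next
    case 2
    have "((\<lambda>_. 0) has_real_derivative 0) (at x)" by simp
    then have "(flat P has_real_derivative 0) (at x)"
      by (rule has_field_derivative_transform_within_open[of _ _ _ "{..<0}"]) (use 2 in \<open>auto simp: flat_def\<close>)
    then show ?thesis using 2 by (simp add: flat_def)
  next
    case 3
    have "((\<lambda>y. flat P y / y) \<longlongrightarrow> 0) (at_left 0)"
      by (rule tendsto_eventually) (auto simp: flat_def eventually_at_filter intro!: always_eventually)
    moreover have "((\<lambda>y. flat P y / y) \<longlongrightarrow> 0) (at_right 0)"
    proof -
      \<comment> \<open>With z = 1/y the difference quotient at 0 is z * P(z) * exp (-z); the extra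
        factor z is the polynomial \<open>[:0, 1:]\<close>.\<close>
      have "((\<lambda>y. poly ([:0, 1:] * P) (inverse y) * exp (- inverse y)) \<longlongrightarrow> 0) (at_right 0)"
        by (rule filterlim_compose[OF poly_mult_exp_uminus_tendsto_0 filterlim_inverse_at_top_right])
      then show ?thesis
        by (rule Lim_transform_eventually)
          (auto simp: flat_def eventually_at_filter divide_inverse intro!: always_eventually)
    qed
    ultimately have "((\<lambda>y. flat P y / y) \<longlongrightarrow> 0) (at 0)" by (rule filterlim_split_at)
    then show ?thesis using 3 by (simp add: has_field_derivative_iff flat_def)
  qed
qed

text \<open>An algebra that partial derivatives map into itself: differentiability of its members
  already covers all iterated derivatives, without formulas for them.\<close>

inductive_set smooth_alg :: "('a::euclidean_space \<Rightarrow> real) set" where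
  const: "(\<lambda>_. c) \<in> smooth_alg"
| flat: "(\<lambda>x. flat P (v \<bullet> x + c)) \<in> smooth_alg"
| add: "f \<in> smooth_alg \<Longrightarrow> g \<in> smooth_alg \<Longrightarrow> (\<lambda>x. f x + g x) \<in> smooth_alg"
| mult: "f \<in> smooth_alg \<Longrightarrow> g \<in> smooth_alg \<Longrightarrow> (\<lambda>x. f x * g x) \<in> smooth_alg"

lemma pderiv1_eqI: "(\<And>x. (f has_derivative f' x) (at x)) \<Longrightarrow> pderiv1 i f = (\<lambda>x. f' x i)"
  unfolding pderiv1_def by (metis frechet_derivative_at)

lemma smooth_alg_derivative:
  "f \<in> smooth_alg \<Longrightarrow> (\<forall>x. f differentiable (at x)) \<and> pderiv1 i f \<in> smooth_alg"
proof (induction f rule: smooth_alg.induct)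
  case (const c)
  have "pderiv1 i (\<lambda>_::'a. c) = (\<lambda>x. 0)" by (rule pderiv1_eqI) (auto intro: derivative_eq_intros)
  then show ?case by (simp add: smooth_alg.const)
next
  case (flat P v c)
  let ?Q = "[:0, 0, 1:] * (P - pderiv P)"
  have d: "((\<lambda>x. flat P (v \<bullet> x + c)) has_derivative (\<lambda>h. flat ?Q (v \<bullet> x + c) * (v \<bullet> h))) (at x)" for x
  proof -
    have 1: "((\<lambda>x. v \<bullet> x + c) has_derivative (\<lambda>h. v \<bullet> h)) (at x)" by (auto intro!: derivative_eq_intros)
    have 2: "(flat P has_derivative (\<lambda>h. flat ?Q (v \<bullet> x + c) * h)) (at (v \<bullet> x + c))"
      using DERIV_flat[of P] by (simp add: has_field_derivative_def)
    from diff_chain_at[OF 1 2] show ?thesis by (simp add: o_def)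
  qed
  have "pderiv1 i (\<lambda>x. flat P (v \<bullet> x + c)) = (\<lambda>x. flat ?Q (v \<bullet> x + c) * (v \<bullet> i))"
    by (rule pderiv1_eqI[OF d])
  moreover have "(\<lambda>x. flat ?Q (v \<bullet> x + c) * (v \<bullet> i)) \<in> smooth_alg"
    by (rule smooth_alg.mult[OF smooth_alg.flat smooth_alg.const])
  ultimately show ?case using d unfolding differentiable_def by auto
next
  case (add f g)
  from add.IH have d: "\<And>x. (f has_derivative frechet_derivative f (at x)) (at x)"
    "\<And>x. (g has_derivative frechet_derivative g (at x)) (at x)" by (auto simp: frechet_derivative_works)
  note d' = has_derivative_add[OF d]
  have "pderiv1 i (\<lambda>x. f x + g x) = (\<lambda>x. pderiv1 i f x + pderiv1 i g x)"
    unfolding pderiv1_def[of i f] pderiv1_def[of i g] by (rule pderiv1_eqI[OF d'])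
  then show ?case using add.IH d' unfolding differentiable_def by (metis smooth_alg.add)
next
  case (mult f g)
  from mult.IH have d: "\<And>x. (f has_derivative frechet_derivative f (at x)) (at x)"
    "\<And>x. (g has_derivative frechet_derivative g (at x)) (at x)" by (auto simp: frechet_derivative_works)
  note d' = has_derivative_mult[OF d]
  have "pderiv1 i (\<lambda>x. f x * g x) = (\<lambda>x. f x * pderiv1 i g x + pderiv1 i f x * g x)"
    unfolding pderiv1_def[of i f] pderiv1_def[of i g] by (rule pderiv1_eqI[OF d'])
  moreover have "(\<lambda>x. f x * pderiv1 i g x + pderiv1 i f x * g x) \<in> smooth_alg"
    by (intro smooth_alg.add smooth_alg.mult) (use mult in auto)
  ultimately show ?case using d' unfolding differentiable_def by metis
qed

lemma smooth_alg_pderivs: "f \<in> smooth_alg \<Longrightarrow> pderivs \<omega> f \<in> smooth_alg"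
  by (induction \<omega>) (auto simp: smooth_alg_derivative)

lemma smooth_alg_prod:
  "finite A \<Longrightarrow> (\<And>i. i \<in> A \<Longrightarrow> f i \<in> smooth_alg) \<Longrightarrow> (\<lambda>x. \<Prod>i\<in>A. f i x) \<in> smooth_alg"
proof (induction A rule: finite_induct)
  case empty
  show ?case using smooth_alg.const[of 1] by simp
next
  case (insert a A)
  then have "(\<lambda>x. f a x * (\<Prod>i\<in>A. f i x)) \<in> smooth_alg" by (intro smooth_alg.mult) auto
  then show ?case using insert.hyps by simp
qed

text \<open>The parameter n rescales the argument of the flat function but leaves the support inside
  the box. The bumps tend to the indicator of the open box, which replaces mollification.\<close>

definition box_bump :: "'a::euclidean_space \<Rightarrow> 'a \<Rightarrow> nat \<Rightarrow> 'a \<Rightarrow> real" where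
  "box_bump a b n x = (\<Prod>i\<in>Basis. flat 1 ((real n *\<^sub>R i) \<bullet> x + (- real n * (a \<bullet> i))) *
      flat 1 ((- real n *\<^sub>R i) \<bullet> x + real n * (b \<bullet> i)))"

lemma box_bump_smooth: "box_bump a b n \<in> smooth_alg"
  unfolding box_bump_def[abs_def]
  by (intro smooth_alg_prod smooth_alg.mult smooth_alg.flat) auto

lemma flat_1_bounds: "0 \<le> flat 1 x" "flat 1 x \<le> 1"
  by (auto simp: flat_def)

lemma box_bump_bounds: "0 \<le> box_bump a b n x" "box_bump a b n x \<le> 1"
  unfolding box_bump_def
  by (intro prod_nonneg mult_nonneg_nonneg flat_1_bounds) (intro prod_le_1 conjI mult_nonneg_nonneg mult_le_one flat_1_bounds)

lemma box_bump_zero: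
  assumes "x \<notin> box a b" shows "box_bump a b n x = 0"
proof -
  obtain i where i: "i \<in> Basis" "\<not> (a \<bullet> i < x \<bullet> i \<and> x \<bullet> i < b \<bullet> i)" using assms by (auto simp: mem_box)
  have "flat 1 ((real n *\<^sub>R i) \<bullet> x + (- real n * (a \<bullet> i))) * flat 1 ((- real n *\<^sub>R i) \<bullet> x + real n * (b \<bullet> i)) = 0"
  proof (cases "a \<bullet> i < x \<bullet> i")
    case True
    then have "real n * (b \<bullet> i) \<le> real n * (x \<bullet> i)" using i by (intro mult_left_mono) auto
    then show ?thesis by (simp add: flat_def inner_commute)
  next
    case False
    then have "real n * (x \<bullet> i) \<le> real n * (a \<bullet> i)" by (intro mult_left_mono) auto
    then show ?thesis by (simp add: flat_def inner_commute)
  qed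
  then show ?thesis unfolding box_bump_def using i(1) by (intro prod_zero) auto
qed

lemma flat_1_tendsto: "0 < s \<Longrightarrow> (\<lambda>n. flat 1 (real n * s)) \<longlonglongrightarrow> 1"
proof -
  assume s: "0 < s"
  have "(\<lambda>n. exp (- (inverse (real n) * inverse s))) \<longlonglongrightarrow> exp (- (0 * inverse s))"
    by (intro tendsto_intros lim_inverse_n)
  then have "(\<lambda>n. exp (- (inverse (real n) * inverse s))) \<longlonglongrightarrow> 1" by simp
  then show ?thesis
  proof (rule Lim_transform_eventually)
    show "\<forall>\<^sub>F n in sequentially. exp (- (inverse (real n) * inverse s)) = flat 1 (real n * s)"
      using eventually_gt_at_top[of 0] by eventually_elim (use s in \<open>auto simp: flat_def divide_inverse\<close>)
  qed
qed

lemma box_bump_tendsto: "(\<lambda>n. box_bump a b n x) \<longlonglongrightarrow> indicator (box a b) x"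
proof (cases "x \<in> box a b")
  case True
  have "(\<lambda>n. \<Prod>i\<in>Basis. flat 1 (real n * (x \<bullet> i - a \<bullet> i)) * flat 1 (real n * (b \<bullet> i - x \<bullet> i))) \<longlonglongrightarrow> (\<Prod>i\<in>(Basis::'a set). 1 * 1)"
  proof (rule tendsto_prod)
    fix i :: 'a assume "i \<in> Basis"
    then have "0 < x \<bullet> i - a \<bullet> i" "0 < b \<bullet> i - x \<bullet> i" using True by (auto simp: mem_box)
    then show "(\<lambda>n. flat 1 (real n * (x \<bullet> i - a \<bullet> i)) * flat 1 (real n * (b \<bullet> i - x \<bullet> i))) \<longlonglongrightarrow> 1 * 1"
      by (intro tendsto_mult flat_1_tendsto)
  qed
  then show ?thesis using True unfolding box_bump_def by (simp add: inner_commute algebra_simps)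
next
  case False
  then show ?thesis using box_bump_zero[OF False] by (simp add: indicator_def)
qed

lemma box_bump_test_fun: assumes "cbox a b \<subseteq> D" shows "box_bump a b n \<in> test_fun D"
proof -
  have sub: "closure {x. box_bump a b n x \<noteq> 0} \<subseteq> cbox a b"
  proof (rule closure_minimal[OF _ closed_cbox])
    show "{x. box_bump a b n x \<noteq> 0} \<subseteq> cbox a b"
      using box_bump_zero[of _ a b n] box_subset_cbox[of a b] by blast
  qed
  then have "compact (closure {x. box_bump a b n x \<noteq> 0})"
    by (metis bounded_cbox bounded_subset closed_closure compact_eq_bounded_closed)
  then show ?thesis using sub assms smooth_alg_pderivs[OF box_bump_smooth] smooth_alg_derivative
    unfolding test_fun_def by blast
qed

text \<open>Open boxes are stable under intersection and generate the Borel sets, so Dynkin's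
  argument extends the vanishing of the integrals to all Borel sets. The support hypothesis
  \<open>out\<close> provides the total integral needed for complements.\<close>

lemma AE_zero_if_box_integrals_zero:
  fixes g :: "'a::euclidean_space \<Rightarrow> real"
  assumes g: "integrable lborel g" and out: "\<And>x. x \<notin> box c d \<Longrightarrow> g x = 0"
    and zero: "\<And>a b. (LINT x:box a b|lborel. g x) = 0"
  shows "AE x in lborel. g x = 0"
proof -
  have set_int: "set_integrable lborel A g" if "A \<in> sets lborel" for A
    unfolding set_integrable_def using g that by (intro integrable_mult_indicator) auto
  have sb: "sets (borel :: 'a measure) = sigma_sets UNIV (range (\<lambda>(a, b). box a b))"
    unfolding borel_eq_box by (rule sets_measure_of) auto
  have A: "(LINT x:A|lborel. g x) = 0" if "A \<in> sets lborel" for A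
  proof -
    have "Int_stable (range (\<lambda>(a, b). box a b :: 'a set))"
      by (auto simp: Int_stable_def box_Int_box)
    moreover have "range (\<lambda>(a, b). box a b :: 'a set) \<subseteq> Pow UNIV" by simp
    moreover have "A \<in> sigma_sets UNIV (range (\<lambda>(a, b). box a b))"
      using that by (simp add: sb)
    ultimately show ?thesis
    proof (induction A rule: sigma_sets_induct_disjoint)
      fix A assume "A \<in> range (\<lambda>(a, b). box a b :: 'a set)"
      then show "(LINT x:A|lborel. g x) = 0" using zero by auto
    next
      show "(LINT x:{}|lborel. g x) = 0" by (simp add: set_lebesgue_integral_def)
    next
      fix A assume A: "A \<in> sigma_sets UNIV (range (\<lambda>(a, b). box a b :: 'a set))" "(LINT x:A|lborel. g x) = 0"
      then have As: "A \<in> sets lborel" by (simp add: sb)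
      have "(LINT x:UNIV|lborel. g x) = (LINT x:box c d|lborel. g x)"
        unfolding set_lebesgue_integral_def
        by (rule Bochner_Integration.integral_cong) (use out in \<open>auto simp: indicator_def\<close>)
      moreover have "(LINT x:UNIV|lborel. g x) = (LINT x:A|lborel. g x) + (LINT x:UNIV - A|lborel. g x)"
        using set_integral_Un[of A "UNIV - A" lborel g] set_int As by auto
      ultimately show "(LINT x:UNIV - A|lborel. g x) = 0" using A zero[of c d] by simp
    next
      fix A :: "nat \<Rightarrow> 'a set"
      assume dj: "disjoint_family A" and As: "range A \<subseteq> sigma_sets UNIV (range (\<lambda>(a, b). box a b :: 'a set))"
        and z: "\<And>i. (LINT x:A i|lborel. g x) = 0"
      then have s: "A i \<in> sets lborel" for i by (auto simp: sb)
      have "(LINT x:(\<Union>i. A i)|lborel. g x) = (\<Sum>i. (LINT x:A i|lborel. g x))"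
        by (rule lebesgue_integral_countable_add) (use s dj set_int in \<open>auto simp: disjoint_family_on_def\<close>)
      then show "(LINT x:(\<Union>i. A i)|lborel. g x) = 0" using z by simp
    qed
  qed
  have "AE x in lborel. g x = (\<lambda>_. 0) x"
    by (rule density_unique_real) (use g A in \<open>auto simp: set_lebesgue_integral_def\<close>)
  then show ?thesis by simp
qed

lemma loc_integrable_indicator:
  assumes "loc_integrable D w" "compact K" "K \<subseteq> D"
  shows "integrable lebesgue (\<lambda>x. indicator K x * w x)"
proof -
  have "integrable (lebesgue_on K) w" using assms by (auto simp: loc_integrable_def)
  then show ?thesis using assms(2) by (subst (asm) integrable_restrict_space) (auto simp: lmeasurable_compact fmeasurableD)
qed

lemma open_lebesgue: "open D \<Longrightarrow> D \<in> sets lebesgue"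
  by (simp add: lebesgue_openin)

lemma LINT_lebesgue_on:
  "D \<in> sets lebesgue \<Longrightarrow> (LINT x|lebesgue_on D. f x) = (LINT x|lebesgue. indicator D x * (f x :: real))"
  by (subst integral_restrict_space) auto

text \<open>Source of the almost-everywhere uniqueness of weak derivatives. Bumps approximate
  indicators of boxes whose closure lies in D, so dominated convergence gives vanishing integrals
  over these boxes; a countable cover of D by closed boxes then globalises.\<close>

lemma fundamental_lemma:
  fixes D :: "'a::euclidean_space set"
  assumes D: "open D" and w: "loc_integrable D w"
    and zero: "\<And>\<phi>. \<phi> \<in> test_fun D \<Longrightarrow> (LINT x|lebesgue_on D. w x * \<phi> x) = 0"
  shows "AE x in lebesgue_on D. w x = 0"
proof -
  have boxz: "(LINT x|lebesgue. indicator (box a b) x * w x) = 0" if K: "cbox a b \<subseteq> D" for a b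
  proof -
    have i: "integrable lebesgue (\<lambda>x. indicator (cbox a b) x * w x)"
      by (rule loc_integrable_indicator[OF w compact_cbox K])
    have bm: "box_bump a b n \<in> borel_measurable lebesgue" for n
    proof -
      have "continuous_on UNIV (box_bump a b n)"
        using smooth_alg_derivative[OF box_bump_smooth[of a b n]] differentiable_imp_continuous_within[of "box_bump a b n" _ UNIV]
        by (auto intro!: continuous_at_imp_continuous_on)
      then have "box_bump a b n \<in> borel_measurable borel" by (rule borel_measurable_continuous_onI)
      then show ?thesis by (intro measurable_completion) simp
    qed
    have "(\<lambda>n. LINT x|lebesgue. indicator (cbox a b) x * w x * box_bump a b n x) \<longlonglongrightarrow>
        (LINT x|lebesgue. indicator (box a b) x * w x)"
    proof (rule integral_dominated_convergence)
      show "(\<lambda>x. indicator (box a b) x * w x) \<in> borel_measurable lebesgue"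
      proof -
        have "(\<lambda>x. indicator (box a b) x * (indicator (cbox a b) x * w x)) \<in> borel_measurable lebesgue"
          by (rule borel_measurable_times[OF borel_measurable_indicator borel_measurable_integrable[OF i]]) simp
        moreover have "(\<lambda>x. indicator (box a b) x * (indicator (cbox a b) x * w x)) = (\<lambda>x. indicator (box a b) x * w x)"
          using box_subset_cbox[of a b] by (auto simp: indicator_def fun_eq_iff)
        ultimately show ?thesis by simp
      qed
      show "(\<lambda>x. indicator (cbox a b) x * w x * box_bump a b n x) \<in> borel_measurable lebesgue" for n
        by (rule borel_measurable_times[OF borel_measurable_integrable[OF i] bm])
      show "integrable lebesgue (\<lambda>x. \<bar>indicator (cbox a b) x * w x\<bar>)" using i by (rule integrable_abs)
      show "AE x in lebesgue. (\<lambda>n. indicator (cbox a b) x * w x * box_bump a b n x) \<longlonglongrightarrow> indicator (box a b) x * w x"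
      proof (intro AE_I2)
        fix x
        have "(\<lambda>n. indicator (cbox a b) x * w x * box_bump a b n x) \<longlonglongrightarrow> indicator (cbox a b) x * w x * indicator (box a b) x"
          by (intro tendsto_intros box_bump_tendsto)
        moreover have "indicator (cbox a b) x * w x * indicator (box a b) x = indicator (box a b) x * w x"
          using box_subset_cbox[of a b] by (auto simp: indicator_def)
        ultimately show "(\<lambda>n. indicator (cbox a b) x * w x * box_bump a b n x) \<longlonglongrightarrow> indicator (box a b) x * w x" by simp
      qed
      show "AE x in lebesgue. norm (indicator (cbox a b) x * w x * box_bump a b n x) \<le> \<bar>indicator (cbox a b) x * w x\<bar>" for n
        using box_bump_bounds[of a b n] by (intro AE_I2) (auto simp: abs_mult intro!: mult_left_le)
    qed
    moreover have "(LINT x|lebesgue. indicator (cbox a b) x * w x * box_bump a b n x) = 0" for n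
    proof -
      have "(LINT x|lebesgue_on D. w x * box_bump a b n x) = (LINT x|lebesgue. indicator (cbox a b) x * w x * box_bump a b n x)"
        unfolding LINT_lebesgue_on[OF open_lebesgue[OF D]]
        by (rule Bochner_Integration.integral_cong)
          (use box_bump_zero[of _ a b n] K box_subset_cbox[of a b] in \<open>auto simp: indicator_def\<close>)
      then show ?thesis using zero[OF box_bump_test_fun[OF K]] by simp
    qed
    ultimately show ?thesis using LIMSEQ_unique[OF _ tendsto_const] by simp
  qed
  obtain \<D> where \<D>: "countable \<D>" "\<D> \<subseteq> Pow D" "\<And>X. X \<in> \<D> \<Longrightarrow> \<exists>a b. X = cbox a b" "\<Union>\<D> = D"
    using open_countable_Union_open_cbox[OF D] by metis
  have pieces: "AE x in lebesgue. x \<in> X \<longrightarrow> w x = 0" if "X \<in> \<D>" for X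
  proof -
    obtain c d where X: "X = cbox c d" using \<D>(3)[OF \<open>X \<in> \<D>\<close>] by blast
    have XD: "cbox c d \<subseteq> D" using \<D>(2) that X by auto
    have i: "integrable lebesgue (\<lambda>x. indicator (cbox c d) x * w x)"
      by (rule loc_integrable_indicator[OF w compact_cbox XD])
    then obtain v where v: "v \<in> borel_measurable lborel" "AE x in lborel. indicator (cbox c d) x * w x = v x"
      using completion_ex_borel_measurable_real[of "\<lambda>x. indicator (cbox c d) x * w x" lborel] by auto
    \<comment> \<open>w is only Lebesgue measurable, while the box argument is about Borel
      functions: v is a Borel version of w on the closed box. Cutting it to the open box loses only
      the frontier, a null set.\<close>
    define g where "g x = indicator (box c d) x * v x" for x
    have gm: "g \<in> borel_measurable lborel" unfolding g_def using v(1) by measurable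
    have veq: "AE x in lebesgue. indicator (cbox c d) x * w x = v x" using v(2) by (rule AE_completion)
    have "integrable lebesgue v"
      using i veq v(1) by (subst integrable_cong_AE[symmetric]) (auto intro: measurable_completion)
    then have vi: "integrable lborel v" using v(1) by (simp add: integrable_completion)
    then have gi: "integrable lborel g"
      unfolding g_def using integrable_mult_indicator[of "box c d" lborel v] by simp
    have "AE x in lborel. g x = 0"
    proof (rule AE_zero_if_box_integrals_zero[OF gi])
      show "g x = 0" if "x \<notin> box c d" for x using that by (simp add: g_def)
      fix a b
      obtain a' b' where ab: "box a b \<inter> box c d = box a' b'" by (simp add: box_Int_box)
      have "(LINT x:box a b|lborel. g x) = (LINT x|lebesgue. indicator (box a b) x * g x)"
        unfolding set_lebesgue_integral_def using gm by (subst integral_completion) auto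
      also have "\<dots> = (LINT x|lebesgue. indicator (box a' b') x * w x)"
      proof (rule integral_cong_AE)
        show "(\<lambda>x. indicator (box a b) x * g x) \<in> borel_measurable lebesgue"
          using gm by (intro borel_measurable_times measurable_completion) auto
        have e: "(\<lambda>x. indicator (box a' b') x * w x) = (\<lambda>x. indicator (box a' b') x * (indicator (cbox c d) x * w x))"
          using ab[symmetric] box_subset_cbox[of c d] by (auto simp: indicator_def fun_eq_iff)
        show "(\<lambda>x. indicator (box a' b') x * w x) \<in> borel_measurable lebesgue"
          unfolding e by (rule borel_measurable_times[OF borel_measurable_indicator borel_measurable_integrable[OF i]]) simp
        show "AE x in lebesgue. indicator (box a b) x * g x = indicator (box a' b') x * w x"
          using veq
        proof eventually_elim
          case (elim x)
          then show ?case unfolding g_def ab[symmetric] using box_subset_cbox[of c d]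
            by (auto simp: indicator_def split: if_splits)
        qed
      qed
      also have "\<dots> = 0"
      \<comment> \<open>From the inclusion of open boxes the inclusion of the closed ones follows
        only if the smaller open box is nonempty; the empty case is trivial.\<close>
      proof (cases "box a' b' = {}")
        case False
        have "box a' b' \<subseteq> box c d" using ab by blast
        then have "cbox a' b' \<subseteq> cbox c d" by (metis False closure_box closure_mono closure_empty box_eq_empty(1) box_subset_cbox closed_cbox closure_minimal dual_order.trans)
        then show ?thesis using boxz XD by blast
      qed simp
      finally show "(LINT x:box a b|lborel. g x) = 0" .
    qed
    then have "AE x in lebesgue. g x = 0" by (rule AE_completion)
    moreover have "AE x in lebesgue. x \<notin> cbox c d - box c d"
      using negligible_frontier_interval[of c d] by (intro AE_not_in) (simp add: negligible_iff_null_sets)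
    ultimately show ?thesis using veq
      by eventually_elim (auto simp: X g_def indicator_def split: if_splits)
  qed
  then have "AE x in lebesgue. \<forall>X\<in>\<D>. x \<in> X \<longrightarrow> w x = 0"
    unfolding AE_ball_countable[OF \<D>(1)] using pieces by blast
  then have "AE x in lebesgue. x \<in> D \<longrightarrow> w x = 0" by eventually_elim (use \<D>(4) in auto)
  then show ?thesis using open_lebesgue[OF D] by (simp add: AE_restrict_space_iff)
qed

section \<open>Calculus of weak derivatives\<close>

lemma test_funD:
  assumes "\<phi> \<in> test_fun D"
  shows "set \<omega> \<subseteq> Basis \<Longrightarrow> pderivs \<omega> \<phi> differentiable (at x)"
    "compact (closure {x. \<phi> x \<noteq> 0})" "closure {x. \<phi> x \<noteq> 0} \<subseteq> D"
  using assms unfolding test_fun_def by auto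

lemma pderivs_outside_support:
  assumes "x \<notin> closure {x. \<phi> x \<noteq> 0}" shows "pderivs \<omega> \<phi> x = 0"
  using assms
proof (induction \<omega> arbitrary: x)
  case Nil
  then show ?case using closure_subset[of "{x. \<phi> x \<noteq> 0}"] by auto
next
  case (Cons i \<omega>)
  have "((\<lambda>_. 0) has_derivative (\<lambda>_. 0)) (at x)" by simp
  then have "(pderivs \<omega> \<phi> has_derivative (\<lambda>_. 0)) (at x)"
    by (rule has_derivative_transform_within_open[of _ _ _ "UNIV" "- closure {x. \<phi> x \<noteq> 0}"])
      (use Cons in auto)
  from frechet_derivative_at[OF this, symmetric] show ?case by (simp add: pderiv1_def)
qed

lemma continuous_pderivs:
  assumes "\<phi> \<in> test_fun D" "set \<omega> \<subseteq> Basis" shows "continuous_on UNIV (pderivs \<omega> \<phi>)"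
proof -
  have "isCont (pderivs \<omega> \<phi>) x" for x
    by (rule differentiable_imp_continuous_within) (rule test_funD(1)[OF assms])
  then show ?thesis by (simp add: continuous_at_imp_continuous_on)
qed

lemma integrable_test:
  fixes D :: "'a::euclidean_space set"
  assumes D: "open D" and v: "loc_integrable D v" and \<phi>: "\<phi> \<in> test_fun D" and \<omega>: "set \<omega> \<subseteq> Basis"
  shows "integrable (lebesgue_on D) (\<lambda>x. v x * pderivs \<omega> \<phi> x)"
proof -
  define K where "K = closure {x. \<phi> x \<noteq> 0}"
  define \<psi> where "\<psi> = pderivs \<omega> \<phi>"
  have K: "compact K" "K \<subseteq> D" using test_funD[OF \<phi>] by (auto simp: K_def)
  have c: "continuous_on UNIV \<psi>" unfolding \<psi>_def by (rule continuous_pderivs[OF \<phi> \<omega>])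
  have "bounded (\<psi> ` K)" using compact_continuous_image[OF continuous_on_subset[OF c] K(1)] compact_imp_bounded by blast
  then obtain B where B: "\<And>x. x \<in> K \<Longrightarrow> \<bar>\<psi> x\<bar> \<le> B" by (auto simp: bounded_iff)
  have \<psi>0: "\<psi> x = 0" if "x \<notin> K" for x unfolding \<psi>_def by (rule pderivs_outside_support) (use that K_def in simp)
  have i: "integrable lebesgue (\<lambda>x. indicator K x * v x)" by (rule loc_integrable_indicator[OF v K])
  have m: "\<psi> \<in> borel_measurable lebesgue"
    using borel_measurable_continuous_onI[OF c] by (intro measurable_completion) simp
  have "integrable lebesgue (\<lambda>x. indicator K x * v x * \<psi> x)"
  proof (rule Bochner_Integration.integrable_bound)
    show "integrable lebesgue (\<lambda>x. B * (indicator K x * v x))" using i by simp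
    show "(\<lambda>x. indicator K x * v x * \<psi> x) \<in> borel_measurable lebesgue"
      by (rule borel_measurable_times[OF borel_measurable_integrable[OF i] m])
    show "AE x in lebesgue. norm (indicator K x * v x * \<psi> x) \<le> norm (B * (indicator K x * v x))"
    proof (intro AE_I2)
      fix x
      show "norm (indicator K x * v x * \<psi> x) \<le> norm (B * (indicator K x * v x))"
      proof (cases "x \<in> K")
        case True
        from B[OF this] have "\<bar>\<psi> x\<bar> \<le> \<bar>B\<bar>" by linarith
        then show ?thesis using True by (simp add: abs_mult mult_left_mono mult.commute[of "\<bar>B\<bar>"])
      qed simp
    qed
  qed
  moreover have "(\<lambda>x. indicator K x * v x * \<psi> x) = (\<lambda>x. indicator D x *\<^sub>R (v x * \<psi> x))"
    using \<psi>0 K(2) by (auto simp: indicator_def fun_eq_iff)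
  ultimately show ?thesis
    unfolding \<psi>_def using open_lebesgue[OF D] by (subst integrable_restrict_space) auto
qed

lemma loc_integrable_add: "loc_integrable D v \<Longrightarrow> loc_integrable D w \<Longrightarrow> loc_integrable D (\<lambda>x. v x + w x)"
  and loc_integrable_scale: "loc_integrable D v \<Longrightarrow> loc_integrable D (\<lambda>x. c * v x)"
  unfolding loc_integrable_def by auto

lemma weak_deriv_add:
  assumes D: "open D" and \<omega>: "set \<omega> \<subseteq> Basis" and 1: "weak_deriv D \<omega> v w" and 2: "weak_deriv D \<omega> v' w'"
  shows "weak_deriv D \<omega> (\<lambda>x. v x + v' x) (\<lambda>x. w x + w' x)"
  unfolding weak_deriv_def
proof (intro conjI ballI)
  show "loc_integrable D (\<lambda>x. v x + v' x)" "loc_integrable D (\<lambda>x. w x + w' x)"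
    using 1 2 unfolding weak_deriv_def by (auto intro: loc_integrable_add)
  fix \<phi> assume \<phi>: "\<phi> \<in> test_fun D"
  have i: "integrable (lebesgue_on D) (\<lambda>x. v x * pderivs \<omega> \<phi> x)" "integrable (lebesgue_on D) (\<lambda>x. v' x * pderivs \<omega> \<phi> x)"
     "integrable (lebesgue_on D) (\<lambda>x. w x * \<phi> x)" "integrable (lebesgue_on D) (\<lambda>x. w' x * \<phi> x)"
    using integrable_test[OF D _ \<phi> \<omega>] integrable_test[OF D _ \<phi>, of _ "[]"] 1 2 unfolding weak_deriv_def by auto
  have "(LINT x|lebesgue_on D. v x * pderivs \<omega> \<phi> x) = (-1) ^ length \<omega> * (LINT x|lebesgue_on D. w x * \<phi> x)"
    "(LINT x|lebesgue_on D. v' x * pderivs \<omega> \<phi> x) = (-1) ^ length \<omega> * (LINT x|lebesgue_on D. w' x * \<phi> x)"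
    using 1 2 \<phi> unfolding weak_deriv_def by auto
  then show "(LINT x|lebesgue_on D. (v x + v' x) * pderivs \<omega> \<phi> x) = (-1) ^ length \<omega> * (LINT x|lebesgue_on D. (w x + w' x) * \<phi> x)"
    using i by (simp add: distrib_right distrib_left)
qed

lemma weak_deriv_scale:
  assumes 1: "weak_deriv D \<omega> v w" shows "weak_deriv D \<omega> (\<lambda>x. c * v x) (\<lambda>x. c * w x)"
  using assms unfolding weak_deriv_def by (auto intro: loc_integrable_scale simp: mult.assoc)

lemma weak_deriv_unique:
  fixes D :: "'a::euclidean_space set"
  assumes D: "open D" and 1: "weak_deriv D \<omega> v w" and 2: "weak_deriv D \<omega> v w'"
  shows "AE x in lebesgue_on D. w x = w' x"
proof -
  have l: "loc_integrable D w" "loc_integrable D w'" using 1 2 unfolding weak_deriv_def by auto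
  have "loc_integrable D (\<lambda>x. w x + (-1) * w' x)" by (intro loc_integrable_add loc_integrable_scale l)
  then have "AE x in lebesgue_on D. w x + (-1) * w' x = 0"
  proof (rule fundamental_lemma[OF D])
    fix \<phi> assume \<phi>: "\<phi> \<in> test_fun D"
    have i: "integrable (lebesgue_on D) (\<lambda>x. w x * \<phi> x)" "integrable (lebesgue_on D) (\<lambda>x. w' x * \<phi> x)"
      using integrable_test[OF D _ \<phi>, of _ "[]"] l by auto
    have "(-1) ^ length \<omega> * (LINT x|lebesgue_on D. w x * \<phi> x) = (-1) ^ length \<omega> * (LINT x|lebesgue_on D. w' x * \<phi> x)"
    proof -
      have "(LINT x|lebesgue_on D. v x * pderivs \<omega> \<phi> x) = (-1) ^ length \<omega> * (LINT x|lebesgue_on D. w x * \<phi> x)"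
        using 1 \<phi> unfolding weak_deriv_def by blast
      moreover have "(LINT x|lebesgue_on D. v x * pderivs \<omega> \<phi> x) = (-1) ^ length \<omega> * (LINT x|lebesgue_on D. w' x * \<phi> x)"
        using 2 \<phi> unfolding weak_deriv_def by blast
      ultimately show ?thesis by simp
    qed
    then have "(LINT x|lebesgue_on D. w x * \<phi> x) = (LINT x|lebesgue_on D. w' x * \<phi> x)" by simp
    then show "(LINT x|lebesgue_on D. (w x + (-1) * w' x) * \<phi> x) = 0"
      using i by (simp add: left_diff_distrib)
  qed
  then show ?thesis by eventually_elim simp
qed

lemma weak_grad_unique:
  fixes D :: "'a::euclidean_space set"
  assumes D: "open D" and 1: "weak_grad D v g" and 2: "weak_grad D v g'"
  shows "AE x in lebesgue_on D. g x = g' x"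
proof -
  have "AE x in lebesgue_on D. \<forall>i\<in>Basis. g x \<bullet> i = g' x \<bullet> i"
    unfolding AE_ball_countable[OF countable_finite[OF finite_Basis]]
  proof
    fix i :: 'a assume "i \<in> Basis"
    then have "weak_deriv D [i] v (\<lambda>x. g x \<bullet> i)" "weak_deriv D [i] v (\<lambda>x. g' x \<bullet> i)"
      using 1 2 unfolding weak_grad_def by auto
    then show "AE x in lebesgue_on D. g x \<bullet> i = g' x \<bullet> i" by (rule weak_deriv_unique[OF D])
  qed
  then show ?thesis by eventually_elim (rule euclidean_eqI, blast)
qed

lemma weak_grad_add:
  fixes D :: "'a::euclidean_space set"
  assumes "open D" "weak_grad D v g" "weak_grad D v' g'"
  shows "weak_grad D (\<lambda>x. v x + v' x) (\<lambda>x. g x + g' x)"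
  unfolding weak_grad_def inner_add_left
proof
  fix i :: 'a assume i: "i \<in> Basis"
  then show "weak_deriv D [i] (\<lambda>x. v x + v' x) (\<lambda>x. g x \<bullet> i + g' x \<bullet> i)"
    using assms(2,3) by (intro weak_deriv_add[OF assms(1)]) (auto simp: weak_grad_def)
qed

lemma weak_grad_scale:
  assumes "weak_grad D v g" shows "weak_grad D (\<lambda>x. c * v x) (\<lambda>x. c *\<^sub>R g x)"
  unfolding weak_grad_def inner_scaleR_left
  by (rule ballI, rule weak_deriv_scale) (use assms in \<open>simp add: weak_grad_def\<close>)

text \<open>Local integrability speaks only of compact subsets; measurability on D is glued from
  countably many closed boxes that cover it.\<close>

lemma loc_integrable_measurable:
  fixes D :: "'a::euclidean_space set"
  assumes D: "open D" and v: "loc_integrable D v"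
  shows "v \<in> borel_measurable (lebesgue_on D)"
proof -
  obtain \<D> where \<D>: "countable \<D>" "\<D> \<subseteq> Pow D" "\<And>X. X \<in> \<D> \<Longrightarrow> \<exists>a b. X = cbox a b" "\<Union>\<D> = D"
    using open_countable_Union_open_cbox[OF D] by metis
  show ?thesis
  proof (rule measurable_piecewise_restrict[OF \<D>(1)])
    fix X assume X: "X \<in> \<D>"
    then obtain a b where ab: "X = cbox a b" using \<D>(3) by blast
    have XD: "X \<subseteq> D" using X \<D>(2) by auto
    show "X \<inter> space (lebesgue_on D) \<in> sets (lebesgue_on D)"
      using XD ab open_lebesgue[OF D] by (auto simp: sets_restrict_space_iff Int_absorb2 intro!: )
    have "restrict_space (lebesgue_on D) X = lebesgue_on X"
      using XD ab open_lebesgue[OF D] by (subst restrict_restrict_space) (auto simp: Int_absorb1)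
    moreover have "integrable (lebesgue_on X) v" using v XD ab by (auto simp: loc_integrable_def)
    ultimately show "v \<in> borel_measurable (restrict_space (lebesgue_on D) X)" by simp
  qed (use \<D>(4) in auto)
qed

lemma weak_grad_measurable:
  fixes D :: "'a::euclidean_space set"
  assumes D: "open D" and g: "weak_grad D v g"
  shows "g \<in> borel_measurable (lebesgue_on D)" "v \<in> borel_measurable (lebesgue_on D)"
proof -
  have l: "loc_integrable D (\<lambda>x. g x \<bullet> i)" "loc_integrable D v" if "i \<in> Basis" for i
    using g that unfolding weak_grad_def weak_deriv_def by auto
  show "g \<in> borel_measurable (lebesgue_on D)"
    unfolding borel_measurable_euclidean_space[of g] using loc_integrable_measurable[OF D l(1)] by blast
  show "v \<in> borel_measurable (lebesgue_on D)"
    using loc_integrable_measurable[OF D l(2)[OF SOME_Basis]] .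
qed

lemma test_fun_measurable:
  assumes "\<psi> \<in> test_fun D"
  shows "\<psi> \<in> borel_measurable (lebesgue_on D)" "grad \<psi> \<in> borel_measurable (lebesgue_on D)"
proof -
  have m: "pderivs \<omega> \<psi> \<in> borel_measurable (lebesgue_on D)" if "set \<omega> \<subseteq> Basis" for \<omega>
    using borel_measurable_continuous_onI[OF continuous_pderivs[OF assms that]]
    by (intro measurable_restrict_space1 measurable_completion) simp
  show "\<psi> \<in> borel_measurable (lebesgue_on D)" using m[of "[]"] by simp
  have "pderiv1 i \<psi> \<in> borel_measurable (lebesgue_on D)" if "i \<in> Basis" for i using m[of "[i]"] that by simp
  then show "grad \<psi> \<in> borel_measurable (lebesgue_on D)" unfolding grad_def[abs_def]
    by (intro borel_measurable_sum borel_measurable_scaleR) auto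
qed

lemma pderivs_add:
  assumes "\<phi> \<in> test_fun D" "\<psi> \<in> test_fun D" "set \<omega> \<subseteq> Basis"
  shows "pderivs \<omega> (\<lambda>x. \<phi> x + \<psi> x) = (\<lambda>x. pderivs \<omega> \<phi> x + pderivs \<omega> \<psi> x)"
  using assms(3)
proof (induction \<omega>)
  case (Cons i \<omega>)
  then have "set \<omega> \<subseteq> Basis" by simp
  then have d: "\<And>x. (pderivs \<omega> \<phi> has_derivative frechet_derivative (pderivs \<omega> \<phi>) (at x)) (at x)"
    "\<And>x. (pderivs \<omega> \<psi> has_derivative frechet_derivative (pderivs \<omega> \<psi>) (at x)) (at x)"
    using test_funD(1)[OF assms(1)] test_funD(1)[OF assms(2)] by (auto simp: frechet_derivative_works)
  have "pderivs (i # \<omega>) (\<lambda>x. \<phi> x + \<psi> x) = pderiv1 i (\<lambda>x. pderivs \<omega> \<phi> x + pderivs \<omega> \<psi> x)"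
    using Cons by simp
  also have "\<dots> = (\<lambda>x. frechet_derivative (pderivs \<omega> \<phi>) (at x) i + frechet_derivative (pderivs \<omega> \<psi>) (at x) i)"
    by (rule pderiv1_eqI[OF has_derivative_add[OF d]])
  finally show ?case by (simp add: pderiv1_def)
qed simp

lemma pderivs_scale:
  assumes "\<phi> \<in> test_fun D" "set \<omega> \<subseteq> Basis"
  shows "pderivs \<omega> (\<lambda>x. c * \<phi> x) = (\<lambda>x. c * pderivs \<omega> \<phi> x)"
  using assms(2)
proof (induction \<omega>)
  case (Cons i \<omega>)
  then have "set \<omega> \<subseteq> Basis" by simp
  then have d: "\<And>x. (pderivs \<omega> \<phi> has_derivative frechet_derivative (pderivs \<omega> \<phi>) (at x)) (at x)"
    using test_funD(1)[OF assms(1)] by (auto simp: frechet_derivative_works)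
  have "pderivs (i # \<omega>) (\<lambda>x. c * \<phi> x) = pderiv1 i (\<lambda>x. c * pderivs \<omega> \<phi> x)"
    using Cons by simp
  also have "\<dots> = (\<lambda>x. c * frechet_derivative (pderivs \<omega> \<phi>) (at x) i)"
    by (rule pderiv1_eqI[OF has_derivative_mult_right[OF d]])
  finally show ?case by (simp add: pderiv1_def)
qed simp

lemma test_fun_add: assumes "\<phi> \<in> test_fun D" "\<psi> \<in> test_fun D" shows "(\<lambda>x. \<phi> x + \<psi> x) \<in> test_fun D"
proof -
  have s: "closure {x. \<phi> x + \<psi> x \<noteq> 0} \<subseteq> closure {x. \<phi> x \<noteq> 0} \<union> closure {x. \<psi> x \<noteq> 0}"
    unfolding closure_Un[symmetric] by (intro closure_mono) auto
  have "compact (closure {x. \<phi> x \<noteq> 0} \<union> closure {x. \<psi> x \<noteq> 0})"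
    using test_funD(2)[OF assms(1)] test_funD(2)[OF assms(2)] by (rule compact_Un)
  from compact_Int_closed[OF this closed_closure[of "{x. \<phi> x + \<psi> x \<noteq> 0}"]]
  have "compact (closure {x. \<phi> x + \<psi> x \<noteq> 0})" unfolding Int_absorb1[OF s] .
  moreover have "pderivs \<omega> (\<lambda>x. \<phi> x + \<psi> x) differentiable (at x)" if "set \<omega> \<subseteq> Basis" for \<omega> x
    unfolding pderivs_add[OF assms that] using test_funD(1)[OF assms(1) that] test_funD(1)[OF assms(2) that]
    by (intro differentiable_add) auto
  ultimately show ?thesis using s test_funD(3)[OF assms(1)] test_funD(3)[OF assms(2)] unfolding test_fun_def by blast
qed

lemma test_fun_scale: assumes "\<phi> \<in> test_fun D" shows "(\<lambda>x. c * \<phi> x) \<in> test_fun D"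
proof -
  have s: "closure {x. c * \<phi> x \<noteq> 0} \<subseteq> closure {x. \<phi> x \<noteq> 0}"
    by (intro closure_mono) auto
  from compact_Int_closed[OF test_funD(2)[OF assms(1)] closed_closure[of "{x. c * \<phi> x \<noteq> 0}"]]
  have "compact (closure {x. c * \<phi> x \<noteq> 0})" unfolding Int_absorb1[OF s] .
  moreover have "pderivs \<omega> (\<lambda>x. c * \<phi> x) differentiable (at x)" if "set \<omega> \<subseteq> Basis" for \<omega> x
    unfolding pderivs_scale[OF assms that] using test_funD(1)[OF assms(1) that]
    by (intro differentiable_mult) auto
  ultimately show ?thesis using s test_funD(3)[OF assms(1)] unfolding test_fun_def by blast
qed

lemma grad_add: assumes "\<phi> \<in> test_fun D" "\<psi> \<in> test_fun D" shows "grad (\<lambda>x. \<phi> x + \<psi> x) x = grad \<phi> x + grad \<psi> x"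
  unfolding grad_def sum.distrib[symmetric] using pderivs_add[OF assms, of "[_]"]
  by (intro sum.cong refl) (simp add: scaleR_left_distrib)

lemma grad_scale: assumes "\<phi> \<in> test_fun D" shows "grad (\<lambda>x. c * \<phi> x) x = c *\<^sub>R grad \<phi> x"
  unfolding grad_def scaleR_sum_right using pderivs_scale[OF assms, of "[_]"]
  by (intro sum.cong refl) simp

section \<open>Linear operations in \<open>H10 D\<close>\<close>

lemma L2_sq_add_le:
  assumes "f \<in> borel_measurable (lebesgue_on D)" "g \<in> borel_measurable (lebesgue_on D)"
  shows "L2_sq D (\<lambda>x. f x + (g x :: 'b::{real_normed_vector, second_countable_topology})) \<le> 2 * L2_sq D f + 2 * L2_sq D g"
proof -
  have "(norm (f x + g x))\<^sup>2 \<le> 2 * (norm (f x))\<^sup>2 + 2 * (norm (g x))\<^sup>2" for x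
  proof -
    have "(norm (f x + g x))\<^sup>2 \<le> (norm (f x) + norm (g x))\<^sup>2" by (intro power_mono norm_triangle_ineq) auto
    also have "\<dots> \<le> 2 * (norm (f x))\<^sup>2 + 2 * (norm (g x))\<^sup>2"
      using sum_squares_bound[of "norm (f x)" "norm (g x)"] by (simp add: power2_sum)
    finally show ?thesis .
  qed
  then have "L2_sq D (\<lambda>x. f x + g x) \<le> (\<integral>\<^sup>+x. 2 * ennreal ((norm (f x))\<^sup>2) + 2 * ennreal ((norm (g x))\<^sup>2) \<partial>lebesgue_on D)"
    unfolding L2_sq_def
    by (intro nn_integral_mono) (simp add: ennreal_leI flip: ennreal_plus ennreal_numeral ennreal_mult)
  also have "\<dots> = 2 * L2_sq D f + 2 * L2_sq D g"
    unfolding L2_sq_def using assms by (simp add: nn_integral_add nn_integral_cmult)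
  finally show ?thesis .
qed

lemma L2_sq_scale:
  assumes "f \<in> borel_measurable (lebesgue_on D)"
  shows "L2_sq D (\<lambda>x. c *\<^sub>R (f x :: 'b::{real_normed_vector, second_countable_topology})) = ennreal (c\<^sup>2) * L2_sq D f"
  unfolding L2_sq_def using assms
  by (simp add: nn_integral_cmult[symmetric] power_mult_distrib ennreal_mult)

text \<open>The gradient that witnesses membership need not be the one picked by
  \<open>wgrad\<close>; by uniqueness they agree almost everywhere, so integrability
  transfers.\<close>

lemma H10_weak_grad:
  assumes D: "open D" and v: "v \<in> H10 D"
  shows "weak_grad D v (wgrad D v)" "wgrad D v \<in> borel_measurable (lebesgue_on D)" "L2_sq D (wgrad D v) < \<infinity>"
proof -
  from v obtain g where g: "weak_grad D v g" "L2_sq D g < \<infinity>" unfolding H10_def by auto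
  show w: "weak_grad D v (wgrad D v)" unfolding wgrad_def by (rule someI[of "weak_grad D v", OF g(1)])
  show "wgrad D v \<in> borel_measurable (lebesgue_on D)" by (rule weak_grad_measurable[OF D w])
  have "L2_sq D (wgrad D v) = L2_sq D g" unfolding L2_sq_def
    by (rule nn_integral_cong_AE) (use weak_grad_unique[OF D w g(1)] in \<open>auto\<close>)
  then show "L2_sq D (wgrad D v) < \<infinity>" using g by simp
qed

lemma H10_add: 
  assumes D: "open D" and v: "v \<in> H10 D" and w: "w \<in> H10 D" shows "(\<lambda>x. v x + w x) \<in> H10 D"
proof -
  from v obtain g \<psi> where g: "weak_grad D v g" "L2_sq D v < \<infinity>" "L2_sq D g < \<infinity>"
    and \<psi>: "\<And>n::nat. \<psi> n \<in> test_fun D" "(\<lambda>n. L2_sq D (\<lambda>x. v x - \<psi> n x) + L2_sq D (\<lambda>x. g x - grad (\<psi> n) x)) \<longlonglongrightarrow> 0"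
    unfolding H10_def by auto
  from w obtain g' \<psi>' where g': "weak_grad D w g'" "L2_sq D w < \<infinity>" "L2_sq D g' < \<infinity>"
    and \<psi>': "\<And>n::nat. \<psi>' n \<in> test_fun D" "(\<lambda>n. L2_sq D (\<lambda>x. w x - \<psi>' n x) + L2_sq D (\<lambda>x. g' x - grad (\<psi>' n) x)) \<longlonglongrightarrow> 0"
    unfolding H10_def by auto
  note m = weak_grad_measurable[OF D g(1)] weak_grad_measurable[OF D g'(1)]
    test_fun_measurable[OF \<psi>(1)] test_fun_measurable[OF \<psi>'(1)]
  have 1: "L2_sq D (\<lambda>x. v x + w x) < \<infinity>"
    using L2_sq_add_le[OF m(2) m(4)] g g' by (auto simp: ennreal_mult_less_top less_top top_unique intro: le_less_trans)
  have 2: "L2_sq D (\<lambda>x. g x + g' x) < \<infinity>"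
    using L2_sq_add_le[OF m(1) m(3)] g g' by (auto simp: ennreal_mult_less_top less_top top_unique intro: le_less_trans)
  define A where "A n = L2_sq D (\<lambda>x. v x - \<psi> n x) + L2_sq D (\<lambda>x. g x - grad (\<psi> n) x)" for n
  define B where "B n = L2_sq D (\<lambda>x. w x - \<psi>' n x) + L2_sq D (\<lambda>x. g' x - grad (\<psi>' n) x)" for n
  have le: "L2_sq D (\<lambda>x. (v x + w x) - (\<psi> n x + \<psi>' n x)) + L2_sq D (\<lambda>x. (g x + g' x) - grad (\<lambda>x. \<psi> n x + \<psi>' n x) x) \<le> 2 * A n + 2 * B n" for n
  proof -
    have l1: "L2_sq D (\<lambda>x. (v x - \<psi> n x) + (w x - \<psi>' n x)) \<le> 2 * L2_sq D (\<lambda>x. v x - \<psi> n x) + 2 * L2_sq D (\<lambda>x. w x - \<psi>' n x)"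
      by (intro L2_sq_add_le borel_measurable_diff m)
    have l2: "L2_sq D (\<lambda>x. (g x - grad (\<psi> n) x) + (g' x - grad (\<psi>' n) x)) \<le> 2 * L2_sq D (\<lambda>x. g x - grad (\<psi> n) x) + 2 * L2_sq D (\<lambda>x. g' x - grad (\<psi>' n) x)"
      by (intro L2_sq_add_le borel_measurable_diff m)
    have e1: "(\<lambda>x. (v x - \<psi> n x) + (w x - \<psi>' n x)) = (\<lambda>x. (v x + w x) - (\<psi> n x + \<psi>' n x))"
      and e2: "(\<lambda>x. (g x - grad (\<psi> n) x) + (g' x - grad (\<psi>' n) x)) = (\<lambda>x. (g x + g' x) - grad (\<lambda>x. \<psi> n x + \<psi>' n x) x)"
      unfolding grad_add[OF \<psi>(1) \<psi>'(1)] by (auto simp: algebra_simps)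
    show ?thesis using add_mono[OF l1[unfolded e1] l2[unfolded e2]]
      unfolding A_def B_def distrib_left by (simp only: add_ac)
  qed
  have "(\<lambda>n. 2 * A n + 2 * B n) \<longlonglongrightarrow> 2 * 0 + 2 * 0"
    using \<psi>(2) \<psi>'(2) unfolding A_def[symmetric] B_def[symmetric]
    by (intro tendsto_add ennreal_tendsto_cmult) auto
  then have "(\<lambda>n. 2 * A n + 2 * B n) \<longlonglongrightarrow> 0" by simp
  then have 3: "(\<lambda>n. L2_sq D (\<lambda>x. (v x + w x) - (\<psi> n x + \<psi>' n x)) + L2_sq D (\<lambda>x. (g x + g' x) - grad (\<lambda>x. \<psi> n x + \<psi>' n x) x)) \<longlonglongrightarrow> 0"
    by (rule tendsto_sandwich[OF always_eventually[OF allI[OF zero_le]] always_eventually[OF allI[OF le]] tendsto_const[of 0]])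
  show ?thesis unfolding H10_def
    by (intro CollectI exI[of _ "\<lambda>x. g x + g' x"] conjI weak_grad_add[OF D g(1) g'(1)] 1 2
        exI[of _ "\<lambda>n x. \<psi> n x + \<psi>' n x"] allI test_fun_add \<psi>(1) \<psi>'(1) 3)
qed

lemma H10_scale: 
  assumes D: "open D" and v: "v \<in> H10 D" shows "(\<lambda>x. c * v x) \<in> H10 D"
proof -
  from v obtain g \<psi> where g: "weak_grad D v g" "L2_sq D v < \<infinity>" "L2_sq D g < \<infinity>"
    and \<psi>: "\<And>n::nat. \<psi> n \<in> test_fun D" "(\<lambda>n. L2_sq D (\<lambda>x. v x - \<psi> n x) + L2_sq D (\<lambda>x. g x - grad (\<psi> n) x)) \<longlonglongrightarrow> 0"
    unfolding H10_def by auto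
  note m = weak_grad_measurable[OF D g(1)] test_fun_measurable[OF \<psi>(1)]
  have 1: "L2_sq D (\<lambda>x. c * v x) < \<infinity>" 
    using L2_sq_scale[OF m(2), of c] g by (auto simp: ennreal_mult_less_top)
  have 2: "L2_sq D (\<lambda>x. c *\<^sub>R g x) < \<infinity>"
    using L2_sq_scale[OF m(1), of c] g by (auto simp: ennreal_mult_less_top)
  define A where "A n = L2_sq D (\<lambda>x. v x - \<psi> n x) + L2_sq D (\<lambda>x. g x - grad (\<psi> n) x)" for n
  have eq: "L2_sq D (\<lambda>x. c * v x - c * \<psi> n x) + L2_sq D (\<lambda>x. c *\<^sub>R g x - grad (\<lambda>x. c * \<psi> n x) x) = ennreal (c\<^sup>2) * A n" for n
  proof -
    have "L2_sq D (\<lambda>x. c *\<^sub>R (v x - \<psi> n x)) = ennreal (c\<^sup>2) * L2_sq D (\<lambda>x. v x - \<psi> n x)"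
      "L2_sq D (\<lambda>x. c *\<^sub>R (g x - grad (\<psi> n) x)) = ennreal (c\<^sup>2) * L2_sq D (\<lambda>x. g x - grad (\<psi> n) x)"
      by (intro L2_sq_scale borel_measurable_diff m)+
    then show ?thesis unfolding A_def
      by (simp add: grad_scale[OF \<psi>(1)] algebra_simps distrib_left scaleR_diff_right)
  qed
  have "(\<lambda>n. ennreal (c\<^sup>2) * A n) \<longlonglongrightarrow> ennreal (c\<^sup>2) * 0"
    using \<psi>(2) unfolding A_def[symmetric] by (intro ennreal_tendsto_cmult) auto
  then have 3: "(\<lambda>n. L2_sq D (\<lambda>x. c * v x - c * \<psi> n x) + L2_sq D (\<lambda>x. c *\<^sub>R g x - grad (\<lambda>x. c * \<psi> n x) x)) \<longlonglongrightarrow> 0"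
    unfolding eq by simp
  show ?thesis unfolding H10_def
    by (intro CollectI exI[of _ "\<lambda>x. c *\<^sub>R g x"] conjI weak_grad_scale g 1 2
        exI[of _ "\<lambda>n x. c * \<psi> n x"] allI test_fun_scale \<psi>(1) 3)
qed

text \<open>Only almost everywhere, because \<open>wgrad\<close> selects a representative for each
  function separately.\<close>

lemma wgrad_add:
  assumes D: "open D" and v: "v \<in> H10 D" and w: "w \<in> H10 D"
  shows "AE x in lebesgue_on D. wgrad D (\<lambda>x. v x + w x) x = wgrad D v x + wgrad D w x"
  by (rule weak_grad_unique[OF D H10_weak_grad(1)[OF D H10_add[OF D v w]]
        weak_grad_add[OF D H10_weak_grad(1)[OF D v] H10_weak_grad(1)[OF D w]]])

lemma wgrad_scale:
  assumes D: "open D" and v: "v \<in> H10 D"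
  shows "AE x in lebesgue_on D. wgrad D (\<lambda>x. c * v x) x = c *\<^sub>R wgrad D v x"
  by (rule weak_grad_unique[OF D H10_weak_grad(1)[OF D H10_scale[OF D v]]
        weak_grad_scale[OF H10_weak_grad(1)[OF D v]]])

section \<open>Bilinear forms of the diffusion problem\<close>

definition form :: "'a::euclidean_space set \<Rightarrow> ('a \<Rightarrow> real) \<Rightarrow> ('a \<Rightarrow> real) \<Rightarrow> ('a \<Rightarrow> real) \<Rightarrow> real" where
  "form D c v w = (LINT x|lebesgue_on D. c x * (wgrad D v x \<bullet> wgrad D w x))"

definition bdd_coeff :: "'a::euclidean_space set \<Rightarrow> ('a \<Rightarrow> real) \<Rightarrow> bool" where
  "bdd_coeff D c \<longleftrightarrow> c \<in> borel_measurable (lebesgue_on D) \<and> (\<exists>B. AE x in lebesgue_on D. \<bar>c x\<bar> \<le> B)"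

context
  fixes D :: "'a::euclidean_space set"
  assumes D: "open D"
begin

lemma integrable_wgrad_sq:
  assumes "v \<in> H10 D" shows "integrable (lebesgue_on D) (\<lambda>x. (norm (wgrad D v x))\<^sup>2)"
  using H10_weak_grad[OF D assms] unfolding L2_sq_def
  by (intro integrableI_nonneg) (auto intro!: borel_measurable_power)

lemma form_measurable:
  assumes "c \<in> borel_measurable (lebesgue_on D)" "v \<in> H10 D" "w \<in> H10 D"
  shows "(\<lambda>x. c x * (wgrad D v x \<bullet> wgrad D w x)) \<in> borel_measurable (lebesgue_on D)"
  using assms H10_weak_grad(2)[OF D] by (intro borel_measurable_times borel_measurable_inner) auto

lemma form_integrable:
  assumes c: "bdd_coeff D c" and v: "v \<in> H10 D" and w: "w \<in> H10 D"
  shows "integrable (lebesgue_on D) (\<lambda>x. c x * (wgrad D v x \<bullet> wgrad D w x))"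
proof -
  obtain B where B: "AE x in lebesgue_on D. \<bar>c x\<bar> \<le> B" using c unfolding bdd_coeff_def by blast
  show ?thesis
  proof (rule Bochner_Integration.integrable_bound)
    show "integrable (lebesgue_on D) (\<lambda>x. B * ((norm (wgrad D v x))\<^sup>2 + (norm (wgrad D w x))\<^sup>2))"
      using integrable_wgrad_sq[OF v] integrable_wgrad_sq[OF w] by simp
    show "(\<lambda>x. c x * (wgrad D v x \<bullet> wgrad D w x)) \<in> borel_measurable (lebesgue_on D)"
      using c v w by (intro form_measurable) (auto simp: bdd_coeff_def)
    show "AE x in lebesgue_on D. norm (c x * (wgrad D v x \<bullet> wgrad D w x)) \<le> norm (B * ((norm (wgrad D v x))\<^sup>2 + (norm (wgrad D w x))\<^sup>2))"
      using B
    proof eventually_elim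
      case (elim x)
      have "\<bar>wgrad D v x \<bullet> wgrad D w x\<bar> \<le> norm (wgrad D v x) * norm (wgrad D w x)" by (rule Cauchy_Schwarz_ineq2)
      also have "\<dots> \<le> (norm (wgrad D v x))\<^sup>2 + (norm (wgrad D w x))\<^sup>2"
        using sum_squares_bound[of "norm (wgrad D v x)" "norm (wgrad D w x)"]
          mult_nonneg_nonneg[OF norm_ge_zero norm_ge_zero, of "wgrad D v x" "wgrad D w x"] by linarith
      finally have "\<bar>c x\<bar> * \<bar>wgrad D v x \<bullet> wgrad D w x\<bar> \<le> B * ((norm (wgrad D v x))\<^sup>2 + (norm (wgrad D w x))\<^sup>2)"
        using elim by (intro mult_mono) auto
      moreover have "0 \<le> B" using elim abs_ge_zero[of "c x"] by linarith
      ultimately show ?case by (simp add: abs_mult)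
    qed
  qed
qed

lemma form_sym: "form D c v w = form D c w v"
  by (simp add: form_def inner_commute)

lemma form_add_left:
  assumes c: "bdd_coeff D c" and "v \<in> H10 D" "v' \<in> H10 D" "w \<in> H10 D"
  shows "form D c (\<lambda>x. v x + v' x) w = form D c v w + form D c v' w"
proof -
  have cm: "c \<in> borel_measurable (lebesgue_on D)" using c unfolding bdd_coeff_def by simp
  have "form D c (\<lambda>x. v x + v' x) w = (LINT x|lebesgue_on D. c x * (wgrad D v x \<bullet> wgrad D w x) + c x * (wgrad D v' x \<bullet> wgrad D w x))"
    unfolding form_def
  proof (rule integral_cong_AE)
    show "AE x in lebesgue_on D. c x * (wgrad D (\<lambda>x. v x + v' x) x \<bullet> wgrad D w x) =
        c x * (wgrad D v x \<bullet> wgrad D w x) + c x * (wgrad D v' x \<bullet> wgrad D w x)"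
      using wgrad_add[OF D assms(2,3)] by eventually_elim (simp add: inner_add_left distrib_left)
  qed (intro form_measurable borel_measurable_add cm assms H10_add[OF D])+
  also have "\<dots> = form D c v w + form D c v' w"
    unfolding form_def by (rule Bochner_Integration.integral_add) (intro form_integrable assms)+
  finally show ?thesis .
qed

lemma form_scale_left:
  assumes c: "c \<in> borel_measurable (lebesgue_on D)" and "v \<in> H10 D" "w \<in> H10 D"
  shows "form D c (\<lambda>x. s * v x) w = s * form D c v w"
proof -
  have "form D c (\<lambda>x. s * v x) w = (LINT x|lebesgue_on D. s * (c x * (wgrad D v x \<bullet> wgrad D w x)))"
    unfolding form_def
  proof (rule integral_cong_AE)
    show "AE x in lebesgue_on D. c x * (wgrad D (\<lambda>x. s * v x) x \<bullet> wgrad D w x) = s * (c x * (wgrad D v x \<bullet> wgrad D w x))"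
      using wgrad_scale[OF D assms(2), of s] by eventually_elim simp
    show "(\<lambda>x. c x * (wgrad D (\<lambda>x. s * v x) x \<bullet> wgrad D w x)) \<in> borel_measurable (lebesgue_on D)"
      by (rule form_measurable[OF c H10_scale[OF D assms(2)] assms(3)])
    show "(\<lambda>x. s * (c x * (wgrad D v x \<bullet> wgrad D w x))) \<in> borel_measurable (lebesgue_on D)"
      by (intro borel_measurable_times[OF borel_measurable_const] form_measurable[OF c assms(2,3)])
  qed
  then show ?thesis unfolding form_def by simp
qed

lemma form_coeff_add:
  assumes "bdd_coeff D c" "bdd_coeff D c'" "v \<in> H10 D" "w \<in> H10 D"
  shows "form D (\<lambda>x. c x + c' x) v w = form D c v w + form D c' v w"
  unfolding form_def distrib_right by (rule Bochner_Integration.integral_add) (intro form_integrable assms)+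

lemma form_coeff_scale: "form D (\<lambda>x. s * c x) v w = s * form D c v w"
  unfolding form_def mult.assoc by simp

lemma form_nonneg:
  assumes "AE x in lebesgue_on D. 0 \<le> c x" shows "0 \<le> form D c v v"
  unfolding form_def by (rule integral_nonneg_AE) (use assms in eventually_elim, simp)

lemma form_mono:
  assumes "bdd_coeff D c" "bdd_coeff D c'" "AE x in lebesgue_on D. c x \<le> c' x" "v \<in> H10 D"
  shows "form D c v v \<le> form D c' v v"
  unfolding form_def
proof (rule integral_mono_AE)
  show "AE x in lebesgue_on D. c x * (wgrad D v x \<bullet> wgrad D v x) \<le> c' x * (wgrad D v x \<bullet> wgrad D v x)"
    using assms(3) by eventually_elim (simp add: mult_right_mono)
qed (intro form_integrable assms)+

text \<open>The arithmetic mean of the energies is used rather than the product of norms because it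
  is linear in the energies, so bounds for many coefficient functions can be added. The product form
  is recovered where required by scaling v and w reciprocally.\<close>

lemma form_abs_le:
  assumes "bdd_coeff D c" "bdd_coeff D c'" "AE x in lebesgue_on D. \<bar>c x\<bar> \<le> c' x" and v: "v \<in> H10 D" and w: "w \<in> H10 D"
  shows "\<bar>form D c v w\<bar> \<le> (form D c' v v + form D c' w w) / 2"
proof -
  have "\<bar>form D c v w\<bar> \<le> (LINT x|lebesgue_on D. \<bar>c x * (wgrad D v x \<bullet> wgrad D w x)\<bar>)"
    unfolding form_def by (rule integral_abs_bound)
  also have "\<dots> \<le> (LINT x|lebesgue_on D. (c' x * (wgrad D v x \<bullet> wgrad D v x) + c' x * (wgrad D w x \<bullet> wgrad D w x)) / 2)"
  proof (rule integral_mono_AE)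
    show "AE x in lebesgue_on D. \<bar>c x * (wgrad D v x \<bullet> wgrad D w x)\<bar> \<le>
        (c' x * (wgrad D v x \<bullet> wgrad D v x) + c' x * (wgrad D w x \<bullet> wgrad D w x)) / 2"
      using assms(3)
    proof eventually_elim
      case (elim x)
      have "\<bar>wgrad D v x \<bullet> wgrad D w x\<bar> \<le> norm (wgrad D v x) * norm (wgrad D w x)" by (rule Cauchy_Schwarz_ineq2)
      also have "\<dots> \<le> (wgrad D v x \<bullet> wgrad D v x + wgrad D w x \<bullet> wgrad D w x) / 2"
        using sum_squares_bound[of "norm (wgrad D v x)" "norm (wgrad D w x)"]
        by (simp add: power2_norm_eq_inner)
      finally have "\<bar>c x\<bar> * \<bar>wgrad D v x \<bullet> wgrad D w x\<bar> \<le> c' x * ((wgrad D v x \<bullet> wgrad D v x + wgrad D w x \<bullet> wgrad D w x) / 2)"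
        using elim by (intro mult_mono) auto
      then show ?case by (simp add: abs_mult distrib_left)
    qed
  qed (intro integrable_abs form_integrable assms integrable_divide Bochner_Integration.integrable_add)+
  also have "\<dots> = (form D c' v v + form D c' w w) / 2"
    unfolding form_def using form_integrable[OF assms(2) v v] form_integrable[OF assms(2) w w] by simp
  finally show ?thesis .
qed

lemma bdd_coeff_scale: "bdd_coeff D c \<Longrightarrow> bdd_coeff D (\<lambda>x. s * c x)"
proof -
  assume c: "bdd_coeff D c"
  then obtain B where B: "AE x in lebesgue_on D. \<bar>c x\<bar> \<le> B" by (auto simp: bdd_coeff_def)
  then have "AE x in lebesgue_on D. \<bar>s * c x\<bar> \<le> \<bar>s\<bar> * B"
    by eventually_elim (simp add: abs_mult mult_left_mono)
  then show ?thesis using c unfolding bdd_coeff_def by (auto intro: borel_measurable_times)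
qed

lemma bdd_coeff_sum:
  "finite u \<Longrightarrow> (\<And>j. j \<in> u \<Longrightarrow> bdd_coeff D (c j)) \<Longrightarrow> bdd_coeff D (\<lambda>x. \<Sum>j\<in>u. c j x)"
proof (induction u rule: finite_induct)
  case empty
  show ?case unfolding bdd_coeff_def by (auto intro!: exI[of _ 0])
next
  case (insert j u)
  then obtain B B' where "AE x in lebesgue_on D. \<bar>c j x\<bar> \<le> B" "AE x in lebesgue_on D. \<bar>\<Sum>j\<in>u. c j x\<bar> \<le> B'"
    unfolding bdd_coeff_def by blast
  then have "AE x in lebesgue_on D. \<bar>\<Sum>j\<in>insert j u. c j x\<bar> \<le> B + B'"
    by eventually_elim (use insert.hyps in \<open>auto intro: order_trans[OF abs_triangle_ineq] add_mono\<close>)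
  moreover have "(\<lambda>x. \<Sum>j\<in>insert j u. c j x) \<in> borel_measurable (lebesgue_on D)"
    using insert.prems unfolding bdd_coeff_def by (intro borel_measurable_sum) auto
  ultimately show ?case unfolding bdd_coeff_def by blast
qed

lemma form_coeff_sum:
  "finite u \<Longrightarrow> (\<And>j. j \<in> u \<Longrightarrow> bdd_coeff D (c j)) \<Longrightarrow> v \<in> H10 D \<Longrightarrow> w \<in> H10 D \<Longrightarrow>
    form D (\<lambda>x. \<Sum>j\<in>u. c j x) v w = (\<Sum>j\<in>u. form D (c j) v w)"
proof (induction u rule: finite_induct)
  case empty
  show ?case by (simp add: form_def)
next
  case (insert j u)
  have "form D (\<lambda>x. c j x + (\<Sum>j\<in>u. c j x)) v w = form D (c j) v w + form D (\<lambda>x. \<Sum>j\<in>u. c j x) v w"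
    by (rule form_coeff_add) (use insert bdd_coeff_sum in auto)
  then show ?case using insert by simp
qed

end

section \<open>The affine coefficient and its energy bounds\<close>

locale diffusion =
  fixes D :: "'a::euclidean_space set" and a0 :: "'a \<Rightarrow> real" and \<phi> :: "nat \<Rightarrow> 'a \<Rightarrow> real"
    and b :: "nat \<Rightarrow> real" and amin A0 :: real
  assumes D: "open D" and a0: "a0 \<in> borel_measurable (lebesgue_on D)"
    and amin: "0 < amin" "AE x in lebesgue_on D. amin \<le> a0 x" "AE x in lebesgue_on D. a0 x \<le> A0"
    and \<phi>: "\<And>j. \<phi> j \<in> borel_measurable (lebesgue_on D)"
    and b: "\<And>j. 0 < b j" "\<And>j. b j \<le> 1"
    and \<phi>_sum: "AE x in lebesgue_on D. summable (\<lambda>j. \<bar>\<phi> j x\<bar> / b j) \<and> (\<Sum>j. \<bar>\<phi> j x\<bar> / b j) \<le> 2/3 * a0 x"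
begin

abbreviation "En v w \<equiv> form D a0 v w"

lemma bdd_a0: "bdd_coeff D a0"
proof -
  have "AE x in lebesgue_on D. \<bar>a0 x\<bar> \<le> A0" using amin(2,3) by eventually_elim (use amin(1) in auto)
  then show ?thesis using a0 unfolding bdd_coeff_def by blast
qed

lemma a0_nonneg: "AE x in lebesgue_on D. 0 \<le> a0 x"
  using amin(2) by eventually_elim (use amin(1) in auto)

lemma \<phi>_le: "AE x in lebesgue_on D. \<bar>\<phi> j x\<bar> \<le> a0 x"
  using \<phi>_sum a0_nonneg
proof eventually_elim
  case (elim x)
  have "\<bar>\<phi> j x\<bar> \<le> \<bar>\<phi> j x\<bar> / b j" using b[of j] by (simp add: le_divide_eq mult_left_le)
  also have "\<dots> \<le> (\<Sum>j. \<bar>\<phi> j x\<bar> / b j)"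
    using sum_le_suminf[of "\<lambda>j. \<bar>\<phi> j x\<bar> / b j" "{j}"] elim b(1) by (auto simp: less_imp_le)
  also have "\<dots> \<le> a0 x" using elim by linarith
  finally show ?case .
qed

lemma bdd_\<phi>: "bdd_coeff D (\<phi> j)"
proof -
  obtain B where "AE x in lebesgue_on D. \<bar>a0 x\<bar> \<le> B" using bdd_a0 unfolding bdd_coeff_def by blast
  with \<phi>_le[of j] have "AE x in lebesgue_on D. \<bar>\<phi> j x\<bar> \<le> B" by eventually_elim auto
  then show ?thesis using \<phi> unfolding bdd_coeff_def by blast
qed

lemma bdd_abs_\<phi>: "bdd_coeff D (\<lambda>x. \<bar>\<phi> j x\<bar> / b j)"
proof -
  have "bdd_coeff D (\<lambda>x. \<bar>\<phi> j x\<bar>)" using bdd_\<phi>[of j] unfolding bdd_coeff_def by auto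
  from bdd_coeff_scale[OF D this, of "1 / b j"] show ?thesis by simp
qed

text \<open>The weight 1 / b j is placed in the seminorm: pairings with \<phi> j then show an
  explicit factor b j, while the seminorms still add up to at most 2/3 of the energy.\<close>

definition Nj :: "nat \<Rightarrow> ('a \<Rightarrow> real) \<Rightarrow> real" where "Nj j v = form D (\<lambda>x. \<bar>\<phi> j x\<bar> / b j) v v"

lemma Nj_nonneg: "0 \<le> Nj j v"
  unfolding Nj_def by (rule form_nonneg[OF D]) (use b(1)[of j] in auto)

lemma form_\<phi>_le:
  assumes "v \<in> H10 D" "w \<in> H10 D"
  shows "\<bar>form D (\<phi> j) v w\<bar> \<le> b j * ((Nj j v + Nj j w) / 2)"
proof -
  have "\<bar>form D (\<phi> j) v w\<bar> \<le> (form D (\<lambda>x. b j * (\<bar>\<phi> j x\<bar> / b j)) v v + form D (\<lambda>x. b j * (\<bar>\<phi> j x\<bar> / b j)) w w) / 2"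
    by (rule form_abs_le[OF D bdd_\<phi> bdd_coeff_scale[OF D bdd_abs_\<phi>] _ assms]) (use b(1)[of j] in auto)
  also have "\<dots> = b j * ((Nj j v + Nj j w) / 2)"
    unfolding form_coeff_scale[OF D] Nj_def by (simp add: distrib_left)
  finally show ?thesis .
qed

lemma sum_Nj_le:
  assumes "finite u" "v \<in> H10 D" shows "(\<Sum>j\<in>u. Nj j v) \<le> 2/3 * En v v"
proof -
  have "(\<Sum>j\<in>u. Nj j v) = form D (\<lambda>x. \<Sum>j\<in>u. \<bar>\<phi> j x\<bar> / b j) v v"
    unfolding Nj_def by (rule form_coeff_sum[OF D, symmetric]) (use assms bdd_abs_\<phi> in auto)
  also have "\<dots> \<le> form D (\<lambda>x. 2/3 * a0 x) v v"
  proof (rule form_mono[OF D bdd_coeff_sum[OF D] bdd_coeff_scale[OF D bdd_a0] _ assms(2)])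
    show "AE x in lebesgue_on D. (\<Sum>j\<in>u. \<bar>\<phi> j x\<bar> / b j) \<le> 2/3 * a0 x"
      using \<phi>_sum
    proof eventually_elim
      case (elim x)
      then have "(\<Sum>j\<in>u. \<bar>\<phi> j x\<bar> / b j) \<le> (\<Sum>j. \<bar>\<phi> j x\<bar> / b j)"
        by (intro sum_le_suminf) (use assms(1) b(1) in \<open>auto simp: less_imp_le\<close>)
      then show ?case using elim by linarith
    qed
  qed (use assms bdd_abs_\<phi> in auto)
  also have "\<dots> = 2/3 * En v v" by (rule form_coeff_scale[OF D])
  finally show ?thesis .
qed

lemma coeff_measurable: "coeff_a a0 \<phi> y \<in> borel_measurable (lebesgue_on D)"
  unfolding coeff_a_def[abs_def]
  by (intro borel_measurable_add a0 borel_measurable_suminf borel_measurable_times \<phi>) auto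

text \<open>Beyond N one has |\<phi> j| \<le> \<delta> |\<phi> j| / b j, and |y j| \<le> 1/2 turns
  the total 2/3 into 1/3. With N = 0 and \<delta> = 1 the same lemma measures the distance from
  a0.\<close>

lemma \<phi>_tail:
  assumes y: "y \<in> param_seqs" and \<delta>: "\<And>j. j \<ge> N \<Longrightarrow> b j \<le> \<delta>" "0 \<le> \<delta>"
  shows "AE x in lebesgue_on D. \<bar>coeff_a a0 \<phi> y x - coeff_a a0 \<phi> (anchor {..<N} y) x\<bar> \<le> \<delta> * (1/3 * a0 x)"
  using \<phi>_sum
proof eventually_elim
  case (elim x)
  define d where "d j = (y j - anchor {..<N} y j) * \<phi> j x" for j
  have yb: "\<bar>y j\<bar> \<le> 1/2" for j
  proof -
    have "y j \<in> \<Omega>" using y by (simp add: param_seqs_def)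
    then show ?thesis by (auto simp: \<Omega>_def abs_le_iff)
  qed
  have db: "\<bar>d j\<bar> \<le> \<delta> / 2 * (\<bar>\<phi> j x\<bar> / b j)" for j
  proof (cases "j < N")
    case True
    then show ?thesis using \<delta>(2) b(1)[of j] by (simp add: d_def anchor_def)
  next
    case False
    have "\<bar>d j\<bar> = \<bar>y j\<bar> * \<bar>\<phi> j x\<bar>" using False by (simp add: d_def anchor_def abs_mult)
    also have "\<dots> \<le> 1/2 * \<bar>\<phi> j x\<bar>" using yb by (intro mult_right_mono) auto
    also have "\<dots> \<le> 1/2 * (\<delta> * (\<bar>\<phi> j x\<bar> / b j))"
      using \<delta>(1)[of j] False b(1)[of j] mult_right_mono[of "b j" \<delta> "\<bar>\<phi> j x\<bar>"]
      by (intro mult_left_mono) (auto simp: le_divide_eq mult.commute)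
    finally show ?thesis by simp
  qed
  have sb: "summable (\<lambda>j. \<delta> / 2 * (\<bar>\<phi> j x\<bar> / b j))" using elim by (intro summable_mult) auto
  have yz: "summable (\<lambda>j. z j * \<phi> j x)" if "\<And>j. \<bar>z j\<bar> \<le> 1/2" for z
  proof (rule summable_comparison_test'[of "\<lambda>j. \<bar>\<phi> j x\<bar> / b j" 0])
    fix j
    have "\<bar>z j\<bar> * \<bar>\<phi> j x\<bar> \<le> 1 * \<bar>\<phi> j x\<bar>" using that[of j] by (intro mult_right_mono) auto
    also have "\<dots> \<le> \<bar>\<phi> j x\<bar> / b j" using b[of j] by (simp add: le_divide_eq mult_left_le)
    finally show "norm (z j * \<phi> j x) \<le> \<bar>\<phi> j x\<bar> / b j" by (simp add: abs_mult)
  qed (use elim in auto)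
  have s1: "summable (\<lambda>j. y j * \<phi> j x)" by (rule yz[OF yb])
  have s2: "summable (\<lambda>j. anchor {..<N} y j * \<phi> j x)" by (rule yz) (use yb in \<open>auto simp: anchor_def\<close>)
  have "coeff_a a0 \<phi> y x - coeff_a a0 \<phi> (anchor {..<N} y) x = (\<Sum>j. d j)"
    unfolding coeff_a_def d_def using suminf_diff[OF s1 s2] by (simp add: left_diff_distrib)
  also have "\<bar>\<dots>\<bar> \<le> (\<Sum>j. \<delta> / 2 * (\<bar>\<phi> j x\<bar> / b j))"
  proof -
    have sd: "summable (\<lambda>j. \<bar>d j\<bar>)" by (rule summable_comparison_test'[OF sb, of 0]) (use db in auto)
    have "\<bar>\<Sum>j. d j\<bar> \<le> (\<Sum>j. \<bar>d j\<bar>)" by (rule summable_rabs[OF sd])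
    also have "\<dots> \<le> (\<Sum>j. \<delta> / 2 * (\<bar>\<phi> j x\<bar> / b j))" by (rule suminf_le[OF db sd sb])
    finally show ?thesis .
  qed
  also have "\<dots> = \<delta> / 2 * (\<Sum>j. \<bar>\<phi> j x\<bar> / b j)" using elim by (intro suminf_mult) auto
  also have "\<dots> \<le> \<delta> / 2 * (2/3 * a0 x)" using elim \<delta>(2) by (intro mult_left_mono) auto
  finally show ?case by simp
qed

lemma coeff_anchor_empty: "coeff_a a0 \<phi> (anchor {..<0} y) = a0"
  by (simp add: coeff_a_def anchor_def fun_eq_iff)

text \<open>The coefficient thus stays between 2/3 and 4/3 of a0 for all parameters, which makes the
  energy of a0 a common yardstick.\<close>

lemma coeff_perturb:
  assumes y: "y \<in> param_seqs" shows "AE x in lebesgue_on D. \<bar>coeff_a a0 \<phi> y x - a0 x\<bar> \<le> 1/3 * a0 x"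
  using \<phi>_tail[OF y, of 0 1] b(2) unfolding coeff_anchor_empty by simp

lemma bdd_coeff_a:
  assumes y: "y \<in> param_seqs" shows "bdd_coeff D (coeff_a a0 \<phi> y)"
proof -
  have "AE x in lebesgue_on D. \<bar>coeff_a a0 \<phi> y x\<bar> \<le> 2 * A0"
    using coeff_perturb[OF y] amin(2,3)
  proof eventually_elim
    case (elim x)
    have "\<bar>coeff_a a0 \<phi> y x\<bar> \<le> \<bar>coeff_a a0 \<phi> y x - a0 x\<bar> + \<bar>a0 x\<bar>" by simp
    then show ?case using elim amin(1) by linarith
  qed
  then show ?thesis using coeff_measurable unfolding bdd_coeff_def by blast
qed

lemma form_coeff_diff_le:
  assumes y: "y \<in> param_seqs" and z: "z \<in> param_seqs" and v: "v \<in> H10 D" and w: "w \<in> H10 D"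
    and \<delta>: "AE x in lebesgue_on D. \<bar>coeff_a a0 \<phi> y x - coeff_a a0 \<phi> z x\<bar> \<le> \<delta> * (1/3 * a0 x)"
  shows "\<bar>form D (coeff_a a0 \<phi> y) v w - form D (coeff_a a0 \<phi> z) v w\<bar> \<le> \<delta> * ((En v v + En w w) / 6)"
proof -
  have bd: "bdd_coeff D (\<lambda>x. -1 * coeff_a a0 \<phi> z x)" by (rule bdd_coeff_scale[OF D bdd_coeff_a[OF z]])
  have e: "form D (\<lambda>x. coeff_a a0 \<phi> y x + -1 * coeff_a a0 \<phi> z x) v w =
      form D (coeff_a a0 \<phi> y) v w + -1 * form D (coeff_a a0 \<phi> z) v w"
    unfolding form_coeff_add[OF D bdd_coeff_a[OF y] bd v w] form_coeff_scale[OF D] ..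
  have l: "\<bar>form D (\<lambda>x. coeff_a a0 \<phi> y x + -1 * coeff_a a0 \<phi> z x) v w\<bar> \<le>
      (form D (\<lambda>x. \<delta> * (1/3) * a0 x) v v + form D (\<lambda>x. \<delta> * (1/3) * a0 x) w w) / 2"
  proof (rule form_abs_le[OF D _ bdd_coeff_scale[OF D bdd_a0] _ v w])
    show "AE x in lebesgue_on D. \<bar>coeff_a a0 \<phi> y x + -1 * coeff_a a0 \<phi> z x\<bar> \<le> \<delta> * (1/3) * a0 x"
      using \<delta> by eventually_elim simp
    \<comment> \<open>The difference is written as a sum over two indices so that
      \<open>bdd_coeff_sum\<close> applies.\<close>
    have "bdd_coeff D (\<lambda>x. \<Sum>i\<in>{0,1::nat}. if i = 0 then coeff_a a0 \<phi> y x else -1 * coeff_a a0 \<phi> z x)"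
      by (rule bdd_coeff_sum[OF D]) (use bd bdd_coeff_a[OF y] in auto)
    then show "bdd_coeff D (\<lambda>x. coeff_a a0 \<phi> y x + -1 * coeff_a a0 \<phi> z x)" by simp
  qed
  show ?thesis using l unfolding e form_coeff_scale[OF D] by (simp add: algebra_simps)
qed

lemma form_coeff_coercive:
  assumes y: "y \<in> param_seqs" and v: "v \<in> H10 D"
  shows "2/3 * En v v \<le> form D (coeff_a a0 \<phi> y) v v"
proof -
  have z: "(\<lambda>_. 0) \<in> param_seqs" by (simp add: param_seqs_def \<Omega>_def)
  have "coeff_a a0 \<phi> (\<lambda>_. 0) = a0" by (simp add: coeff_a_def fun_eq_iff)
  moreover have "AE x in lebesgue_on D. \<bar>coeff_a a0 \<phi> y x - a0 x\<bar> \<le> 1 * (1/3 * a0 x)"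
    using coeff_perturb[OF y] by simp
  ultimately have "\<bar>form D (coeff_a a0 \<phi> y) v v - En v v\<bar> \<le> 1 * ((En v v + En v v) / 6)"
    using form_coeff_diff_le[OF y z v v, of 1] by metis
  from abs_le_D2[OF this] show ?thesis by simp
qed

lemma form_coeff_finite:
  assumes y: "y \<in> param_seqs" and u: "finite u" "\<And>j. j \<notin> u \<Longrightarrow> y j = 0" and v: "v \<in> H10 D" and w: "w \<in> H10 D"
  shows "form D (coeff_a a0 \<phi> y) v w = En v w + (\<Sum>j\<in>u. y j * form D (\<phi> j) v w)"
proof -
  have "coeff_a a0 \<phi> y = (\<lambda>x. a0 x + (\<Sum>j\<in>u. y j * \<phi> j x))"
    unfolding coeff_a_def using u by (auto simp: fun_eq_iff intro!: suminf_finite)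
  then have "form D (coeff_a a0 \<phi> y) v w = En v w + form D (\<lambda>x. \<Sum>j\<in>u. y j * \<phi> j x) v w"
    using form_coeff_add[OF D bdd_a0 bdd_coeff_sum[OF D u(1) bdd_coeff_scale[OF D bdd_\<phi>]] v w] by simp
  also have "form D (\<lambda>x. \<Sum>j\<in>u. y j * \<phi> j x) v w = (\<Sum>j\<in>u. form D (\<lambda>x. y j * \<phi> j x) v w)"
    by (rule form_coeff_sum[OF D u(1) bdd_coeff_scale[OF D bdd_\<phi>] v w])
  finally show ?thesis by (simp add: form_coeff_scale[OF D])
qed

lemma V_norm_le:
  assumes v: "v \<in> H10 D" shows "V_norm D v \<le> sqrt (1 / amin) * sqrt (En v v)"
proof -
  have b1: "bdd_coeff D (\<lambda>_. 1)" unfolding bdd_coeff_def by (auto intro!: exI[of _ 1])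
  have "form D (\<lambda>x. amin * 1) v v \<le> En v v"
    by (rule form_mono[OF D bdd_coeff_scale[OF D b1] bdd_a0 _ v]) (use amin(2) in simp)
  then have "amin * form D (\<lambda>_. 1) v v \<le> En v v" by (simp only: form_coeff_scale[OF D])
  moreover have "form D (\<lambda>_. 1) v v = (LINT x|lebesgue_on D. (norm (wgrad D v x))\<^sup>2)"
    by (simp add: form_def power2_norm_eq_inner)
  ultimately have "(LINT x|lebesgue_on D. (norm (wgrad D v x))\<^sup>2) \<le> 1 / amin * En v v"
    using amin(1) by (simp add: le_divide_eq mult.commute)
  then show ?thesis unfolding V_norm_def real_sqrt_mult[symmetric] by (rule real_sqrt_le_mono)
qed

text \<open>Passes from the gradient norm to the energy norm on the whole of \<open>H10 D\<close>,
  so that one constant serves all subspaces.\<close>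

lemma V_dual_bound:
  assumes "l \<in> V_dual D" obtains C where "0 \<le> C" "\<And>v. v \<in> H10 D \<Longrightarrow> \<bar>l v\<bar> \<le> C * sqrt (En v v)"
proof -
  obtain C where C: "\<And>v. v \<in> H10 D \<Longrightarrow> \<bar>l v\<bar> \<le> C * V_norm D v" using assms unfolding V_dual_def by blast
  have "\<bar>l v\<bar> \<le> \<bar>C\<bar> * sqrt (1 / amin) * sqrt (En v v)" if "v \<in> H10 D" for v
  proof -
    have "\<bar>l v\<bar> \<le> \<bar>C\<bar> * V_norm D v"
      by (rule order_trans[OF C[OF that]], rule mult_right_mono) (auto simp: V_norm_def)
    also have "\<dots> \<le> \<bar>C\<bar> * (sqrt (1 / amin) * sqrt (En v v))" by (intro mult_left_mono V_norm_le[OF that]) auto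
    finally show ?thesis by simp
  qed
  moreover have "0 \<le> \<bar>C\<bar> * sqrt (1 / amin)" using amin(1) by simp
  ultimately show thesis using that by blast
qed

end

section \<open>Galerkin solutions as power series in the parameters\<close>

text \<open>Pointwise operations receive names so that linearity can be stated by rewrite rules with
  constants instead of lambda terms.\<close>

definition fadd :: "('a \<Rightarrow> real) \<Rightarrow> ('a \<Rightarrow> real) \<Rightarrow> 'a \<Rightarrow> real" where "fadd v w = (\<lambda>x. v x + w x)"
definition fscale :: "real \<Rightarrow> ('a \<Rightarrow> real) \<Rightarrow> 'a \<Rightarrow> real" where "fscale c v = (\<lambda>x. c * v x)"
definition flin :: "'i set \<Rightarrow> ('i \<Rightarrow> real) \<Rightarrow> ('i \<Rightarrow> 'a \<Rightarrow> real) \<Rightarrow> 'a \<Rightarrow> real" where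
  "flin I c v = (\<lambda>x. \<Sum>i\<in>I. c i * v i x)"

lemma flin_empty: "flin {} c v = fscale 0 w" by (simp add: flin_def fscale_def)
lemma flin_insert: "finite I \<Longrightarrow> i \<notin> I \<Longrightarrow> flin (insert i I) c v = fadd (fscale (c i) (v i)) (flin I c v)"
  by (simp add: flin_def fscale_def fadd_def)

section \<open>Semi-inner products and representation of functionals on a finite span\<close>

locale semi_inner =
  fixes V :: "('a \<Rightarrow> real) set" and E :: "('a \<Rightarrow> real) \<Rightarrow> ('a \<Rightarrow> real) \<Rightarrow> real"
  assumes ne: "V \<noteq> {}"
    and add [simp]: "v \<in> V \<Longrightarrow> w \<in> V \<Longrightarrow> fadd v w \<in> V"
    and scale [simp]: "v \<in> V \<Longrightarrow> fscale c v \<in> V"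
    and sym: "v \<in> V \<Longrightarrow> w \<in> V \<Longrightarrow> E v w = E w v"
    and E_add [simp]: "v \<in> V \<Longrightarrow> v' \<in> V \<Longrightarrow> w \<in> V \<Longrightarrow> E (fadd v v') w = E v w + E v' w"
    and E_scale [simp]: "v \<in> V \<Longrightarrow> w \<in> V \<Longrightarrow> E (fscale c v) w = c * E v w"
    and E_nonneg: "v \<in> V \<Longrightarrow> 0 \<le> E v v"
begin

lemma E_add' [simp]: "v \<in> V \<Longrightarrow> v' \<in> V \<Longrightarrow> w \<in> V \<Longrightarrow> E w (fadd v v') = E w v + E w v'"
  by (metis add sym E_add)
lemma E_scale' [simp]: "v \<in> V \<Longrightarrow> w \<in> V \<Longrightarrow> E w (fscale c v) = c * E w v"
  by (metis scale sym E_scale)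

lemma flin_in: "finite I \<Longrightarrow> (\<And>i. i \<in> I \<Longrightarrow> v i \<in> V) \<Longrightarrow> flin I c v \<in> V"
proof (induction I rule: finite_induct)
  case empty
  obtain w where "w \<in> V" using ne by auto
  then show ?case using scale[of w 0] flin_empty by metis
qed (simp add: flin_insert)

lemma Cauchy_Schwarz: assumes "v \<in> V" "w \<in> V" shows "\<bar>E v w\<bar> \<le> sqrt (E v v) * sqrt (E w w)"
proof -
  have q: "0 \<le> E v v + 2 * s * E v w + s\<^sup>2 * E w w" for s
    using E_nonneg[of "fadd v (fscale s w)"] assms sym[of w v] by (simp add: power2_eq_square algebra_simps)
  have "(E v w)\<^sup>2 \<le> E v v * E w w"
  proof (cases "E w w = 0")
    case True
    have "E v w = 0"
    proof (rule ccontr)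
      assume n: "E v w \<noteq> 0"
      then have "E v v + 2 * (- (E v v + 1) / (2 * E v w)) * E v w + (- (E v v + 1) / (2 * E v w))\<^sup>2 * E w w = -1"
        unfolding True by (simp add: field_simps)
      with q[of "- (E v v + 1) / (2 * E v w)"] show False by linarith
    qed
    then show ?thesis using True by simp
  next
    case False
    then have p: "E w w > 0" using E_nonneg[OF assms(2)] by simp
    have "0 \<le> (E v v + 2 * (- E v w / E w w) * E v w + (- E v w / E w w)\<^sup>2 * E w w) * E w w"
      by (rule mult_nonneg_nonneg[OF q]) (use p in simp)
    also have "\<dots> = E v v * E w w - (E v w)\<^sup>2" using p by (simp add: power2_eq_square field_simps)
    finally show ?thesis by simp
  qed
  then have "sqrt ((E v w)\<^sup>2) \<le> sqrt (E v v * E w w)" by (rule real_sqrt_le_mono)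
  then show ?thesis by (simp add: real_sqrt_mult)
qed

definition bdd_lin :: "(('a \<Rightarrow> real) \<Rightarrow> real) \<Rightarrow> bool" where
  "bdd_lin l \<longleftrightarrow> (\<forall>v\<in>V. \<forall>w\<in>V. l (fadd v w) = l v + l w) \<and> (\<forall>c. \<forall>v\<in>V. l (fscale c v) = c * l v) \<and>
     (\<exists>C. \<forall>v\<in>V. \<bar>l v\<bar> \<le> C * sqrt (E v v))"

definition sp :: "('a \<Rightarrow> real) set \<Rightarrow> ('a \<Rightarrow> real) set" where
  "sp Bs = {flin Bs c (\<lambda>\<beta>. \<beta>) |c. True}"

lemma sp_insert:
  assumes "finite Bs" "\<beta> \<notin> Bs"
  shows "v \<in> sp (insert \<beta> Bs) \<longleftrightarrow> (\<exists>v0\<in>sp Bs. \<exists>c. v = fadd v0 (fscale c \<beta>))"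
proof
  assume "v \<in> sp (insert \<beta> Bs)"
  then obtain c where "v = flin (insert \<beta> Bs) c (\<lambda>\<beta>. \<beta>)" unfolding sp_def by blast
  then have "v = fadd (flin Bs c (\<lambda>\<beta>. \<beta>)) (fscale (c \<beta>) \<beta>)"
    using assms by (simp add: flin_insert fadd_def fun_eq_iff)
  then show "\<exists>v0\<in>sp Bs. \<exists>c. v = fadd v0 (fscale c \<beta>)" unfolding sp_def by blast
next
  assume "\<exists>v0\<in>sp Bs. \<exists>c. v = fadd v0 (fscale c \<beta>)"
  then obtain c s where "v = fadd (flin Bs c (\<lambda>\<beta>. \<beta>)) (fscale s \<beta>)" unfolding sp_def by blast
  moreover have "flin Bs c (\<lambda>\<beta>. \<beta>) = flin Bs (c(\<beta> := s)) (\<lambda>\<beta>. \<beta>)"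
    unfolding flin_def by (rule ext, rule sum.cong[OF refl]) (use assms in auto)
  ultimately have "v = flin (insert \<beta> Bs) (c(\<beta> := s)) (\<lambda>\<beta>. \<beta>)"
    using assms by (simp add: flin_insert fadd_def fun_eq_iff)
  then show "v \<in> sp (insert \<beta> Bs)" unfolding sp_def by blast
qed

lemma sp_subset: "finite Bs \<Longrightarrow> Bs \<subseteq> V \<Longrightarrow> sp Bs \<subseteq> V"
  unfolding sp_def using flin_in[of Bs "\<lambda>\<beta>. \<beta>"] by auto

lemma sp_add: "v \<in> sp Bs \<Longrightarrow> w \<in> sp Bs \<Longrightarrow> fadd v w \<in> sp Bs"
proof -
  assume "v \<in> sp Bs" "w \<in> sp Bs"
  then obtain c d where "v = flin Bs c (\<lambda>\<beta>. \<beta>)" "w = flin Bs d (\<lambda>\<beta>. \<beta>)" unfolding sp_def by blast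
  then have "fadd v w = flin Bs (\<lambda>i. c i + d i) (\<lambda>\<beta>. \<beta>)"
    by (simp add: flin_def fadd_def sum.distrib distrib_right)
  then show ?thesis unfolding sp_def by blast
qed

lemma sp_scale: "v \<in> sp Bs \<Longrightarrow> fscale s v \<in> sp Bs"
proof -
  assume "v \<in> sp Bs"
  then obtain c where "v = flin Bs c (\<lambda>\<beta>. \<beta>)" unfolding sp_def by blast
  then have "fscale s v = flin Bs (\<lambda>i. s * c i) (\<lambda>\<beta>. \<beta>)"
    by (simp add: flin_def fscale_def sum_distrib_left mult.assoc)
  then show ?thesis unfolding sp_def by blast
qed

text \<open>Gram-Schmidt, one spanning function at a time. E may be degenerate, since functions that
  agree almost everywhere differ by energy 0; if the orthogonalised function \<beta>' has energy 0,
  the bound on l forces \<open>l \<beta>' = 0\<close> and the coefficient s = 0 works.\<close>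

lemma riesz:
  assumes "finite Bs" "Bs \<subseteq> V" "bdd_lin l"
  shows "\<exists>w\<in>sp Bs. \<forall>v\<in>sp Bs. E w v = l v"
  using assms
proof (induction Bs arbitrary: l rule: finite_induct)
  case empty
  obtain w0 where w0: "w0 \<in> V" using ne by auto
  have sp: "sp {} = {fscale 0 w0}" unfolding sp_def using flin_empty[of _ _ w0] by auto
  have "l (fscale 0 w0) = 0 * l w0" using empty w0 unfolding bdd_lin_def by blast
  then show ?case unfolding sp using w0 by simp
next
  case (insert \<beta> Bs)
  have BV: "Bs \<subseteq> V" and \<beta>: "\<beta> \<in> V" using insert.prems by auto
  note spV = subsetD[OF sp_subset[OF insert.hyps(1) BV]]
  have l1: "l (fadd v w) = l v + l w" if "v \<in> V" "w \<in> V" for v w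
    using insert.prems(2) that unfolding bdd_lin_def by blast
  have l2: "l (fscale c v) = c * l v" if "v \<in> V" for v c
    using insert.prems(2) that unfolding bdd_lin_def by blast
  obtain C where C: "\<And>v. v \<in> V \<Longrightarrow> \<bar>l v\<bar> \<le> C * sqrt (E v v)"
    using insert.prems(2) unfolding bdd_lin_def by blast
  obtain w where w: "w \<in> sp Bs" "\<And>v. v \<in> sp Bs \<Longrightarrow> E w v = l v" using insert.IH[OF BV insert.prems(2)] by blast
  have "bdd_lin (E \<beta>)" unfolding bdd_lin_def using \<beta> Cauchy_Schwarz[OF \<beta>] by auto
  then obtain \<pi> where \<pi>: "\<pi> \<in> sp Bs" "\<And>v. v \<in> sp Bs \<Longrightarrow> E \<pi> v = E \<beta> v" using insert.IH[OF BV] by blast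
  define \<beta>' where "\<beta>' = fadd \<beta> (fscale (-1) \<pi>)"
  have \<beta>'V: "\<beta>' \<in> V" unfolding \<beta>'_def using \<beta> spV[OF \<pi>(1)] by simp
  have orth: "E \<beta>' v = 0" if "v \<in> sp Bs" for v
    unfolding \<beta>'_def using \<beta> spV[OF \<pi>(1)] spV[OF that] \<pi>(2)[OF that] by simp
  have split: "\<exists>v1\<in>sp Bs. \<exists>c. v = fadd v1 (fscale c \<beta>')" if v: "v \<in> sp (insert \<beta> Bs)" for v
  proof -
    obtain v0 c where v0: "v0 \<in> sp Bs" "v = fadd v0 (fscale c \<beta>)" using v sp_insert[OF insert.hyps(1,2)] by blast
    have "v = fadd (fadd v0 (fscale c \<pi>)) (fscale c \<beta>')"
      unfolding v0(2) \<beta>'_def by (simp add: fadd_def fscale_def fun_eq_iff algebra_simps)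
    then show ?thesis using sp_add[OF v0(1) sp_scale[OF \<pi>(1)]] by blast
  qed
  define s where "s = (if E \<beta>' \<beta>' = 0 then 0 else l \<beta>' / E \<beta>' \<beta>')"
  have s: "s * E \<beta>' \<beta>' = l \<beta>'"
    using C[OF \<beta>'V] by (auto simp: s_def)
  define w' where "w' = fadd w (fscale s \<beta>')"
  have "w' = fadd (fadd w (fscale (- s) \<pi>)) (fscale s \<beta>)"
    unfolding w'_def \<beta>'_def by (simp add: fadd_def fscale_def fun_eq_iff algebra_simps)
  then have "w' \<in> sp (insert \<beta> Bs)"
    using sp_insert[OF insert.hyps(1,2)] sp_add[OF w(1) sp_scale[OF \<pi>(1)]] by blast
  moreover have "E w' v = l v" if v: "v \<in> sp (insert \<beta> Bs)" for v
  proof -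
    obtain v1 c where v1: "v1 \<in> sp Bs" "v = fadd v1 (fscale c \<beta>')" using split[OF v] by blast
    note V = spV[OF v1(1)] spV[OF w(1)] \<beta>'V
    have "E w' v = E w v1 + c * E w \<beta>' + s * E \<beta>' v1 + c * (s * E \<beta>' \<beta>')"
      unfolding w'_def v1(2) using V by (simp add: algebra_simps)
    also have "\<dots> = l v1 + c * l \<beta>'" using orth[OF v1(1)] orth[OF w(1)] sym[OF V(2,3)] w(2)[OF v1(1)] s by simp
    also have "\<dots> = l v" unfolding v1(2) l1[OF V(1) scale[OF V(3)]] l2[OF V(3)] ..
    finally show ?thesis .
  qed
  ultimately show ?case by blast
qed

end

section \<open>Multi-indices on a finite set, graded by total degree\<close>

definition mindex :: "nat set \<Rightarrow> nat \<Rightarrow> (nat \<Rightarrow> nat) set" where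
  "mindex u k = {\<nu> \<in> PiE u (\<lambda>_. UNIV). sum \<nu> u = k}"

lemma mindex_subset: "finite u \<Longrightarrow> mindex u k \<subseteq> PiE u (\<lambda>_. {..k})"
proof
  fix \<nu> assume u: "finite u" and \<nu>: "\<nu> \<in> mindex u k"
  have "\<nu> j \<le> k" if "j \<in> u" for j
    using member_le_sum[of j u \<nu>] that u \<nu> by (auto simp: mindex_def)
  then show "\<nu> \<in> PiE u (\<lambda>_. {..k})" using \<nu> by (auto simp: mindex_def PiE_iff)
qed

lemma finite_mindex: "finite u \<Longrightarrow> finite (mindex u k)"
  using mindex_subset finite_PiE[of u "\<lambda>_. {..k}"] by (metis finite_atMost finite_subset)

lemma card_mindex_le: "finite u \<Longrightarrow> card (mindex u k) \<le> (k + 1) ^ card u"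
  using card_mono[OF finite_PiE mindex_subset, of u k] by (simp add: card_PiE)

lemma mindex_0: "mindex u 0 = {restrict (\<lambda>_. 0) u}" if "finite u"
proof -
  have "\<nu> = restrict (\<lambda>_. 0) u" if "\<nu> \<in> mindex u 0" for \<nu>
    using that \<open>finite u\<close> by (auto simp: mindex_def PiE_iff extensional_def fun_eq_iff restrict_def)
  moreover have "restrict (\<lambda>_. 0) u \<in> mindex u 0" by (simp add: mindex_def)
  ultimately show ?thesis by blast
qed

definition dec :: "(nat \<Rightarrow> nat) \<Rightarrow> nat \<Rightarrow> nat \<Rightarrow> nat" where "dec \<nu> j = \<nu>(j := \<nu> j - 1)"

lemma dec_mindex: "finite u \<Longrightarrow> \<nu> \<in> mindex u (Suc k) \<Longrightarrow> j \<in> u \<Longrightarrow> 0 < \<nu> j \<Longrightarrow> dec \<nu> j \<in> mindex u k"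
proof -
  assume a: "finite u" "\<nu> \<in> mindex u (Suc k)" "j \<in> u" "0 < \<nu> j"
  have "sum (dec \<nu> j) u = \<nu> j - 1 + sum \<nu> (u - {j})"
    using a unfolding dec_def by (subst sum.remove[of _ j]) auto
  moreover have "sum \<nu> u = \<nu> j + sum \<nu> (u - {j})" using a by (subst sum.remove[of _ j]) auto
  ultimately show ?thesis using a by (auto simp: mindex_def dec_def PiE_iff extensional_def)
qed

text \<open>Lowering the j-th exponent matches pairs (\<nu>, j) of degree k + 1 with all pairs
  (\<mu>, j) of degree k. Both the energy recursion and the telescoping of the series rest on this
  exchange.\<close>

lemma sum_mindex_Suc:
  fixes g :: "(nat \<Rightarrow> nat) \<Rightarrow> nat \<Rightarrow> real"
  assumes "finite u"
  shows "(\<Sum>\<nu>\<in>mindex u (Suc k). \<Sum>j\<in>{j\<in>u. 0 < \<nu> j}. g (dec \<nu> j) j) = (\<Sum>\<mu>\<in>mindex u k. \<Sum>j\<in>u. g \<mu> j)"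
proof -
  have "(\<Sum>\<nu>\<in>mindex u (Suc k). \<Sum>j\<in>{j\<in>u. 0 < \<nu> j}. g (dec \<nu> j) j) =
      (\<Sum>(\<nu>, j)\<in>Sigma (mindex u (Suc k)) (\<lambda>\<nu>. {j\<in>u. 0 < \<nu> j}). g (dec \<nu> j) j)"
    by (rule sum.Sigma) (use assms finite_mindex in auto)
  also have "\<dots> = (\<Sum>(\<mu>, j)\<in>mindex u k \<times> u. g \<mu> j)"
  proof (rule sum.reindex_bij_witness[where i = "\<lambda>(\<mu>, j). (\<mu>(j := Suc (\<mu> j)), j)" and j = "\<lambda>(\<nu>, j). (dec \<nu> j, j)"], goal_cases)
    case (1 a) then show ?case by (auto simp: dec_def)
  next
    case (2 a) then show ?case using dec_mindex[OF assms] by auto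
  next
    case (3 a) then show ?case by (auto simp: dec_def)
  next
    case (4 a)
    then obtain \<mu> j where a: "a = (\<mu>, j)" "\<mu> \<in> mindex u k" "j \<in> u" by auto
    have "sum (\<mu>(j := Suc (\<mu> j))) u = Suc (\<mu> j) + sum \<mu> (u - {j})"
      using a assms by (subst sum.remove[of _ j]) auto
    moreover have "sum \<mu> u = \<mu> j + sum \<mu> (u - {j})" using a assms by (subst sum.remove[of _ j]) auto
    ultimately show ?case using a by (auto simp: mindex_def PiE_iff extensional_def)
  next
    case (5 a) then show ?case by auto
  qed
  also have "\<dots> = (\<Sum>\<mu>\<in>mindex u k. \<Sum>j\<in>u. g \<mu> j)" by (rule sum.Sigma[symmetric]) (use assms finite_mindex in auto)
  finally show ?thesis .
qed

lemma prod_dec: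
  fixes z :: "nat \<Rightarrow> real"
  assumes "finite u" "j \<in> u" "0 < \<nu> j"
  shows "(\<Prod>i\<in>u. z i ^ \<nu> i) = z j * (\<Prod>i\<in>u. z i ^ dec \<nu> j i)"
proof -
  have "(\<Prod>i\<in>u. z i ^ dec \<nu> j i) = z j ^ (\<nu> j - 1) * (\<Prod>i\<in>u - {j}. z i ^ \<nu> i)"
    using assms unfolding dec_def by (subst prod.remove[of _ j]) auto
  moreover have "(\<Prod>i\<in>u. z i ^ \<nu> i) = z j ^ \<nu> j * (\<Prod>i\<in>u - {j}. z i ^ \<nu> i)"
    using assms by (subst prod.remove[of _ j]) auto
  moreover have "z j ^ \<nu> j = z j * z j ^ (\<nu> j - 1)" using assms(3) by (cases "\<nu> j") auto
  ultimately show ?thesis by simp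
qed

text \<open>Optimising the parameter r of Young's inequality gives the geometric mean. If p or q is
  0 no optimal r exists; the choices made there give x \<le> x / 2, which contradicts 0 < x.\<close>

lemma le_sqrt_mult_sqrt:
  fixes x p q :: real
  assumes "\<And>r. 0 < r \<Longrightarrow> x \<le> (r * p + q / r) / 2" "0 \<le> p" "0 \<le> q"
  shows "x \<le> sqrt p * sqrt q"
proof (cases "0 < x")
  case True
  consider "p = 0" | "q = 0" | "0 < p" "0 < q" using assms(2,3) by linarith
  then show ?thesis
  proof cases
    case 1
    have "0 < q / x + 1" using True assms(3) by (simp add: add_nonneg_pos)
    from assms(1)[OF this] have "x \<le> q / (q / x + 1) / 2" using 1 by simp
    also have "\<dots> \<le> x / 2" using True assms(3) by (simp add: field_simps)
    finally show ?thesis using True by simp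
  next
    case 2
    have "0 < x / (p + 1)" using True assms(2) by simp
    from assms(1)[OF this] have "x \<le> x * (p / (p + 1)) / 2" using 2 by simp
    also have "\<dots> \<le> x * 1 / 2" using True assms(2) by (intro divide_right_mono mult_left_mono) auto
    finally show ?thesis using True by simp
  next
    case 3
    then have "0 < sqrt q / sqrt p" by simp
    from assms(1)[OF this] have "x \<le> (sqrt q / sqrt p * p + q / (sqrt q / sqrt p)) / 2" .
    also have "sqrt q / sqrt p * p = sqrt p * sqrt q" using 3 by (simp add: field_simps)
    also have "q / (sqrt q / sqrt p) = sqrt p * sqrt q" using 3 by (simp add: field_simps)
    finally show ?thesis by simp
  qed
next
  case False
  moreover have "0 \<le> sqrt p * sqrt q" using assms by simp
  ultimately show ?thesis by linarith
qed

section \<open>The abstract Galerkin problem with affine parameter dependence\<close>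

locale galerkin = semi_inner W E for W :: "('a \<Rightarrow> real) set" and E +
  fixes B :: "nat \<Rightarrow> ('a \<Rightarrow> real) \<Rightarrow> ('a \<Rightarrow> real) \<Rightarrow> real" and N :: "nat \<Rightarrow> ('a \<Rightarrow> real) \<Rightarrow> real"
    and b :: "nat \<Rightarrow> real" and f G :: "('a \<Rightarrow> real) \<Rightarrow> real" and cf cg :: real
  assumes B_sym: "v \<in> W \<Longrightarrow> w \<in> W \<Longrightarrow> B j v w = B j w v"
    and B_add: "v \<in> W \<Longrightarrow> v' \<in> W \<Longrightarrow> w \<in> W \<Longrightarrow> B j (fadd v v') w = B j v w + B j v' w"
    and B_scale: "v \<in> W \<Longrightarrow> w \<in> W \<Longrightarrow> B j (fscale c v) w = c * B j v w"
    and B_le: "v \<in> W \<Longrightarrow> w \<in> W \<Longrightarrow> \<bar>B j v w\<bar> \<le> b j * ((N j v + N j w) / 2)"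
    and N_scale: "v \<in> W \<Longrightarrow> N j (fscale c v) = c\<^sup>2 * N j v"
    and N_nonneg: "v \<in> W \<Longrightarrow> 0 \<le> N j v"
    and N_sum: "finite u \<Longrightarrow> v \<in> W \<Longrightarrow> (\<Sum>j\<in>u. N j v) \<le> 2/3 * E v v"
    and b: "0 < b j" "b j \<le> 1"
    and riesz_rep: "bdd_lin l \<Longrightarrow> \<exists>w\<in>W. \<forall>v\<in>W. E w v = l v"
    and f_add: "v \<in> W \<Longrightarrow> w \<in> W \<Longrightarrow> f (fadd v w) = f v + f w"
    and f_scale: "v \<in> W \<Longrightarrow> f (fscale c v) = c * f v"
    and f_bound: "v \<in> W \<Longrightarrow> \<bar>f v\<bar> \<le> cf * sqrt (E v v)" "0 \<le> cf"
    and G_add: "v \<in> W \<Longrightarrow> w \<in> W \<Longrightarrow> G (fadd v w) = G v + G w"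
    and G_scale: "v \<in> W \<Longrightarrow> G (fscale c v) = c * G v"
    and G_bound: "v \<in> W \<Longrightarrow> \<bar>G v\<bar> \<le> cg * sqrt (E v v)" "0 \<le> cg"
begin

lemma B_add': "v \<in> W \<Longrightarrow> v' \<in> W \<Longrightarrow> w \<in> W \<Longrightarrow> B j w (fadd v v') = B j w v + B j w v'"
  using B_sym[of w "fadd v v'"] B_sym[of w v] B_sym[of w v'] B_add by simp
lemma B_scale': "v \<in> W \<Longrightarrow> w \<in> W \<Longrightarrow> B j w (fscale c v) = c * B j w v"
  using B_sym[of w "fscale c v"] B_sym[of w v] B_scale by simp

text \<open>\<open>B j\<close> is unchanged when v is multiplied and w divided by the square root of
  r, while the seminorms scale; this adds a free weight to the arithmetic-mean bound.\<close>

lemma B_weighted: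
  assumes "v \<in> W" "w \<in> W" "0 < r"
  shows "\<bar>B j v w\<bar> \<le> b j * ((r * N j v + N j w / r) / 2)"
proof -
  define s where "s = sqrt r"
  have s: "0 < s" "s\<^sup>2 = r" using assms by (auto simp: s_def)
  have "B j v w = B j (fscale s v) (fscale (1 / s) w)"
    using assms s by (simp add: B_scale B_scale')
  also have "\<bar>\<dots>\<bar> \<le> b j * ((N j (fscale s v) + N j (fscale (1 / s) w)) / 2)"
    by (rule B_le) (use assms in auto)
  also have "N j (fscale s v) = r * N j v" using s by (simp add: N_scale assms)
  also have "N j (fscale (1 / s) w) = N j w / r" using s by (simp add: N_scale assms power_divide)
  finally show ?thesis .
qed

lemma N_le: "v \<in> W \<Longrightarrow> N j v \<le> E v v"
  using N_sum[of "{j}" v] E_nonneg[of v] by simp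

lemma B_bound:
  assumes "v \<in> W" "w \<in> W" shows "\<bar>B j v w\<bar> \<le> sqrt (E v v) * sqrt (E w w)"
proof (rule le_sqrt_mult_sqrt)
  fix r :: real assume r: "0 < r"
  have "\<bar>B j v w\<bar> \<le> b j * ((r * N j v + N j w / r) / 2)" by (rule B_weighted[OF assms r])
  also have "\<dots> \<le> 1 * ((r * E v v + E w w / r) / 2)"
    using b[of j] r assms N_nonneg E_nonneg
    by (intro mult_mono divide_right_mono add_mono mult_left_mono N_le) (auto intro!: add_nonneg_nonneg)
  finally show "\<bar>B j v w\<bar> \<le> (r * E v v + E w w / r) / 2" by simp
qed (use assms E_nonneg in auto)

text \<open>A choice, because a degenerate E fixes the representing function only up to energy
  0.\<close>

definition rep :: "(('a \<Rightarrow> real) \<Rightarrow> real) \<Rightarrow> 'a \<Rightarrow> real" where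
  "rep l = (SOME w. w \<in> W \<and> (\<forall>v\<in>W. E w v = l v))"

lemma rep: assumes "bdd_lin l" shows "rep l \<in> W" "v \<in> W \<Longrightarrow> E (rep l) v = l v"
proof -
  have "\<exists>w. w \<in> W \<and> (\<forall>v\<in>W. E w v = l v)" using riesz_rep[OF assms] by blast
  from someI_ex[OF this] show "rep l \<in> W" "v \<in> W \<Longrightarrow> E (rep l) v = l v" unfolding rep_def by auto
qed

text \<open>\<open>taylor u (sum \<nu> u) \<nu>\<close> is the coefficient at \<open>y\<^sup>\<nu>\<close> of the Galerkin solution, read off by comparing
  coefficients in the Galerkin equation.\<close>

primrec taylor :: "nat set \<Rightarrow> nat \<Rightarrow> (nat \<Rightarrow> nat) \<Rightarrow> 'a \<Rightarrow> real" where
  "taylor u 0 \<nu> = rep f"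
| "taylor u (Suc k) \<nu> = rep (\<lambda>v. - (\<Sum>j\<in>{j\<in>u. 0 < \<nu> j}. B j (taylor u k (dec \<nu> j)) v))"

lemma bdd_lin_f: "bdd_lin f"
  unfolding bdd_lin_def using f_add f_scale f_bound by blast

lemma bdd_lin_step:
  assumes "finite I" "\<And>j. j \<in> I \<Longrightarrow> t j \<in> W"
  shows "bdd_lin (\<lambda>v. - (\<Sum>j\<in>I. B j (t j) v))"
  unfolding bdd_lin_def
proof (intro conjI ballI allI exI)
  fix v assume v: "v \<in> W"
  have "\<bar>- (\<Sum>j\<in>I. B j (t j) v)\<bar> \<le> (\<Sum>j\<in>I. \<bar>B j (t j) v\<bar>)" by simp
  also have "\<dots> \<le> (\<Sum>j\<in>I. sqrt (E (t j) (t j)) * sqrt (E v v))"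
    by (intro sum_mono B_bound assms(2) v)
  finally show "\<bar>- (\<Sum>j\<in>I. B j (t j) v)\<bar> \<le> (\<Sum>j\<in>I. sqrt (E (t j) (t j))) * sqrt (E v v)"
    by (simp add: sum_distrib_right)
  fix c
  have "(\<Sum>j\<in>I. B j (t j) (fscale c v)) = (\<Sum>j\<in>I. c * B j (t j) v)"
    by (intro sum.cong refl B_scale' v assms(2))
  then show "- (\<Sum>j\<in>I. B j (t j) (fscale c v)) = c * - (\<Sum>j\<in>I. B j (t j) v)" by (simp add: sum_distrib_left)
next
  fix v w assume v: "v \<in> W" and w: "w \<in> W"
  have "(\<Sum>j\<in>I. B j (t j) (fadd v w)) = (\<Sum>j\<in>I. B j (t j) v + B j (t j) w)"
    by (intro sum.cong refl B_add' v w assms(2))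
  then show "- (\<Sum>j\<in>I. B j (t j) (fadd v w)) = - (\<Sum>j\<in>I. B j (t j) v) + - (\<Sum>j\<in>I. B j (t j) w)"
    by (simp add: sum.distrib)
qed

lemma taylor_in: "finite u \<Longrightarrow> taylor u k \<nu> \<in> W"
  by (induction k arbitrary: \<nu>) (auto intro!: rep(1) bdd_lin_f bdd_lin_step simp: taylor.simps)

lemma taylor_0: "v \<in> W \<Longrightarrow> E (taylor u 0 \<nu>) v = f v"
  by (simp add: rep(2) bdd_lin_f taylor.simps(1))

lemma taylor_Suc:
  "finite u \<Longrightarrow> v \<in> W \<Longrightarrow> E (taylor u (Suc k) \<nu>) v = - (\<Sum>j\<in>{j\<in>u. 0 < \<nu> j}. B j (taylor u k (dec \<nu> j)) v)"
  unfolding taylor.simps by (rule rep(2)[OF bdd_lin_step]) (auto intro: taylor_in)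

declare taylor.simps [simp del]

context
  fixes u :: "nat set" assumes u: "finite u"
begin

text \<open>The reciprocal of the expected size of the coefficient at \<nu>; in these units the
  coefficients are to stay bounded.\<close>

definition rho :: "(nat \<Rightarrow> nat) \<Rightarrow> real" where "rho \<nu> = (\<Prod>j\<in>u. (1 / b j) ^ \<nu> j)"

lemma rho_pos: "0 < rho \<nu>" unfolding rho_def using b by (intro prod_pos) auto

text \<open>Young's inequality (\<open>B_weighted\<close>) makes these weighted energies nonincreasing in the order \<open>k\<close>.\<close>

definition level :: "nat \<Rightarrow> real" where
  "level k = (\<Sum>\<nu>\<in>mindex u k. (rho \<nu>)\<^sup>2 * E (taylor u k \<nu>) (taylor u k \<nu>))"

lemma level_Suc_le: "level (Suc k) \<le> level k"
proof -
  let ?t = "taylor u"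
  have tW: "?t k \<nu> \<in> W" for k \<nu> by (rule taylor_in[OF u])
  have step: "(rho \<nu>)\<^sup>2 * E (?t (Suc k) \<nu>) (?t (Suc k) \<nu>) \<le>
     (\<Sum>j\<in>{j\<in>u. 0 < \<nu> j}. ((rho (dec \<nu> j))\<^sup>2 * N j (?t k (dec \<nu> j))) / 2) + (rho \<nu>)\<^sup>2 * (\<Sum>j\<in>u. N j (?t (Suc k) \<nu>)) / 2" for \<nu>
  proof -
    let ?J = "{j\<in>u. 0 < \<nu> j}" and ?s = "?t (Suc k) \<nu>"
    have one: "(rho \<nu>)\<^sup>2 * \<bar>B j (?t k (dec \<nu> j)) ?s\<bar> \<le> ((rho (dec \<nu> j))\<^sup>2 * N j (?t k (dec \<nu> j)) + (rho \<nu>)\<^sup>2 * N j ?s) / 2"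
      if "j \<in> ?J" for j
    proof -
      have r: "rho \<nu> = rho (dec \<nu> j) / b j"
        unfolding rho_def using prod_dec[OF u, of j \<nu> "\<lambda>j. 1 / b j"] that by simp
      \<comment> \<open>The Young parameter \<open>rho (dec \<nu> j) / rho \<nu>\<close> equals b j.
        It absorbs the factor b j exactly and leaves each of the two coefficients with its own
        weight.\<close>
      have "\<bar>B j (?t k (dec \<nu> j)) ?s\<bar> \<le> b j * ((rho (dec \<nu> j) / rho \<nu> * N j (?t k (dec \<nu> j)) + N j ?s / (rho (dec \<nu> j) / rho \<nu>)) / 2)"
        by (rule B_weighted[OF tW tW]) (use rho_pos in auto)
      then have "(rho \<nu>)\<^sup>2 * \<bar>B j (?t k (dec \<nu> j)) ?s\<bar> \<le> (rho \<nu>)\<^sup>2 * (b j * ((rho (dec \<nu> j) / rho \<nu> * N j (?t k (dec \<nu> j)) + N j ?s / (rho (dec \<nu> j) / rho \<nu>)) / 2))"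
        by (rule mult_left_mono) simp
      also have "rho (dec \<nu> j) = b j * rho \<nu>" unfolding r using b[of j] by simp
      then have "(rho \<nu>)\<^sup>2 * (b j * ((rho (dec \<nu> j) / rho \<nu> * N j (?t k (dec \<nu> j)) + N j ?s / (rho (dec \<nu> j) / rho \<nu>)) / 2)) =
          ((rho (dec \<nu> j))\<^sup>2 * N j (?t k (dec \<nu> j)) + (rho \<nu>)\<^sup>2 * N j ?s) / 2"
        using b(1)[of j] rho_pos[of \<nu>] by (simp add: power2_eq_square field_simps)
      finally show ?thesis .
    qed
    have "E ?s ?s = - (\<Sum>j\<in>?J. B j (?t k (dec \<nu> j)) ?s)" by (rule taylor_Suc[OF u tW])
    also have "\<dots> \<le> (\<Sum>j\<in>?J. \<bar>B j (?t k (dec \<nu> j)) ?s\<bar>)" unfolding sum_negf[symmetric] by (intro sum_mono) simp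
    finally have "(rho \<nu>)\<^sup>2 * E ?s ?s \<le> (rho \<nu>)\<^sup>2 * (\<Sum>j\<in>?J. \<bar>B j (?t k (dec \<nu> j)) ?s\<bar>)" by (rule mult_left_mono) simp
    also have "\<dots> \<le> (\<Sum>j\<in>?J. ((rho (dec \<nu> j))\<^sup>2 * N j (?t k (dec \<nu> j)) + (rho \<nu>)\<^sup>2 * N j ?s) / 2)"
      unfolding sum_distrib_left by (intro sum_mono one)
    also have "\<dots> = (\<Sum>j\<in>?J. ((rho (dec \<nu> j))\<^sup>2 * N j (?t k (dec \<nu> j))) / 2) + (\<Sum>j\<in>?J. (rho \<nu>)\<^sup>2 * N j ?s) / 2"
      by (simp add: sum.distrib sum_divide_distrib add_divide_distrib)
    also have "(\<Sum>j\<in>?J. (rho \<nu>)\<^sup>2 * N j ?s) \<le> (\<Sum>j\<in>u. (rho \<nu>)\<^sup>2 * N j ?s)"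
      by (rule sum_mono2) (use u N_nonneg[OF tW] in auto)
    also have "\<dots> = (rho \<nu>)\<^sup>2 * (\<Sum>j\<in>u. N j ?s)" by (rule sum_distrib_left[symmetric])
    finally show ?thesis by simp
  qed
  have sl: "(\<Sum>\<mu>\<in>mindex u k. (rho \<mu>)\<^sup>2 * (\<Sum>j\<in>u. N j (?t k \<mu>)) / 2) \<le> 1/3 * level k" for k
  proof -
    have "(rho \<mu>)\<^sup>2 * (\<Sum>j\<in>u. N j (?t k \<mu>)) \<le> (rho \<mu>)\<^sup>2 * (2/3 * E (?t k \<mu>) (?t k \<mu>))" for \<mu>
      by (intro mult_left_mono N_sum u tW) simp
    then have "(rho \<mu>)\<^sup>2 * (\<Sum>j\<in>u. N j (?t k \<mu>)) / 2 \<le> 1/3 * ((rho \<mu>)\<^sup>2 * E (?t k \<mu>) (?t k \<mu>))" for \<mu>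
      by (auto simp: field_simps intro: order_trans)
    then show ?thesis unfolding level_def sum_distrib_left by (intro sum_mono)
  qed
  have "level (Suc k) \<le> (\<Sum>\<nu>\<in>mindex u (Suc k). (\<Sum>j\<in>{j\<in>u. 0 < \<nu> j}. ((rho (dec \<nu> j))\<^sup>2 * N j (?t k (dec \<nu> j))) / 2) + (rho \<nu>)\<^sup>2 * (\<Sum>j\<in>u. N j (?t (Suc k) \<nu>)) / 2)"
    unfolding level_def by (rule sum_mono) (rule step)
  also have "\<dots> = (\<Sum>\<mu>\<in>mindex u k. \<Sum>j\<in>u. ((rho \<mu>)\<^sup>2 * N j (?t k \<mu>)) / 2) + (\<Sum>\<nu>\<in>mindex u (Suc k). (rho \<nu>)\<^sup>2 * (\<Sum>j\<in>u. N j (?t (Suc k) \<nu>)) / 2)"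
    unfolding sum.distrib using sum_mindex_Suc[OF u, of "\<lambda>\<mu> j. ((rho \<mu>)\<^sup>2 * N j (?t k \<mu>)) / 2" k] by simp
  also have "(\<Sum>\<mu>\<in>mindex u k. \<Sum>j\<in>u. ((rho \<mu>)\<^sup>2 * N j (?t k \<mu>)) / 2) = (\<Sum>\<mu>\<in>mindex u k. (rho \<mu>)\<^sup>2 * (\<Sum>j\<in>u. N j (?t k \<mu>)) / 2)"
    by (simp add: sum_distrib_left sum_divide_distrib)
  \<comment> \<open>Each 1/3 is half of the constant 2/3 in \<open>N_sum\<close>, the half coming
    from Young's inequality. Moving the term of degree k + 1 to the left leaves the factor (1/3) /
    (2/3) = 1/2.\<close>
  finally have "level (Suc k) \<le> 1/3 * level k + 1/3 * level (Suc k)" using sl[of k] sl[of "Suc k"] by linarith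
  then have "level (Suc k) \<le> 1/2 * level k" by simp
  moreover have "0 \<le> level k" unfolding level_def by (intro sum_nonneg mult_nonneg_nonneg E_nonneg tW) simp
  ultimately show ?thesis by simp
qed

text \<open>\<open>level k\<close> bounds the weighted energies of all coefficients of one degree
  jointly, so each of them is at most the energy at degree 0, which the bound on f controls. No
  factor |\<nu>|! / \<nu>! enters.\<close>

lemma taylor_bound:
  assumes "\<nu> \<in> mindex u k"
  shows "sqrt (E (taylor u k \<nu>) (taylor u k \<nu>)) \<le> cf * (\<Prod>j\<in>u. b j ^ \<nu> j)"
proof -
  have tW: "taylor u k \<nu> \<in> W" for k \<nu> by (rule taylor_in[OF u])
  have E0: "sqrt (E (taylor u 0 \<mu>) (taylor u 0 \<mu>)) \<le> cf" for \<mu>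
  proof -
    let ?e = "E (taylor u 0 \<mu>) (taylor u 0 \<mu>)"
    have "?e \<le> cf * sqrt ?e" using f_bound(1)[OF tW[of 0 \<mu>]] taylor_0[OF tW[of 0 \<mu>], of u \<mu>] by simp
    then have "sqrt ?e * sqrt ?e \<le> cf * sqrt ?e" using E_nonneg[OF tW[of 0 \<mu>]] by simp
    then show ?thesis
    proof (cases "?e = 0")
      case False
      then have "0 < sqrt ?e" using E_nonneg[OF tW[of 0 \<mu>]] by simp
      then show ?thesis using mult_right_le_imp_le \<open>sqrt ?e * sqrt ?e \<le> cf * sqrt ?e\<close> by blast
    qed (simp add: f_bound(2))
  qed
  have "level k \<le> level 0" by (induction k) (use level_Suc_le order_trans in blast)+
  also have "level 0 = (rho (restrict (\<lambda>_. 0) u))\<^sup>2 * E (taylor u 0 (restrict (\<lambda>_. 0) u)) (taylor u 0 (restrict (\<lambda>_. 0) u))"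
    unfolding level_def mindex_0[OF u] by simp
  also have "rho (restrict (\<lambda>_. 0) u) = 1" unfolding rho_def by simp
  also have "1\<^sup>2 * E (taylor u 0 (restrict (\<lambda>_. 0) u)) (taylor u 0 (restrict (\<lambda>_. 0) u)) \<le> cf\<^sup>2"
    using power_mono[OF E0[of "restrict (\<lambda>_. 0) u"], of 2] E_nonneg[OF tW[of 0 "restrict (\<lambda>_. 0) u"]] by simp
  finally have "level k \<le> cf\<^sup>2" .
  moreover have "(rho \<nu>)\<^sup>2 * E (taylor u k \<nu>) (taylor u k \<nu>) \<le> level k"
    unfolding level_def by (rule member_le_sum[OF assms]) (use E_nonneg[OF tW] finite_mindex[OF u] in auto)
  ultimately have "sqrt ((rho \<nu>)\<^sup>2 * E (taylor u k \<nu>) (taylor u k \<nu>)) \<le> sqrt (cf\<^sup>2)" by (intro real_sqrt_le_mono) simp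
  then have "rho \<nu> * sqrt (E (taylor u k \<nu>) (taylor u k \<nu>)) \<le> cf"
    using f_bound(2) rho_pos[of \<nu>] by (simp add: real_sqrt_mult)
  moreover have "rho \<nu> * (\<Prod>j\<in>u. b j ^ \<nu> j) = 1"
    unfolding rho_def prod.distrib[symmetric] using b(1) by (intro prod.neutral) (auto simp: power_one_over less_imp_neq[symmetric])
  ultimately have "rho \<nu> * sqrt (E (taylor u k \<nu>) (taylor u k \<nu>)) \<le> rho \<nu> * (cf * (\<Prod>j\<in>u. b j ^ \<nu> j))"
    by (simp add: mult.left_commute)
  then show ?thesis using rho_pos by simp
qed

definition tcoeff :: "(nat \<Rightarrow> nat) \<Rightarrow> real" where "tcoeff \<nu> = G (taylor u (sum \<nu> u) \<nu>)"

lemma tcoeff_bound: assumes "\<nu> \<in> PiE u (\<lambda>_. UNIV)" shows "\<bar>tcoeff \<nu>\<bar> \<le> cg * cf * (\<Prod>j\<in>u. b j ^ \<nu> j)"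
proof -
  have "\<nu> \<in> mindex u (sum \<nu> u)" using assms by (simp add: mindex_def)
  from taylor_bound[OF this] G_bound show ?thesis unfolding tcoeff_def mult.assoc
    by (intro order_trans[OF G_bound(1)] mult_left_mono taylor_in u) auto
qed

section \<open>Convergence of the partial sums to the Galerkin solution\<close>

context
  fixes y :: "nat \<Rightarrow> real" and U :: "'a \<Rightarrow> real"
  assumes y: "\<And>j. \<bar>y j\<bar> \<le> 1/2" and U: "U \<in> W"
    and sol: "\<And>v. v \<in> W \<Longrightarrow> E U v + (\<Sum>j\<in>u. y j * B j U v) = f v"
begin

private definition mon :: "(nat \<Rightarrow> nat) \<Rightarrow> real" where "mon \<nu> = (\<Prod>j\<in>u. y j ^ \<nu> j)"

private definition part :: "nat \<Rightarrow> 'a \<Rightarrow> real" where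
  "part n = flin (Sigma {..n} (mindex u)) (\<lambda>(k, \<nu>). mon \<nu>) (\<lambda>(k, \<nu>). taylor u k \<nu>)"

text \<open>What the parameter-dependent part of the equation makes of the terms of degree k. The
  energy part at degree k + 1 cancels it, so a partial sum up to degree n has residual
  \<open>flow n\<close> only.\<close>

private definition flow :: "nat \<Rightarrow> ('a \<Rightarrow> real) \<Rightarrow> real" where
  "flow k v = (\<Sum>\<nu>\<in>mindex u k. \<Sum>j\<in>u. mon \<nu> * y j * B j (taylor u k \<nu>) v)"

private lemma tW: "taylor u k \<nu> \<in> W" by (rule taylor_in[OF u])

private lemma linear_flin:
  assumes "finite I" "\<And>i. i \<in> I \<Longrightarrow> t i \<in> W"
    and "\<And>v w. v \<in> W \<Longrightarrow> w \<in> W \<Longrightarrow> L (fadd v w) = L v + L w" "\<And>c v. v \<in> W \<Longrightarrow> L (fscale c v) = c * L v"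
  shows "L (flin I c t) = (\<Sum>i\<in>I. c i * (L (t i) :: real))"
  using assms(1,2)
proof (induction I rule: finite_induct)
  case empty
  show ?case using flin_empty[of c t U] assms(4)[OF U, of 0] by simp
next
  case (insert i I)
  then show ?case by (simp add: flin_insert assms(3,4) flin_in)
qed

private lemma finI: "finite (Sigma {..n} (mindex u))"
  by (intro finite_SigmaI finite_mindex u) auto

private lemma part_in: "part n \<in> W"
  unfolding part_def by (rule flin_in[OF finI]) (auto intro: tW)

private lemma part_apply:
  assumes "\<And>v w. v \<in> W \<Longrightarrow> w \<in> W \<Longrightarrow> L (fadd v w) = L v + L w" "\<And>c v. v \<in> W \<Longrightarrow> L (fscale c v) = c * L v"
  shows "L (part n) = (\<Sum>k\<le>n. \<Sum>\<nu>\<in>mindex u k. mon \<nu> * (L (taylor u k \<nu>) :: real))"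
proof -
  have "L (part n) = (\<Sum>i\<in>Sigma {..n} (mindex u). (case i of (k, \<nu>) \<Rightarrow> mon \<nu>) * L (case i of (k, \<nu>) \<Rightarrow> taylor u k \<nu>))"
    unfolding part_def by (rule linear_flin[OF finI]) (use assms tW in auto)
  also have "\<dots> = (\<Sum>(k, \<nu>)\<in>Sigma {..n} (mindex u). mon \<nu> * L (taylor u k \<nu>))" by (intro sum.cong) auto
  finally show ?thesis by (subst sum.Sigma) (use finite_mindex[OF u] in auto)
qed

private lemma level_flow:
  assumes v: "v \<in> W"
  shows "(\<Sum>\<nu>\<in>mindex u (Suc k). mon \<nu> * E (taylor u (Suc k) \<nu>) v) = - flow k v"
proof -
  have "(\<Sum>\<nu>\<in>mindex u (Suc k). mon \<nu> * E (taylor u (Suc k) \<nu>) v) =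
     (\<Sum>\<nu>\<in>mindex u (Suc k). \<Sum>j\<in>{j\<in>u. 0 < \<nu> j}. - (mon (dec \<nu> j) * y j * B j (taylor u k (dec \<nu> j)) v))"
  proof (rule sum.cong[OF refl])
    fix \<nu> assume "\<nu> \<in> mindex u (Suc k)"
    have "mon \<nu> * E (taylor u (Suc k) \<nu>) v = (\<Sum>j\<in>{j\<in>u. 0 < \<nu> j}. - (mon \<nu> * B j (taylor u k (dec \<nu> j)) v))"
      unfolding taylor_Suc[OF u v] by (simp add: sum_distrib_left sum_negf)
    also have "\<dots> = (\<Sum>j\<in>{j\<in>u. 0 < \<nu> j}. - (mon (dec \<nu> j) * y j * B j (taylor u k (dec \<nu> j)) v))"
    proof (intro sum.cong refl)
      fix j assume "j \<in> {j\<in>u. 0 < \<nu> j}"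
      then have "mon \<nu> = y j * mon (dec \<nu> j)" unfolding mon_def using prod_dec[OF u, of j \<nu> y] by simp
      then show "- (mon \<nu> * B j (taylor u k (dec \<nu> j)) v) = - (mon (dec \<nu> j) * y j * B j (taylor u k (dec \<nu> j)) v)"
        by simp
    qed
    finally show "mon \<nu> * E (taylor u (Suc k) \<nu>) v = \<dots>" .
  qed
  also have "\<dots> = (\<Sum>\<mu>\<in>mindex u k. \<Sum>j\<in>u. - (mon \<mu> * y j * B j (taylor u k \<mu>) v))"
    by (rule sum_mindex_Suc[OF u])
  finally show ?thesis unfolding flow_def by (simp add: sum_negf)
qed

private lemma part_residual:
  assumes v: "v \<in> W"
  shows "E (part n) v + (\<Sum>j\<in>u. y j * B j (part n) v) = f v + flow n v"
proof -
  have "E (part n) v = (\<Sum>k\<le>n. \<Sum>\<nu>\<in>mindex u k. mon \<nu> * E (taylor u k \<nu>) v)"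
    by (rule part_apply) (use v in auto)
  also have "\<dots> = f v - (\<Sum>k<n. flow k v)"
  proof (induction n)
    case 0
    show ?case using taylor_0[OF v] by (simp add: mindex_0[OF u] mon_def)
  next
    case (Suc n)
    then show ?case using level_flow[OF v, of n] by simp
  qed
  finally have 1: "E (part n) v = f v - (\<Sum>k<n. flow k v)" .
  have "(\<Sum>j\<in>u. y j * B j (part n) v) = (\<Sum>j\<in>u. y j * (\<Sum>k\<le>n. \<Sum>\<nu>\<in>mindex u k. mon \<nu> * B j (taylor u k \<nu>) v))"
    by (intro sum.cong refl arg_cong2[of _ _ _ _ "(*)"] part_apply) (use v B_add B_scale in auto)
  also have "\<dots> = (\<Sum>k\<le>n. flow k v)"
  proof -
    have "(\<Sum>j\<in>u. y j * (\<Sum>k\<le>n. \<Sum>\<nu>\<in>mindex u k. mon \<nu> * B j (taylor u k \<nu>) v)) =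
      (\<Sum>j\<in>u. \<Sum>k\<le>n. \<Sum>\<nu>\<in>mindex u k. mon \<nu> * y j * B j (taylor u k \<nu>) v)"
      by (simp add: sum_distrib_left mult_ac)
    also have "\<dots> = (\<Sum>k\<le>n. \<Sum>j\<in>u. \<Sum>\<nu>\<in>mindex u k. mon \<nu> * y j * B j (taylor u k \<nu>) v)"
      by (rule sum.swap)
    also have "\<dots> = (\<Sum>k\<le>n. flow k v)" unfolding flow_def by (intro sum.cong refl sum.swap)
    finally show ?thesis .
  qed
  finally show ?thesis unfolding 1 by (simp add: lessThan_Suc_atMost[symmetric])
qed

text \<open>The difference R solves the Galerkin equation with right-hand side
  \<open>- flow n\<close>. Testing with R gives 2/3 of its energy from below; from above Young's
  inequality is used with the balanced parameter r = X, the sum of the monomials of degree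
  n.\<close>

private lemma remainder:
  "\<bar>G U - G (part n)\<bar> \<le> cg * (cf * (\<Sum>\<nu>\<in>mindex u n. \<bar>mon \<nu>\<bar>))"
proof -
  define R where "R = fadd U (fscale (-1) (part n))"
  define e where "e = E R R"
  define X where "X = (\<Sum>\<nu>\<in>mindex u n. \<bar>mon \<nu>\<bar>)"
  have R: "R \<in> W" unfolding R_def using U part_in by simp
  have e0: "0 \<le> e" unfolding e_def by (rule E_nonneg[OF R])
  have X0: "0 \<le> X" unfolding X_def by (intro sum_nonneg) simp
  have eq: "E R R + (\<Sum>j\<in>u. y j * B j R R) = - flow n R"
  proof -
    have "E R R = E U R - E (part n) R"
      by (subst R_def) (simp add: U part_in R)
    moreover have "B j R R = B j U R - B j (part n) R" for j
      by (subst R_def) (simp add: U part_in R B_add B_scale)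
    ultimately have "E R R + (\<Sum>j\<in>u. y j * B j R R) =
       (E U R + (\<Sum>j\<in>u. y j * B j U R)) - (E (part n) R + (\<Sum>j\<in>u. y j * B j (part n) R))"
      by (simp add: sum_subtractf right_diff_distrib)
    then show ?thesis unfolding sol[OF R] part_residual[OF R] by simp
  qed
  have "\<bar>\<Sum>j\<in>u. y j * B j R R\<bar> \<le> (\<Sum>j\<in>u. \<bar>y j * B j R R\<bar>)" by (rule sum_abs)
  also have "\<dots> \<le> (\<Sum>j\<in>u. 1/2 * N j R)"
  proof (rule sum_mono)
    fix j
    have "\<bar>B j R R\<bar> \<le> b j * N j R" using B_le[OF R R, of j] by simp
    also have "\<dots> \<le> 1 * N j R" using b N_nonneg[OF R] by (intro mult_right_mono) auto
    finally show "\<bar>y j * B j R R\<bar> \<le> 1/2 * N j R" unfolding abs_mult using y[of j] by (intro mult_mono) auto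
  qed
  also have "\<dots> \<le> 1/3 * e" using N_sum[OF u R] unfolding sum_distrib_left[symmetric] e_def by simp
  finally have lower: "2/3 * e \<le> \<bar>flow n R\<bar>" using eq e0 unfolding e_def[symmetric] by linarith
  have upper: "\<bar>flow n R\<bar> \<le> X * ((r * cf\<^sup>2 + e / r) / 6)" if r: "0 < r" for r
  proof -
    have "\<bar>flow n R\<bar> \<le> (\<Sum>\<nu>\<in>mindex u n. \<bar>\<Sum>j\<in>u. mon \<nu> * y j * B j (taylor u n \<nu>) R\<bar>)"
      unfolding flow_def by (rule sum_abs)
    also have "\<dots> \<le> (\<Sum>\<nu>\<in>mindex u n. \<bar>mon \<nu>\<bar> * ((r * cf\<^sup>2 + e / r) / 6))"
    proof (rule sum_mono)
      fix \<nu> assume \<nu>: "\<nu> \<in> mindex u n"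
      let ?t = "taylor u n \<nu>"
      have "(\<Prod>j\<in>u. b j ^ \<nu> j) \<le> 1"
        by (intro prod_le_1 conjI zero_le_power power_le_one) (use b less_imp_le in auto)
      then have "sqrt (E ?t ?t) \<le> cf * 1"
        by (rule order_trans[OF taylor_bound[OF \<nu>] mult_left_mono[OF _ f_bound(2)]])
      then have Et: "E ?t ?t \<le> cf\<^sup>2"
        using power_mono[of "sqrt (E ?t ?t)" cf 2] E_nonneg[OF tW[of n \<nu>]] by simp
      have "\<bar>\<Sum>j\<in>u. mon \<nu> * y j * B j ?t R\<bar> \<le> (\<Sum>j\<in>u. \<bar>mon \<nu> * y j * B j ?t R\<bar>)" by (rule sum_abs)
      also have "\<dots> \<le> (\<Sum>j\<in>u. \<bar>mon \<nu>\<bar> * ((r * N j ?t + N j R / r) / 4))"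
      proof (rule sum_mono)
        fix j
        have nn: "0 \<le> (r * N j ?t + N j R / r) / 2"
          using r N_nonneg[OF R] N_nonneg[OF tW] by (auto intro!: add_nonneg_nonneg)
        have "\<bar>B j ?t R\<bar> \<le> 1 * ((r * N j ?t + N j R / r) / 2)"
          by (rule order_trans[OF B_weighted[OF tW R r] mult_right_mono[OF b(2) nn]])
        then have "\<bar>y j\<bar> * \<bar>B j ?t R\<bar> \<le> 1/2 * ((r * N j ?t + N j R / r) / 2)"
          using y[of j] by (intro mult_mono) auto
        then show "\<bar>mon \<nu> * y j * B j ?t R\<bar> \<le> \<bar>mon \<nu>\<bar> * ((r * N j ?t + N j R / r) / 4)"
          unfolding abs_mult mult.assoc by (intro mult_left_mono) auto
      qed
      also have "\<dots> = \<bar>mon \<nu>\<bar> * ((r * (\<Sum>j\<in>u. N j ?t) + (\<Sum>j\<in>u. N j R) / r) / 4)"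
        by (simp add: sum_distrib_left sum_divide_distrib sum.distrib[symmetric])
      also have "\<dots> \<le> \<bar>mon \<nu>\<bar> * ((r * (2/3 * cf\<^sup>2) + (2/3 * e) / r) / 4)"
        using N_sum[OF u R] N_sum[OF u tW[of n \<nu>]] Et r unfolding e_def
        by (intro mult_left_mono divide_right_mono add_mono) auto
      also have "(r * (2/3 * cf\<^sup>2) + (2/3 * e) / r) / 4 = (r * cf\<^sup>2 + e / r) / 6" by (simp add: field_simps)
      finally show "\<bar>\<Sum>j\<in>u. mon \<nu> * y j * B j ?t R\<bar> \<le> \<bar>mon \<nu>\<bar> * ((r * cf\<^sup>2 + e / r) / 6)" .
    qed
    also have "\<dots> = X * ((r * cf\<^sup>2 + e / r) / 6)" unfolding X_def by (rule sum_distrib_right[symmetric])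
    finally show ?thesis .
  qed
  have "sqrt e \<le> cf * X"
  proof (cases "X = 0")
    case True
    then have "e \<le> 0" using upper[of 1] lower by simp
    then show ?thesis using e0 True by simp
  next
    case False
    then have Xp: "0 < X" using X0 by simp
    then have "X * ((X * cf\<^sup>2 + e / X) / 6) = ((cf * X)\<^sup>2 + e) / 6"
      by (simp add: power2_eq_square field_simps)
    with upper[OF Xp] have "\<bar>flow n R\<bar> \<le> ((cf * X)\<^sup>2 + e) / 6" by simp
    with lower have "4 * e \<le> (cf * X)\<^sup>2 + e" by simp
    then have "e \<le> (cf * X)\<^sup>2" using e0 zero_le_power2[of "cf * X"] by linarith
    then have "sqrt e \<le> sqrt ((cf * X)\<^sup>2)" by (rule real_sqrt_le_mono)
    then show ?thesis using f_bound(2) X0 by simp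
  qed
  moreover have "G U - G (part n) = G R" unfolding R_def by (simp add: G_add G_scale U part_in)
  ultimately show ?thesis using G_bound(1)[OF R] G_bound(2) unfolding X_def e_def
    by (metis mult_left_mono order_trans)
qed

lemma taylor_expansion:
  "(\<lambda>n. \<Sum>k\<le>n. \<Sum>\<nu>\<in>mindex u k. tcoeff \<nu> * (\<Prod>j\<in>u. y j ^ \<nu> j)) \<longlonglongrightarrow> G U"
proof -
  have eq: "G (part n) = (\<Sum>k\<le>n. \<Sum>\<nu>\<in>mindex u k. tcoeff \<nu> * (\<Prod>j\<in>u. y j ^ \<nu> j))" for n
  proof -
    have "G (part n) = (\<Sum>k\<le>n. \<Sum>\<nu>\<in>mindex u k. mon \<nu> * G (taylor u k \<nu>))"
      by (rule part_apply) (auto simp: G_add G_scale)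
    also have "\<dots> = (\<Sum>k\<le>n. \<Sum>\<nu>\<in>mindex u k. tcoeff \<nu> * (\<Prod>j\<in>u. y j ^ \<nu> j))"
      by (intro sum.cong refl) (simp add: tcoeff_def mindex_def mon_def)
    finally show ?thesis .
  qed
  have mon_le: "(\<Sum>\<nu>\<in>mindex u n. \<bar>mon \<nu>\<bar>) \<le> real (n + 1) ^ card u * (1/2) ^ n" for n
  proof -
    have "\<bar>mon \<nu>\<bar> \<le> (1/2) ^ n" if "\<nu> \<in> mindex u n" for \<nu>
    proof -
      have "\<bar>mon \<nu>\<bar> = (\<Prod>j\<in>u. \<bar>y j\<bar> ^ \<nu> j)" unfolding mon_def by (simp add: abs_prod power_abs)
      also have "\<dots> \<le> (\<Prod>j\<in>u. (1/2) ^ \<nu> j)" by (intro prod_mono conjI power_mono y) auto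
      also have "\<dots> = (1/2) ^ n" using that by (simp add: power_sum[symmetric] mindex_def)
      finally show ?thesis .
    qed
    then have "(\<Sum>\<nu>\<in>mindex u n. \<bar>mon \<nu>\<bar>) \<le> real (card (mindex u n)) * (1/2) ^ n" by (rule sum_bounded_above)
    also have "\<dots> \<le> real ((n + 1) ^ card u) * (1/2) ^ n"
      by (intro mult_right_mono of_nat_mono card_mindex_le u) auto
    finally show ?thesis by simp
  qed
  have lim: "(\<lambda>n. real (n + 1) ^ card u * (1/2) ^ n) \<longlonglongrightarrow> 0"
  proof -
    have "(\<lambda>n. 2 * (real (Suc n) ^ card u * (1/2) ^ Suc n)) \<longlonglongrightarrow> 2 * 0"
      by (intro tendsto_intros LIMSEQ_Suc[where f = "\<lambda>n. real n ^ card u * (1/2) ^ n"] summable_LIMSEQ_zero summable_power_mult_geometric) simp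
    then show ?thesis by simp
  qed
  have "(\<lambda>n. cg * (cf * (real (n + 1) ^ card u * (1/2) ^ n))) \<longlonglongrightarrow> cg * (cf * 0)"
    by (intro tendsto_mult tendsto_const lim)
  then have z: "(\<lambda>n. cg * (cf * (real (n + 1) ^ card u * (1/2) ^ n))) \<longlonglongrightarrow> 0" by simp
  have "norm (G (part n) - G U) \<le> cg * (cf * (real (n + 1) ^ card u * (1/2) ^ n))" for n
    using order_trans[OF remainder[of n] mult_left_mono[OF mult_left_mono[OF mon_le[of n] f_bound(2)] G_bound(2)]]
    by (simp add: abs_minus_commute)
  then have "(\<lambda>n. G (part n) - G U) \<longlonglongrightarrow> 0"
    by (intro Lim_null_comparison[OF always_eventually[OF allI] z])
  then show ?thesis unfolding eq by (simp add: LIM_zero_iff)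
qed

end

end

end

text \<open>The coefficients may depend on the finite set u, and the partial sums run by total
  degree, so no absolute convergence is claimed. Only C is uniform, and that is all that the
  anchored terms require.\<close>

definition power_expansion :: "real \<Rightarrow> (nat \<Rightarrow> real) \<Rightarrow> ((nat \<Rightarrow> real) \<Rightarrow> real) \<Rightarrow> bool" where
  "power_expansion C b F \<longleftrightarrow> (\<forall>u. finite u \<longrightarrow> (\<exists>t. (\<forall>\<nu>\<in>PiE u (\<lambda>_. UNIV). \<bar>t \<nu>\<bar> \<le> C * (\<Prod>j\<in>u. b j ^ \<nu> j)) \<and>
     (\<forall>y\<in>param_seqs. (\<forall>j. j \<notin> u \<longrightarrow> y j = 0) \<longrightarrow>
       (\<lambda>n. \<Sum>k\<le>n. \<Sum>\<nu>\<in>mindex u k. t \<nu> * (\<Prod>j\<in>u. y j ^ \<nu> j)) \<longlonglongrightarrow> F y)))"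

lemma param_seqs_abs_le: "y \<in> param_seqs \<Longrightarrow> \<bar>y j\<bar> \<le> 1/2"
proof -
  assume "y \<in> param_seqs"
  then have "y j \<in> \<Omega>" by (simp add: param_seqs_def)
  then show ?thesis by (auto simp: \<Omega>_def abs_le_iff)
qed

section \<open>The Galerkin bounds for the diffusion problem\<close>

context diffusion
begin

lemma semi_inner_H10: assumes "H10 D \<noteq> {}" shows "semi_inner (H10 D) (form D a0)"
proof
  show "fadd v w \<in> H10 D" if "v \<in> H10 D" "w \<in> H10 D" for v w
    unfolding fadd_def by (rule H10_add[OF D that])
  show "fscale c v \<in> H10 D" if "v \<in> H10 D" for v c
    unfolding fscale_def by (rule H10_scale[OF D that])
  show "En v w = En w v" for v w by (rule form_sym[OF D])
  show "En (fadd v v') w = En v w + En v' w" if "v \<in> H10 D" "v' \<in> H10 D" "w \<in> H10 D" for v v' w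
    unfolding fadd_def by (rule form_add_left[OF D bdd_a0 that])
  show "En (fscale c v) w = c * En v w" if "v \<in> H10 D" "w \<in> H10 D" for v w c
    unfolding fscale_def by (rule form_scale_left[OF D a0 that])
  show "0 \<le> En v v" for v by (rule form_nonneg[OF D a0_nonneg])
qed (rule assms)

text \<open>\<open>cf\<close> and \<open>cg\<close> bound f and G on all of \<open>H10 D\<close>,
  hence on every subspace with the same value; this is why the final constants do not depend on the
  mesh.\<close>

lemma fin_dim_galerkin:
  assumes ne: "H10 D \<noteq> {}" and W: "fin_dim_subspace W (H10 D)"
    and f: "f \<in> V_dual D" and G: "G \<in> V_dual D"
    and cf: "0 \<le> cf" "\<And>v. v \<in> H10 D \<Longrightarrow> \<bar>f v\<bar> \<le> cf * sqrt (En v v)"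
    and cg: "0 \<le> cg" "\<And>v. v \<in> H10 D \<Longrightarrow> \<bar>G v\<bar> \<le> cg * sqrt (En v v)"
  shows "galerkin W (form D a0) (\<lambda>j. form D (\<phi> j)) Nj b f G cf cg" "W \<subseteq> H10 D"
proof -
  interpret V: semi_inner "H10 D" "form D a0" by (rule semi_inner_H10[OF ne])
  obtain Bs where Bs: "finite Bs" "Bs \<subseteq> H10 D" "W = {\<lambda>x. \<Sum>\<beta>\<in>Bs. c \<beta> * \<beta> x |c. True}"
    using W unfolding fin_dim_subspace_def by blast
  have Wsp: "W = V.sp Bs" unfolding Bs(3) V.sp_def flin_def ..
  show sub: "W \<subseteq> H10 D" unfolding Wsp by (rule V.sp_subset[OF Bs(1,2)])
  have BW: "Bs \<subseteq> W"
  proof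
    fix \<beta> assume \<beta>: "\<beta> \<in> Bs"
    have "\<beta> = flin Bs (\<lambda>i. if i = \<beta> then 1 else 0) (\<lambda>\<beta>. \<beta>)"
    proof
      fix x
      have "(\<Sum>i\<in>Bs. (if i = \<beta> then 1 else 0) * i x) = (\<Sum>i\<in>Bs. if i = \<beta> then \<beta> x else 0)"
        by (rule sum.cong[OF refl]) auto
      also have "\<dots> = \<beta> x" using Bs(1) \<beta> by simp
      finally show "\<beta> x = flin Bs (\<lambda>i. if i = \<beta> then 1 else 0) (\<lambda>\<beta>. \<beta>) x" unfolding flin_def by simp
    qed
    then show "\<beta> \<in> W" unfolding Wsp V.sp_def by blast
  qed
  note S = subsetD[OF sub]
  interpret Wi: semi_inner W "form D a0"
  proof
    have "flin Bs (\<lambda>_. 0) (\<lambda>\<beta>. \<beta>) \<in> W" unfolding Wsp V.sp_def by blast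
    then show "W \<noteq> {}" by blast
    show "fadd v w \<in> W" if "v \<in> W" "w \<in> W" for v w using that V.sp_add unfolding Wsp by blast
    show "fscale c v \<in> W" if "v \<in> W" for v c using that V.sp_scale unfolding Wsp by blast
  qed (use S V.sym V.E_nonneg in auto)
  show "galerkin W (form D a0) (\<lambda>j. form D (\<phi> j)) Nj b f G cf cg"
  proof
    fix v v' w j assume v: "v \<in> W" and v': "v' \<in> W" and w: "w \<in> W"
    show "form D (\<phi> j) v w = form D (\<phi> j) w v" by (rule form_sym[OF D])
    show "form D (\<phi> j) (fadd v v') w = form D (\<phi> j) v w + form D (\<phi> j) v' w"
      unfolding fadd_def by (rule form_add_left[OF D bdd_\<phi> S[OF v] S[OF v'] S[OF w]])
    show "\<bar>form D (\<phi> j) v w\<bar> \<le> b j * ((Nj j v + Nj j w) / 2)" by (rule form_\<phi>_le[OF S[OF v] S[OF w]])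
    show "f (fadd v w) = f v + f w" "G (fadd v w) = G v + G w"
      using f G S[OF v] S[OF w] unfolding V_dual_def fadd_def by blast+
    show "0 \<le> Nj j v" by (rule Nj_nonneg)
    show "\<bar>f v\<bar> \<le> cf * sqrt (En v v)" "\<bar>G v\<bar> \<le> cg * sqrt (En v v)" using cf(2) cg(2) S[OF v] by auto
    show "(\<Sum>j\<in>u. Nj j v) \<le> 2/3 * En v v" if "finite u" for u by (rule sum_Nj_le[OF that S[OF v]])
    fix c
    show "form D (\<phi> j) (fscale c v) w = c * form D (\<phi> j) v w"
      unfolding fscale_def by (rule form_scale_left[OF D \<phi> S[OF v] S[OF w]])
    show "f (fscale c v) = c * f v" "G (fscale c v) = c * G v"
      using f G S[OF v] unfolding V_dual_def fscale_def by blast+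
    have m: "(\<lambda>x. \<bar>\<phi> j x\<bar> / b j) \<in> borel_measurable (lebesgue_on D)" using bdd_abs_\<phi>[of j] unfolding bdd_coeff_def by simp
    have cv: "(\<lambda>x. c * v x) \<in> H10 D" by (rule H10_scale[OF D S[OF v]])
    show "Nj j (fscale c v) = c\<^sup>2 * Nj j v"
      unfolding Nj_def fscale_def form_scale_left[OF D m S[OF v] cv] form_sym[OF D, of _ v "\<lambda>x. c * v x"]
        form_scale_left[OF D m S[OF v] S[OF v]] by (simp add: power2_eq_square)
  next
    fix l assume "Wi.bdd_lin l"
    then show "\<exists>w\<in>W. \<forall>v\<in>W. En w v = l v"
      using Wi.riesz[OF Bs(1) BW] unfolding Wsp V.sp_def Wi.sp_def by blast
  qed (use b cf(1) cg(1) in auto)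
qed

lemma weak_solution_form:
  "weak_solution D a f W w \<longleftrightarrow> w \<in> W \<and> (\<forall>v\<in>W. form D a w v = f v)"
  unfolding weak_solution_def form_def ..

text \<open>The expansion covers parameters of finite support; the second bound reaches general
  parameters by showing that those beyond N matter little, through a comparison of two Galerkin
  equations. Both are uniform in W and therefore survive the limit h to 0.\<close>

lemma galerkin_expansion:
  assumes ne: "H10 D \<noteq> {}" and f: "f \<in> V_dual D" and G: "G \<in> V_dual D"
  obtains C where "0 \<le> C"
    "\<And>W U. fin_dim_subspace W (H10 D) \<Longrightarrow>
        (\<And>y. y \<in> param_seqs \<Longrightarrow> weak_solution D (coeff_a a0 \<phi> y) f W (U y)) \<Longrightarrow>
        power_expansion C b (\<lambda>y. G (U y))"
    "\<And>W U y N \<delta>. fin_dim_subspace W (H10 D) \<Longrightarrow>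
        (\<And>y. y \<in> param_seqs \<Longrightarrow> weak_solution D (coeff_a a0 \<phi> y) f W (U y)) \<Longrightarrow>
        y \<in> param_seqs \<Longrightarrow> (\<And>j. j \<ge> N \<Longrightarrow> b j \<le> \<delta>) \<Longrightarrow> 0 \<le> \<delta> \<Longrightarrow> \<delta> \<le> 1 \<Longrightarrow>
        \<bar>G (U y) - G (U (anchor {..<N} y))\<bar> \<le> C * \<delta>"
proof -
  obtain cf where cf: "0 \<le> cf" "\<And>v. v \<in> H10 D \<Longrightarrow> \<bar>f v\<bar> \<le> cf * sqrt (En v v)" using V_dual_bound[OF f] by metis
  obtain cg where cg: "0 \<le> cg" "\<And>v. v \<in> H10 D \<Longrightarrow> \<bar>G v\<bar> \<le> cg * sqrt (En v v)" using V_dual_bound[OF G] by metis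
  define C where "C = 2 * (cg * cf)"
  have C0: "0 \<le> C" using cf cg by (simp add: C_def)
  have 1: "power_expansion C b (\<lambda>y. G (U y))" if W: "fin_dim_subspace W (H10 D)"
    and U: "\<And>y. y \<in> param_seqs \<Longrightarrow> weak_solution D (coeff_a a0 \<phi> y) f W (U y)" for W U
  proof -
    have "W \<subseteq> H10 D" by (rule fin_dim_galerkin(2)[OF ne W f G cf cg])
    note S = subsetD[OF this]
    interpret galerkin W "form D a0" "\<lambda>j. form D (\<phi> j)" Nj b f G cf cg by (rule fin_dim_galerkin(1)[OF ne W f G cf cg])
    show ?thesis unfolding power_expansion_def
    proof (intro allI impI exI conjI ballI)
      fix u :: "nat set" and \<nu> :: "nat \<Rightarrow> nat" assume u: "finite u" and \<nu>: "\<nu> \<in> PiE u (\<lambda>_. UNIV)"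
      have "0 \<le> (\<Prod>j\<in>u. b j ^ \<nu> j)" using b(1) by (intro prod_nonneg) (auto intro: less_imp_le)
      then have "cg * cf * (\<Prod>j\<in>u. b j ^ \<nu> j) \<le> C * (\<Prod>j\<in>u. b j ^ \<nu> j)"
        unfolding C_def using cf cg by (intro mult_right_mono) auto
      then show "\<bar>tcoeff u \<nu>\<bar> \<le> C * (\<Prod>j\<in>u. b j ^ \<nu> j)" using tcoeff_bound[OF u \<nu>] by linarith
    next
      fix u :: "nat set" and y assume u: "finite u" and y: "y \<in> param_seqs" and y0: "\<forall>j. j \<notin> u \<longrightarrow> y j = 0"
      have UW: "U y \<in> W" and sol: "\<And>v. v \<in> W \<Longrightarrow> form D (coeff_a a0 \<phi> y) (U y) v = f v"
        using U[OF y] unfolding weak_solution_form by auto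
      show "(\<lambda>n. \<Sum>k\<le>n. \<Sum>\<nu>\<in>mindex u k. tcoeff u \<nu> * (\<Prod>j\<in>u. y j ^ \<nu> j)) \<longlonglongrightarrow> G (U y)"
      proof (rule taylor_expansion[OF u param_seqs_abs_le[OF y] UW])
        fix v assume v: "v \<in> W"
        show "En (U y) v + (\<Sum>j\<in>u. y j * form D (\<phi> j) (U y) v) = f v"
          using form_coeff_finite[OF y u _ S[OF UW] S[OF v]] y0 sol[OF v] by simp
      qed
    qed
  qed
  have 2: "\<bar>G (U y) - G (U (anchor {..<N} y))\<bar> \<le> C * \<delta>" if W: "fin_dim_subspace W (H10 D)"
    and U: "\<And>y. y \<in> param_seqs \<Longrightarrow> weak_solution D (coeff_a a0 \<phi> y) f W (U y)"
    and y: "y \<in> param_seqs" and \<delta>: "\<And>j. j \<ge> N \<Longrightarrow> b j \<le> \<delta>" "0 \<le> \<delta>" "\<delta> \<le> 1" for W U y N \<delta>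
  proof -
    have "W \<subseteq> H10 D" by (rule fin_dim_galerkin(2)[OF ne W f G cf cg])
    note S = subsetD[OF this]
    interpret galerkin W "form D a0" "\<lambda>j. form D (\<phi> j)" Nj b f G cf cg by (rule fin_dim_galerkin(1)[OF ne W f G cf cg])
    define z where "z = anchor {..<N} y"
    have z: "z \<in> param_seqs" using y unfolding z_def param_seqs_def anchor_def \<Omega>_def by auto
    have UW: "U y \<in> W" "U z \<in> W" and sol: "\<And>v. v \<in> W \<Longrightarrow> form D (coeff_a a0 \<phi> y) (U y) v = f v"
       "\<And>v. v \<in> W \<Longrightarrow> form D (coeff_a a0 \<phi> z) (U z) v = f v"
      using U[OF y] U[OF z] unfolding weak_solution_form by auto
    define R where "R = fadd (U y) (fscale (-1) (U z))"
    define e where "e = En R R"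
    define m where "m = En (U z) (U z)"
    have R: "R \<in> W" unfolding R_def using UW by simp
    have e0: "0 \<le> e" and m0: "0 \<le> m" unfolding e_def m_def using E_nonneg R UW by auto
    have "2/3 * m \<le> f (U z)" using form_coeff_coercive[OF z S[OF UW(2)]] sol(2)[OF UW(2)] unfolding m_def by simp
    also have "\<dots> \<le> cf * sqrt m" using f_bound(1)[OF UW(2)] unfolding m_def by simp
    finally have "2/3 * (sqrt m * sqrt m) \<le> cf * sqrt m" using m0 by simp
    then have m1: "2/3 * sqrt m \<le> cf"
    proof (cases "m = 0")
      case False
      then have "0 < sqrt m" using m0 by simp
      moreover have "2/3 * sqrt m * sqrt m \<le> cf * sqrt m" using \<open>2/3 * (sqrt m * sqrt m) \<le> cf * sqrt m\<close> by (simp only: mult.assoc)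
      ultimately show ?thesis using mult_right_le_imp_le by blast
    qed (simp add: f_bound(2))
    have H: "(\<lambda>x. (-1) * U z x) \<in> H10 D" by (rule H10_scale[OF D S[OF UW(2)]])
    have "form D (coeff_a a0 \<phi> y) R R = form D (coeff_a a0 \<phi> y) (U y) R + form D (coeff_a a0 \<phi> y) (\<lambda>x. (-1) * U z x) R"
      unfolding R_def[unfolded fadd_def fscale_def]
      by (rule form_add_left[OF D bdd_coeff_a[OF y] S[OF UW(1)] H S[OF R[unfolded R_def fadd_def fscale_def]]])
    also have "form D (coeff_a a0 \<phi> y) (\<lambda>x. (-1) * U z x) R = (-1) * form D (coeff_a a0 \<phi> y) (U z) R"
      by (rule form_scale_left[OF D coeff_measurable S[OF UW(2)] S[OF R]])
    \<comment> \<open>Both solutions see the same right-hand side \<open>f R\<close>, so only the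
      change of the coefficient, acting on the solution at z, remains.\<close>
    finally have RR: "form D (coeff_a a0 \<phi> y) R R = form D (coeff_a a0 \<phi> z) (U z) R - form D (coeff_a a0 \<phi> y) (U z) R"
      using sol(1)[OF R] sol(2)[OF R] by simp
    have "2/3 * e \<le> form D (coeff_a a0 \<phi> y) R R" unfolding e_def by (rule form_coeff_coercive[OF y S[OF R]])
    also have "\<dots> \<le> \<delta> / 3 * (sqrt m * sqrt e)"
    proof -
      let ?d = "\<lambda>v w. form D (coeff_a a0 \<phi> z) v w - form D (coeff_a a0 \<phi> y) v w"
      \<comment> \<open>The form is invariant under reciprocal scaling of its two arguments, so the
        arithmetic-mean bound holds for every r and improves to a geometric mean. The factor 3 turns
        the denominator 6 into the 2 of that lemma.\<close>
      have "3 * ?d (U z) R \<le> sqrt (\<delta> * m) * sqrt (\<delta> * e)"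
      proof (rule le_sqrt_mult_sqrt)
        fix r :: real assume r: "0 < r"
        define s where "s = sqrt r"
        have s: "0 < s" "s\<^sup>2 = r" using r by (auto simp: s_def)
        have sW: "fscale s (U z) \<in> W" "fscale (1/s) R \<in> W" using UW R by auto
        have "form D c (fscale s (U z)) (fscale (1/s) R) = form D c (U z) R" if "c \<in> borel_measurable (lebesgue_on D)" for c
        proof -
          have "form D c (fscale s (U z)) (fscale (1/s) R) = s * form D c (fscale (1/s) R) (U z)"
            unfolding form_sym[OF D, of c "fscale (1/s) R"] unfolding fscale_def[of s]
            by (rule form_scale_left[OF D that S[OF UW(2)] S[OF sW(2)]])
          also have "form D c (fscale (1/s) R) (U z) = 1/s * form D c R (U z)"
            unfolding fscale_def[of "1/s"] by (rule form_scale_left[OF D that S[OF R] S[OF UW(2)]])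
          finally show ?thesis using s by (simp add: form_sym[OF D, of c R])
        qed
        note fs = this[OF coeff_measurable]
        have "\<bar>form D (coeff_a a0 \<phi> y) (fscale s (U z)) (fscale (1/s) R) - form D (coeff_a a0 \<phi> z) (fscale s (U z)) (fscale (1/s) R)\<bar>
           \<le> \<delta> * ((En (fscale s (U z)) (fscale s (U z)) + En (fscale (1/s) R) (fscale (1/s) R)) / 6)"
          by (rule form_coeff_diff_le[OF y z S[OF sW(1)] S[OF sW(2)]]) (unfold z_def, rule \<phi>_tail[OF y \<delta>(1,2)])
        then have "\<bar>form D (coeff_a a0 \<phi> y) (U z) R - form D (coeff_a a0 \<phi> z) (U z) R\<bar> \<le> \<delta> * ((s * (s * m) + 1/s * (1/s * e)) / 6)"
          unfolding fs E_scale[OF UW(2) sW(1)] E_scale'[OF UW(2) UW(2)] E_scale[OF R sW(2)] E_scale'[OF R R] m_def e_def .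
        also have "s * (s * m) = r * m" using s by (simp add: power2_eq_square)
        also have "1/s * (1/s * e) = e / r" using s by (simp add: power2_eq_square)
        finally have "\<bar>form D (coeff_a a0 \<phi> y) (U z) R - form D (coeff_a a0 \<phi> z) (U z) R\<bar> \<le> \<delta> * ((r * m + e / r) / 6)" .
        from abs_le_D2[OF this] have "?d (U z) R \<le> \<delta> * ((r * m + e / r) / 6)" by simp
        moreover have "\<delta> * ((r * m + e / r) / 6) = (r * (\<delta> * m) + \<delta> * e / r) / 6" by (simp add: algebra_simps)
        ultimately have "?d (U z) R \<le> (r * (\<delta> * m) + \<delta> * e / r) / 6" by simp
        moreover have "3 * X \<le> Y / 2" if "X \<le> Y / 6" for X Y :: real using that by simp
        ultimately show "3 * ?d (U z) R \<le> (r * (\<delta> * m) + \<delta> * e / r) / 2" by blast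
      qed (use \<delta> m0 e0 in auto)
      also have "\<dots> = \<delta> * (sqrt m * sqrt e)" using \<delta>(2) by (simp add: real_sqrt_mult)
      finally show ?thesis unfolding RR by simp
    qed
    finally have "2/3 * (sqrt e * sqrt e) \<le> \<delta> / 3 * sqrt m * sqrt e" using e0 by simp
    then have "2/3 * sqrt e \<le> \<delta> / 3 * sqrt m"
    proof (cases "e = 0")
      case False
      then have "0 < sqrt e" using e0 by simp
      moreover have "2/3 * sqrt e * sqrt e \<le> \<delta> / 3 * sqrt m * sqrt e" using \<open>2/3 * (sqrt e * sqrt e) \<le> \<delta> / 3 * sqrt m * sqrt e\<close> by (simp only: mult.assoc)
      ultimately show ?thesis using mult_right_le_imp_le by blast
    qed (use \<delta> m0 in simp)
    then have "sqrt e \<le> \<delta> * (sqrt m / 2)" by simp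
    also have "\<dots> \<le> \<delta> * cf" using m1 real_sqrt_ge_zero[OF m0] by (intro mult_left_mono \<delta>) linarith
    finally have se: "sqrt e \<le> \<delta> * cf" .
    have "G (U y) - G (U z) = G R" unfolding R_def using UW by (simp add: G_add G_scale)
    then have "\<bar>G (U y) - G (U z)\<bar> \<le> cg * sqrt e" using G_bound(1)[OF R] unfolding e_def by simp
    also have "\<dots> \<le> cg * (\<delta> * cf)" by (rule mult_left_mono[OF se cg(1)])
    also have "\<dots> \<le> C * \<delta>" unfolding C_def using cf cg \<delta>(2) by (simp add: mult_ac)
    finally show ?thesis unfolding z_def .
  qed
  show thesis by (rule that[OF C0 1 2])
qed

end

section \<open>Terms of the anchored decomposition\<close>

definition anchored_term :: "((nat \<Rightarrow> real) \<Rightarrow> real) \<Rightarrow> nat set \<Rightarrow> (nat \<Rightarrow> real) \<Rightarrow> real" where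
  "anchored_term F u y = (\<Sum>v\<in>Pow u. (-1) ^ (card u - card v) * F (anchor v y))"

definition weight_sum :: "nat \<Rightarrow> real" where "weight_sum \<alpha> = (\<Sum>n. mono_weight \<alpha> n)"

definition pos_index :: "nat set \<Rightarrow> nat \<Rightarrow> (nat \<Rightarrow> nat) set" where
  "pos_index u n = {\<nu> \<in> PiE u (\<lambda>_. {1..}). sum \<nu> u \<le> n}"

lemma mono_weight_nonneg: "0 \<le> mono_weight \<alpha> n" by (simp add: mono_weight_def)

lemma weight_sum_nonneg: "0 \<le> weight_sum \<alpha>"
  unfolding weight_sum_def by (intro suminf_nonneg summable_mono_weight mono_weight_nonneg)

lemma anchor_param_seqs: "y \<in> param_seqs \<Longrightarrow> anchor u y \<in> param_seqs"
  unfolding param_seqs_def anchor_def \<Omega>_def by auto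

lemma anchor_anchor: "v \<subseteq> u \<Longrightarrow> anchor v (anchor u y) = anchor v y"
  unfolding anchor_def by (auto simp: fun_eq_iff)

lemma anchored_term_anchor: "anchored_term F u (anchor u y) = anchored_term F u y"
  unfolding anchored_term_def by (intro sum.cong refl) (simp add: anchor_anchor)

lemma pos_index_subset: "finite u \<Longrightarrow> pos_index u n \<subseteq> PiE u (\<lambda>_. {1..n})"
proof
  fix \<nu> assume u: "finite u" and \<nu>: "\<nu> \<in> pos_index u n"
  have "\<nu> j \<le> n" if "j \<in> u" for j
    using member_le_sum[of j u \<nu>] that u \<nu> by (auto simp: pos_index_def)
  then show "\<nu> \<in> PiE u (\<lambda>_. {1..n})" using \<nu> by (auto simp: pos_index_def PiE_iff)
qed

text \<open>All exponents are at least 1 and b j \<le> 1, so b j ^ m \<le> b j: one factor b j per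
  variable survives, and these form \<open>gamma_u\<close>. The sums over the exponents are
  independent and each is at most \<open>weight_sum \<alpha>\<close>.\<close>

lemma sum_weights_le:
  assumes u: "finite u" and b: "\<And>j. 0 < b j" "\<And>j. b j \<le> 1"
  shows "(\<Sum>\<nu>\<in>pos_index u n. (\<Prod>j\<in>u. b j ^ \<nu> j) * (\<Prod>j\<in>u. mono_weight \<alpha> (\<nu> j))) \<le> weight_sum \<alpha> ^ card u * gamma_u b u"
proof -
  have nn: "0 \<le> b j ^ m * mono_weight \<alpha> m" for j m using b(1)[of j] by (simp add: mono_weight_nonneg)
  have "(\<Sum>\<nu>\<in>pos_index u n. (\<Prod>j\<in>u. b j ^ \<nu> j) * (\<Prod>j\<in>u. mono_weight \<alpha> (\<nu> j))) = (\<Sum>\<nu>\<in>pos_index u n. \<Prod>j\<in>u. b j ^ \<nu> j * mono_weight \<alpha> (\<nu> j))"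
    by (simp add: prod.distrib)
  also have "\<dots> \<le> (\<Sum>\<nu>\<in>PiE u (\<lambda>_. {1..n}). \<Prod>j\<in>u. b j ^ \<nu> j * mono_weight \<alpha> (\<nu> j))"
    by (rule sum_mono2[OF finite_PiE pos_index_subset]) (use u nn in \<open>auto intro!: prod_nonneg\<close>)
  also have "\<dots> = (\<Prod>j\<in>u. \<Sum>m\<in>{1..n}. b j ^ m * mono_weight \<alpha> m)" by (rule prod_sum_PiE[symmetric]) (use u in auto)
  also have "\<dots> \<le> (\<Prod>j\<in>u. b j * weight_sum \<alpha>)"
  proof (intro prod_mono conjI)
    fix j
    show "0 \<le> (\<Sum>m\<in>{1..n}. b j ^ m * mono_weight \<alpha> m)" by (intro sum_nonneg nn)
    have "(\<Sum>m\<in>{1..n}. b j ^ m * mono_weight \<alpha> m) \<le> (\<Sum>m\<in>{1..n}. b j * mono_weight \<alpha> m)"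
    proof (intro sum_mono mult_right_mono mono_weight_nonneg)
      fix m assume "m \<in> {1..n}"
      then show "b j ^ m \<le> b j" using power_decreasing[of 1 m "b j"] b[of j] by (simp add: less_imp_le)
    qed
    also have "\<dots> = b j * (\<Sum>m\<in>{1..n}. mono_weight \<alpha> m)" by (rule sum_distrib_left[symmetric])
    also have "\<dots> \<le> b j * weight_sum \<alpha>"
      unfolding weight_sum_def using b(1)[of j] mono_weight_nonneg
      by (intro mult_left_mono sum_le_suminf summable_mono_weight) auto
    finally show "(\<Sum>m\<in>{1..n}. b j ^ m * mono_weight \<alpha> m) \<le> b j * weight_sum \<alpha>" .
  qed
  also have "\<dots> = weight_sum \<alpha> ^ card u * gamma_u b u" by (simp add: prod.distrib gamma_u_def mult.commute)
  finally show ?thesis .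
qed

text \<open>Inclusion-exclusion factorises into the product of y j ^ \<nu> j - 0 ^ \<nu> j. As 0 ^ 0
  = 1, a variable with exponent 0 makes the product vanish.\<close>

lemma sum_anchor_monomial:
  assumes u: "finite u"
  shows "(\<Sum>v\<in>Pow u. (-1) ^ (card u - card v) * (\<Prod>j\<in>u. (anchor v y j :: real) ^ \<nu> j)) =
     (if \<forall>j\<in>u. 1 \<le> \<nu> j then \<Prod>j\<in>u. y j ^ \<nu> j else 0)"
proof -
  have "(\<Sum>v\<in>Pow u. (-1) ^ (card u - card v) * (\<Prod>j\<in>u. anchor v y j ^ \<nu> j)) =
     (\<Sum>v\<in>Pow u. (-1) ^ (card u - card v) * (\<Prod>j\<in>v. y j ^ \<nu> j) * (\<Prod>j\<in>u-v. 0 ^ \<nu> j))"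
  proof (intro sum.cong refl)
    fix v assume v: "v \<in> Pow u"
    have "(\<Prod>j\<in>u. anchor v y j ^ \<nu> j) = (\<Prod>j\<in>v. anchor v y j ^ \<nu> j) * (\<Prod>j\<in>u-v. anchor v y j ^ \<nu> j)"
      using v u by (subst prod.subset_diff[of v]) (auto simp: mult.commute)
    also have "\<dots> = (\<Prod>j\<in>v. y j ^ \<nu> j) * (\<Prod>j\<in>u-v. 0 ^ \<nu> j)"
      by (intro arg_cong2[of _ _ _ _ "(*)"] prod.cong refl) (auto simp: anchor_def)
    finally show "(-1) ^ (card u - card v) * (\<Prod>j\<in>u. anchor v y j ^ \<nu> j) =
        (-1) ^ (card u - card v) * (\<Prod>j\<in>v. y j ^ \<nu> j) * (\<Prod>j\<in>u-v. 0 ^ \<nu> j)" by (simp add: mult.assoc)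
  qed
  also have "\<dots> = (\<Prod>j\<in>u. y j ^ \<nu> j - 0 ^ \<nu> j)" by (rule prod_diff_conv_sum'[OF u, symmetric])
  also have "\<dots> = (if \<forall>j\<in>u. 1 \<le> \<nu> j then \<Prod>j\<in>u. y j ^ \<nu> j else 0)"
  proof (cases "\<forall>j\<in>u. 1 \<le> \<nu> j")
    case True
    then show ?thesis by (auto intro!: prod.cong)
  next
    case False
    then obtain j where "j \<in> u" "\<nu> j = 0" by force
    then have "(\<Prod>j\<in>u. y j ^ \<nu> j - 0 ^ \<nu> j) = 0" using u by (intro prod_zero bexI[of _ j]) auto
    then show ?thesis unfolding if_not_P[OF False] .
  qed
  finally show ?thesis .
qed

lemma anchored_term_expansion:
  assumes F: "power_expansion C b F" and u: "finite u"
  shows "\<exists>t. (\<forall>\<nu>\<in>PiE u (\<lambda>_. UNIV). \<bar>t \<nu>\<bar> \<le> C * (\<Prod>j\<in>u. b j ^ \<nu> j)) \<and>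
    (\<forall>y\<in>param_seqs. (\<lambda>n. \<Sum>\<nu>\<in>pos_index u n. t \<nu> * (\<Prod>j\<in>u. y j ^ \<nu> j)) \<longlonglongrightarrow> anchored_term F u y)"
proof -
  obtain t where t: "\<And>\<nu>. \<nu> \<in> PiE u (\<lambda>_. UNIV) \<Longrightarrow> \<bar>t \<nu>\<bar> \<le> C * (\<Prod>j\<in>u. b j ^ \<nu> j)"
    and lim: "\<And>y. y \<in> param_seqs \<Longrightarrow> (\<forall>j. j \<notin> u \<longrightarrow> y j = 0) \<Longrightarrow>
       (\<lambda>n. \<Sum>k\<le>n. \<Sum>\<nu>\<in>mindex u k. t \<nu> * (\<Prod>j\<in>u. y j ^ \<nu> j)) \<longlonglongrightarrow> F y"
    using F[unfolded power_expansion_def, rule_format, OF u] by blast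
  have "(\<lambda>n. \<Sum>\<nu>\<in>pos_index u n. t \<nu> * (\<Prod>j\<in>u. y j ^ \<nu> j)) \<longlonglongrightarrow> anchored_term F u y" if y: "y \<in> param_seqs" for y
  proof -
    have "(\<lambda>n. \<Sum>v\<in>Pow u. (-1) ^ (card u - card v) * (\<Sum>k\<le>n. \<Sum>\<nu>\<in>mindex u k. t \<nu> * (\<Prod>j\<in>u. anchor v y j ^ \<nu> j)))
        \<longlonglongrightarrow> anchored_term F u y"
      unfolding anchored_term_def
    proof (intro tendsto_sum tendsto_mult tendsto_const lim anchor_param_seqs y)
      fix v assume "v \<in> Pow u"
      then show "\<forall>j. j \<notin> u \<longrightarrow> anchor v y j = 0" by (auto simp: anchor_def)
    qed
    moreover have "(\<Sum>v\<in>Pow u. (-1) ^ (card u - card v) * (\<Sum>k\<le>n. \<Sum>\<nu>\<in>mindex u k. t \<nu> * (\<Prod>j\<in>u. anchor v y j ^ \<nu> j))) =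
        (\<Sum>\<nu>\<in>pos_index u n. t \<nu> * (\<Prod>j\<in>u. y j ^ \<nu> j))" for n
    proof -
      let ?M = "\<Union>k\<in>{..n}. mindex u k"
      have UN: "(\<Sum>k\<le>n. \<Sum>\<nu>\<in>mindex u k. g \<nu>) = (\<Sum>\<nu>\<in>?M. g \<nu>)" for g :: "(nat \<Rightarrow> nat) \<Rightarrow> real"
        by (rule sum.UNION_disjoint[symmetric]) (use finite_mindex[OF u] in \<open>auto simp: mindex_def\<close>)
      have "(\<Sum>v\<in>Pow u. (-1) ^ (card u - card v) * (\<Sum>k\<le>n. \<Sum>\<nu>\<in>mindex u k. t \<nu> * (\<Prod>j\<in>u. anchor v y j ^ \<nu> j))) =
         (\<Sum>v\<in>Pow u. \<Sum>\<nu>\<in>?M. t \<nu> * ((-1) ^ (card u - card v) * (\<Prod>j\<in>u. anchor v y j ^ \<nu> j)))"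
        unfolding UN by (simp add: sum_distrib_left mult_ac)
      also have "\<dots> = (\<Sum>\<nu>\<in>?M. t \<nu> * (\<Sum>v\<in>Pow u. (-1) ^ (card u - card v) * (\<Prod>j\<in>u. anchor v y j ^ \<nu> j)))"
        by (subst sum.swap) (simp add: sum_distrib_left)
      also have "\<dots> = (\<Sum>\<nu>\<in>?M. if \<forall>j\<in>u. 1 \<le> \<nu> j then t \<nu> * (\<Prod>j\<in>u. y j ^ \<nu> j) else 0)"
        unfolding sum_anchor_monomial[OF u] by (intro sum.cong) auto
      also have "\<dots> = (\<Sum>\<nu>\<in>{\<nu>\<in>?M. \<forall>j\<in>u. 1 \<le> \<nu> j}. t \<nu> * (\<Prod>j\<in>u. y j ^ \<nu> j))"
        by (rule sum.inter_filter[symmetric]) (use finite_mindex[OF u] in auto)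
      also have "{\<nu>\<in>?M. \<forall>j\<in>u. 1 \<le> \<nu> j} = pos_index u n"
        by (auto simp: pos_index_def mindex_def PiE_iff)
      finally show ?thesis .
    qed
    ultimately show ?thesis by simp
  qed
  with t show ?thesis by blast
qed

text \<open>This is the hypothesis of the membership criterion. It involves only finitely many
  values, so it passes from the partial sums, where each monomial is dominated separately, to their
  limit.\<close>

lemma dominated_anchored_term:
  fixes m :: nat
  assumes F: "power_expansion C b F" and C: "0 \<le> C" and u: "finite u" and b: "\<And>j. 0 < b j" "\<And>j. b j \<le> 1"
    and \<alpha>: "1 \<le> \<alpha>" and x: "\<And>i. i < m \<Longrightarrow> x i \<in> param_seqs"
  shows "(\<Sum>i<m. c i * anchored_term F u (x i))\<^sup>2 \<le>
    (C * weight_sum \<alpha> ^ card u * gamma_u b u)\<^sup>2 * (\<Sum>i<m. \<Sum>j<m. c i * c j * kernel_u \<alpha> u (x i) (x j))"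
proof -
  obtain t where t: "\<And>\<nu>. \<nu> \<in> PiE u (\<lambda>_. UNIV) \<Longrightarrow> \<bar>t \<nu>\<bar> \<le> C * (\<Prod>j\<in>u. b j ^ \<nu> j)"
    and lim: "\<And>y. y \<in> param_seqs \<Longrightarrow> (\<lambda>n. \<Sum>\<nu>\<in>pos_index u n. t \<nu> * (\<Prod>j\<in>u. y j ^ \<nu> j)) \<longlonglongrightarrow> anchored_term F u y"
    using anchored_term_expansion[OF F u] by blast
  let ?Q = "\<Sum>i<m. \<Sum>j<m. c i * c j * kernel_u \<alpha> u (x i) (x j)"
  let ?A = "C * weight_sum \<alpha> ^ card u * gamma_u b u"
  let ?W = "\<lambda>\<nu>. \<Prod>j\<in>u. mono_weight \<alpha> (\<nu> j)"
  have dom: "(\<Sum>i<m. c i * (\<Prod>j\<in>u. x i j ^ \<nu> j))\<^sup>2 \<le> (?W \<nu>)\<^sup>2 * ?Q" if "\<And>j. j \<in> u \<Longrightarrow> 1 \<le> \<nu> j" for \<nu>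
    by (rule dominated_monomial[OF u \<alpha>]) (use param_seqs_abs_le[OF x] that in auto)
  \<comment> \<open>Nonnegativity of the kernel form is read off from the domination of one fixed
    monomial, all of whose exponents are 1.\<close>
  have Q0: "0 \<le> ?Q"
  proof -
    have "0 \<le> (?W (\<lambda>_. 1))\<^sup>2 * ?Q" using dom[of "\<lambda>_. 1"] by (rule order_trans[rotated]) simp_all
    moreover have "0 < (?W (\<lambda>_. 1))\<^sup>2" using mono_weight_pos[of 1 \<alpha>] by (intro zero_less_power prod_pos) auto
    ultimately show ?thesis
      by (intro mult_left_le_imp_le[of "(?W (\<lambda>_. 1))\<^sup>2" 0 ?Q]) (simp_all only: mult_zero_right)
  qed
  have A0: "0 \<le> ?A" unfolding gamma_u_def
    by (intro mult_nonneg_nonneg zero_le_power prod_nonneg ballI C weight_sum_nonneg less_imp_le[OF b(1)])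
  have "(\<lambda>n. \<bar>\<Sum>i<m. c i * (\<Sum>\<nu>\<in>pos_index u n. t \<nu> * (\<Prod>j\<in>u. x i j ^ \<nu> j))\<bar>) \<longlonglongrightarrow> \<bar>\<Sum>i<m. c i * anchored_term F u (x i)\<bar>"
    by (intro tendsto_rabs tendsto_sum tendsto_mult tendsto_const lim x) auto
  moreover have "\<bar>\<Sum>i<m. c i * (\<Sum>\<nu>\<in>pos_index u n. t \<nu> * (\<Prod>j\<in>u. x i j ^ \<nu> j))\<bar> \<le> ?A * sqrt ?Q" for n
  proof -
    have "(\<Sum>i<m. c i * (\<Sum>\<nu>\<in>pos_index u n. t \<nu> * (\<Prod>j\<in>u. x i j ^ \<nu> j))) =
       (\<Sum>\<nu>\<in>pos_index u n. t \<nu> * (\<Sum>i<m. c i * (\<Prod>j\<in>u. x i j ^ \<nu> j)))"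
      unfolding sum_distrib_left by (subst sum.swap) (simp add: mult_ac)
    also have "\<bar>\<dots>\<bar> \<le> (\<Sum>\<nu>\<in>pos_index u n. \<bar>t \<nu> * (\<Sum>i<m. c i * (\<Prod>j\<in>u. x i j ^ \<nu> j))\<bar>)" by (rule sum_abs)
    also have "\<dots> \<le> (\<Sum>\<nu>\<in>pos_index u n. C * (\<Prod>j\<in>u. b j ^ \<nu> j) * (?W \<nu> * sqrt ?Q))"
    proof (rule sum_mono)
      fix \<nu> assume \<nu>: "\<nu> \<in> pos_index u n"
      have W0: "0 \<le> ?W \<nu>" by (intro prod_nonneg mono_weight_nonneg)
      have "sqrt ((\<Sum>i<m. c i * (\<Prod>j\<in>u. x i j ^ \<nu> j))\<^sup>2) \<le> sqrt ((?W \<nu>)\<^sup>2 * ?Q)"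
        by (intro real_sqrt_le_mono dom) (use \<nu> in \<open>auto simp: pos_index_def PiE_iff\<close>)
      then have "\<bar>\<Sum>i<m. c i * (\<Prod>j\<in>u. x i j ^ \<nu> j)\<bar> \<le> ?W \<nu> * sqrt ?Q"
        using W0 by (simp add: real_sqrt_mult)
      moreover have "\<bar>t \<nu>\<bar> \<le> C * (\<Prod>j\<in>u. b j ^ \<nu> j)" by (rule t) (use \<nu> in \<open>auto simp: pos_index_def PiE_iff\<close>)
      ultimately show "\<bar>t \<nu> * (\<Sum>i<m. c i * (\<Prod>j\<in>u. x i j ^ \<nu> j))\<bar> \<le> C * (\<Prod>j\<in>u. b j ^ \<nu> j) * (?W \<nu> * sqrt ?Q)"
        unfolding abs_mult by (intro mult_mono) (auto intro: order_trans[OF abs_ge_zero])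
    qed
    also have "\<dots> = C * (\<Sum>\<nu>\<in>pos_index u n. (\<Prod>j\<in>u. b j ^ \<nu> j) * ?W \<nu>) * sqrt ?Q"
      by (simp add: sum_distrib_left sum_distrib_right mult_ac)
    also have "\<dots> \<le> C * (weight_sum \<alpha> ^ card u * gamma_u b u) * sqrt ?Q"
      by (intro mult_right_mono mult_left_mono sum_weights_le u b C) (use Q0 in simp)
    finally show ?thesis by (simp add: mult.assoc)
  qed
  ultimately have "\<bar>\<Sum>i<m. c i * anchored_term F u (x i)\<bar> \<le> ?A * sqrt ?Q"
    by (intro LIMSEQ_le_const2) auto
  then have "\<bar>\<Sum>i<m. c i * anchored_term F u (x i)\<bar>\<^sup>2 \<le> (?A * sqrt ?Q)\<^sup>2" by (intro power_mono) auto
  then show ?thesis using Q0 by (simp add: power_mult_distrib)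
qed

text \<open>On the parameter domain |y| ^ m \<le> 1 / 2 ^ m \<le> \<open>mono_weight 1 m\<close> for
  m \<ge> 1, so the summation lemma for the Hilbert space norms serves for the supremum as
  well.\<close>

lemma anchored_term_bound:
  assumes F: "power_expansion C b F" and C: "0 \<le> C" and u: "finite u" and b: "\<And>j. 0 < b j" "\<And>j. b j \<le> 1"
    and y: "y \<in> param_seqs"
  shows "\<bar>anchored_term F u y\<bar> \<le> C * weight_sum 1 ^ card u * gamma_u b u"
proof -
  obtain t where t: "\<And>\<nu>. \<nu> \<in> PiE u (\<lambda>_. UNIV) \<Longrightarrow> \<bar>t \<nu>\<bar> \<le> C * (\<Prod>j\<in>u. b j ^ \<nu> j)"
    and lim: "\<And>y. y \<in> param_seqs \<Longrightarrow> (\<lambda>n. \<Sum>\<nu>\<in>pos_index u n. t \<nu> * (\<Prod>j\<in>u. y j ^ \<nu> j)) \<longlonglongrightarrow> anchored_term F u y"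
    using anchored_term_expansion[OF F u] by blast
  have "(\<lambda>n. \<bar>\<Sum>\<nu>\<in>pos_index u n. t \<nu> * (\<Prod>j\<in>u. y j ^ \<nu> j)\<bar>) \<longlonglongrightarrow> \<bar>anchored_term F u y\<bar>"
    by (intro tendsto_rabs lim y)
  moreover have "\<bar>\<Sum>\<nu>\<in>pos_index u n. t \<nu> * (\<Prod>j\<in>u. y j ^ \<nu> j)\<bar> \<le> C * weight_sum 1 ^ card u * gamma_u b u" for n
  proof -
    have "\<bar>\<Sum>\<nu>\<in>pos_index u n. t \<nu> * (\<Prod>j\<in>u. y j ^ \<nu> j)\<bar> \<le> (\<Sum>\<nu>\<in>pos_index u n. \<bar>t \<nu> * (\<Prod>j\<in>u. y j ^ \<nu> j)\<bar>)" by (rule sum_abs)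
    also have "\<dots> \<le> (\<Sum>\<nu>\<in>pos_index u n. C * ((\<Prod>j\<in>u. b j ^ \<nu> j) * (\<Prod>j\<in>u. mono_weight 1 (\<nu> j))))"
    proof (rule sum_mono)
      fix \<nu> assume \<nu>: "\<nu> \<in> pos_index u n"
      have "\<bar>\<Prod>j\<in>u. y j ^ \<nu> j\<bar> = (\<Prod>j\<in>u. \<bar>y j\<bar> ^ \<nu> j)" by (simp add: abs_prod power_abs)
      also have "\<dots> \<le> (\<Prod>j\<in>u. mono_weight 1 (\<nu> j))"
      proof (intro prod_mono conjI)
        fix j assume j: "j \<in> u"
        then have n1: "1 \<le> \<nu> j" using \<nu> by (auto simp: pos_index_def PiE_iff)
        have "\<bar>y j\<bar> ^ \<nu> j \<le> (1/2) ^ \<nu> j" by (intro power_mono param_seqs_abs_le y) auto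
        also have "\<dots> = 1 * (1/2) ^ \<nu> j" by simp
        also have "\<dots> \<le> real (\<nu> j) * 2 * (1/2) ^ \<nu> j" by (intro mult_right_mono) (use n1 in auto)
        finally show "\<bar>y j\<bar> ^ \<nu> j \<le> mono_weight 1 (\<nu> j)" by (simp add: mono_weight_def power_divide)
      qed simp
      finally have "\<bar>\<Prod>j\<in>u. y j ^ \<nu> j\<bar> \<le> (\<Prod>j\<in>u. mono_weight 1 (\<nu> j))" .
      moreover have "\<bar>t \<nu>\<bar> \<le> C * (\<Prod>j\<in>u. b j ^ \<nu> j)" by (rule t) (use \<nu> in \<open>auto simp: pos_index_def PiE_iff\<close>)
      ultimately show "\<bar>t \<nu> * (\<Prod>j\<in>u. y j ^ \<nu> j)\<bar> \<le> C * ((\<Prod>j\<in>u. b j ^ \<nu> j) * (\<Prod>j\<in>u. mono_weight 1 (\<nu> j)))"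
        unfolding abs_mult mult.assoc[symmetric] by (intro mult_mono) (auto intro: order_trans[OF abs_ge_zero])
    qed
    also have "\<dots> \<le> C * (weight_sum 1 ^ card u * gamma_u b u)"
      unfolding sum_distrib_left[symmetric] by (intro mult_left_mono sum_weights_le u b C)
    finally show ?thesis by (simp add: mult.assoc)
  qed
  ultimately show ?thesis by (intro LIMSEQ_le_const2) auto
qed

text \<open>Moebius inversion on the lattice of subsets: the signs over all sets between w and u add
  up to 0 unless w = u.\<close>

lemma sum_anchored_terms:
  assumes u: "finite u" shows "(\<Sum>v\<in>Pow u. anchored_term F v y) = F (anchor u y)"
  using u
proof (induction u rule: finite_psubset_induct)
  case (psubset u)
  have "(\<Sum>v\<in>Pow u. anchored_term F v y) = (\<Sum>v\<in>Pow u. \<Sum>w\<in>Pow u. if w \<subseteq> v then (-1) ^ (card v - card w) * F (anchor w y) else 0)"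
  proof (rule sum.cong[OF refl])
    fix v assume v: "v \<in> Pow u"
    have "anchored_term F v y = (\<Sum>w\<in>{w\<in>Pow u. w \<subseteq> v}. (-1) ^ (card v - card w) * F (anchor w y))"
      unfolding anchored_term_def by (rule sum.cong) (use v in auto)
    also have "\<dots> = (\<Sum>w\<in>Pow u. if w \<subseteq> v then (-1) ^ (card v - card w) * F (anchor w y) else 0)"
      by (rule sum.inter_filter) (use psubset.hyps in simp)
    finally show "anchored_term F v y = \<dots>" .
  qed
  also have "\<dots> = (\<Sum>w\<in>Pow u. \<Sum>v\<in>Pow u. if w \<subseteq> v then (-1) ^ (card v - card w) * F (anchor w y) else 0)"
    by (rule sum.swap)
  also have "\<dots> = (\<Sum>w\<in>Pow u. if w = u then F (anchor w y) else 0)"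
  proof (rule sum.cong[OF refl])
    fix w assume w: "w \<in> Pow u"
    then have fw: "finite w" "finite (u - w)" using psubset.hyps finite_subset by auto
    have "(\<Sum>v\<in>Pow u. if w \<subseteq> v then (-1) ^ (card v - card w) * F (anchor w y) else 0) =
        (\<Sum>v\<in>{v\<in>Pow u. w \<subseteq> v}. (-1) ^ (card v - card w) * F (anchor w y))"
      by (rule sum.inter_filter[symmetric]) (use psubset.hyps in simp)
    also have "\<dots> = (\<Sum>z\<in>Pow (u - w). (-1) ^ card z * F (anchor w y))"
    proof (rule sum.reindex_bij_witness[where i = "\<lambda>z. w \<union> z" and j = "\<lambda>v. v - w"])
      fix v assume v: "v \<in> {v\<in>Pow u. w \<subseteq> v}"
      then have "card (v - w) = card v - card w" using fw by (intro card_Diff_subset) auto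
      then show "(-1) ^ card (v - w) * F (anchor w y) = (-1) ^ (card v - card w) * F (anchor w y)" by simp
    qed (use w in auto)
    also have "\<dots> = (\<Prod>j\<in>u - w. 1 - (1::real)) * F (anchor w y)"
      unfolding prod_diff_conv_sum[OF fw(2)] by (simp add: sum_distrib_right)
    also have "\<dots> = (if w = u then F (anchor w y) else 0)"
    proof (cases "w = u")
      case False
      then have "u - w \<noteq> {}" using w by auto
      then show ?thesis using False fw by (simp add: card_gt_0_iff)
    qed simp
    finally show "(\<Sum>v\<in>Pow u. if w \<subseteq> v then (-1) ^ (card v - card w) * F (anchor w y) else 0) = \<dots>" .
  qed
  also have "\<dots> = F (anchor u y)" using psubset.hyps by simp
  finally show ?case .
qed

text \<open>Members of the space vanish outside \<open>box_u u\<close> by convention, which is the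
  reason for the cut-off in \<open>F'\<close>.\<close>

lemma anchored_term_rkhs:
  assumes F: "power_expansion C b F" and C: "0 \<le> C" and u: "finite u" and b: "\<And>j. 0 < b j" "\<And>j. b j \<le> 1"
    and \<alpha>: "1 \<le> \<alpha>" and rk: "is_rkhs (box_u u) (kernel_u \<alpha> u) H ip"
  defines "F' \<equiv> \<lambda>y. if y \<in> box_u u then anchored_term F u y else 0"
  shows "F' \<in> H" "sqrt (ip F' F') \<le> C * weight_sum \<alpha> ^ card u * gamma_u b u"
proof -
  interpret rkhs "box_u u" "kernel_u \<alpha> u" H ip by (rule rkhs.intro[OF rk])
  let ?A = "C * weight_sum \<alpha> ^ card u * gamma_u b u"
  have A0: "0 \<le> ?A" unfolding gamma_u_def
    by (intro mult_nonneg_nonneg zero_le_power prod_nonneg ballI C weight_sum_nonneg less_imp_le[OF b(1)])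
  have bound: "(\<Sum>(c, x)\<leftarrow>xs. c * F' x)\<^sup>2 \<le> ?A\<^sup>2 * (\<Sum>(c, x)\<leftarrow>xs. \<Sum>(c', x')\<leftarrow>xs. c * c' * kernel_u \<alpha> u x x')"
    if xs: "snd ` set xs \<subseteq> box_u u" for xs :: "(real \<times> (nat \<Rightarrow> real)) list"
  proof -
    let ?m = "length xs"
    have mem: "snd (xs ! i) \<in> box_u u" if "i < ?m" for i using xs that by auto
    have "(\<Sum>i<?m. fst (xs ! i) * anchored_term F u (snd (xs ! i)))\<^sup>2 \<le> ?A\<^sup>2 *
      (\<Sum>i<?m. \<Sum>j<?m. fst (xs ! i) * fst (xs ! j) * kernel_u \<alpha> u (snd (xs ! i)) (snd (xs ! j)))"
      by (rule dominated_anchored_term[OF F C u b \<alpha>]) (use mem in \<open>auto simp: box_u_def\<close>)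
    moreover have "(\<Sum>(c, x)\<leftarrow>xs. c * F' x) = (\<Sum>i<?m. fst (xs ! i) * anchored_term F u (snd (xs ! i)))"
      using mem by (simp add: sum_list_sum_nth atLeast0LessThan case_prod_beta F'_def)
    moreover have "(\<Sum>(c, x)\<leftarrow>xs. \<Sum>(c', x')\<leftarrow>xs. c * c' * kernel_u \<alpha> u x x') =
       (\<Sum>i<?m. \<Sum>j<?m. fst (xs ! i) * fst (xs ! j) * kernel_u \<alpha> u (snd (xs ! i)) (snd (xs ! j)))"
      by (simp add: sum_list_sum_nth atLeast0LessThan case_prod_beta)
    ultimately show ?thesis by simp
  qed
  have out: "F' x = 0" if "x \<notin> box_u u" for x using that by (simp add: F'_def)
  show "F' \<in> H" by (rule criterion(1)[OF out A0 bound])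
  have "ip F' F' \<le> ?A\<^sup>2" by (rule criterion(2)[OF out A0 bound])
  then have "sqrt (ip F' F') \<le> sqrt (?A\<^sup>2)" by (rule real_sqrt_le_mono)
  then show "sqrt (ip F' F') \<le> ?A" using A0 by simp
qed

section \<open>Cubature points and truncation\<close>

lemma bdigit_bounds: "0 \<le> real_of_int (bdigit a x)" "real_of_int (bdigit a x) \<le> 1"
proof -
  have "0 \<le> bdigit a x \<and> bdigit a x \<le> 1" unfolding bdigit_def by auto
  then show "0 \<le> real_of_int (bdigit a x)" "real_of_int (bdigit a x) \<le> 1" by auto
qed

lemma suminf_bounds:
  fixes T :: "nat \<Rightarrow> real"
  assumes "\<And>a. 0 \<le> T a" "\<And>a. T a \<le> (1 - c) * c ^ a" "0 \<le> c" "c < 1"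
  shows "0 \<le> suminf T" "suminf T \<le> 1" "summable T"
proof -
  have s: "(\<lambda>a. (1 - c) * c ^ a) sums ((1 - c) * (1 / (1 - c)))"
    by (intro sums_mult geometric_sums) (use assms in simp)
  show T: "summable T"
    by (rule summable_comparison_test'[OF sums_summable[OF s], of 0]) (use assms in auto)
  then show "0 \<le> suminf T" using assms by (intro suminf_nonneg)
  have "suminf T \<le> (\<Sum>a. (1 - c) * c ^ a)" by (rule suminf_le[OF assms(2) T sums_summable[OF s]])
  also have "\<dots> = 1" using sums_unique[OF s] assms by simp
  finally show "suminf T \<le> 1" .
qed

text \<open>Binary digits are 0 or 1 for every real z, so nothing about lattices enters. Block a
  contributes at most (1 - c) * c ^ a with c = (1/2) ^ \<alpha>, a geometric series of sum 1. The
  value 1 is harmless, as the box of parameters is closed.\<close>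

lemma interlace_bounds:
  assumes "1 \<le> \<alpha>" shows "0 \<le> interlace \<alpha> z i" "interlace \<alpha> z i \<le> 1"
proof -
  define T where "T a = (\<Sum>r=1..\<alpha>. real_of_int (bdigit (Suc a) (z (\<alpha> * i + r - 1))) / 2 ^ (r + a * \<alpha>))" for a
  have g: "(\<Sum>r=1..\<alpha>. (1/2::real) ^ r) = 1 - (1/2) ^ \<alpha>" for \<alpha>
    by (induction \<alpha>) auto
  have T0: "0 \<le> T a" for a unfolding T_def by (intro sum_nonneg divide_nonneg_nonneg bdigit_bounds) simp
  have T1: "T a \<le> (1 - (1/2) ^ \<alpha>) * ((1/2) ^ \<alpha>) ^ a" for a
  proof -
    have "T a \<le> (\<Sum>r=1..\<alpha>. 1 / 2 ^ (r + a * \<alpha>))"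
      unfolding T_def by (intro sum_mono divide_right_mono bdigit_bounds) simp
    also have "\<dots> = (\<Sum>r=1..\<alpha>. (1/2) ^ r * ((1/2) ^ \<alpha>) ^ a)"
      by (intro sum.cong refl) (simp add: power_add power_divide power_mult mult.commute)
    also have "\<dots> = (1 - (1/2) ^ \<alpha>) * ((1/2) ^ \<alpha>) ^ a" unfolding g[symmetric] by (rule sum_distrib_right[symmetric])
    finally show ?thesis .
  qed
  have c: "(1/2::real) ^ \<alpha> < 1" using assms by (intro power_Suc_less_one[of "1/2" "\<alpha> - 1", simplified] | simp add: power_less_one_iff)+
  have "interlace \<alpha> z i = suminf T" unfolding interlace_def T_def ..
  then show "0 \<le> interlace \<alpha> z i" "interlace \<alpha> z i \<le> 1"
    using suminf_bounds[of T "(1/2) ^ \<alpha>", OF T0 T1] c by auto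
qed

lemma digital_shift_bounds: "0 \<le> digital_shift x \<delta>" "digital_shift x \<delta> \<le> 1"
proof -
  define T where "T a = real_of_int ((bdigit (Suc a) x + bdigit (Suc a) \<delta>) mod 2) / 2 ^ Suc a" for a
  have m: "0 \<le> real_of_int (k mod 2)" "real_of_int (k mod 2) \<le> 1" for k :: int
  proof -
    have "0 \<le> k mod 2 \<and> k mod 2 \<le> 1" by auto
    then show "0 \<le> real_of_int (k mod 2)" "real_of_int (k mod 2) \<le> 1" by auto
  qed
  have T0: "0 \<le> T a" for a unfolding T_def by (intro divide_nonneg_nonneg m) simp
  have T1: "T a \<le> (1 - 1/2) * (1/2) ^ a" for a
  proof -
    have "T a \<le> 1 / 2 ^ Suc a" unfolding T_def by (intro divide_right_mono m) simp
    then show ?thesis by (simp add: power_divide)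
  qed
  have "digital_shift x \<delta> = suminf T" unfolding digital_shift_def T_def ..
  then show "0 \<le> digital_shift x \<delta>" "digital_shift x \<delta> \<le> 1"
    using suminf_bounds[of T "1/2", OF T0 T1] by auto
qed

lemma measurable_digital_shift: "digital_shift x \<in> borel_measurable borel"
  unfolding digital_shift_def[abs_def] bdigit_def by measurable

lemma shifted_box:
  assumes "\<And>j. j \<in> u \<Longrightarrow> 0 \<le> f j" "\<And>j. j \<in> u \<Longrightarrow> f j \<le> 1"
  shows "(\<lambda>j. if j \<in> u then f j - 1/2 else 0) \<in> box_u u"
  using assms unfolding box_u_def param_seqs_def \<Omega>_def by auto

lemma average_cong: "(\<And>k. pts k \<in> B) \<Longrightarrow> (\<And>y. y \<in> B \<Longrightarrow> F y = F' y) \<Longrightarrow> average n pts F = average n pts F'"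
  unfolding average_def by simp

text \<open>The rule sees its integrand only on the box; hence the finite element functional may be
  exchanged for its cut-off version, the one that belongs to the Hilbert space.\<close>

lemma interlaced_rule_cong:
  assumes "1 \<le> \<alpha>" "\<And>y. y \<in> box_u u \<Longrightarrow> F y = F' y"
  shows "interlaced_rule \<alpha> P q u n F = interlaced_rule \<alpha> P q u n F'"
  unfolding interlaced_rule_def
  by (rule average_cong[of _ "box_u u"], rule shifted_box) (use assms interlace_bounds in auto)

lemma shifted_rule_cong:
  assumes "\<And>y. y \<in> box_u u \<Longrightarrow> F y = F' y"
  shows "shifted_rule P q u n \<delta> F = shifted_rule P q u n \<delta> F'"
  unfolding shifted_rule_def
  by (rule average_cong[of _ "box_u u"], rule shifted_box) (use assms digital_shift_bounds in auto)

section \<open>Product measures and measurability in the parameters\<close>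

lemma unif_prob: "prob_space unif_\<Omega>"
  unfolding unif_\<Omega>_def \<Omega>_def by (rule prob_spaceI) (simp add: emeasure_restrict_space space_restrict_space)

lemma unif_01_prob: "prob_space unif_01"
  unfolding unif_01_def by (rule prob_spaceI) (simp add: emeasure_restrict_space space_restrict_space)

lemma space_PiM_unif: "space (PiM u (\<lambda>_. unif_\<Omega>)) = PiE u (\<lambda>_. \<Omega>)"
  by (simp add: space_PiM unif_\<Omega>_def space_restrict_space)

lemma anchor_in_box: "y \<in> space (PiM u (\<lambda>_. unif_\<Omega>)) \<Longrightarrow> anchor u y \<in> box_u u"
  unfolding space_PiM_unif by (auto simp: anchor_def box_u_def param_seqs_def \<Omega>_def PiE_iff)

lemma measurable_coord: "j \<in> u \<Longrightarrow> (\<lambda>y. y j) \<in> borel_measurable (PiM u (\<lambda>_. restrict_space lborel (A :: real set)))"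
proof -
  let ?R = "restrict_space lborel A"
  assume "j \<in> u"
  then have "(\<lambda>y. y j) \<in> measurable (PiM u (\<lambda>_. ?R)) ?R" by (rule measurable_component_singleton)
  moreover have "(\<lambda>x. x) \<in> borel_measurable ?R" by (rule measurable_restrict_space1) simp
  ultimately show ?thesis by (rule measurable_compose)
qed

lemma integral_fin_cong: "(\<And>y. y \<in> box_u u \<Longrightarrow> F y = F' y) \<Longrightarrow> integral_fin u F = integral_fin u F'"
  unfolding integral_fin_def by (rule Bochner_Integration.integral_cong) (auto simp: anchor_in_box)

text \<open>The dependence of a solution on y is not given as measurable; the expansion supplies
  this, as a pointwise limit of polynomials.\<close>

lemma measurable_anchored_term:
  assumes F: "power_expansion C b F" and u: "finite u"
    and g: "\<And>x. x \<in> space M \<Longrightarrow> g x \<in> param_seqs" "\<And>j. j \<in> u \<Longrightarrow> (\<lambda>x. g x j) \<in> borel_measurable M"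
  shows "(\<lambda>x. anchored_term F u (g x)) \<in> borel_measurable M"
proof -
  obtain t where lim: "\<And>y. y \<in> param_seqs \<Longrightarrow> (\<lambda>n. \<Sum>\<nu>\<in>pos_index u n. t \<nu> * (\<Prod>j\<in>u. y j ^ \<nu> j)) \<longlonglongrightarrow> anchored_term F u y"
    using anchored_term_expansion[OF F u] by blast
  show ?thesis
  proof (rule borel_measurable_LIMSEQ_real)
    show "(\<lambda>n. \<Sum>\<nu>\<in>pos_index u n. t \<nu> * (\<Prod>j\<in>u. g x j ^ \<nu> j)) \<longlonglongrightarrow> anchored_term F u (g x)" if "x \<in> space M" for x
      by (rule lim[OF g(1)[OF that]])
    show "(\<lambda>x. \<Sum>\<nu>\<in>pos_index u n. t \<nu> * (\<Prod>j\<in>u. g x j ^ \<nu> j)) \<in> borel_measurable M" for n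
      by (intro borel_measurable_sum borel_measurable_times borel_measurable_const borel_measurable_prod borel_measurable_power g(2)) auto
  qed
qed

section \<open>The exact functional as limit of its discretisations\<close>

locale fe_family =
  fixes F :: "(nat \<Rightarrow> real) \<Rightarrow> real" and Fh :: "real \<Rightarrow> (nat \<Rightarrow> real) \<Rightarrow> real" and C \<tau> :: real and b :: "nat \<Rightarrow> real"
  assumes C: "0 \<le> C" and \<tau>: "0 < \<tau>" and b: "\<And>j. 0 < b j" "\<And>j. b j \<le> 1" "b \<longlonglongrightarrow> 0"
    and exp_h: "\<And>h. 0 < h \<Longrightarrow> power_expansion C b (Fh h)"
    and conv: "\<And>h y. 0 < h \<Longrightarrow> y \<in> param_seqs \<Longrightarrow> \<bar>F y - Fh h y\<bar> \<le> C * h powr \<tau>"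
    and tail_h: "\<And>h y N \<delta>. 0 < h \<Longrightarrow> y \<in> param_seqs \<Longrightarrow> (\<And>j. j \<ge> N \<Longrightarrow> b j \<le> \<delta>) \<Longrightarrow> 0 \<le> \<delta> \<Longrightarrow> \<delta> \<le> 1 \<Longrightarrow>
        \<bar>Fh h y - Fh h (anchor {..<N} y)\<bar> \<le> C * \<delta>"
begin

lemma Fh_lim: assumes y: "y \<in> param_seqs" shows "(\<lambda>n. Fh (inverse (real (Suc n))) y) \<longlonglongrightarrow> F y"
proof -
  have "(\<lambda>n. inverse (real (Suc n)) powr \<tau>) \<longlonglongrightarrow> 0"
    using tendsto_powr'[OF LIMSEQ_inverse_real_of_nat tendsto_const[of \<tau>]] \<tau> by simp
  then have "(\<lambda>n. C * inverse (real (Suc n)) powr \<tau>) \<longlonglongrightarrow> C * 0" by (intro tendsto_intros)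
  then have z: "(\<lambda>n. C * inverse (real (Suc n)) powr \<tau>) \<longlonglongrightarrow> 0" by simp
  have "norm (Fh (inverse (real (Suc n))) y - F y) \<le> C * inverse (real (Suc n)) powr \<tau>" for n
    using conv[of "inverse (real (Suc n))", OF _ y] by (simp add: abs_minus_commute del: of_nat_Suc)
  then have "(\<lambda>n. Fh (inverse (real (Suc n))) y - F y) \<longlonglongrightarrow> 0"
    by (intro Lim_null_comparison[OF always_eventually[OF allI] z])
  then show ?thesis by (simp add: LIM_zero_iff)
qed

lemma tail:
  assumes y: "y \<in> param_seqs" and \<delta>: "\<And>j. j \<ge> N \<Longrightarrow> b j \<le> \<delta>" "0 \<le> \<delta>" "\<delta> \<le> 1"
  shows "\<bar>F y - F (anchor {..<N} y)\<bar> \<le> C * \<delta>"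
proof (rule LIMSEQ_le_const2)
  show "(\<lambda>n. \<bar>Fh (inverse (real (Suc n))) y - Fh (inverse (real (Suc n))) (anchor {..<N} y)\<bar>) \<longlonglongrightarrow> \<bar>F y - F (anchor {..<N} y)\<bar>"
    by (intro tendsto_intros Fh_lim y anchor_param_seqs)
  show "\<exists>M. \<forall>n\<ge>M. \<bar>Fh (inverse (real (Suc n))) y - Fh (inverse (real (Suc n))) (anchor {..<N} y)\<bar> \<le> C * \<delta>"
    using tail_h[OF _ y \<delta>] by (auto simp del: of_nat_Suc)
qed

lemma anchored_term_Fh_lim:
  assumes y: "y \<in> param_seqs"
  shows "(\<lambda>n. anchored_term (Fh (inverse (real (Suc n)))) u y) \<longlonglongrightarrow> anchored_term F u y"
  unfolding anchored_term_def by (intro tendsto_sum tendsto_mult tendsto_const Fh_lim anchor_param_seqs y)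

lemma anchored_term_F_bound:
  assumes u: "finite u" and y: "y \<in> param_seqs"
  shows "\<bar>anchored_term F u y\<bar> \<le> C * weight_sum 1 ^ card u * gamma_u b u"
proof (rule LIMSEQ_le_const2)
  show "(\<lambda>n. \<bar>anchored_term (Fh (inverse (real (Suc n)))) u y\<bar>) \<longlonglongrightarrow> \<bar>anchored_term F u y\<bar>"
    by (intro tendsto_intros anchored_term_Fh_lim y)
  show "\<exists>M. \<forall>n\<ge>M. \<bar>anchored_term (Fh (inverse (real (Suc n)))) u y\<bar> \<le> C * weight_sum 1 ^ card u * gamma_u b u"
    using anchored_term_bound[OF exp_h C u b(1,2) y] by (auto simp del: of_nat_Suc)
qed

lemma measurable_anchored_F:
  assumes u: "finite u"
    and g: "\<And>x. x \<in> space M \<Longrightarrow> g x \<in> param_seqs" "\<And>j. j \<in> u \<Longrightarrow> (\<lambda>x. g x j) \<in> borel_measurable M"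
  shows "(\<lambda>x. anchored_term F u (g x)) \<in> borel_measurable M"
proof (rule borel_measurable_LIMSEQ_real)
  show "(\<lambda>n. anchored_term (Fh (inverse (real (Suc n)))) u (g x)) \<longlonglongrightarrow> anchored_term F u (g x)" if "x \<in> space M" for x
    by (rule anchored_term_Fh_lim[OF g(1)[OF that]])
  show "(\<lambda>x. anchored_term (Fh (inverse (real (Suc n)))) u (g x)) \<in> borel_measurable M" for n
    by (rule measurable_anchored_term[OF exp_h u g]) (auto simp del: of_nat_Suc)
qed

lemma anchored_term_diff:
  assumes h: "0 < h" and u: "finite u" and y: "y \<in> param_seqs"
  shows "\<bar>anchored_term F u y - anchored_term (Fh h) u y\<bar> \<le> 2 ^ card u * (C * h powr \<tau>)"
proof -
  have "anchored_term F u y - anchored_term (Fh h) u y =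
      (\<Sum>v\<in>Pow u. (-1) ^ (card u - card v) * (F (anchor v y) - Fh h (anchor v y)))"
    unfolding anchored_term_def by (simp add: sum_subtractf right_diff_distrib)
  also have "\<bar>\<dots>\<bar> \<le> (\<Sum>v\<in>Pow u. \<bar>(-1) ^ (card u - card v) * (F (anchor v y) - Fh h (anchor v y))\<bar>)" by (rule sum_abs)
  also have "\<dots> \<le> (\<Sum>v\<in>Pow u. C * h powr \<tau>)"
    by (intro sum_mono) (simp add: abs_mult power_abs conv[OF h anchor_param_seqs[OF y]])
  finally show ?thesis by (simp add: card_Pow u)
qed

text \<open>With the parameters cut off after N, the value is a finite sum over the subsets of
  \<open>{..<N}\<close>, and those outside U contribute at most C * T. N has to contain all of U and
  to make the neglected b j small; letting the cut-off error tend to 0 leaves C * T.\<close>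

lemma truncation_pointwise:
  assumes U: "finite U" "\<And>u. u \<in> U \<Longrightarrow> finite u"
    and T: "\<And>V. finite V \<Longrightarrow> V \<inter> U = {} \<Longrightarrow> (\<And>v. v \<in> V \<Longrightarrow> finite v) \<Longrightarrow> (\<Sum>v\<in>V. weight_sum 1 ^ card v * gamma_u b v) \<le> T"
    and y: "y \<in> param_seqs"
  shows "\<bar>F y - (\<Sum>u\<in>U. anchored_term F u y)\<bar> \<le> C * T"
proof (rule field_le_epsilon)
  fix e :: real assume e: "0 < e"
  define \<delta> where "\<delta> = min 1 (e / (C + 1))"
  have \<delta>: "0 < \<delta>" "\<delta> \<le> 1" "C * \<delta> \<le> e"
  proof -
    show "0 < \<delta>" "\<delta> \<le> 1" using e C by (auto simp: \<delta>_def)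
    have "C * \<delta> \<le> C * (e / (C + 1))" using C by (intro mult_left_mono) (auto simp: \<delta>_def)
    also have "\<dots> \<le> e" using C e by (simp add: field_simps)
    finally show "C * \<delta> \<le> e" .
  qed
  obtain N1 where N1: "\<And>j. j \<ge> N1 \<Longrightarrow> b j \<le> \<delta>"
    using order_tendstoD(2)[OF b(3) \<delta>(1)] unfolding eventually_sequentially by (auto intro: less_imp_le)
  obtain N2 where N2: "\<Union>U \<subseteq> {..<N2}" using U by (metis finite_Union finite_nat_iff_bounded)
  define N where "N = max N1 N2"
  have sub: "U \<subseteq> Pow {..<N}" using N2 unfolding N_def by fastforce
  have "F (anchor {..<N} y) - (\<Sum>u\<in>U. anchored_term F u y) = (\<Sum>v\<in>Pow {..<N} - U. anchored_term F v y)"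
    unfolding sum_anchored_terms[OF finite_lessThan, symmetric] by (subst sum_diff) (use sub in auto)
  also have "\<bar>\<dots>\<bar> \<le> (\<Sum>v\<in>Pow {..<N} - U. \<bar>anchored_term F v y\<bar>)" by (rule sum_abs)
  also have "\<dots> \<le> (\<Sum>v\<in>Pow {..<N} - U. C * (weight_sum 1 ^ card v * gamma_u b v))"
  proof (rule sum_mono)
    fix v assume "v \<in> Pow {..<N} - U"
    then have "finite v" by (auto intro: finite_subset)
    then show "\<bar>anchored_term F v y\<bar> \<le> C * (weight_sum 1 ^ card v * gamma_u b v)"
      using anchored_term_F_bound[OF _ y] by (simp add: mult.assoc)
  qed
  also have "\<dots> \<le> C * T" unfolding sum_distrib_left[symmetric]
    by (intro mult_left_mono T C) (auto intro: finite_subset)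
  finally have 1: "\<bar>F (anchor {..<N} y) - (\<Sum>u\<in>U. anchored_term F u y)\<bar> \<le> C * T" .
  have "\<bar>F y - F (anchor {..<N} y)\<bar> \<le> C * \<delta>" by (rule tail[OF y]) (use N1 \<delta> in \<open>auto simp: N_def\<close>)
  with 1 \<delta>(3) show "\<bar>F y - (\<Sum>u\<in>U. anchored_term F u y)\<bar> \<le> C * T + e" by linarith
qed

lemma bounded_F: "\<exists>B. \<forall>y\<in>param_seqs. \<bar>F y\<bar> \<le> B"
proof -
  have "\<bar>F y\<bar> \<le> \<bar>F (\<lambda>_. 0)\<bar> + C * 1" if "y \<in> param_seqs" for y
  proof -
    have "anchor {..<0} y = (\<lambda>_. 0)" by (simp add: anchor_def)
    then have "\<bar>F y - F (\<lambda>_. 0)\<bar> \<le> C * 1" using tail[OF that, of 0 1] b(2) by simp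
    then show ?thesis by linarith
  qed
  then show ?thesis by blast
qed

lemma measurable_F: "F \<in> borel_measurable (PiM UNIV (\<lambda>_. unif_\<Omega>))"
proof (rule borel_measurable_LIMSEQ_real)
  let ?M = "PiM UNIV (\<lambda>_::nat. unif_\<Omega>)"
  have sp: "y \<in> param_seqs" if "y \<in> space ?M" for y
    using that unfolding space_PiM_unif by (auto simp: param_seqs_def PiE_iff)
  show "(\<lambda>y. F (anchor {..<N} y)) \<in> borel_measurable ?M" for N
  proof -
    have "(\<lambda>y. \<Sum>v\<in>Pow {..<N}. anchored_term F v y) \<in> borel_measurable ?M"
    proof (rule borel_measurable_sum)
      fix v assume "v \<in> Pow {..<N}"
      then have v: "finite v" by (auto intro: finite_subset)
      show "anchored_term F v \<in> borel_measurable ?M"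
        by (rule measurable_anchored_F[OF v, where g = "\<lambda>y. y"])
          (use sp in \<open>simp_all add: unif_\<Omega>_def measurable_coord\<close>)
    qed
    then show ?thesis by (simp add: sum_anchored_terms)
  qed
  fix y assume "y \<in> space ?M"
  then have y: "y \<in> param_seqs" by (rule sp)
  show "(\<lambda>N. F (anchor {..<N} y)) \<longlonglongrightarrow> F y"
  proof (rule LIMSEQ_I)
    fix e :: real assume e: "0 < e"
    define \<delta> where "\<delta> = min 1 (e / (C + 1))"
    have \<delta>: "0 < \<delta>" "\<delta> \<le> 1" using e C by (auto simp: \<delta>_def)
    have "C * \<delta> \<le> C * (e / (C + 1))" using C by (intro mult_left_mono) (auto simp: \<delta>_def)
    also have "\<dots> < e" using C e by (simp add: field_simps)
    finally have \<delta>e: "C * \<delta> < e" .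
    obtain N1 where N1: "\<And>j. j \<ge> N1 \<Longrightarrow> b j \<le> \<delta>"
      using order_tendstoD(2)[OF b(3) \<delta>(1)] unfolding eventually_sequentially by (auto intro: less_imp_le)
    have "norm (F (anchor {..<N} y) - F y) < e" if "N \<ge> N1" for N
    proof -
      have "\<bar>F y - F (anchor {..<N} y)\<bar> \<le> C * \<delta>" by (rule tail[OF y]) (use N1 \<delta> that in auto)
      then show ?thesis using \<delta>e by (simp add: abs_minus_commute)
    qed
    then show "\<exists>N0. \<forall>N\<ge>N0. norm (F (anchor {..<N} y) - F y) < e" by blast
  qed
qed

text \<open>Puts the integrals over different sets of variables on one infinite product space, where
  the pointwise truncation bound can be integrated at once.\<close>

lemma integral_fin_eq:
  assumes u: "finite u" and m: "(\<lambda>y. f (anchor u y)) \<in> borel_measurable (PiM u (\<lambda>_. unif_\<Omega>))"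
  shows "integral_fin u f = (LINT y|PiM UNIV (\<lambda>_. unif_\<Omega>). f (anchor u y))"
proof -
  interpret product_prob_space "\<lambda>_::nat. unif_\<Omega>" UNIV
    by (rule product_prob_spaceI) (rule unif_prob)
  have "integral_fin u f = (LINT y|distr (PiM UNIV (\<lambda>_. unif_\<Omega>)) (PiM u (\<lambda>_. unif_\<Omega>)) (\<lambda>x. restrict x u). f (anchor u y))"
    unfolding integral_fin_def using distr_PiM_restrict_finite[OF u] by simp
  also have "\<dots> = (LINT y|PiM UNIV (\<lambda>_. unif_\<Omega>). f (anchor u (restrict y u)))"
    by (rule integral_distr[OF measurable_restrict_subset m]) simp
  also have "(\<lambda>y. f (anchor u (restrict y u))) = (\<lambda>y. f (anchor u y))"
    by (intro ext arg_cong[of _ _ f]) (auto simp: anchor_def fun_eq_iff)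
  finally show ?thesis .
qed

lemma truncation_integral:
  assumes U: "finite U" "\<And>u. u \<in> U \<Longrightarrow> finite u"
    and T: "\<And>V. finite V \<Longrightarrow> V \<inter> U = {} \<Longrightarrow> (\<And>v. v \<in> V \<Longrightarrow> finite v) \<Longrightarrow> (\<Sum>v\<in>V. weight_sum 1 ^ card v * gamma_u b v) \<le> T"
  shows "\<bar>integral_inf F - (\<Sum>u\<in>U. integral_fin u (anchored_term F u))\<bar> \<le> C * T"
proof -
  let ?M = "PiM UNIV (\<lambda>_::nat. unif_\<Omega>)"
  interpret prob_space ?M by (rule prob_space_PiM) (rule unif_prob)
  have sp: "y \<in> param_seqs" if "y \<in> space ?M" for y
    using that unfolding space_PiM_unif by (auto simp: param_seqs_def PiE_iff)
  have fin: "integral_fin u (anchored_term F u) = (LINT y|?M. anchored_term F u y)" if "u \<in> U" for u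
  proof -
    have "(\<lambda>y. anchored_term F u (anchor u y)) \<in> borel_measurable (PiM u (\<lambda>_. unif_\<Omega>))"
    proof (rule measurable_anchored_F[OF U(2)[OF that]])
      show "anchor u y \<in> param_seqs" if "y \<in> space (PiM u (\<lambda>_. unif_\<Omega>))" for y
        using anchor_in_box[OF that] by (simp add: box_u_def)
      show "(\<lambda>y. anchor u y j) \<in> borel_measurable (PiM u (\<lambda>_. unif_\<Omega>))" if "j \<in> u" for j
        using measurable_coord[OF that] that by (simp add: anchor_def unif_\<Omega>_def)
    qed
    from integral_fin_eq[OF U(2)[OF that] this] show ?thesis by (simp add: anchored_term_anchor)
  qed
  have mA: "anchored_term F u \<in> borel_measurable ?M" if "u \<in> U" for u
    by (rule measurable_anchored_F[where g = "\<lambda>y. y"]) (use that U sp in \<open>auto simp: unif_\<Omega>_def measurable_coord\<close>)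
  have iA: "integrable ?M (anchored_term F u)" if "u \<in> U" for u
    by (rule integrable_const_bound[of _ "C * weight_sum 1 ^ card u * gamma_u b u"])
      (use that U anchored_term_F_bound sp mA in auto)
  obtain B where "\<And>y. y \<in> param_seqs \<Longrightarrow> \<bar>F y\<bar> \<le> B" using bounded_F by blast
  then have iF: "integrable ?M F"
    by (intro integrable_const_bound[of _ B] measurable_F AE_I2) (use sp in auto)
  have "integral_inf F - (\<Sum>u\<in>U. integral_fin u (anchored_term F u)) = (LINT y|?M. F y - (\<Sum>u\<in>U. anchored_term F u y))"
    unfolding integral_inf_def using iF iA fin by simp
  also have "\<bar>\<dots>\<bar> \<le> (LINT y|?M. \<bar>F y - (\<Sum>u\<in>U. anchored_term F u y)\<bar>)" by (rule integral_abs_bound)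
  also have "\<dots> \<le> (LINT y|?M. C * T)"
  proof (rule integral_mono)
    show "integrable ?M (\<lambda>y. \<bar>F y - (\<Sum>u\<in>U. anchored_term F u y)\<bar>)"
      by (intro integrable_abs Bochner_Integration.integrable_diff Bochner_Integration.integrable_sum iF iA)
    show "\<bar>F y - (\<Sum>u\<in>U. anchored_term F u y)\<bar> \<le> C * T" if "y \<in> space ?M" for y
      by (rule truncation_pointwise[OF U T sp[OF that]])
  qed simp
  also have "\<dots> = C * T" by (simp add: prob_space)
  finally show ?thesis .
qed

lemma fe_integral_diff:
  assumes h: "0 < h" and u: "finite u"
  shows "\<bar>integral_fin u (anchored_term F u) - integral_fin u (anchored_term (Fh h) u)\<bar> \<le> 2 ^ card u * (C * h powr \<tau>)"
proof -
  let ?M = "PiM u (\<lambda>_::nat. unif_\<Omega>)"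
  interpret prob_space ?M by (rule prob_space_PiM) (rule unif_prob)
  have sp: "anchor u y \<in> param_seqs" if "y \<in> space ?M" for y
    using anchor_in_box[OF that] by (simp add: box_u_def)
  have c: "(\<lambda>y. anchor u y j) \<in> borel_measurable ?M" if "j \<in> u" for j
    using measurable_coord[OF that] that by (simp add: anchor_def unif_\<Omega>_def)
  have 1: "integrable ?M (\<lambda>y. anchored_term F u (anchor u y))"
    by (rule integrable_const_bound[of _ "C * weight_sum 1 ^ card u * gamma_u b u"])
      (use u anchored_term_F_bound sp measurable_anchored_F[OF u sp c] in auto)
  have 2: "integrable ?M (\<lambda>y. anchored_term (Fh h) u (anchor u y))"
    by (rule integrable_const_bound[of _ "C * weight_sum 1 ^ card u * gamma_u b u"])
      (use u anchored_term_bound[OF exp_h[OF h] C u b(1,2)] sp measurable_anchored_term[OF exp_h[OF h] u sp c] in auto)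
  have "integral_fin u (anchored_term F u) - integral_fin u (anchored_term (Fh h) u) =
      (LINT y|?M. anchored_term F u (anchor u y) - anchored_term (Fh h) u (anchor u y))"
    unfolding integral_fin_def using 1 2 by simp
  also have "\<bar>\<dots>\<bar> \<le> (LINT y|?M. \<bar>anchored_term F u (anchor u y) - anchored_term (Fh h) u (anchor u y)\<bar>)"
    by (rule integral_abs_bound)
  also have "\<dots> \<le> (LINT y|?M. 2 ^ card u * (C * h powr \<tau>))"
  proof (rule integral_mono)
    show "integrable ?M (\<lambda>y. \<bar>anchored_term F u (anchor u y) - anchored_term (Fh h) u (anchor u y)\<bar>)"
      by (intro integrable_abs Bochner_Integration.integrable_diff 1 2)
    show "\<bar>anchored_term F u (anchor u y) - anchored_term (Fh h) u (anchor u y)\<bar> \<le> 2 ^ card u * (C * h powr \<tau>)" if "y \<in> space ?M" for y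
      by (rule anchored_term_diff[OF h u sp[OF that]])
  qed simp
  also have "\<dots> = 2 ^ card u * (C * h powr \<tau>)" by (simp add: prob_space)
  finally show ?thesis .
qed

end

section \<open>Active set, error budget and work\<close>

locale mdfem_params =
  fixes b :: "nat \<Rightarrow> real" and \<alpha> :: nat and p \<tau> d' lam :: real
  assumes b: "\<And>j. 0 < b j" "\<And>j. b j \<le> 1" "summable (\<lambda>j. b j powr p)"
    and p: "0 < p" "p < 1" and \<tau>: "0 < \<tau>" "0 < d'"
    and lam: "lam = \<tau> * (1 - p) / (p * (\<tau> + d'))" and alpha: "\<alpha> = nat \<lfloor>lam\<rfloor> + 1" and lam2: "1/2 \<le> lam"
begin

lemma alpha1: "1 \<le> \<alpha>" by (simp add: alpha)
lemma M_pos: "0 < M_const \<alpha>" by (rule M_const_pos[OF alpha1])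
lemma lam_pos: "0 < lam" using lam2 by simp

lemma gamma_pos: "0 < gamma_u b u" unfolding gamma_u_def by (intro prod_pos) (use b in auto)
lemma gamma_le_1: "gamma_u b u \<le> 1" unfolding gamma_u_def by (intro prod_le_1) (use b less_imp_le in auto)

lemma gamma_powr: "gamma_u b u powr q = (\<Prod>j\<in>u. b j powr q)"
  unfolding gamma_u_def
  by (induction u rule: infinite_finite_induct) (auto simp: powr_mult prod_nonneg less_imp_le[OF b(1)])

lemma gamma_le_powr: assumes "0 \<le> q" "q \<le> 1" shows "gamma_u b u \<le> gamma_u b u powr q"
  using powr_mono'[OF assms(2), of "gamma_u b u"] gamma_pos[of u] gamma_le_1[of u] by simp

lemma weighted_sum_bounded:
  assumes "0 \<le> c"
  obtains B where "0 < B" "\<And>V. finite V \<Longrightarrow> (\<And>v. v \<in> V \<Longrightarrow> finite v) \<Longrightarrow> (\<Sum>v\<in>V. c ^ card v * gamma_u b v powr p) \<le> B"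
proof
  let ?x = "\<lambda>j. c * b j powr p"
  show "0 < exp (suminf ?x)" by simp
  fix V :: "nat set set" assume V: "finite V" "\<And>v. v \<in> V \<Longrightarrow> finite v"
  have "(\<Sum>v\<in>V. c ^ card v * gamma_u b v powr p) = (\<Sum>v\<in>V. \<Prod>j\<in>v. ?x j)"
    unfolding gamma_powr by (simp add: prod.distrib)
  also have "\<dots> \<le> exp (suminf ?x)"
    by (rule sum_subsets_prod_le) (use assms b(3) V in \<open>auto intro: summable_mult\<close>)
  finally show "(\<Sum>v\<in>V. c ^ card v * gamma_u b v powr p) \<le> exp (suminf ?x)" .
qed

lemma weighted_sum_bounded1:
  assumes "0 \<le> c"
  obtains B where "0 < B" "\<And>V. finite V \<Longrightarrow> (\<And>v. v \<in> V \<Longrightarrow> finite v) \<Longrightarrow> (\<Sum>v\<in>V. c ^ card v * gamma_u b v) \<le> B"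
proof -
  obtain B where B: "0 < B" "\<And>V. finite V \<Longrightarrow> (\<And>v. v \<in> V \<Longrightarrow> finite v) \<Longrightarrow> (\<Sum>v\<in>V. c ^ card v * gamma_u b v powr p) \<le> B"
    using weighted_sum_bounded[OF assms] by blast
  have "(\<Sum>v\<in>V. c ^ card v * gamma_u b v) \<le> B" if "finite V" "\<And>v. v \<in> V \<Longrightarrow> finite v" for V
  proof -
    have "(\<Sum>v\<in>V. c ^ card v * gamma_u b v) \<le> (\<Sum>v\<in>V. c ^ card v * gamma_u b v powr p)"
      by (intro sum_mono mult_left_mono gamma_le_powr) (use p assms in auto)
    then show ?thesis using B(2)[OF that] by linarith
  qed
  with B(1) show thesis by (rule that)
qed

section \<open>The active set and the truncated terms\<close>

definition gm :: "nat set \<Rightarrow> real" where "gm u = gamma_u b u * M_u \<alpha> u"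
definition SS :: real where "SS = (\<Sum>\<^sub>\<infinity>v\<in>{v. finite v}. gm v powr p)"

lemma gm_pos: "0 < gm u" unfolding gm_def M_u_def using gamma_pos M_pos by simp

lemma gm_powr: "gm u powr p = (M_const \<alpha> powr p) ^ card u * gamma_u b u powr p"
proof -
  have "M_u \<alpha> u powr p = (M_const \<alpha> powr p) ^ card u"
    unfolding M_u_def using M_pos by (simp add: powr_realpow[symmetric] powr_powr mult.commute)
  then show ?thesis unfolding gm_def by (simp add: powr_mult mult.commute)
qed

text \<open>Guards the threshold of the active set: the infinite sum of a non-summable family would
  be 0 by default.\<close>

lemma gm_summable: "(\<lambda>v. gm v powr p) summable_on {v. finite v}"
proof -
  obtain B where B: "\<And>V. finite V \<Longrightarrow> (\<And>v. v \<in> V \<Longrightarrow> finite v) \<Longrightarrow> (\<Sum>v\<in>V. (M_const \<alpha> powr p) ^ card v * gamma_u b v powr p) \<le> B"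
    using weighted_sum_bounded[OF powr_ge_zero, of "M_const \<alpha>" p] by blast
  show ?thesis
    by (rule nonneg_bdd_above_summable_on) (auto intro!: bdd_aboveI[of _ B] simp: gm_powr B subset_eq)
qed

lemma SS_ge_1: "1 \<le> SS"
proof -
  have "(\<Sum>v\<in>{{}}. gm v powr p) \<le> SS" unfolding SS_def
    by (rule finite_sum_le_infsum[OF gm_summable]) auto
  then show ?thesis by (simp add: gm_def gamma_u_def M_u_def)
qed

lemma active_set_eq: "active_set \<alpha> b p \<epsilon> = {u. finite u \<and> \<epsilon> / 2 / SS < gm u powr (1 - p)}"
  unfolding active_set_def SS_def gm_def ..

lemma finite_active_set:
  assumes \<epsilon>: "0 < \<epsilon>" shows "finite (active_set \<alpha> b p \<epsilon>)"
proof -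
  \<comment> \<open>The exponent p / (1 - p) converts the lower bound on the power 1 - p, which
    defines the active set, into one on the power p, whose sum is bounded.\<close>
  define \<eta> where "\<eta> = (\<epsilon> / 2 / SS) powr (p / (1 - p))"
  have \<eta>0: "0 < \<epsilon> / 2 / SS" using \<epsilon> SS_ge_1 by simp
  have \<eta>: "0 < \<eta>" unfolding \<eta>_def using \<epsilon> SS_ge_1 by simp
  have g: "\<eta> \<le> gm u powr p" if "u \<in> active_set \<alpha> b p \<epsilon>" for u
  proof -
    have "\<epsilon> / 2 / SS \<le> gm u powr (1 - p)" using that unfolding active_set_eq by simp
    then have "\<eta> \<le> (gm u powr (1 - p)) powr (p / (1 - p))" unfolding \<eta>_def
      using \<eta>0 p by (intro powr_mono2) auto
    also have "\<dots> = gm u powr p" using p by (simp add: powr_powr)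
    finally show ?thesis .
  qed
  obtain B where B: "0 < B" "\<And>V. finite V \<Longrightarrow> (\<And>v. v \<in> V \<Longrightarrow> finite v) \<Longrightarrow> (\<Sum>v\<in>V. (M_const \<alpha> powr p) ^ card v * gamma_u b v powr p) \<le> B"
    using weighted_sum_bounded[OF powr_ge_zero, of "M_const \<alpha>" p] by blast
  show ?thesis
  proof (rule ccontr)
    assume inf: "infinite (active_set \<alpha> b p \<epsilon>)"
    obtain n where n: "B / \<eta> < real n" using reals_Archimedean2 by blast
    obtain V where V: "V \<subseteq> active_set \<alpha> b p \<epsilon>" "finite V" "card V = n"
      using infinite_arbitrarily_large[OF inf] by blast
    have "real n * \<eta> = (\<Sum>v\<in>V. \<eta>)" using V by simp
    also have "\<dots> \<le> (\<Sum>v\<in>V. gm v powr p)" by (intro sum_mono g) (use V in auto)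
    also have "\<dots> \<le> B" unfolding gm_powr by (rule B(2)[OF V(2)]) (use V in \<open>auto simp: active_set_eq\<close>)
    finally show False using n \<eta> by (simp add: divide_less_eq)
  qed
qed

text \<open>Outside the active set write gm = gm ^ (1 - p) * gm ^ p and bound the first factor by
  the threshold, which is proportional to \<epsilon>. The bounds on the terms have base c instead of
  M; the quotient c / M is put into the new base \<open>c'\<close>.\<close>

lemma truncation_sum:
  assumes "0 \<le> c"
  obtains K where "0 \<le> K" "\<And>\<epsilon> V. 0 < \<epsilon> \<Longrightarrow> finite V \<Longrightarrow> V \<inter> active_set \<alpha> b p \<epsilon> = {} \<Longrightarrow> (\<And>v. v \<in> V \<Longrightarrow> finite v) \<Longrightarrow>
    (\<Sum>v\<in>V. c ^ card v * gamma_u b v) \<le> K * \<epsilon>"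
proof -
  define c' where "c' = c / M_const \<alpha> * M_const \<alpha> powr p"
  have c'0: "0 \<le> c'" using assms M_pos by (simp add: c'_def)
  obtain B where B: "0 < B" "\<And>V. finite V \<Longrightarrow> (\<And>v. v \<in> V \<Longrightarrow> finite v) \<Longrightarrow> (\<Sum>v\<in>V. c' ^ card v * gamma_u b v powr p) \<le> B"
    using weighted_sum_bounded[OF c'0] by blast
  have "(\<Sum>v\<in>V. c ^ card v * gamma_u b v) \<le> B / (2 * SS) * \<epsilon>"
    if \<epsilon>: "0 < \<epsilon>" and V: "finite V" "V \<inter> active_set \<alpha> b p \<epsilon> = {}" "\<And>v. v \<in> V \<Longrightarrow> finite v" for \<epsilon> V
  proof -
    have "(\<Sum>v\<in>V. c ^ card v * gamma_u b v) \<le> (\<Sum>v\<in>V. \<epsilon> / 2 / SS * (c' ^ card v * gamma_u b v powr p))"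
    proof (rule sum_mono)
      fix v assume v: "v \<in> V"
      then have "gm v powr (1 - p) \<le> \<epsilon> / 2 / SS" using V unfolding active_set_eq by force
      have "c ^ card v * gamma_u b v = (c / M_const \<alpha>) ^ card v * gm v"
        unfolding gm_def M_u_def using M_pos by (simp add: power_divide)
      also have "gm v = gm v powr (1 - p) * gm v powr p" using gm_pos[of v] by (simp add: powr_add[symmetric])
      also have "(c / M_const \<alpha>) ^ card v * (gm v powr (1 - p) * gm v powr p) \<le> (c / M_const \<alpha>) ^ card v * (\<epsilon> / 2 / SS * gm v powr p)"
        by (intro mult_left_mono mult_right_mono) (use \<open>gm v powr (1 - p) \<le> \<epsilon> / 2 / SS\<close> assms M_pos in auto)
      also have "\<dots> = \<epsilon> / 2 / SS * (c' ^ card v * gamma_u b v powr p)"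
        unfolding gm_powr c'_def power_mult_distrib by (simp only: mult_ac)
      finally show "c ^ card v * gamma_u b v \<le> \<epsilon> / 2 / SS * (c' ^ card v * gamma_u b v powr p)" .
    qed
    also have "\<dots> = \<epsilon> / 2 / SS * (\<Sum>v\<in>V. c' ^ card v * gamma_u b v powr p)" by (rule sum_distrib_left[symmetric])
    also have "\<dots> \<le> \<epsilon> / 2 / SS * B" by (intro mult_left_mono B(2) V) (use \<epsilon> SS_ge_1 in auto)
    finally show ?thesis by (simp add: mult.commute)
  qed
  moreover have "0 \<le> B / (2 * SS)" using B SS_ge_1 by simp
  ultimately show thesis by (rule that[rotated])
qed

text \<open>Only the exponential dependence on |u| matters later. By the choice of \<alpha> one has
  lam < \<alpha> in the first case and lam < 1 in the second, which makes the powers of 2 in the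
  denominators exceed 2.\<close>

lemma C_cub_form: obtains K1 K2 where "0 < K1" "0 < K2" "\<And>u. C_cub \<alpha> lam u = K1 * K2 ^ card u"
proof (cases "\<alpha> \<ge> 2")
  case True
  define X where "X = 2 powr (real \<alpha> * (real \<alpha> - 1) / 2) * fact \<alpha> * sqrt (real \<alpha>) * (3/2) ^ \<alpha> *
      (5/3) ^ (\<alpha> - 1) * (1 + 1 / (2 powr (real \<alpha> / lam) - 2)) ^ \<alpha>"
  have "lam < real \<alpha>" unfolding alpha using lam_pos by linarith
  then have "1 < real \<alpha> / lam" using lam_pos by simp
  then have "(2::real) powr 1 < 2 powr (real \<alpha> / lam)" by (rule powr_less_mono) simp
  then have "0 < 2 powr (real \<alpha> / lam) - 2" by simp
  then have X: "0 < X" unfolding X_def using True by (intro mult_pos_pos zero_less_power add_pos_pos divide_pos_pos) auto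
  have "C_cub \<alpha> lam u = 4 powr lam * (X powr lam) ^ card u" for u
  proof -
    have "X powr (real (card u) * lam) = (X powr lam) ^ card u"
      using X by (simp add: powr_realpow[symmetric] powr_powr mult.commute)
    then show ?thesis using True by (simp add: C_cub_def C_interlaced_def X_def)
  qed
  then show thesis by (intro that[of "4 powr lam" "X powr lam"]) (use X in auto)
next
  case False
  define X where "X = (13/12) powr (1 / (2 * lam)) +
      (if lam = 1/2 then 1/6 else 1 / (3 powr (1 / (2 * lam)) * (2 powr (1 / lam) - 2)))"
  have l1: "lam < 1" using False unfolding alpha using lam_pos by linarith
  have "1 < 1 / lam" using l1 lam_pos by simp
  then have "(2::real) powr 1 < 2 powr (1 / lam)" by (rule powr_less_mono) simp
  then have "0 < 2 powr (1 / lam) - 2" by simp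
  then have X: "0 < X" unfolding X_def by (intro add_pos_nonneg) auto
  have "C_cub \<alpha> lam u = 2 powr lam * (X powr lam) ^ card u" for u
  proof -
    have "X powr (real (card u) * lam) = (X powr lam) ^ card u"
      using X by (simp add: powr_realpow[symmetric] powr_powr mult.commute)
    then show ?thesis using False by (simp add: C_cub_def C_shifted_def X_def)
  qed
  then show thesis by (intro that[of "2 powr lam" "X powr lam"]) (use X in auto)
qed

text \<open>The second identity is the design equation of lam: the optimal weights raise
  \<open>gamma_u\<close> to the power on its left, and p is the power for which summability is
  known.\<close>

lemma rate_identities:
  "1 / lam + d' / \<tau> = (1 + d' / \<tau>) / (1 / p - 1) + d' / \<tau>"
  "(1 / lam) * (1 / (1 / lam + d' / \<tau> + 1)) = p"
proof -
  define e where "e = d' / \<tau>"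
  have e: "0 < e" using \<tau> by (simp add: e_def)
  have d: "d' = e * \<tau>" using \<tau> by (simp add: e_def)
  have l: "1 / lam = p * (1 + e) / (1 - p)"
    unfolding lam d using \<tau> p e by (simp add: field_simps)
  have "(1 + e) / (1 / p - 1) = p * (1 + e) / (1 - p)" using p by (simp add: field_simps)
  then show "1 / lam + d' / \<tau> = (1 + d' / \<tau>) / (1 / p - 1) + d' / \<tau>" unfolding l e_def[symmetric] by simp
  have "1 / lam + e + 1 = (1 + e) / (1 - p)" unfolding l using p by (simp add: field_simps)
  then show "(1 / lam) * (1 / (1 / lam + d' / \<tau> + 1)) = p" unfolding e_def[symmetric] unfolding l using p e by simp
qed

text \<open>In the variables \<open>p u = AA u / k u powr lam\<close> and \<open>q u = 2 ^ card u * h u powr \<tau>\<close> the cost is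
  \<open>\<Sum>u. WW u * p u powr - (1 / lam) * q u powr - (d' / \<tau>)\<close> and the constraint fixes \<open>\<Sum>u. p u + q u\<close>.\<close>

definition AA :: "nat set \<Rightarrow> real" where "AA u = gamma_u b u * 2 powr lam * C_cub \<alpha> lam u"
definition WW :: "nat set \<Rightarrow> real" where
  "WW u = pounds u * AA u powr (1 / lam) * (2 ^ card u) powr (d' / \<tau>)"

lemma C_cub_pos: "0 < C_cub \<alpha> lam u"
  by (rule C_cub_form) simp

lemma AA_pos: "0 < AA u" unfolding AA_def using gamma_pos C_cub_pos by simp
lemma pounds_pos: "0 < pounds u" unfolding pounds_def by simp
lemma WW_pos: "0 < WW u" unfolding WW_def by (intro mult_pos_pos pounds_pos) (use AA_pos[of u] in auto)

lemma error_splitting_WW: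
  "finite U \<Longrightarrow> U \<noteq> {} \<Longrightarrow> 0 < \<epsilon> \<Longrightarrow> error_splitting U WW (1 / lam) (d' / \<tau>) (\<epsilon> / 2)"
  using WW_pos lam_pos \<tau> by unfold_locales auto

text \<open>The exponent s times 1 / lam is p, so AA contributes \<open>gamma_u\<close> to the power
  p. Everything else is exponential in |u|; the linear factor in \<open>pounds\<close> is absorbed
  by \<open>pounds u \<le> 4 ^ card u\<close>.\<close>

lemma wt_bound:
  obtains K c where "0 < K" "0 \<le> c" "\<And>u. WW u powr (1 / (1 / lam + d' / \<tau> + 1)) \<le> K * c ^ card u * gamma_u b u powr p"
proof -
  obtain K1 K2 where K: "0 < K1" "0 < K2" "\<And>u. C_cub \<alpha> lam u = K1 * K2 ^ card u" using C_cub_form by blast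
  define s where "s = 1 / (1 / lam + d' / \<tau> + 1)"
  have s0: "0 < s" unfolding s_def using lam_pos \<tau> by (intro divide_pos_pos add_pos_pos) auto
  define c where "c = 4 powr s * K2 powr p * (2 powr (d' / \<tau>)) powr s"
  have pow: "(x ^ card u) powr q = (x powr q) ^ card u" if "0 < x" for x q :: real and u :: "nat set"
    proof -
    have "(x ^ n) powr q = (x powr q) ^ n" for n by (induction n) (use that in \<open>auto simp: powr_mult\<close>)
    then show ?thesis .
  qed
  have "WW u powr s \<le> (2 powr lam * K1) powr p * c ^ card u * gamma_u b u powr p" for u
  proof -
    have pd: "pounds u \<le> 4 ^ card u"
    proof -
      have "max 1 (real (card u)) \<le> 2 ^ card u" using of_nat_less_two_power[of "card u", where ?'a = real] by (auto simp: less_imp_le)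
      then have "pounds u \<le> 2 ^ card u * 2 ^ card u" unfolding pounds_def by (intro mult_left_mono) auto
      then show ?thesis by (simp add: power_mult_distrib[symmetric])
    qed
    have "WW u powr s = pounds u powr s * (AA u powr (1 / lam)) powr s * ((2 ^ card u) powr (d' / \<tau>)) powr s"
      unfolding WW_def using pounds_pos[of u] AA_pos[of u] by (simp add: powr_mult)
    also have "(AA u powr (1 / lam)) powr s = AA u powr p"
      unfolding powr_powr s_def using rate_identities(2) by simp
    also have "AA u powr p = gamma_u b u powr p * (2 powr lam * K1) powr p * (K2 powr p) ^ card u"
      unfolding AA_def K(3) using gamma_pos[of u] K(1,2) by (simp add: powr_mult pow mult_ac)
    also have "((2 ^ card u) powr (d' / \<tau>)) powr s = ((2 powr (d' / \<tau>)) powr s) ^ card u"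
      by (simp add: pow)
    also have "pounds u powr s * (gamma_u b u powr p * (2 powr lam * K1) powr p * (K2 powr p) ^ card u) * ((2 powr (d' / \<tau>)) powr s) ^ card u
      \<le> (4 powr s) ^ card u * (gamma_u b u powr p * (2 powr lam * K1) powr p * (K2 powr p) ^ card u) * ((2 powr (d' / \<tau>)) powr s) ^ card u"
    proof (intro mult_right_mono)
      show "pounds u powr s \<le> (4 powr s) ^ card u"
        using powr_mono2[OF less_imp_le[OF s0] less_imp_le[OF pounds_pos] pd] by (simp add: pow)
    qed auto
    also have "\<dots> = (2 powr lam * K1) powr p * c ^ card u * gamma_u b u powr p"
      unfolding c_def power_mult_distrib by (simp only: mult_ac)
    finally show ?thesis .
  qed
  then show thesis unfolding s_def by (intro that[of "(2 powr lam * K1) powr p" c]) (use K in \<open>auto simp: c_def\<close>)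
qed

section \<open>What optimality implies for a fixed tolerance\<close>

context
  fixes \<epsilon> :: real and k h :: "nat set \<Rightarrow> real"
  assumes \<epsilon>: "0 < \<epsilon>" and ne: "active_set \<alpha> b p \<epsilon> \<noteq> {}"
    and opt: "mdfem_optimal \<alpha> lam b \<tau> d' (active_set \<alpha> b p \<epsilon>) \<epsilon> k h"
begin

private abbreviation "U \<equiv> active_set \<alpha> b p \<epsilon>"

interpretation S: error_splitting U WW "1 / lam" "d' / \<tau>" "\<epsilon> / 2"
  by (rule error_splitting_WW[OF finite_active_set[OF \<epsilon>] ne \<epsilon>])

private lemma feas: "mdfem_feasible \<alpha> lam b \<tau> U \<epsilon> k h" using opt unfolding mdfem_optimal_def by blast

lemma kh_pos: "u \<in> U \<Longrightarrow> 0 < k u" "u \<in> U \<Longrightarrow> 0 < h u"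
  using feas unfolding mdfem_feasible_def by auto

private lemma cost_term:
  assumes "0 < k'" "0 < h'"
  shows "k' * h' powr (- d') * pounds u = WW u * (AA u / k' powr lam) powr (- (1 / lam)) * (2 ^ card u * h' powr \<tau>) powr (- (d' / \<tau>))"
proof -
  have 1: "(AA u / k' powr lam) powr (- (1 / lam)) = k' / AA u powr (1 / lam)"
  proof -
    have "(AA u / k' powr lam) powr (- (1 / lam)) = AA u powr (- (1 / lam)) / (k' powr lam) powr (- (1 / lam))"
      using AA_pos[of u] assms by (simp add: powr_divide)
    also have "(k' powr lam) powr (- (1 / lam)) = k' powr (-1)" using lam_pos by (simp add: powr_powr)
    also have "k' powr (-1) = 1 / k'" using assms by (simp add: powr_minus_divide)
    also have "AA u powr (- (1 / lam)) = 1 / AA u powr (1 / lam)" by (rule powr_minus_divide)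
    finally show ?thesis by simp
  qed
  have 2: "(2 ^ card u * h' powr \<tau>) powr (- (d' / \<tau>)) = h' powr (- d') / (2 ^ card u) powr (d' / \<tau>)"
  proof -
    have "(2 ^ card u * h' powr \<tau>) powr (- (d' / \<tau>)) = (2 ^ card u) powr (- (d' / \<tau>)) * (h' powr \<tau>) powr (- (d' / \<tau>))"
      by (simp add: powr_mult)
    also have "(h' powr \<tau>) powr (- (d' / \<tau>)) = h' powr (- d')" using \<tau> by (simp add: powr_powr)
    also have "(2 ^ card u :: real) powr (- (d' / \<tau>)) = 1 / (2 ^ card u) powr (d' / \<tau>)" by (rule powr_minus_divide)
    finally show ?thesis by simp
  qed
  show ?thesis unfolding 1 2 WW_def using AA_pos[of u] by simp
qed

private lemma cost_eq:
  assumes "\<And>u. u \<in> U \<Longrightarrow> 0 < k' u" "\<And>u. u \<in> U \<Longrightarrow> 0 < h' u"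
  shows "mdfem_cost (\<lambda>x. x powr (- d')) U k' h' =
    (\<Sum>u\<in>U. WW u * (AA u / k' u powr lam) powr (- (1 / lam)) * (2 ^ card u * h' u powr \<tau>) powr (- (d' / \<tau>)))"
  unfolding mdfem_cost_def by (intro sum.cong refl cost_term assms)

text \<open>The explicit optimal split, translated back into numbers of points and meshwidths, is a
  feasible competitor.\<close>

private lemma opt_le: "mdfem_cost (\<lambda>x. x powr (- d')) U k h \<le> S.KK * S.Z"
proof -
  define k' where "k' u = (AA u / S.P u) powr (1 / lam)" for u
  define h' where "h' u = (S.Q u / 2 ^ card u) powr (1 / \<tau>)" for u
  have pos: "0 < k' u" "0 < h' u" if "u \<in> U" for u
    using S.P_pos[OF that] S.Q_pos[OF that] AA_pos[of u] by (auto simp: k'_def h'_def)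
  have P: "AA u / k' u powr lam = S.P u" and Q: "2 ^ card u * h' u powr \<tau> = S.Q u" if "u \<in> U" for u
    using S.P_pos[OF that] S.Q_pos[OF that] AA_pos[of u] lam_pos \<tau> by (auto simp: k'_def h'_def powr_powr)
  have "mdfem_feasible \<alpha> lam b \<tau> U \<epsilon> k' h'"
    unfolding mdfem_feasible_def
  proof (intro conjI ballI pos)
    have "(\<Sum>u\<in>U. gamma_u b u * 2 powr lam * C_cub \<alpha> lam u / k' u powr lam + 2 ^ card u * h' u powr \<tau>) = (\<Sum>u\<in>U. S.P u + S.Q u)"
      by (intro sum.cong refl) (use P Q in \<open>simp add: AA_def\<close>)
    then show "(\<Sum>u\<in>U. gamma_u b u * 2 powr lam * C_cub \<alpha> lam u / k' u powr lam + 2 ^ card u * h' u powr \<tau>) = \<epsilon> / 2"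
      using S.PQ_sum by simp
  qed
  then have "mdfem_cost (\<lambda>x. x powr (- d')) U k h \<le> mdfem_cost (\<lambda>x. x powr (- d')) U k' h'"
    using opt unfolding mdfem_optimal_def by blast
  also have "\<dots> = (\<Sum>u\<in>U. WW u * S.P u powr (- (1 / lam)) * S.Q u powr (- (d' / \<tau>)))"
    using cost_eq[of k' h', OF pos] P Q by (simp cong: sum.cong)
  also have "\<dots> = S.KK * S.Z" by (rule S.optimal_value)
  finally show ?thesis .
qed

private lemma share: assumes "u \<in> U" shows "AA u / k u powr lam = S.P u"
proof (rule S.optimal_unique(1)[where q = "\<lambda>u. 2 ^ card u * h u powr \<tau>"])
  show "(\<Sum>u\<in>U. AA u / k u powr lam + 2 ^ card u * h u powr \<tau>) = \<epsilon> / 2"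
    using feas unfolding mdfem_feasible_def AA_def by simp
  show "(\<Sum>u\<in>U. WW u * (AA u / k u powr lam) powr (- (1 / lam)) * (2 ^ card u * h u powr \<tau>) powr (- (d' / \<tau>))) \<le> S.KK * S.Z"
    using opt_le cost_eq[of k h, OF kh_pos] by simp
qed (use assms kh_pos AA_pos in \<open>auto intro!: divide_pos_pos simp: less_imp_neq[THEN not_sym]\<close>)

lemma fe_share: "(\<Sum>u\<in>U. 2 ^ card u * h u powr \<tau>) \<le> \<epsilon> / 2"
proof -
  have "(\<Sum>u\<in>U. 2 ^ card u * h u powr \<tau>) \<le> (\<Sum>u\<in>U. AA u / k u powr lam + 2 ^ card u * h u powr \<tau>)"
    using less_imp_le[OF AA_pos] by (intro sum_mono) simp
  also have "\<dots> = \<epsilon> / 2" using feas unfolding mdfem_feasible_def AA_def by simp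
  finally show ?thesis .
qed

text \<open>Rounding k down to a power of two at most halves it, and the factor 2 powr lam in the
  constraint pays for this. By uniqueness of the split the share of u is then explicit.\<close>

lemma cubature_share:
  assumes u: "u \<in> U"
  shows "C_cub \<alpha> lam u * gamma_u b u * (if 1 \<le> k u then real (n_points (k u)) powr (- lam) else 1) \<le>
     \<epsilon> / 2 * (WW u powr (1 / (1 / lam + d' / \<tau> + 1)) / (\<Sum>u\<in>U. WW u powr (1 / (1 / lam + d' / \<tau> + 1))))"
proof -
  have kp: "0 < k u" by (rule kh_pos(1)[OF u])
  have "(if 1 \<le> k u then real (n_points (k u)) powr (- lam) else 1) \<le> 2 powr lam / k u powr lam"
  proof (cases "1 \<le> k u")
    case True
    have "log 2 (k u) < real_of_int (\<lfloor>log 2 (k u)\<rfloor> + 1)" by linarith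
    moreover have "0 \<le> \<lfloor>log 2 (k u)\<rfloor>" using True by simp
    then have "real_of_int (\<lfloor>log 2 (k u)\<rfloor> + 1) = real (nat \<lfloor>log 2 (k u)\<rfloor> + 1)" by simp
    ultimately have "log 2 (k u) \<le> real (nat \<lfloor>log 2 (k u)\<rfloor> + 1)" by linarith
    then have "k u \<le> 2 powr real (nat \<lfloor>log 2 (k u)\<rfloor> + 1)" using kp by (simp add: log_le_iff)
    also have "\<dots> = 2 * real (n_points (k u))" using True unfolding powr_realpow[of 2, simplified] n_points_def by simp
    finally have "k u / 2 \<le> real (n_points (k u))" by simp
    then have "real (n_points (k u)) powr (- lam) \<le> (k u / 2) powr (- lam)"
      using kp lam_pos by (intro powr_mono2') auto
    also have "\<dots> = 2 powr lam / k u powr lam" using kp by (simp add: powr_divide powr_minus field_simps)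
    finally show ?thesis using True by simp
  next
    case False
    \<comment> \<open>For k < 1 no points are used and the error bound has no decay; the budget
      still covers it, because 2 powr lam / k powr lam \<ge> 1.\<close>
    have "k u powr lam \<le> 1 powr lam" using False kp lam_pos by (intro powr_mono2) auto
    also have "\<dots> \<le> 2 powr lam" using lam_pos by (intro powr_mono2) auto
    finally show ?thesis using False kp by simp
  qed
  then have "C_cub \<alpha> lam u * gamma_u b u * (if 1 \<le> k u then real (n_points (k u)) powr (- lam) else 1) \<le> C_cub \<alpha> lam u * gamma_u b u * (2 powr lam / k u powr lam)"
    by (intro mult_left_mono) (use C_cub_pos[of u] gamma_pos[of u] in auto)
  also have "\<dots> = AA u / k u powr lam" by (simp add: AA_def)
  also have "\<dots> = S.P u" by (rule share[OF u])
  also have "\<dots> = (1 / lam / (1 / lam + d' / \<tau>)) * (\<epsilon> / 2 * S.wt u / S.Z)" by (simp add: S.P_def)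
  also have "\<dots> \<le> 1 * (\<epsilon> / 2 * S.wt u / S.Z)"
  proof (rule mult_right_mono)
    have "0 < 1 / lam" "0 < d' / \<tau>" using lam_pos \<tau> by auto
    then show "1 / lam / (1 / lam + d' / \<tau>) \<le> 1" by (subst divide_le_eq_1_pos) linarith+
    show "0 \<le> \<epsilon> / 2 * S.wt u / S.Z" using \<epsilon> S.wt_pos[OF u] S.Z_pos by simp
  qed
  finally show ?thesis unfolding S.Z_def S.wt_def by simp
qed

lemma n_points_le: "0 < x \<Longrightarrow> real (n_points x) \<le> x"
proof (cases "1 \<le> x")
  case True
  then have "real (n_points x) = 2 powr real (nat \<lfloor>log 2 x\<rfloor>)" unfolding powr_realpow[of 2, simplified] n_points_def by simp
  also have "\<dots> \<le> 2 powr log 2 x" using True by (intro powr_mono) auto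
  also have "\<dots> = x" using True by simp
  finally show ?thesis .
qed (simp add: n_points_def)

lemma cost_le:
  "mdfem_cost (\<lambda>x. x powr (- d')) U (\<lambda>u. real (n_points (k u))) h \<le>
    ((1 / lam) / (1 / lam + d' / \<tau>)) powr (- (1 / lam)) * ((d' / \<tau>) / (1 / lam + d' / \<tau>)) powr (- (d' / \<tau>)) *
    (\<epsilon> / 2) powr (- (1 / lam + d' / \<tau>)) * (\<Sum>u\<in>U. WW u powr (1 / (1 / lam + d' / \<tau> + 1))) powr (1 / lam + d' / \<tau> + 1)"
proof -
  have "mdfem_cost (\<lambda>x. x powr (- d')) U (\<lambda>u. real (n_points (k u))) h \<le> mdfem_cost (\<lambda>x. x powr (- d')) U k h"
    unfolding mdfem_cost_def
    by (intro sum_mono mult_right_mono n_points_le kh_pos) (auto simp: less_imp_le[OF pounds_pos])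
  also have "\<dots> \<le> S.KK * S.Z" by (rule opt_le)
  also note S.KK_Z_eq
  finally show ?thesis unfolding S.Z_def S.wt_def .
qed

end

text \<open>The constraint controls this sum only without the factor c ^ |u|. With the factor, the
  individual shares are inserted; they decay like c0 ^ |u| times the power p of
  \<open>gamma_u\<close>, whose sum stays bounded for every base.\<close>

lemma cubature_sum:
  assumes c: "0 \<le> c"
  obtains K where "0 \<le> K" "\<And>\<epsilon> k h. 0 < \<epsilon> \<Longrightarrow> active_set \<alpha> b p \<epsilon> \<noteq> {} \<Longrightarrow>
      mdfem_optimal \<alpha> lam b \<tau> d' (active_set \<alpha> b p \<epsilon>) \<epsilon> k h \<Longrightarrow>
      (\<Sum>u\<in>active_set \<alpha> b p \<epsilon>. C_cub \<alpha> lam u * gamma_u b u * (if 1 \<le> k u then real (n_points (k u)) powr (- lam) else 1) * c ^ card u) \<le> K * \<epsilon>"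
proof -
  let ?s = "1 / (1 / lam + d' / \<tau> + 1)"
  obtain K0 c0 where K0: "0 < K0" "0 \<le> c0" "\<And>u. WW u powr ?s \<le> K0 * c0 ^ card u * gamma_u b u powr p" using wt_bound by blast
  obtain B where B: "0 < B" "\<And>V. finite V \<Longrightarrow> (\<And>v. v \<in> V \<Longrightarrow> finite v) \<Longrightarrow> (\<Sum>v\<in>V. (c * c0) ^ card v * gamma_u b v powr p) \<le> B"
    using weighted_sum_bounded[OF mult_nonneg_nonneg[OF c K0(2)]] by blast
  obtain K1 K2 where K12: "0 < K1" "0 < K2" "\<And>u. C_cub \<alpha> lam u = K1 * K2 ^ card u" using C_cub_form by blast
  obtain B' where B': "0 < B'" "\<And>V. finite V \<Longrightarrow> (\<And>v. v \<in> V \<Longrightarrow> finite v) \<Longrightarrow> (\<Sum>v\<in>V. (c * K2) ^ card v * gamma_u b v) \<le> B'"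
    using weighted_sum_bounded1[OF mult_nonneg_nonneg[OF c less_imp_le[OF K12(2)]]] by blast
  \<comment> \<open>The shares are normalised by the total weight, which must not become small. The
    empty set alone contributes w0, a positive number independent of \<epsilon>.\<close>
  define w0 where "w0 = WW {} powr ?s"
  have w0: "0 < w0" unfolding w0_def using WW_pos[of "{}"] by simp
  define K where "K = K0 * B / w0 + K1 * B'"
  have Kp: "0 \<le> K0 * B / w0" "0 \<le> K1 * B'" using K0 B B' K12 w0 by auto
  have "(\<Sum>u\<in>active_set \<alpha> b p \<epsilon>. C_cub \<alpha> lam u * gamma_u b u * (if 1 \<le> k u then real (n_points (k u)) powr (- lam) else 1) * c ^ card u) \<le> K * \<epsilon>"
    if \<epsilon>: "0 < \<epsilon>" and ne: "active_set \<alpha> b p \<epsilon> \<noteq> {}"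
      and opt: "mdfem_optimal \<alpha> lam b \<tau> d' (active_set \<alpha> b p \<epsilon>) \<epsilon> k h" for \<epsilon> k h
  proof -
    let ?U = "active_set \<alpha> b p \<epsilon>" and ?q = "\<lambda>u. if 1 \<le> k u then real (n_points (k u)) powr (- lam) else 1"
    have fU: "finite ?U" "\<And>u. u \<in> ?U \<Longrightarrow> finite u" using finite_active_set[OF \<epsilon>] by (auto simp: active_set_eq)
    show ?thesis
    proof (cases "{} \<in> ?U")
      case True
      have w0Z: "w0 \<le> (\<Sum>u\<in>?U. WW u powr ?s)" unfolding w0_def
        by (rule member_le_sum[OF True]) (use fU in auto)
      have "(\<Sum>u\<in>?U. C_cub \<alpha> lam u * gamma_u b u * ?q u * c ^ card u) \<le> (\<Sum>u\<in>?U. \<epsilon> * K0 / w0 * ((c * c0) ^ card u * gamma_u b u powr p))"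
      proof (rule sum_mono)
        fix u assume u: "u \<in> ?U"
        have "C_cub \<alpha> lam u * gamma_u b u * ?q u \<le> \<epsilon> / 2 * (WW u powr ?s / (\<Sum>u\<in>?U. WW u powr ?s))"
          by (rule cubature_share[OF \<epsilon> ne opt u])
        also have "\<dots> \<le> \<epsilon> * (K0 * c0 ^ card u * gamma_u b u powr p / w0)"
          using \<epsilon> w0 w0Z K0 by (intro mult_mono frac_le) auto
        finally have "C_cub \<alpha> lam u * gamma_u b u * ?q u * c ^ card u \<le> \<epsilon> * (K0 * c0 ^ card u * gamma_u b u powr p / w0) * c ^ card u"
          using c by (intro mult_right_mono) auto
        also have "\<dots> = \<epsilon> * K0 / w0 * ((c * c0) ^ card u * gamma_u b u powr p)" by (simp add: power_mult_distrib)
        finally show "C_cub \<alpha> lam u * gamma_u b u * ?q u * c ^ card u \<le> \<epsilon> * K0 / w0 * ((c * c0) ^ card u * gamma_u b u powr p)" .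
      qed
      also have "\<dots> \<le> \<epsilon> * K0 / w0 * B" unfolding sum_distrib_left[symmetric]
        by (intro mult_left_mono B(2) fU) (use \<epsilon> K0 w0 in auto)
      also have "\<dots> = (K0 * B / w0) * \<epsilon>" by simp
      also have "\<dots> \<le> K * \<epsilon>" unfolding K_def using Kp \<epsilon> by (intro mult_right_mono) auto
      finally show ?thesis .
    next
      case False
      \<comment> \<open>The empty set has gm = 1, so it is inactive only if \<epsilon> \<ge> 2 * SS
        \<ge> 2. For such tolerances an error bound independent of \<epsilon> suffices.\<close>
      then have "\<not> \<epsilon> / 2 / SS < 1" unfolding active_set_eq by (simp add: gm_def gamma_u_def M_u_def)
      then have "2 * SS \<le> \<epsilon>" using SS_ge_1 by (simp add: not_less le_divide_eq)
      then have \<epsilon>1: "1 \<le> \<epsilon>" using SS_ge_1 by simp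
      have "(\<Sum>u\<in>?U. C_cub \<alpha> lam u * gamma_u b u * ?q u * c ^ card u) \<le> (\<Sum>u\<in>?U. K1 * ((c * K2) ^ card u * gamma_u b u))"
      proof (rule sum_mono)
        fix u
        have q1: "?q u \<le> 1"
        proof (cases "1 \<le> k u")
          case True
          then have "1 \<le> real (n_points (k u))" by (simp add: n_points_def)
          then have "real (n_points (k u)) powr (- lam) \<le> 1 powr (- lam)" using lam_pos by (intro powr_mono2') auto
          then show ?thesis using True by simp
        qed simp
        have "C_cub \<alpha> lam u * gamma_u b u * ?q u * c ^ card u \<le> C_cub \<alpha> lam u * gamma_u b u * 1 * c ^ card u"
          using c C_cub_pos[of u] gamma_pos[of u] q1 by (intro mult_right_mono mult_left_mono) auto
        also have "\<dots> = K1 * ((c * K2) ^ card u * gamma_u b u)" unfolding K12(3) by (simp add: power_mult_distrib)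
        finally show "C_cub \<alpha> lam u * gamma_u b u * ?q u * c ^ card u \<le> K1 * ((c * K2) ^ card u * gamma_u b u)" .
      qed
      also have "\<dots> \<le> K1 * B'" unfolding sum_distrib_left[symmetric]
        by (intro mult_left_mono B'(2) fU) (use K12 in auto)
      also have "\<dots> \<le> K * 1" unfolding K_def using Kp by simp
      also have "\<dots> \<le> K * \<epsilon>" using \<epsilon>1 Kp unfolding K_def by (intro mult_left_mono) auto
      finally show ?thesis .
    qed
  qed
  moreover have "0 \<le> K" using Kp unfolding K_def by simp
  ultimately show thesis by (rule that[rotated])
qed

text \<open>The minimum of the cost is explicit, with the tolerance to the power - (1 / lam + d' /
  \<tau>) and a power of the total weight, which is bounded uniformly in \<epsilon>. An empty active
  set costs nothing.\<close>

lemma cost_bound: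
  obtains K where "0 \<le> K" "\<And>\<epsilon> k h. 0 < \<epsilon> \<Longrightarrow> (active_set \<alpha> b p \<epsilon> \<noteq> {} \<Longrightarrow>
      mdfem_optimal \<alpha> lam b \<tau> d' (active_set \<alpha> b p \<epsilon>) \<epsilon> k h) \<Longrightarrow>
      mdfem_cost (\<lambda>x. x powr (- d')) (active_set \<alpha> b p \<epsilon>) (\<lambda>u. real (n_points (k u))) h \<le> K * \<epsilon> powr (- (1 / lam + d' / \<tau>))"
proof -
  let ?s = "1 / (1 / lam + d' / \<tau> + 1)"
  obtain K0 c0 where K0: "0 < K0" "0 \<le> c0" "\<And>u. WW u powr ?s \<le> K0 * c0 ^ card u * gamma_u b u powr p" using wt_bound by blast
  obtain B where B: "0 < B" "\<And>V. finite V \<Longrightarrow> (\<And>v. v \<in> V \<Longrightarrow> finite v) \<Longrightarrow> (\<Sum>v\<in>V. c0 ^ card v * gamma_u b v powr p) \<le> B"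
    using weighted_sum_bounded[OF K0(2)] by blast
  define X where "X = ((1 / lam) / (1 / lam + d' / \<tau>)) powr (- (1 / lam)) * ((d' / \<tau>) / (1 / lam + d' / \<tau>)) powr (- (d' / \<tau>))"
  define K where "K = X * (1/2) powr (- (1 / lam + d' / \<tau>)) * (K0 * B) powr (1 / lam + d' / \<tau> + 1)"
  have K: "0 \<le> K" by (simp add: K_def X_def)
  have "mdfem_cost (\<lambda>x. x powr (- d')) (active_set \<alpha> b p \<epsilon>) (\<lambda>u. real (n_points (k u))) h \<le> K * \<epsilon> powr (- (1 / lam + d' / \<tau>))"
    if \<epsilon>: "0 < \<epsilon>" and opt: "active_set \<alpha> b p \<epsilon> \<noteq> {} \<Longrightarrow> mdfem_optimal \<alpha> lam b \<tau> d' (active_set \<alpha> b p \<epsilon>) \<epsilon> k h" for \<epsilon> k h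
  proof (cases "active_set \<alpha> b p \<epsilon> = {}")
    case True
    then show ?thesis using K by (simp add: mdfem_cost_def)
  next
    case False
    let ?U = "active_set \<alpha> b p \<epsilon>"
    have fU: "finite ?U" "\<And>u. u \<in> ?U \<Longrightarrow> finite u" using finite_active_set[OF \<epsilon>] by (auto simp: active_set_eq)
    have "(\<Sum>u\<in>?U. WW u powr ?s) \<le> (\<Sum>u\<in>?U. K0 * (c0 ^ card u * gamma_u b u powr p))"
      by (intro sum_mono) (use K0(3) in \<open>simp add: mult.assoc\<close>)
    also have "\<dots> \<le> K0 * B" unfolding sum_distrib_left[symmetric] by (intro mult_left_mono B(2) fU) (use K0 in auto)
    finally have Z: "(\<Sum>u\<in>?U. WW u powr ?s) powr (1 / lam + d' / \<tau> + 1) \<le> (K0 * B) powr (1 / lam + d' / \<tau> + 1)"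
      using lam_pos \<tau> by (intro powr_mono2 sum_nonneg) (auto intro!: add_nonneg_nonneg divide_nonneg_nonneg)
    have "mdfem_cost (\<lambda>x. x powr (- d')) ?U (\<lambda>u. real (n_points (k u))) h \<le>
        X * (\<epsilon> / 2) powr (- (1 / lam + d' / \<tau>)) * (\<Sum>u\<in>?U. WW u powr ?s) powr (1 / lam + d' / \<tau> + 1)"
      unfolding X_def by (rule cost_le[OF \<epsilon> False opt[OF False]])
    also have "\<dots> \<le> X * (\<epsilon> / 2) powr (- (1 / lam + d' / \<tau>)) * (K0 * B) powr (1 / lam + d' / \<tau> + 1)"
      by (intro mult_left_mono Z) (simp add: X_def)
    also have "(\<epsilon> / 2) powr (- (1 / lam + d' / \<tau>)) = \<epsilon> powr (- (1 / lam + d' / \<tau>)) * (1/2) powr (- (1 / lam + d' / \<tau>))"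
      using \<epsilon> powr_mult[of \<epsilon> "1/2" "- (1 / lam + d' / \<tau>)"] by simp
    finally show ?thesis unfolding K_def by (simp only: mult_ac)
  qed
  with K show thesis by (rule that)
qed

end

section \<open>Error of the method\<close>

lemma weighted_cauchy_schwarz:
  fixes s X :: "'i \<Rightarrow> real"
  assumes "\<And>i. i \<in> I \<Longrightarrow> 0 < s i"
  shows "(\<Sum>i\<in>I. X i)\<^sup>2 \<le> (\<Sum>i\<in>I. s i) * (\<Sum>i\<in>I. (X i)\<^sup>2 / s i)"
proof -
  have "(\<Sum>i\<in>I. X i) = (\<Sum>i\<in>I. sqrt (s i) * (X i / sqrt (s i)))"
    by (intro sum.cong refl) (use assms in force)
  also have "\<dots>\<^sup>2 \<le> (\<Sum>i\<in>I. (sqrt (s i))\<^sup>2) * (\<Sum>i\<in>I. (X i / sqrt (s i))\<^sup>2)" by (rule Cauchy_Schwarz_ineq_sum)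
  also have "\<dots> = (\<Sum>i\<in>I. s i) * (\<Sum>i\<in>I. (X i)\<^sup>2 / s i)"
    by (intro arg_cong2[of _ _ _ _ "(*)"] sum.cong refl) (use assms less_imp_le in \<open>auto simp: power_divide\<close>)
  finally show ?thesis .
qed

text \<open>Stands in for the triangle inequality in L2. Cauchy-Schwarz weighted with the bounds s i
  themselves yields the square of their sum; separating the deterministic part a costs the factor
  2.\<close>

lemma sqrt_second_moment_sum_le:
  fixes X :: "'i \<Rightarrow> 'x \<Rightarrow> real"
  assumes I: "finite I" and s: "\<And>i. i \<in> I \<Longrightarrow> 0 < s i"
    and X: "\<And>i. i \<in> I \<Longrightarrow> integrable M (\<lambda>x. (X i x)\<^sup>2)" "\<And>i. i \<in> I \<Longrightarrow> (LINT x|M. (X i x)\<^sup>2) \<le> (s i)\<^sup>2"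
    and M: "prob_space M"
  shows "sqrt (LINT x|M. \<bar>a + (\<Sum>i\<in>I. X i x)\<bar>\<^sup>2) \<le> 2 * (\<bar>a\<bar> + (\<Sum>i\<in>I. s i))"
proof -
  interpret prob_space M by (rule M)
  let ?S = "\<Sum>i\<in>I. s i"
  let ?Q = "\<lambda>x. 2 * a\<^sup>2 + 2 * (?S * (\<Sum>i\<in>I. (X i x)\<^sup>2 / s i))"
  have S0: "0 \<le> ?S" by (intro sum_nonneg) (use s less_imp_le in auto)
  have int: "integrable M ?Q" using X(1) by simp
  have le: "\<bar>a + (\<Sum>i\<in>I. X i x)\<bar>\<^sup>2 \<le> ?Q x" for x
  proof -
    have "\<bar>a + t\<bar>\<^sup>2 \<le> 2 * a\<^sup>2 + 2 * t\<^sup>2" for t :: real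
      using zero_le_power2[of "a - t"] by (simp add: power2_eq_square algebra_simps)
    from this[of "\<Sum>i\<in>I. X i x"] weighted_cauchy_schwarz[of I s "\<lambda>i. X i x", OF s] show ?thesis by simp
  qed
  have "(LINT x|M. \<bar>a + (\<Sum>i\<in>I. X i x)\<bar>\<^sup>2) \<le> (LINT x|M. ?Q x)"
  proof (rule integral_mono'[OF int le])
    show "0 \<le> ?Q x" for x using le[of x] zero_le_power2[of "\<bar>a + (\<Sum>i\<in>I. X i x)\<bar>"] by linarith
  qed
  also have "\<dots> = 2 * a\<^sup>2 + 2 * (?S * (\<Sum>i\<in>I. (LINT x|M. (X i x)\<^sup>2) / s i))"
    using X(1) by (simp add: prob_space)
  also have "\<dots> \<le> 2 * a\<^sup>2 + 2 * (?S * (\<Sum>i\<in>I. s i))"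
  proof (intro add_left_mono mult_left_mono sum_mono S0)
    fix i assume i: "i \<in> I"
    show "(LINT x|M. (X i x)\<^sup>2) / s i \<le> s i" using X(2)[OF i] s[OF i] by (simp add: divide_le_eq power2_eq_square)
  qed simp
  also have "\<dots> \<le> (2 * (\<bar>a\<bar> + ?S))\<^sup>2"
  proof -
    have "2 * a\<^sup>2 + 2 * (t * t) \<le> (2 * (\<bar>a\<bar> + t))\<^sup>2" if "0 \<le> t" for t :: real
    proof -
      have "0 \<le> \<bar>a\<bar> * t" using that by simp
      moreover have "0 \<le> a\<^sup>2" "0 \<le> t\<^sup>2" by auto
      moreover have "(2 * (\<bar>a\<bar> + t))\<^sup>2 = 4 * a\<^sup>2 + 8 * (\<bar>a\<bar> * t) + 4 * t\<^sup>2"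
        by (simp add: power2_eq_square algebra_simps)
      ultimately show ?thesis unfolding power2_eq_square[of t, symmetric] by linarith
    qed
    from this[OF S0] show ?thesis .
  qed
  finally show ?thesis using S0 by (intro real_le_lsqrt) auto
qed

section \<open>Assembling truncation, discretisation and cubature errors\<close>

locale mdfem_error = P: mdfem_params b \<alpha> p \<tau> d' lam + E: fe_family F Fh C \<tau> b
  for b :: "nat \<Rightarrow> real" and \<alpha> :: nat and p \<tau> d' lam C :: real and F :: "(nat \<Rightarrow> real) \<Rightarrow> real" and Fh +
  fixes H ip and k h :: "real \<Rightarrow> nat set \<Rightarrow> real"
  assumes rkhs: "\<And>u. finite u \<Longrightarrow> is_rkhs (box_u u) (kernel_u \<alpha> u) (H u) (ip u)"
    and optimal: "\<And>\<epsilon>. 0 < \<epsilon> \<Longrightarrow> active_set \<alpha> b p \<epsilon> \<noteq> {} \<Longrightarrow>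
      mdfem_optimal \<alpha> lam b \<tau> d' (active_set \<alpha> b p \<epsilon>) \<epsilon> (k \<epsilon>) (h \<epsilon>)"
begin

abbreviation U :: "real \<Rightarrow> nat set set" where "U \<equiv> active_set \<alpha> b p"

definition fe_term :: "real \<Rightarrow> nat set \<Rightarrow> (nat \<Rightarrow> real) \<Rightarrow> real" where
  "fe_term \<epsilon> u = anchored_term (Fh (h \<epsilon> u)) u"

definition cub_bound :: "real \<Rightarrow> nat set \<Rightarrow> real" where
  "cub_bound \<epsilon> u = C_cub \<alpha> lam u * (if 1 \<le> k \<epsilon> u then real (n_points (k \<epsilon> u)) powr (- lam) else 1) *
     (C * weight_sum \<alpha> ^ card u * gamma_u b u)"

lemma U_finite: "0 < \<epsilon> \<Longrightarrow> finite (U \<epsilon>)" "u \<in> U \<epsilon> \<Longrightarrow> finite u"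
  using P.finite_active_set by (auto simp: P.active_set_eq)

lemma h_pos: "0 < \<epsilon> \<Longrightarrow> u \<in> U \<epsilon> \<Longrightarrow> 0 < h \<epsilon> u"
  using P.kh_pos(2)[OF _ _ optimal] by blast

lemma cub_bound_nonneg: "0 \<le> cub_bound \<epsilon> u"
  unfolding cub_bound_def using E.C weight_sum_nonneg[of \<alpha>] P.gamma_pos[of u] P.C_cub_pos[of u]
  by (intro mult_nonneg_nonneg zero_le_power) auto

text \<open>Truncation plus discretisation. An anchored term has 2 ^ |u| summands, exactly the
  factor that the constraint gives to h powr \<tau>, so here the total budget is enough and no
  individual shares are needed.\<close>

lemma model_error: "\<exists>K. \<forall>\<epsilon>>0. \<bar>integral_inf F - (\<Sum>u\<in>U \<epsilon>. integral_fin u (fe_term \<epsilon> u))\<bar> \<le> K * \<epsilon>"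
proof -
  obtain K where K: "\<And>\<epsilon> V. 0 < \<epsilon> \<Longrightarrow> finite V \<Longrightarrow> V \<inter> U \<epsilon> = {} \<Longrightarrow> (\<And>v. v \<in> V \<Longrightarrow> finite v) \<Longrightarrow>
    (\<Sum>v\<in>V. weight_sum 1 ^ card v * gamma_u b v) \<le> K * \<epsilon>"
    using P.truncation_sum[OF weight_sum_nonneg[of 1]] by metis
  have "\<bar>integral_inf F - (\<Sum>u\<in>U \<epsilon>. integral_fin u (fe_term \<epsilon> u))\<bar> \<le> (C * K + C / 2) * \<epsilon>" if \<epsilon>: "0 < \<epsilon>" for \<epsilon>
  proof -
    have 1: "\<bar>integral_inf F - (\<Sum>u\<in>U \<epsilon>. integral_fin u (anchored_term F u))\<bar> \<le> C * (K * \<epsilon>)"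
      by (rule E.truncation_integral[OF U_finite(1)[OF \<epsilon>] U_finite(2)], assumption, rule K[OF \<epsilon>], blast+)
    have "\<bar>(\<Sum>u\<in>U \<epsilon>. integral_fin u (anchored_term F u)) - (\<Sum>u\<in>U \<epsilon>. integral_fin u (fe_term \<epsilon> u))\<bar>
        \<le> (\<Sum>u\<in>U \<epsilon>. \<bar>integral_fin u (anchored_term F u) - integral_fin u (fe_term \<epsilon> u)\<bar>)"
      unfolding sum_subtractf[symmetric] by (rule sum_abs)
    also have "\<dots> \<le> (\<Sum>u\<in>U \<epsilon>. C * (2 ^ card u * h \<epsilon> u powr \<tau>))"
    proof (rule sum_mono)
      fix u assume u: "u \<in> U \<epsilon>"
      show "\<bar>integral_fin u (anchored_term F u) - integral_fin u (fe_term \<epsilon> u)\<bar> \<le> C * (2 ^ card u * h \<epsilon> u powr \<tau>)"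
        using E.fe_integral_diff[OF h_pos[OF \<epsilon> u] U_finite(2)[OF u]] unfolding fe_term_def by (simp only: mult_ac)
    qed
    also have "\<dots> \<le> C * (\<epsilon> / 2)"
    proof (cases "U \<epsilon> = {}")
      case False
      then show ?thesis unfolding sum_distrib_left[symmetric]
        by (intro mult_left_mono P.fe_share[OF \<epsilon> False optimal[OF \<epsilon> False]] E.C)
    qed (use E.C \<epsilon> in simp)
    finally show ?thesis using 1 unfolding distrib_right by (simp only: mult.assoc times_divide_eq_left times_divide_eq_right)
  qed
  then show ?thesis by blast
qed

lemma cub_bound_sum: "\<exists>K. \<forall>\<epsilon>>0. (\<Sum>u\<in>U \<epsilon>. cub_bound \<epsilon> u) \<le> K * \<epsilon>"
proof -
  let ?q = "\<lambda>k u. if 1 \<le> k u then real (n_points (k u)) powr (- lam) else 1"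
  obtain K where K: "0 \<le> K" "\<And>\<epsilon> k h. 0 < \<epsilon> \<Longrightarrow> U \<epsilon> \<noteq> {} \<Longrightarrow> mdfem_optimal \<alpha> lam b \<tau> d' (U \<epsilon>) \<epsilon> k h \<Longrightarrow>
      (\<Sum>u\<in>U \<epsilon>. C_cub \<alpha> lam u * gamma_u b u * ?q k u * weight_sum \<alpha> ^ card u) \<le> K * \<epsilon>"
    by (rule P.cubature_sum[OF weight_sum_nonneg[of \<alpha>]]) blast
  have "(\<Sum>u\<in>U \<epsilon>. cub_bound \<epsilon> u) \<le> C * K * \<epsilon>" if \<epsilon>: "0 < \<epsilon>" for \<epsilon>
  proof (cases "U \<epsilon> = {}")
    case False
    have "(\<Sum>u\<in>U \<epsilon>. cub_bound \<epsilon> u) = C * (\<Sum>u\<in>U \<epsilon>. C_cub \<alpha> lam u * gamma_u b u * ?q (k \<epsilon>) u * weight_sum \<alpha> ^ card u)"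
      unfolding sum_distrib_left cub_bound_def by (intro sum.cong refl) (simp only: mult_ac)
    also have "\<dots> \<le> C * (K * \<epsilon>)" by (intro mult_left_mono K(2)[OF \<epsilon> False optimal[OF \<epsilon> False]] E.C)
    finally show ?thesis by (simp add: mult.assoc)
  qed (use K E.C \<epsilon> in simp)
  then show ?thesis by blast
qed

definition boxed_term :: "real \<Rightarrow> nat set \<Rightarrow> (nat \<Rightarrow> real) \<Rightarrow> real" where
  "boxed_term \<epsilon> u = (\<lambda>y. if y \<in> box_u u then fe_term \<epsilon> u y else 0)"

lemma boxed_term:
  assumes "0 < \<epsilon>" "u \<in> U \<epsilon>"
  shows "boxed_term \<epsilon> u \<in> H u" "sqrt (ip u (boxed_term \<epsilon> u) (boxed_term \<epsilon> u)) \<le> C * weight_sum \<alpha> ^ card u * gamma_u b u"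
  unfolding boxed_term_def fe_term_def
  by (rule anchored_term_rkhs[OF E.exp_h[OF h_pos[OF assms]] E.C U_finite(2)[OF assms(2)] P.b(1,2) P.alpha1 rkhs[OF U_finite(2)[OF assms(2)]]])+

text \<open>\<open>e\<close> abstracts the error as a function of the number of points, so that the
  deterministic and the root-mean-square case share the distinction between 0 points and a power of
  two.\<close>

lemma cub_bound_ge:
  assumes \<epsilon>: "0 < \<epsilon>" and u: "u \<in> U \<epsilon>"
    and 1: "\<And>m. e (2 ^ m) \<le> C_cub \<alpha> lam u * real (2 ^ m) powr (- lam) * sqrt (ip u (boxed_term \<epsilon> u) (boxed_term \<epsilon> u))"
    and 0: "e 0 \<le> C_cub \<alpha> lam u * sqrt (ip u (boxed_term \<epsilon> u) (boxed_term \<epsilon> u))"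
  shows "e (n_points (k \<epsilon> u)) \<le> cub_bound \<epsilon> u"
proof -
  let ?q = "if 1 \<le> k \<epsilon> u then real (n_points (k \<epsilon> u)) powr (- lam) else 1"
  have "e (n_points (k \<epsilon> u)) \<le> C_cub \<alpha> lam u * ?q * sqrt (ip u (boxed_term \<epsilon> u) (boxed_term \<epsilon> u))"
  proof (cases "1 \<le> k \<epsilon> u")
    case True
    then have "n_points (k \<epsilon> u) = 2 ^ nat \<lfloor>log 2 (k \<epsilon> u)\<rfloor>" by (simp add: n_points_def)
    then show ?thesis using 1[of "nat \<lfloor>log 2 (k \<epsilon> u)\<rfloor>"] True by presburger
  next
    case False
    then show ?thesis using 0 by (simp add: n_points_def)
  qed
  also have "\<dots> \<le> cub_bound \<epsilon> u" unfolding cub_bound_def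
    by (intro mult_left_mono boxed_term[OF \<epsilon> u]) (use P.C_cub_pos[of u] in simp)
  finally show ?thesis .
qed

lemma interlaced_error:
  assumes "interlaced_bound \<alpha> lam H ip P q"
  shows "\<exists>K. \<forall>\<epsilon>>0. \<bar>integral_inf F - (\<Sum>u\<in>U \<epsilon>. interlaced_rule \<alpha> P q u (n_points (k \<epsilon> u)) (fe_term \<epsilon> u))\<bar> \<le> K * \<epsilon>"
proof -
  obtain K1 where K1: "\<And>\<epsilon>. 0 < \<epsilon> \<Longrightarrow> \<bar>integral_inf F - (\<Sum>u\<in>U \<epsilon>. integral_fin u (fe_term \<epsilon> u))\<bar> \<le> K1 * \<epsilon>"
    using model_error by blast
  obtain K2 where K2: "\<And>\<epsilon>. 0 < \<epsilon> \<Longrightarrow> (\<Sum>u\<in>U \<epsilon>. cub_bound \<epsilon> u) \<le> K2 * \<epsilon>"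
    using cub_bound_sum by blast
  have "\<bar>integral_inf F - (\<Sum>u\<in>U \<epsilon>. interlaced_rule \<alpha> P q u (n_points (k \<epsilon> u)) (fe_term \<epsilon> u))\<bar> \<le> (K1 + K2) * \<epsilon>"
    if \<epsilon>: "0 < \<epsilon>" for \<epsilon>
  proof -
    have "\<bar>integral_fin u (fe_term \<epsilon> u) - interlaced_rule \<alpha> P q u (n_points (k \<epsilon> u)) (fe_term \<epsilon> u)\<bar> \<le> cub_bound \<epsilon> u"
      if u: "u \<in> U \<epsilon>" for u
    proof -
      have B: "y \<in> box_u u \<Longrightarrow> fe_term \<epsilon> u y = boxed_term \<epsilon> u y" for y by (simp add: boxed_term_def)
      note b = assms[unfolded interlaced_bound_def, rule_format, OF U_finite(2)[OF u] boxed_term(1)[OF \<epsilon> u]]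
      have "integral_fin u (fe_term \<epsilon> u) = integral_fin u (boxed_term \<epsilon> u)"
        "interlaced_rule \<alpha> P q u n (fe_term \<epsilon> u) = interlaced_rule \<alpha> P q u n (boxed_term \<epsilon> u)" for n
        by (rule integral_fin_cong, erule B) (rule interlaced_rule_cong[OF P.alpha1], erule B)
      note eqs = this
      show ?thesis unfolding eqs
        by (rule cub_bound_ge[OF \<epsilon> u]) (use b in auto)
    qed
    then have "(\<Sum>u\<in>U \<epsilon>. \<bar>integral_fin u (fe_term \<epsilon> u) - interlaced_rule \<alpha> P q u (n_points (k \<epsilon> u)) (fe_term \<epsilon> u)\<bar>) \<le> K2 * \<epsilon>"
      by (intro order_trans[OF sum_mono K2[OF \<epsilon>]])
    then have "\<bar>(\<Sum>u\<in>U \<epsilon>. integral_fin u (fe_term \<epsilon> u)) - (\<Sum>u\<in>U \<epsilon>. interlaced_rule \<alpha> P q u (n_points (k \<epsilon> u)) (fe_term \<epsilon> u))\<bar> \<le> K2 * \<epsilon>"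
      unfolding sum_subtractf[symmetric] by (rule order_trans[OF sum_abs])
    with K1[OF \<epsilon>] show ?thesis by (simp add: distrib_right)
  qed
  then show ?thesis by blast
qed

text \<open>The integral of a non-integrable function is 0 by default, so a bound on the second
  moment says something only together with integrability. Measurability in the shift and a uniform
  bound provide it.\<close>

lemma shifted_rule_measurable_bounded:
  assumes \<epsilon>: "0 < \<epsilon>" and u: "u \<in> U \<epsilon>"
  shows "(\<lambda>\<delta>. shifted_rule P q u n \<delta> (fe_term \<epsilon> u)) \<in> borel_measurable (shift_measure u)"
    "\<bar>shifted_rule P q u n \<delta> (fe_term \<epsilon> u)\<bar> \<le> C * weight_sum 1 ^ card u * gamma_u b u"
proof -
  let ?pt = "\<lambda>i \<delta> j. if j \<in> u then digital_shift (polylat_point (P u n) (q u n) i (rank_in u j)) (\<delta> j) - 1/2 else 0"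
  let ?B = "C * weight_sum 1 ^ card u * gamma_u b u"
  have pt: "?pt i \<delta> \<in> param_seqs" for i \<delta>
    using shifted_box[of u, OF digital_shift_bounds] unfolding box_u_def by fast
  have "(\<lambda>\<delta>. ?pt i \<delta> j) \<in> borel_measurable (shift_measure u)" if "j \<in> u" for i j
  proof -
    have "(\<lambda>\<delta>. digital_shift (polylat_point (P u n) (q u n) i (rank_in u j)) (\<delta> j)) \<in> borel_measurable (shift_measure u)"
      unfolding shift_measure_def unif_01_def
      by (rule measurable_compose[OF measurable_coord[OF that] measurable_digital_shift])
    then show ?thesis using that by simp
  qed
  then have "(\<lambda>\<delta>. fe_term \<epsilon> u (?pt i \<delta>)) \<in> borel_measurable (shift_measure u)" for i
    unfolding fe_term_def by (intro measurable_anchored_term[OF E.exp_h[OF h_pos[OF \<epsilon> u]] U_finite(2)[OF u]] pt)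
  then show "(\<lambda>\<delta>. shifted_rule P q u n \<delta> (fe_term \<epsilon> u)) \<in> borel_measurable (shift_measure u)"
    unfolding shifted_rule_def average_def by simp
  have tb: "\<bar>fe_term \<epsilon> u (?pt i \<delta>)\<bar> \<le> ?B" for i
    unfolding fe_term_def by (rule anchored_term_bound[OF E.exp_h[OF h_pos[OF \<epsilon> u]] E.C U_finite(2)[OF u] P.b(1,2) pt])
  have B0: "0 \<le> ?B" using tb[of 0] by linarith
  have "\<bar>\<Sum>i<n. fe_term \<epsilon> u (?pt i \<delta>)\<bar> \<le> (\<Sum>i<n. ?B)" by (rule order_trans[OF sum_abs sum_mono]) (rule tb)
  then show "\<bar>shifted_rule P q u n \<delta> (fe_term \<epsilon> u)\<bar> \<le> ?B"
    unfolding shifted_rule_def average_def using B0 by (simp add: divide_le_eq mult.commute)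
qed

lemma shifted_error:
  assumes "shifted_bound \<alpha> lam H ip P q"
  shows "\<exists>K. \<forall>\<epsilon>>0. sqrt (LINT \<Delta>|PiM (U \<epsilon>) shift_measure.
     \<bar>integral_inf F - (\<Sum>u\<in>U \<epsilon>. shifted_rule P q u (n_points (k \<epsilon> u)) (\<Delta> u) (fe_term \<epsilon> u))\<bar>\<^sup>2) \<le> K * \<epsilon>"
proof -
  obtain K1 where K1: "\<And>\<epsilon>. 0 < \<epsilon> \<Longrightarrow> \<bar>integral_inf F - (\<Sum>u\<in>U \<epsilon>. integral_fin u (fe_term \<epsilon> u))\<bar> \<le> K1 * \<epsilon>"
    using model_error by blast
  obtain K2 where K2: "\<And>\<epsilon>. 0 < \<epsilon> \<Longrightarrow> (\<Sum>u\<in>U \<epsilon>. cub_bound \<epsilon> u) \<le> K2 * \<epsilon>"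
    using cub_bound_sum by blast
  have shift_prob: "prob_space (shift_measure u)" for u
    unfolding shift_measure_def by (rule prob_space_PiM) (rule unif_01_prob)
  have "sqrt (LINT \<Delta>|PiM (U \<epsilon>) shift_measure.
     \<bar>integral_inf F - (\<Sum>u\<in>U \<epsilon>. shifted_rule P q u (n_points (k \<epsilon> u)) (\<Delta> u) (fe_term \<epsilon> u))\<bar>\<^sup>2) \<le> 2 * (K1 + (K2 + 1)) * \<epsilon>"
    if \<epsilon>: "0 < \<epsilon>" for \<epsilon>
  proof -
    let ?M = "PiM (U \<epsilon>) shift_measure"
    define I where "I u = integral_fin u (fe_term \<epsilon> u)" for u
    define X where "X u \<delta> = I u - shifted_rule P q u (n_points (k \<epsilon> u)) \<delta> (fe_term \<epsilon> u)" for u \<delta>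
    define a where "a = integral_inf F - (\<Sum>u\<in>U \<epsilon>. I u)"
    \<comment> \<open>The weighted Cauchy-Schwarz inequality divides by these bounds. The added term
      keeps them positive even where the cubature bound is 0, and costs at most \<epsilon> in
      total.\<close>
    define s where "s u = cub_bound \<epsilon> u + \<epsilon> / real (card (U \<epsilon>))" for u
    have M: "prob_space ?M" by (rule prob_space_PiM) (rule shift_prob)
    have s: "0 < s u" if "u \<in> U \<epsilon>" for u
      unfolding s_def using cub_bound_nonneg[of \<epsilon> u] \<epsilon> that U_finite(1)[OF \<epsilon>]
      by (intro add_nonneg_pos divide_pos_pos) (auto simp: card_gt_0_iff)
    have S: "(\<Sum>u\<in>U \<epsilon>. s u) \<le> (K2 + 1) * \<epsilon>"
    proof -
      have "(\<Sum>u\<in>U \<epsilon>. \<epsilon> / real (card (U \<epsilon>))) \<le> \<epsilon>" using \<epsilon> by simp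
      then show ?thesis unfolding s_def sum.distrib using K2[OF \<epsilon>] by (simp add: distrib_right)
    qed
    have Xm: "X u \<in> borel_measurable (shift_measure u)" if u: "u \<in> U \<epsilon>" for u
      unfolding X_def[abs_def] using shifted_rule_measurable_bounded(1)[OF \<epsilon> u] by simp
    have Xint: "integrable (shift_measure u) (\<lambda>\<delta>. (X u \<delta>)\<^sup>2)" if u: "u \<in> U \<epsilon>" for u
    proof -
      interpret prob_space "shift_measure u" by (rule shift_prob)
      have "\<bar>X u \<delta>\<bar> \<le> \<bar>I u\<bar> + C * weight_sum 1 ^ card u * gamma_u b u" for \<delta>
        using shifted_rule_measurable_bounded(2)[OF \<epsilon> u, of P q "n_points (k \<epsilon> u)" \<delta>] unfolding X_def by linarith
      then have "\<bar>X u \<delta>\<bar>\<^sup>2 \<le> (\<bar>I u\<bar> + C * weight_sum 1 ^ card u * gamma_u b u)\<^sup>2" for \<delta> by (intro power_mono) auto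
      then show ?thesis using Xm[OF u] by (intro integrable_const_bound) auto
    qed
    have X2: "(LINT \<delta>|shift_measure u. (X u \<delta>)\<^sup>2) \<le> (s u)\<^sup>2" if u: "u \<in> U \<epsilon>" for u
    proof -
      have B: "y \<in> box_u u \<Longrightarrow> fe_term \<epsilon> u y = boxed_term \<epsilon> u y" for y by (simp add: boxed_term_def)
      note b = assms[unfolded shifted_bound_def, rule_format, OF U_finite(2)[OF u] boxed_term(1)[OF \<epsilon> u]]
      have "integral_fin u (fe_term \<epsilon> u) = integral_fin u (boxed_term \<epsilon> u)"
        "shifted_rule P q u n \<delta> (fe_term \<epsilon> u) = shifted_rule P q u n \<delta> (boxed_term \<epsilon> u)" for n \<delta>
        by (rule integral_fin_cong, erule B) (rule shifted_rule_cong, erule B)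
      note eqs = this
      let ?e = "\<lambda>n. sqrt (LINT \<delta>|shift_measure u. \<bar>integral_fin u (boxed_term \<epsilon> u) - shifted_rule P q u n \<delta> (boxed_term \<epsilon> u)\<bar>\<^sup>2)"
      have "?e (n_points (k \<epsilon> u)) \<le> cub_bound \<epsilon> u"
        by (rule cub_bound_ge[OF \<epsilon> u, of ?e]) (use b in blast)+
      also have "\<dots> \<le> s u" unfolding s_def using \<epsilon> by simp
      finally have "sqrt (LINT \<delta>|shift_measure u. (X u \<delta>)\<^sup>2) \<le> s u"
        unfolding X_def I_def eqs by simp
      then show ?thesis by (rule sqrt_le_D)
    qed
    \<comment> \<open>Each summand depends on a single shift, so its second moment can be computed
      under the marginal distribution.\<close>
    have dist: "distr ?M (shift_measure u) (\<lambda>\<Delta>. \<Delta> u) = shift_measure u" if "u \<in> U \<epsilon>" for u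
      by (rule distr_PiM_component[OF shift_prob that])
    have comp: "(\<lambda>\<Delta>. \<Delta> u) \<in> measurable ?M (shift_measure u)" if "u \<in> U \<epsilon>" for u
      by (rule measurable_component_singleton[OF that])
    have m2: "(\<lambda>\<delta>. (X u \<delta>)\<^sup>2) \<in> borel_measurable (shift_measure u)" if u: "u \<in> U \<epsilon>" for u
      using Xm[OF u] by simp
    have "sqrt (LINT \<Delta>|?M. \<bar>a + (\<Sum>u\<in>U \<epsilon>. X u (\<Delta> u))\<bar>\<^sup>2) \<le> 2 * (\<bar>a\<bar> + (\<Sum>u\<in>U \<epsilon>. s u))"
    proof (rule sqrt_second_moment_sum_le[OF U_finite(1)[OF \<epsilon>] s _ _ M])
      fix u assume u: "u \<in> U \<epsilon>"
      show "integrable ?M (\<lambda>\<Delta>. (X u (\<Delta> u))\<^sup>2)"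
        using Xint[OF u] integrable_distr_eq[OF comp[OF u] m2[OF u]] unfolding dist[OF u] by simp
      show "(LINT \<Delta>|?M. (X u (\<Delta> u))\<^sup>2) \<le> (s u)\<^sup>2"
        using X2[OF u] integral_distr[OF comp[OF u] m2[OF u]] unfolding dist[OF u] by simp
    qed
    also have "\<dots> \<le> 2 * (K1 * \<epsilon> + (K2 + 1) * \<epsilon>)"
      using K1[OF \<epsilon>] S unfolding a_def I_def by (intro mult_left_mono add_mono) auto
    finally show ?thesis
      unfolding a_def X_def by (simp add: sum_subtractf algebra_simps)
  qed
  then show ?thesis by blast
qed

end

section \<open>Coefficient bounds and finite element families\<close>

lemma ess_inf_pos_bound:
  assumes "0 < ess_inf D a0"
  obtains m where "0 < m" "AE x in lebesgue_on D. m \<le> a0 x"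
proof -
  obtain m where m: "0 < ereal m" "ereal m < ess_inf D a0" using ereal_dense2[OF assms] by blast
  have "AE x in lebesgue_on D. - ereal (a0 x) \<le> - ess_inf D a0"
    using esssup_AE[of "\<lambda>x. - ereal (a0 x)" "lebesgue_on D"] unfolding ess_inf_def by simp
  then have "AE x in lebesgue_on D. m \<le> a0 x"
  proof (eventually_elim)
    case (elim x)
    then have "ess_inf D a0 \<le> ereal (a0 x)" unfolding ereal_minus_le_minus .
    then have "ereal m < ereal (a0 x)" using m(2) by (rule order_less_le_trans[rotated])
    then show ?case by simp
  qed
  with m(1) show thesis by (intro that) auto
qed

lemma Linf_norm_finite_bound:
  assumes "Linf_norm D v < \<infinity>"
  obtains B where "AE x in lebesgue_on D. \<bar>v x\<bar> \<le> B"
proof -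
  obtain B where B: "0 \<le> B" "Linf_norm D v = ennreal B" using assms by (cases "Linf_norm D v") auto
  have "AE x in lebesgue_on D. ennreal \<bar>v x\<bar> \<le> ennreal B"
    using esssup_AE[of "\<lambda>x. ennreal \<bar>v x\<bar>" "lebesgue_on D"] B(2) unfolding Linf_norm_def by simp
  then have "AE x in lebesgue_on D. \<bar>v x\<bar> \<le> B" by eventually_elim (use B(1) in simp)
  then show thesis by (rule that)
qed

text \<open>An infimum over the empty set is infinite, so a finite norm produces a weak derivative
  of order zero, and having one includes local integrability. The measurability of the functions
  \<phi> j comes from here.\<close>

lemma W_inf_norm_finite_measurable:
  fixes D :: "'a::euclidean_space set"
  assumes D: "open D" and k: "0 \<le> k" and fin: "W_inf_norm D r k v < \<infinity>"
  shows "v \<in> borel_measurable (lebesgue_on D)"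
proof -
  have "([] :: 'a list) \<in> midx k" using k by (simp add: midx_def)
  then have "(INF w\<in>{w. weak_deriv D [] v w}. Linf_norm D (\<lambda>x. r x ^ length ([] :: 'a list) * w x)) \<le> W_inf_norm D r k v"
    unfolding W_inf_norm_def
    by (rule SUP_upper[where f = "\<lambda>\<omega>. INF w\<in>{w. weak_deriv D \<omega> v w}. Linf_norm D (\<lambda>x. r x ^ length \<omega> * w x)"])
  note le = this
  have "\<exists>w. weak_deriv D [] v w"
  proof (rule ccontr)
    assume "\<not> ?thesis"
    then have e: "{w. weak_deriv D [] v w} = {}" by simp
    show False using le fin unfolding e by (simp add: top_unique)
  qed
  then show ?thesis using loc_integrable_measurable[OF D] unfolding weak_deriv_def by blast
qed

text \<open>The extended series is finite almost everywhere, hence converges in the reals. The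
  factor 2 stems from the denominator 2 * a0 in \<open>kappa\<close>.\<close>

lemma kappa_series_bound:
  assumes b: "\<And>j. 0 < b j" and K: "0 \<le> K" "kappa D a0 \<phi> b < ennreal K"
    and pos: "AE x in lebesgue_on D. 0 < a0 x"
  shows "AE x in lebesgue_on D. summable (\<lambda>j. \<bar>\<phi> j x\<bar> / b j) \<and> (\<Sum>j. \<bar>\<phi> j x\<bar> / b j) \<le> 2 * K * a0 x"
proof -
  have "AE x in lebesgue_on D. (\<Sum>j. ennreal (\<bar>\<phi> j x\<bar> / b j)) / ennreal (2 * a0 x) \<le> kappa D a0 \<phi> b"
    unfolding kappa_def by (rule esssup_AE)
  with pos show ?thesis
  proof (eventually_elim)
    case (elim x)
    let ?S = "\<Sum>j. ennreal (\<bar>\<phi> j x\<bar> / b j)"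
    have nn: "0 \<le> \<bar>\<phi> j x\<bar> / b j" for j using less_imp_le[OF b[of j]] by simp
    have "?S / ennreal (2 * a0 x) \<le> ennreal K" using elim(2) K(2) by simp
    then have "?S / ennreal (2 * a0 x) * ennreal (2 * a0 x) \<le> ennreal K * ennreal (2 * a0 x)" by (rule mult_right_mono) simp
    moreover have "?S / ennreal (2 * a0 x) * ennreal (2 * a0 x) = ?S"
      using elim(1) by (simp add: ennreal_divide_times divide_ennreal)
    moreover have "ennreal K * ennreal (2 * a0 x) = ennreal (2 * K * a0 x)"
      using K(1) elim(1) by (simp add: ennreal_mult[symmetric] mult_ac)
    ultimately have S: "?S \<le> ennreal (2 * K * a0 x)" by simp
    then have s: "summable (\<lambda>j. \<bar>\<phi> j x\<bar> / b j)"
      using summable_suminf_not_top[of "\<lambda>j. \<bar>\<phi> j x\<bar> / b j", OF nn] by (metis ennreal_less_top leD top.not_eq_extremum)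
    have "ennreal (\<Sum>j. \<bar>\<phi> j x\<bar> / b j) \<le> ennreal (2 * K * a0 x)"
      using S suminf_ennreal2[of "\<lambda>j. \<bar>\<phi> j x\<bar> / b j", OF nn s] by simp
    then show ?case using s K(1) elim(1) by simp
  qed
qed

section \<open>Functionals of discrete solutions and the family over all meshwidths\<close>

lemma V_dual_sum:
  assumes D: "open D" and G: "G \<in> V_dual D" and w: "\<And>i. i \<in> I \<Longrightarrow> w i \<in> H10 D" and I: "finite I" and ne: "H10 D \<noteq> {}"
  shows "(\<lambda>x. \<Sum>i\<in>I. c i * w i x) \<in> H10 D \<and> G (\<lambda>x. \<Sum>i\<in>I. c i * w i x) = (\<Sum>i\<in>I. c i * G (w i))"
  using I w
proof (induction I rule: finite_induct)
  case empty
  obtain v where v: "v \<in> H10 D" using ne by blast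
  have "(\<lambda>x. 0 * v x) \<in> H10 D" by (rule H10_scale[OF D v])
  moreover have "G (\<lambda>x. 0 * v x) = 0 * G v" using G v unfolding V_dual_def by blast
  ultimately show ?case by simp
next
  case (insert i I)
  let ?s = "\<lambda>x. \<Sum>i\<in>I. c i * w i x"
  have IH: "?s \<in> H10 D" "G ?s = (\<Sum>i\<in>I. c i * G (w i))" using insert by auto
  have i: "(\<lambda>x. c i * w i x) \<in> H10 D" using insert.prems by (intro H10_scale[OF D]) auto
  have add: "G (\<lambda>x. v x + w x) = G v + G w" if "v \<in> H10 D" "w \<in> H10 D" for v w
    using G that unfolding V_dual_def by blast
  note add[OF i IH(1)]
  also have "G (\<lambda>x. c i * w i x) = c i * G (w i)" using G insert.prems unfolding V_dual_def by blast
  finally show ?case using H10_add[OF D i IH(1)] IH(2) insert.hyps by simp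
qed

lemma fin_dim_subspace_H10:
  assumes "open D" "G \<in> V_dual D" "H10 D \<noteq> {}" "fin_dim_subspace W (H10 D)" "w \<in> W"
  shows "w \<in> H10 D"
proof -
  obtain B c where B: "finite B" "B \<subseteq> H10 D" "w = (\<lambda>x. \<Sum>\<beta>\<in>B. c \<beta> * \<beta> x)"
    using assms(4,5) unfolding fin_dim_subspace_def by blast
  then show ?thesis using V_dual_sum[OF assms(1,2) _ B(1) assms(3), where w = "\<lambda>\<beta>. \<beta>" and c = c] by blast
qed

lemma functional_anchored:
  assumes D: "open D" and G: "G \<in> V_dual D" and u: "finite u" and y: "y \<in> param_seqs"
    and w: "\<And>y. y \<in> param_seqs \<Longrightarrow> w y \<in> H10 D"
  shows "G (anchored w u y) = anchored_term (\<lambda>y. G (w y)) u y"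
  unfolding anchored_def anchored_term_def
  by (rule conjunct2[OF V_dual_sum[OF D G]]) (use w anchor_param_seqs[OF y] u in auto)

text \<open>On the empty set the only monomial is 1, so the value is the single coefficient, whose
  bound is C times an empty product. Together with the tail bound it bounds the discrete functionals
  uniformly.\<close>

lemma power_expansion_at_0:
  assumes F: "power_expansion C b F" shows "\<bar>F (\<lambda>_. 0)\<bar> \<le> C"
proof -
  have z: "(\<lambda>_::nat. 0) \<in> param_seqs" by (simp add: param_seqs_def \<Omega>_def)
  have "anchored_term F {} (\<lambda>_. 0) = F (\<lambda>_. 0)" by (simp add: anchored_term_def anchor_def)
  obtain t where t: "\<And>\<nu>. \<nu> \<in> PiE {} (\<lambda>_. UNIV) \<Longrightarrow> \<bar>t \<nu>\<bar> \<le> C * (\<Prod>j\<in>{}. b j ^ \<nu> j)"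
    and lim: "\<And>y. y \<in> param_seqs \<Longrightarrow> (\<lambda>n. \<Sum>\<nu>\<in>pos_index {} n. t \<nu> * (\<Prod>j\<in>{}. y j ^ \<nu> j)) \<longlonglongrightarrow> anchored_term F {} y"
    using anchored_term_expansion[OF F finite.emptyI] by blast
  have "(\<lambda>n::nat. t (\<lambda>_. undefined)) \<longlonglongrightarrow> anchored_term F {} (\<lambda>_. 0)" using lim[OF z] by (simp add: pos_index_def)
  then have "anchored_term F {} (\<lambda>_. 0) = t (\<lambda>_. undefined)" by (simp add: LIMSEQ_const_iff)
  then show ?thesis using t[of "\<lambda>_. undefined"] \<open>anchored_term F {} (\<lambda>_. 0) = F (\<lambda>_. 0)\<close> by simp
qed

lemma power_expansion_mono:
  assumes F: "power_expansion C b F" and le: "C \<le> C'" and b: "\<And>j. 0 < b j"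
  shows "power_expansion C' b F"
  unfolding power_expansion_def
proof (intro allI impI)
  fix u :: "nat set" assume u: "finite u"
  have "C * (\<Prod>j\<in>u. b j ^ \<nu> j) \<le> C' * (\<Prod>j\<in>u. b j ^ \<nu> j)" for \<nu>
    using less_imp_le[OF b] by (intro mult_right_mono le prod_nonneg) simp
  moreover obtain t where "\<forall>\<nu>\<in>PiE u (\<lambda>_. UNIV). \<bar>t \<nu>\<bar> \<le> C * (\<Prod>j\<in>u. b j ^ \<nu> j)"
    "\<forall>y\<in>param_seqs. (\<forall>j. j \<notin> u \<longrightarrow> y j = 0) \<longrightarrow>
       (\<lambda>n. \<Sum>k\<le>n. \<Sum>\<nu>\<in>mindex u k. t \<nu> * (\<Prod>j\<in>u. y j ^ \<nu> j)) \<longlonglongrightarrow> F y"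
    using F[unfolded power_expansion_def, rule_format, OF u] by blast
  ultimately show "\<exists>t. (\<forall>\<nu>\<in>PiE u (\<lambda>_. UNIV). \<bar>t \<nu>\<bar> \<le> C' * (\<Prod>j\<in>u. b j ^ \<nu> j)) \<and>
     (\<forall>y\<in>param_seqs. (\<forall>j. j \<notin> u \<longrightarrow> y j = 0) \<longrightarrow>
       (\<lambda>n. \<Sum>k\<le>n. \<Sum>\<nu>\<in>mindex u k. t \<nu> * (\<Prod>j\<in>u. y j ^ \<nu> j)) \<longlonglongrightarrow> F y)"
    by (meson order_trans)
qed

text \<open>Convergence is only assumed for small \<open>h\<close>; boundedness extends it to all \<open>h\<close>.\<close>

lemma fe_family_exists:
  fixes F :: "(nat \<Rightarrow> real) \<Rightarrow> real" and Fh :: "real \<Rightarrow> (nat \<Rightarrow> real) \<Rightarrow> real"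
  assumes C: "0 \<le> C" and \<tau>: "0 < \<tau>" and b: "\<And>j. 0 < b j" "\<And>j. b j \<le> 1" "b \<longlonglongrightarrow> 0"
    and exp_h: "\<And>h. 0 < h \<Longrightarrow> power_expansion C b (Fh h)"
    and tail_h: "\<And>h y N \<delta>. 0 < h \<Longrightarrow> y \<in> param_seqs \<Longrightarrow> (\<And>j. j \<ge> N \<Longrightarrow> b j \<le> \<delta>) \<Longrightarrow> 0 \<le> \<delta> \<Longrightarrow> \<delta> \<le> 1 \<Longrightarrow>
        \<bar>Fh h y - Fh h (anchor {..<N} y)\<bar> \<le> C * \<delta>"
    and conv: "\<forall>\<^sub>F h in at_right 0. \<forall>y\<in>param_seqs. \<bar>F y - Fh h y\<bar> \<le> C1 * h powr \<tau>"
  shows "\<exists>C'. fe_family F Fh C' \<tau> b"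
proof -
  obtain h0 where h0: "0 < h0" "\<And>h y. 0 < h \<Longrightarrow> h < h0 \<Longrightarrow> y \<in> param_seqs \<Longrightarrow> \<bar>F y - Fh h y\<bar> \<le> C1 * h powr \<tau>"
    using conv unfolding eventually_at_right_field by auto
  have bd: "\<bar>Fh h y\<bar> \<le> 2 * C" if "0 < h" "y \<in> param_seqs" for h y
  proof -
    have "anchor {..<0} y = (\<lambda>_. 0)" by (simp add: anchor_def)
    then have "\<bar>Fh h y - Fh h (\<lambda>_. 0)\<bar> \<le> C * 1" using tail_h[OF that, of 0 1] b(2) by simp
    then show ?thesis using power_expansion_at_0[OF exp_h[OF that(1)]] by linarith
  qed
  \<comment> \<open>For h \<ge> h0 the exact value is compared with the discretisation at h0 / 2,
    where convergence is available; two discrete values, each at most 2 * C, account for 4 * C.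
    Dividing by h0 powr \<tau> turns this constant into a multiple of h powr \<tau>.\<close>
  define B where "B = \<bar>C1\<bar> * (h0 / 2) powr \<tau> + 4 * C"
  define C' where "C' = C + \<bar>C1\<bar> + B / h0 powr \<tau>"
  have B0: "0 \<le> B" using C by (simp add: B_def)
  have C'C: "C \<le> C'" "\<bar>C1\<bar> \<le> C'" "B / h0 powr \<tau> \<le> C'" "0 \<le> C'" using B0 C by (auto simp: C'_def)
  have "\<bar>F y - Fh h y\<bar> \<le> C' * h powr \<tau>" if h: "0 < h" and y: "y \<in> param_seqs" for h y
  proof (cases "h < h0")
    case True
    have "\<bar>F y - Fh h y\<bar> \<le> C1 * h powr \<tau>" by (rule h0(2)[OF h True y])
    also have "\<dots> \<le> C' * h powr \<tau>" using C'C(2) by (intro mult_right_mono) auto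
    finally show ?thesis .
  next
    case False
    have "\<bar>F y - Fh (h0 / 2) y\<bar> \<le> C1 * (h0 / 2) powr \<tau>" using h0(1) y by (intro h0(2)) auto
    also have "\<dots> \<le> \<bar>C1\<bar> * (h0 / 2) powr \<tau>" by (intro mult_right_mono) auto
    finally have "\<bar>F y - Fh h y\<bar> \<le> B"
      using bd[OF h y] bd[of "h0 / 2" y] h0(1) y unfolding B_def by simp
    also have "B = B / h0 powr \<tau> * h0 powr \<tau>" using h0(1) by simp
    also have "\<dots> \<le> C' * h powr \<tau>" using C'C False h0(1) \<tau> by (intro mult_mono powr_mono2) auto
    finally show ?thesis .
  qed
  moreover have "\<bar>Fh h y - Fh h (anchor {..<N} y)\<bar> \<le> C' * \<delta>"
    if "0 < h" "y \<in> param_seqs" "\<And>j. j \<ge> N \<Longrightarrow> b j \<le> \<delta>" "0 \<le> \<delta>" "\<delta> \<le> 1" for h y N \<delta>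
    proof -
    have "\<bar>Fh h y - Fh h (anchor {..<N} y)\<bar> \<le> C * \<delta>" by (rule tail_h) (use that in auto)
    then show ?thesis using mult_right_mono[OF C'C(1) that(4)] by linarith
  qed
  ultimately have "fe_family F Fh C' \<tau> b"
    using C'C(4) \<tau> b power_expansion_mono[OF exp_h C'C(1) b(1)] by unfold_locales auto
  then show ?thesis by blast
qed

theorem theorem3:
  fixes D :: "'a::euclidean_space set"
    and f G :: "('a \<Rightarrow> real) \<Rightarrow> real"
    and a0 r :: "'a \<Rightarrow> real"
    and \<phi> :: "nat \<Rightarrow> 'a \<Rightarrow> real"
    and u :: "(nat \<Rightarrow> real) \<Rightarrow> 'a \<Rightarrow> real"
    and Vh :: "real \<Rightarrow> ('a \<Rightarrow> real) set"
    and uh :: "real \<Rightarrow> (nat \<Rightarrow> real) \<Rightarrow> 'a \<Rightarrow> real"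
    and t t' \<tau> d' p lam :: real
    and \<alpha> :: nat
    and b :: "nat \<Rightarrow> real"
    and H :: "nat set \<Rightarrow> ((nat \<Rightarrow> real) \<Rightarrow> real) set"
    and ip :: "nat set \<Rightarrow> ((nat \<Rightarrow> real) \<Rightarrow> real) \<Rightarrow> ((nat \<Rightarrow> real) \<Rightarrow> real) \<Rightarrow> real"
    and work :: "real \<Rightarrow> real"
    and k h :: "real \<Rightarrow> nat set \<Rightarrow> real"
  assumes domain: "convex_polyhedral_domain D"
    and a0_Linf: "a0 \<in> borel_measurable (lebesgue_on D)" "Linf_norm D a0 < \<infinity>"
    and a0_pos: "ess_inf D a0 > 0"
    and p: "0 < p" "p < 1"
    and b: "\<And>j. 0 < b j" "\<And>j. b j \<le> 1" "summable (\<lambda>j. b j powr p)"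
    and kappa_less_1: "kappa D a0 \<phi> b < 1"
    and rates: "0 \<le> t" "0 \<le> t'" "\<tau> = t + t'" "0 < \<tau>" "0 < d'"
    and f: "f \<in> Hneg D t"
    and G: "G \<in> Hneg D t'"
    and regularity_low: "t \<le> 1 \<and> t' \<le> 1 \<Longrightarrow>
          W_inf_norm D (\<lambda>_. 1) 1 a0 < \<infinity> \<and> (\<Sum>j. W_inf_norm D (\<lambda>_. 1) 1 (\<phi> j)) < \<infinity>"
    and weight: "singular_weight D r"
    and regularity_high: "max t t' > 1 \<Longrightarrow>
          W_inf_norm D r (max t t') a0 < \<infinity> \<and> (\<Sum>j. W_inf_norm D r (max t t') (\<phi> j)) < \<infinity>"
    and u: "\<And>y. y \<in> param_seqs \<Longrightarrow> weak_solution D (coeff_a a0 \<phi> y) f (H10 D) (u y)"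
    and Vh: "\<And>h. h > 0 \<Longrightarrow> fin_dim_subspace (Vh h) (H10 D)"
    and uh: "\<And>h y. h > 0 \<Longrightarrow> y \<in> param_seqs \<Longrightarrow> weak_solution D (coeff_a a0 \<phi> y) f (Vh h) (uh h y)"
    and fe_convergence: "\<exists>C. \<forall>\<^sub>F h in at_right 0. \<forall>y\<in>param_seqs.
          \<bar>G (u y) - G (uh h y)\<bar> \<le> C * h powr \<tau> * Hneg_norm D t f * Hneg_norm D t' G"
    and work: "\<And>h. h > 0 \<Longrightarrow> 0 \<le> work h" "\<exists>C. \<forall>h>0. work h \<le> C * h powr (- d')"
    and lam: "lam = \<tau> * (1 - p) / (p * (\<tau> + d'))"
    and alpha: "\<alpha> = nat \<lfloor>lam\<rfloor> + 1"
    and kappa_small: "kappa D a0 \<phi> b < ennreal (1 / (2 * real \<alpha> + 1))"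
    and rkhs: "\<And>\<uu>. finite \<uu> \<Longrightarrow> is_rkhs (box_u \<uu>) (kernel_u \<alpha> \<uu>) (H \<uu>) (ip \<uu>)"
    and optimal: "\<And>\<epsilon>. \<epsilon> > 0 \<Longrightarrow> active_set \<alpha> b p \<epsilon> \<noteq> {} \<Longrightarrow>
          mdfem_optimal \<alpha> lam b \<tau> d' (active_set \<alpha> b p \<epsilon>) \<epsilon> (k \<epsilon>) (h \<epsilon>)"
  shows "(1 \<le> lam \<longrightarrow>
            (\<forall>P q. polylat_generators \<alpha> P q \<and> interlaced_bound \<alpha> lam H ip P q \<longrightarrow>
              (\<exists>C. \<forall>\<epsilon>>0.
                \<bar>integral_inf (\<lambda>y. G (u y))
                  - mdfem (interlaced_rule \<alpha> P q) G uh (active_set \<alpha> b p \<epsilon>)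
                      (\<lambda>\<uu>. n_points (k \<epsilon> \<uu>)) (h \<epsilon>)\<bar> \<le> C * \<epsilon>)))
       \<and> (1/2 \<le> lam \<and> lam < 1 \<longrightarrow>
            (\<forall>P q. polylat_generators 1 P q \<and> shifted_bound \<alpha> lam H ip P q \<longrightarrow>
              (\<exists>C. \<forall>\<epsilon>>0.
                sqrt (LINT \<Delta>|PiM (active_set \<alpha> b p \<epsilon>) shift_measure.
                  \<bar>integral_inf (\<lambda>y. G (u y))
                    - mdfem (\<lambda>\<uu> n. shifted_rule P q \<uu> n (\<Delta> \<uu>)) G uh (active_set \<alpha> b p \<epsilon>)
                        (\<lambda>\<uu>. n_points (k \<epsilon> \<uu>)) (h \<epsilon>)\<bar>\<^sup>2) \<le> C * \<epsilon>)))
       \<and> (1/2 \<le> lam \<longrightarrow>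
            (\<exists>C. \<forall>\<epsilon>>0.
              mdfem_cost (\<lambda>x. x powr (- d')) (active_set \<alpha> b p \<epsilon>)
                  (\<lambda>\<uu>. real (n_points (k \<epsilon> \<uu>))) (h \<epsilon>) \<le> C * \<epsilon> powr (- (1 / lam + d' / \<tau>)) \<and>
              mdfem_cost work (active_set \<alpha> b p \<epsilon>)
                  (\<lambda>\<uu>. real (n_points (k \<epsilon> \<uu>))) (h \<epsilon>) \<le> C * \<epsilon> powr (- (1 / lam + d' / \<tau>)))
            \<and> 1 / lam + d' / \<tau> = (1 + d' / \<tau>) / (1 / p - 1) + d' / \<tau>)"
proof -
  have D: "open D" using domain by (simp add: convex_polyhedral_domain_def)
  obtain m where m: "0 < m" "AE x in lebesgue_on D. m \<le> a0 x" using ess_inf_pos_bound[OF a0_pos] by blast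
  obtain A0 where "AE x in lebesgue_on D. \<bar>a0 x\<bar> \<le> A0" using Linf_norm_finite_bound[OF a0_Linf(2)] by blast
  then have A0: "AE x in lebesgue_on D. a0 x \<le> A0" by eventually_elim simp
  have \<phi>_meas: "\<phi> j \<in> borel_measurable (lebesgue_on D)" for j
  proof (cases "max t t' > 1")
    case True
    then have "(\<Sum>j. W_inf_norm D r (max t t') (\<phi> j)) < \<infinity>" using regularity_high by blast
    then have "W_inf_norm D r (max t t') (\<phi> j) < \<infinity>" by (rule ennreal_suminf_lessD)
    then show ?thesis by (rule W_inf_norm_finite_measurable[OF D, rotated]) (use True in simp)
  next
    case False
    then have "t \<le> 1 \<and> t' \<le> 1" by auto
    then have "(\<Sum>j. W_inf_norm D (\<lambda>_. 1) 1 (\<phi> j)) < \<infinity>" using regularity_low by blast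
    then have "W_inf_norm D (\<lambda>_. 1) 1 (\<phi> j) < \<infinity>" by (rule ennreal_suminf_lessD)
    then show ?thesis by (rule W_inf_norm_finite_measurable[OF D, rotated]) simp
  qed
  \<comment> \<open>\<alpha> is at least 1 by its definition, so 1 / (2 * \<alpha> + 1) is at most
    1/3; this becomes the 2/3 of the diffusion estimates.\<close>
  have "kappa D a0 \<phi> b < ennreal (1 / 3)"
  proof (rule order_less_le_trans[OF kappa_small ennreal_leI])
    show "1 / (2 * real \<alpha> + 1) \<le> 1 / 3" by (rule divide_left_mono) (auto simp: alpha)
  qed
  moreover have "AE x in lebesgue_on D. 0 < a0 x" using m(2) by eventually_elim (use m(1) in simp)
  ultimately have \<phi>_sum:
    "AE x in lebesgue_on D. summable (\<lambda>j. \<bar>\<phi> j x\<bar> / b j) \<and> (\<Sum>j. \<bar>\<phi> j x\<bar> / b j) \<le> 2/3 * a0 x"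
    using kappa_series_bound[OF b(1), of "1/3" D a0 \<phi>] by simp
  interpret X: diffusion D a0 \<phi> b m A0
    by unfold_locales (use D a0_Linf(1) m A0 \<phi>_meas b(1,2) \<phi>_sum in auto)
  have V: "f \<in> V_dual D" "G \<in> V_dual D" using f G by (auto simp: Hneg_def)
  have ne: "H10 D \<noteq> {}"
    using u[of "\<lambda>_. 0"] by (auto simp: weak_solution_def param_seqs_def \<Omega>_def)
  define F where "F y = G (u y)" for y
  define Fh where "Fh h y = G (uh h y)" for h y
  have fam: "\<exists>C. fe_family F Fh C \<tau> b"
  proof -
    obtain C where C: "0 \<le> C" and exp: "\<And>W U. fin_dim_subspace W (H10 D) \<Longrightarrow>
        (\<And>y. y \<in> param_seqs \<Longrightarrow> weak_solution D (coeff_a a0 \<phi> y) f W (U y)) \<Longrightarrow>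
        power_expansion C b (\<lambda>y. G (U y))"
      and tail: "\<And>W U y N \<delta>. fin_dim_subspace W (H10 D) \<Longrightarrow>
        (\<And>y. y \<in> param_seqs \<Longrightarrow> weak_solution D (coeff_a a0 \<phi> y) f W (U y)) \<Longrightarrow>
        y \<in> param_seqs \<Longrightarrow> (\<And>j. j \<ge> N \<Longrightarrow> b j \<le> \<delta>) \<Longrightarrow> 0 \<le> \<delta> \<Longrightarrow> \<delta> \<le> 1 \<Longrightarrow>
        \<bar>G (U y) - G (U (anchor {..<N} y))\<bar> \<le> C * \<delta>"
      by (rule X.galerkin_expansion[OF ne V]) blast
    obtain Cf where Cf: "\<forall>\<^sub>F h in at_right 0. \<forall>y\<in>param_seqs.
          \<bar>G (u y) - G (uh h y)\<bar> \<le> Cf * h powr \<tau> * Hneg_norm D t f * Hneg_norm D t' G" using fe_convergence by blast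
    have b0: "b \<longlonglongrightarrow> 0"
    proof -
      have "(\<lambda>j. (b j powr p) powr (1 / p)) \<longlonglongrightarrow> 0"
        using tendsto_powr'[OF summable_LIMSEQ_zero[OF b(3)] tendsto_const[of "1 / p"]] p by simp
      then show ?thesis using p b(1) by (simp add: powr_powr less_imp_le)
    qed
    show ?thesis
    proof (rule fe_family_exists[OF C rates(4) b(1,2) b0])
      show "power_expansion C b (Fh h)" if "0 < h" for h
        unfolding Fh_def[abs_def] by (rule exp[OF Vh[OF that] uh[OF that]])
      show "\<bar>Fh h y - Fh h (anchor {..<N} y)\<bar> \<le> C * \<delta>"
        if "0 < h" "y \<in> param_seqs" "\<And>j. j \<ge> N \<Longrightarrow> b j \<le> \<delta>" "0 \<le> \<delta>" "\<delta> \<le> 1" for h y N \<delta>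
        unfolding Fh_def by (rule tail[OF Vh[OF that(1)] uh[OF that(1)] that(2-5)])
      show "\<forall>\<^sub>F h in at_right 0. \<forall>y\<in>param_seqs. \<bar>F y - Fh h y\<bar> \<le> (Cf * Hneg_norm D t f * Hneg_norm D t' G) * h powr \<tau>"
        using Cf unfolding F_def Fh_def by eventually_elim (simp only: mult_ac)
    qed
  qed
  have uh_H10: "uh h y \<in> H10 D" if "0 < h" "y \<in> param_seqs" for h y
    using fin_dim_subspace_H10[OF D V(2) ne Vh[OF that(1)]] uh[OF that] unfolding weak_solution_def by blast
  \<comment> \<open>Links the method, which applies G to a combination of discrete solutions, with
    the scalar anchored terms; the solutions lie in \<open>H10 D\<close>, where G is linear.\<close>
  have anch: "G (anchored (uh h) \<uu> y) = anchored_term (Fh h) \<uu> y" if "0 < h" "finite \<uu>" "y \<in> box_u \<uu>" for h \<uu> y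
    unfolding Fh_def[abs_def] using that
    by (intro functional_anchored[OF D V(2) that(2)] uh_H10) (auto simp: box_u_def)
  obtain C where C: "fe_family F Fh C \<tau> b" using fam by blast
  have err: "mdfem_error b \<alpha> p \<tau> d' lam C F Fh H ip k h" if "1/2 \<le> lam"
    by (intro mdfem_error.intro mdfem_params.intro C mdfem_error_axioms.intro b p rates(4,5) lam alpha that rkhs optimal)
  have Feq: "integral_inf (\<lambda>y. G (u y)) = integral_inf F" unfolding F_def[abs_def] ..
  show ?thesis
  proof (intro conjI impI allI)
    fix P q assume l: "1 \<le> lam" and Pq: "polylat_generators \<alpha> P q \<and> interlaced_bound \<alpha> lam H ip P q"
    interpret err: mdfem_error b \<alpha> p \<tau> d' lam C F Fh H ip k h by (rule err) (use l in simp)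
    have "mdfem (interlaced_rule \<alpha> P q) G uh (active_set \<alpha> b p \<epsilon>) (\<lambda>\<uu>. n_points (k \<epsilon> \<uu>)) (h \<epsilon>) =
        (\<Sum>u\<in>active_set \<alpha> b p \<epsilon>. interlaced_rule \<alpha> P q u (n_points (k \<epsilon> u)) (err.fe_term \<epsilon> u))" if "0 < \<epsilon>" for \<epsilon>
      unfolding mdfem_def err.fe_term_def
      by (intro sum.cong refl interlaced_rule_cong err.P.alpha1 anch err.h_pos[OF that] err.U_finite(2))
    then show "\<exists>C. \<forall>\<epsilon>>0. \<bar>integral_inf (\<lambda>y. G (u y))
        - mdfem (interlaced_rule \<alpha> P q) G uh (active_set \<alpha> b p \<epsilon>) (\<lambda>\<uu>. n_points (k \<epsilon> \<uu>)) (h \<epsilon>)\<bar> \<le> C * \<epsilon>"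
      using err.interlaced_error[OF conjunct2[OF Pq]] unfolding Feq by simp
  next
    fix P q assume l: "1/2 \<le> lam \<and> lam < 1" and Pq: "polylat_generators 1 P q \<and> shifted_bound \<alpha> lam H ip P q"
    interpret err: mdfem_error b \<alpha> p \<tau> d' lam C F Fh H ip k h by (rule err) (use l in simp)
    have "mdfem (\<lambda>\<uu> n. shifted_rule P q \<uu> n (\<Delta> \<uu>)) G uh (active_set \<alpha> b p \<epsilon>) (\<lambda>\<uu>. n_points (k \<epsilon> \<uu>)) (h \<epsilon>) =
        (\<Sum>u\<in>active_set \<alpha> b p \<epsilon>. shifted_rule P q u (n_points (k \<epsilon> u)) (\<Delta> u) (err.fe_term \<epsilon> u))" if "0 < \<epsilon>" for \<epsilon> \<Delta>
      unfolding mdfem_def err.fe_term_def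
      by (intro sum.cong refl shifted_rule_cong anch err.h_pos[OF that] err.U_finite(2))
    then show "\<exists>C. \<forall>\<epsilon>>0. sqrt (LINT \<Delta>|PiM (active_set \<alpha> b p \<epsilon>) shift_measure.
        \<bar>integral_inf (\<lambda>y. G (u y)) - mdfem (\<lambda>\<uu> n. shifted_rule P q \<uu> n (\<Delta> \<uu>)) G uh (active_set \<alpha> b p \<epsilon>)
            (\<lambda>\<uu>. n_points (k \<epsilon> \<uu>)) (h \<epsilon>)\<bar>\<^sup>2) \<le> C * \<epsilon>"
      using err.shifted_error[OF conjunct2[OF Pq]] unfolding Feq by simp
  next
    assume l: "1/2 \<le> lam"
    interpret err: mdfem_error b \<alpha> p \<tau> d' lam C F Fh H ip k h by (rule err[OF l])
    obtain K where K: "0 \<le> K" "\<And>\<epsilon> k h. 0 < \<epsilon> \<Longrightarrow> (active_set \<alpha> b p \<epsilon> \<noteq> {} \<Longrightarrow>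
        mdfem_optimal \<alpha> lam b \<tau> d' (active_set \<alpha> b p \<epsilon>) \<epsilon> k h) \<Longrightarrow>
        mdfem_cost (\<lambda>x. x powr (- d')) (active_set \<alpha> b p \<epsilon>) (\<lambda>u. real (n_points (k u))) h \<le> K * \<epsilon> powr (- (1 / lam + d' / \<tau>))"
      by (rule err.P.cost_bound) blast
    obtain Cw where Cw: "\<And>h. 0 < h \<Longrightarrow> work h \<le> Cw * h powr (- d')" using work(2) by blast
    \<comment> \<open>The maximum with 1 lets a single constant serve both cost models.\<close>
    define K' where "K' = max 1 Cw * K"
    show "\<exists>C. \<forall>\<epsilon>>0.
        mdfem_cost (\<lambda>x. x powr (- d')) (active_set \<alpha> b p \<epsilon>) (\<lambda>\<uu>. real (n_points (k \<epsilon> \<uu>))) (h \<epsilon>) \<le> C * \<epsilon> powr (- (1 / lam + d' / \<tau>)) \<and>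
        mdfem_cost work (active_set \<alpha> b p \<epsilon>) (\<lambda>\<uu>. real (n_points (k \<epsilon> \<uu>))) (h \<epsilon>) \<le> C * \<epsilon> powr (- (1 / lam + d' / \<tau>))"
    proof (intro exI[of _ K'] allI impI)
      fix \<epsilon> :: real assume \<epsilon>: "0 < \<epsilon>"
      let ?U = "active_set \<alpha> b p \<epsilon>" and ?n = "\<lambda>\<uu>. real (n_points (k \<epsilon> \<uu>))" and ?R = "\<epsilon> powr (- (1 / lam + d' / \<tau>))"
      have 0: "mdfem_cost (\<lambda>x. x powr (- d')) ?U ?n (h \<epsilon>) \<le> K * ?R" by (rule K(2)[OF \<epsilon> optimal[OF \<epsilon>]])
      have "1 * K \<le> max 1 Cw * K" by (intro mult_right_mono K) simp
      then have "K * ?R \<le> K' * ?R" unfolding K'_def by (intro mult_right_mono) auto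
      with 0 have 1: "mdfem_cost (\<lambda>x. x powr (- d')) ?U ?n (h \<epsilon>) \<le> K' * ?R" by linarith
      have "mdfem_cost work ?U ?n (h \<epsilon>) \<le> (\<Sum>\<uu>\<in>?U. max 1 Cw * (?n \<uu> * h \<epsilon> \<uu> powr (- d') * pounds \<uu>))"
        unfolding mdfem_cost_def
      proof (rule sum_mono)
        fix \<uu> assume "\<uu> \<in> ?U"
        then have "work (h \<epsilon> \<uu>) \<le> Cw * h \<epsilon> \<uu> powr (- d')" by (intro Cw err.h_pos[OF \<epsilon>])
        also have "\<dots> \<le> max 1 Cw * h \<epsilon> \<uu> powr (- d')" by (intro mult_right_mono) auto
        finally have "?n \<uu> * work (h \<epsilon> \<uu>) * pounds \<uu> \<le> ?n \<uu> * (max 1 Cw * h \<epsilon> \<uu> powr (- d')) * pounds \<uu>"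
          by (intro mult_right_mono mult_left_mono) (auto simp: less_imp_le[OF err.P.pounds_pos])
        then show "?n \<uu> * work (h \<epsilon> \<uu>) * pounds \<uu> \<le> max 1 Cw * (?n \<uu> * h \<epsilon> \<uu> powr (- d') * pounds \<uu>)"
          by (simp only: mult_ac)
      qed
      also have "\<dots> = max 1 Cw * mdfem_cost (\<lambda>x. x powr (- d')) ?U ?n (h \<epsilon>)"
        unfolding mdfem_cost_def by (rule sum_distrib_left[symmetric])
      also have "\<dots> \<le> max 1 Cw * (K * ?R)" by (intro mult_left_mono 0) simp
      also have "\<dots> = K' * ?R" unfolding K'_def by (rule mult.assoc[symmetric])
      finally show "mdfem_cost (\<lambda>x. x powr (- d')) ?U ?n (h \<epsilon>) \<le> K' * ?R \<and> mdfem_cost work ?U ?n (h \<epsilon>) \<le> K' * ?R"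
        using 1 by blast
    qed
    show "1 / lam + d' / \<tau> = (1 + d' / \<tau>) / (1 / p - 1) + d' / \<tau>" by (rule err.P.rate_identities(1))
  qed
qed

end
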